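(* Assume that the genus of $\Gamma_0(N)$ is zero and that $n$ is a positive integer relatively prime to $N$. Assume further that $n$ is not a perfect square. Let $S$ be a set of representatives of all the inequivalent cusps of $\Gamma_0(N)$. Then: (1) $$\sum_{r\in\mathbb Z,\ |r|<2\sqrt n}H(r^2-4n,N)\;+\;\sum_{s\in S}\nu_{s,n,N}\;=\;2\sigma(n).$$ (2) $$\sum_{r\in\mathbb Z,\ |r|<2\sqrt n}t(r^2-4n,N)\;+\;\sum_{s\in S,\ s\not\sim\infty}\nu_{s,n,N}\cdot j_N(s)\;=\;\begin{cases}2&\text{if }4n+1\text{ is a perfect square},\\0&\text{otherwise.}\end{cases}$$
   Context: Assume $X_0(N)=\Gamma_0(N)\backslash\mathbb H^*$ has genus zero ($\mathbb H$ is the upper half plane, $\mathbb H^*=\mathbb H\cup\mathbb Q\cup\{\infty\}$). $j_N(\tau)$ denotes the Hauptmodul for $\Gamma_0(N)$, i.e. the generator over $\mathbb C$ of the function field of $X_0(N)$ whose only pole on $X_0(N)$ is a simple pole at $\infty$, normalized so that $j_N(\tau)=q^{-1}+\sum_{m\ge1}c_mq^m$ with $c_m\in\mathbb Z$, $q=e^{2\pi i\tau}$. For a cusp $s\not\sim\infty$ (inequivalent to $\infty$ under $\Gamma_0(N)$), $j_N(s)$ is the value of $j_N$ at that point of $X_0(N)$. For a negative integer $D$, $\mathrm Q_{D,N}$ is the set of positive definite integral binary quadratic forms $ax^2+bxy+cy^2$ (so $a>0$; primitivity not required) with $b^2-4ac=D$ and $a\equiv0\pmod N$. $\Gamma_0(N)$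 acts on it by $(Q\cdot\gamma)(x,y)=Q(\alpha x+\beta y,\gamma'x+\delta y)$ for $\gamma=\begin{pmatrix}\alpha&\beta\\ \gamma'&\delta\end{pmatrix}$. $\tau_Q$ is the unique root in $\mathbb H$ of $Q(x,1)=0$, $\omega_{Q,N}=|\overline\Gamma_0(N)_Q|$ is the order of the stabilizer of $Q$ in $\overline\Gamma_0(N)=\Gamma_0(N)/\{\pm1\}$, and $$H(D,N)=\sum_{[Q]\in \mathrm Q_{D,N}/\Gamma_0(N)}\frac1{\omega_{Q,N}},\qquad t(D,N)=\sum_{[Q]\in \mathrm Q_{D,N}/\Gamma_0(N)}\frac1{\omega_{Q,N}}\,j_N(\tau_Q).$$ For a cusp $s=\frac ab\in S$ with $\gcd(a,b)=1$ and $b\ge0$ (with $\frac{\pm1}{0}=\infty$), put $b_s=b$ and $\nu_{s,n,N}=\sum\min\{d,\,n/d\}$, the sum being over all positive divisors $d$ of $n$ with $n\equiv d^2\pmod{\gcd(b_s,\,N/\gcd(b_s,N))}$. $\sigma(n)$ is the sum of the positive divisors of $n$. *)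

theory Defs
  imports
    "HOL-Complex_Analysis.Complex_Analysis"
    "HOL-Homology.Homology"
    "HOL-Algebra.Free_Abelian_Groups"
    "HOL-Computational_Algebra.Polynomial"
    "HOL-Computational_Algebra.Nth_Powers"
    "HOL-Number_Theory.Cong"
begin

no_notation fps_nth (infixl \<open>$\<close> 75)

section \<open>The groups and their action on the extended upper half plane\<close>

definition SL2Z :: "(int^2^2) set" where
  "SL2Z = {A. det A = 1}"

definition Gamma0 :: "nat \<Rightarrow> (int^2^2) set" where
  "Gamma0 N = {A \<in> SL2Z. int N dvd A$2$1}"

definition upper_half_plane :: "complex set" where
  "upper_half_plane = {\<tau>. Im \<tau> > 0}"

definition moebius :: "int^2^2 \<Rightarrow> complex \<Rightarrow> complex" where
  "moebius A \<tau> = (of_int (A$1$1) * \<tau> + of_int (A$1$2)) / (of_int (A$2$1) * \<tau> + of_int (A$2$2))"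

datatype riemann_sphere = Pt complex | Infty

fun moebius_ext :: "int^2^2 \<Rightarrow> riemann_sphere \<Rightarrow> riemann_sphere" where
  "moebius_ext A (Pt z) =
     (if of_int (A$2$1) * z + of_int (A$2$2) = 0 then Infty else Pt (moebius A z))"
| "moebius_ext A Infty =
     (if A$2$1 = 0 then Infty else Pt (of_int (A$1$1) / of_int (A$2$1)))"

text \<open>The point \<open>a/b\<close>, with \<open>\<plusminus>1/0\<close> read as \<open>\<infinity>\<close>.\<close>

definition cusp :: "int \<Rightarrow> int \<Rightarrow> riemann_sphere" where
  "cusp a b = (if b = 0 then Infty else Pt (of_int a / of_int b))"

definition cusps :: "riemann_sphere set" where
  "cusps = {cusp a b | a b. coprime a b}"

definition H_star :: "riemann_sphere set" where
  "H_star = Pt ` upper_half_plane \<union> cusps"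

definition Gamma0_equiv :: "nat \<Rightarrow> riemann_sphere \<Rightarrow> riemann_sphere \<Rightarrow> bool" where
  "Gamma0_equiv N p p' \<longleftrightarrow> (\<exists>A\<in>Gamma0 N. p' = moebius_ext A p)"

definition Gamma0_orbit :: "nat \<Rightarrow> riemann_sphere \<Rightarrow> riemann_sphere set" where
  "Gamma0_orbit N p = {p'. Gamma0_equiv N p p'}"

definition cusp_representatives :: "nat \<Rightarrow> riemann_sphere set \<Rightarrow> bool" where
  "cusp_representatives N S \<longleftrightarrow>
     S \<subseteq> cusps \<and> (\<forall>s\<in>cusps. \<exists>!s'. s' \<in> S \<and> Gamma0_equiv N s s')"


section \<open>The modular curve as a topological space, and its genus\<close>

text \<open>
  The usual topology: the neighbourhoods of the cusp \<open>A \<infinity>\<close> are generated by the horoballs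
  \<open>A {Im \<tau> > c}\<close> together with the cusp itself.
\<close>

definition H_star_topology :: "riemann_sphere topology" where
  "H_star_topology = topology_generated_by
     ({Pt ` U | U. open U \<and> U \<subseteq> upper_half_plane} \<union>
      {moebius_ext A ` insert Infty (Pt ` {\<tau>. Im \<tau> > c}) | A c. A \<in> SL2Z \<and> c > 0})"

definition quotient_topology :: "'a topology \<Rightarrow> ('a \<Rightarrow> 'b) \<Rightarrow> 'b topology" where
  "quotient_topology X f =
     topology (\<lambda>U. U \<subseteq> f ` topspace X \<and> openin X {x \<in> topspace X. f x \<in> U})"

lemma openin_quotient_topology:
  "openin (quotient_topology X f) U \<longleftrightarrow>
     U \<subseteq> f ` topspace X \<and> openin X {x \<in> topspace X. f x \<in> U}"
proof -
  have "istopology (\<lambda>U. U \<subseteq> f ` topspace X \<and> openin X {x \<in> topspace X. f x \<in> U})"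
    unfolding istopology_def
  proof (intro conjI allI impI)
    fix S T
    assume S: "S \<subseteq> f ` topspace X \<and> openin X {x \<in> topspace X. f x \<in> S}"
      and T: "T \<subseteq> f ` topspace X \<and> openin X {x \<in> topspace X. f x \<in> T}"
    show "S \<inter> T \<subseteq> f ` topspace X" using S by blast
    have "{x \<in> topspace X. f x \<in> S \<inter> T} =
        {x \<in> topspace X. f x \<in> S} \<inter> {x \<in> topspace X. f x \<in> T}" by blast
    then show "openin X {x \<in> topspace X. f x \<in> S \<inter> T}"
      using openin_Int[OF conjunct2[OF S] conjunct2[OF T]] by simp
  next
    fix K assume K: "\<forall>S\<in>K. S \<subseteq> f ` topspace X \<and> openin X {x \<in> topspace X. f x \<in> S}"
    then show "\<Union>K \<subseteq> f ` topspace X" by blast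
    have eq: "{x \<in> topspace X. f x \<in> \<Union>K} = \<Union>((\<lambda>S. {x \<in> topspace X. f x \<in> S}) ` K)" by blast
    show "openin X {x \<in> topspace X. f x \<in> \<Union>K}"
      unfolding eq by (rule openin_Union) (use K in blast)
  qed
  then show ?thesis
    by (simp add: quotient_topology_def topology_inverse')
qed

lemma topspace_quotient_topology: "topspace (quotient_topology X f) = f ` topspace X"
proof
  show "topspace (quotient_topology X f) \<subseteq> f ` topspace X"
    by (rule conjunct1[OF iffD1[OF openin_quotient_topology openin_topspace]])
  have "{x \<in> topspace X. f x \<in> f ` topspace X} = topspace X" by blast
  then have "openin (quotient_topology X f) (f ` topspace X)"
    by (simp add: openin_quotient_topology)
  then show "f ` topspace X \<subseteq> topspace (quotient_topology X f)"
    by (rule openin_subset)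
qed

lemma quotient_map_quotient_topology: "quotient_map X (quotient_topology X f) f"
  by (simp add: quotient_map_def topspace_quotient_topology openin_quotient_topology)

definition X0 :: "nat \<Rightarrow> riemann_sphere set topology" where
  "X0 N = quotient_topology H_star_topology (Gamma0_orbit N)"

text \<open>A closed orientable surface has genus \<open>g\<close> iff its first integral homology is \<open>\<int>\<^bsup>2g\<^esup>\<close>.\<close>

definition has_genus :: "'a topology \<Rightarrow> nat \<Rightarrow> bool" where
  "has_genus X g \<longleftrightarrow> homology_group 1 X \<cong> free_Abelian_group {..<2 * g}"


section \<open>The function field and the Hauptmodul\<close>

abbreviation at_i_infinity :: "complex filter" where
  "at_i_infinity \<equiv> filtercomap Im at_top"

text \<open>
  Meromorphy at the cusp \<open>A \<infinity>\<close>. The width of every cusp of \<open>\<Gamma>\<^sub>0(N)\<close> divides \<open>N\<close>, so \<open>f \<circ> A\<close> is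
  \<open>N\<close>-periodic and meromorphy may be tested on an expansion in \<open>exp (2 \<pi> i \<tau> / N)\<close>.
\<close>

definition meromorphic_at_cusp :: "nat \<Rightarrow> (complex \<Rightarrow> complex) \<Rightarrow> int^2^2 \<Rightarrow> bool" where
  "meromorphic_at_cusp N f A \<longleftrightarrow>
     (\<exists>F. F meromorphic_on {0} \<and>
          (\<forall>\<^sub>F \<tau> in at_i_infinity. f (moebius A \<tau>) = F (exp (2 * pi * \<i> * \<tau> / of_nat N))))"

text \<open>
  Meromorphic functions on \<open>X\<^sub>0(N)\<close>, as functions on the upper half plane. Each is represented by
  its normal form (removable singularities filled in, value 0 at poles).
\<close>

definition function_field :: "nat \<Rightarrow> (complex \<Rightarrow> complex) set" where
  "function_field N = {f.
     f nicely_meromorphic_on upper_half_plane \<and>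
     (\<forall>A\<in>Gamma0 N. \<forall>\<tau>\<in>upper_half_plane. f (moebius A \<tau>) = f \<tau>) \<and>
     (\<forall>A\<in>SL2Z. meromorphic_at_cusp N f A)}"

definition pole_at_cusp :: "(complex \<Rightarrow> complex) \<Rightarrow> riemann_sphere \<Rightarrow> bool" where
  "pole_at_cusp f s \<longleftrightarrow>
     (\<exists>A\<in>SL2Z. moebius_ext A Infty = s \<and>
        filterlim (\<lambda>\<tau>. f (moebius A \<tau>)) at_infinity at_i_infinity)"

text \<open>The pole at \<open>\<infinity>\<close> is simple by the shape of the expansion in \<open>q = exp (2 \<pi> i \<tau>)\<close>.\<close>

definition is_Hauptmodul :: "nat \<Rightarrow> (complex \<Rightarrow> complex) \<Rightarrow> bool" where
  "is_Hauptmodul N j \<longleftrightarrow>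
     j \<in> function_field N \<and>
     (\<forall>f\<in>function_field N. \<exists>P Q :: complex poly. Q \<noteq> 0 \<and>
        (\<forall>\<^sub>\<approx>\<tau>\<in>upper_half_plane. f \<tau> = poly P (j \<tau>) / poly Q (j \<tau>))) \<and>
     j holomorphic_on upper_half_plane \<and>
     (\<forall>s\<in>cusps. pole_at_cusp j s \<longleftrightarrow> Gamma0_equiv N s Infty) \<and>
     (\<exists>c :: nat \<Rightarrow> int. \<forall>\<tau>\<in>upper_half_plane.
        (\<lambda>m. of_int (c (Suc m)) * exp (2 * pi * \<i> * \<tau>) ^ Suc m) sums
          (j \<tau> - inverse (exp (2 * pi * \<i> * \<tau>))))"

definition value_at_cusp :: "(complex \<Rightarrow> complex) \<Rightarrow> riemann_sphere \<Rightarrow> complex" where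
  "value_at_cusp f s = (THE L. \<forall>A\<in>SL2Z. moebius_ext A Infty = s \<longrightarrow>
     filterlim (\<lambda>\<tau>. f (moebius A \<tau>)) (nhds L) at_i_infinity)"


section \<open>Quadratic forms, class numbers and traces\<close>

text \<open>The triple \<open>(a, b, c)\<close> stands for \<open>a x\<^sup>2 + b x y + c y\<^sup>2\<close>.\<close>

type_synonym qform = "int \<times> int \<times> int"

fun form_eval :: "qform \<Rightarrow> 'a::comm_ring_1 \<Rightarrow> 'a \<Rightarrow> 'a" where
  "form_eval (a, b, c) x y = of_int a * x^2 + of_int b * x * y + of_int c * y^2"

fun form_disc :: "qform \<Rightarrow> int" where
  "form_disc (a, b, c) = b^2 - 4 * a * c"

definition form_pos_def :: "qform \<Rightarrow> bool" where
  "form_pos_def Q \<longleftrightarrow> (\<forall>x y :: real. (x, y) \<noteq> (0, 0) \<longrightarrow> form_eval Q x y > 0)"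

definition forms :: "int \<Rightarrow> nat \<Rightarrow> qform set" where
  "forms D N = {Q. form_pos_def Q \<and> form_disc Q = D \<and> int N dvd fst Q}"

fun form_act :: "qform \<Rightarrow> int^2^2 \<Rightarrow> qform" where
  "form_act (a, b, c) A =
     (a * (A$1$1)^2 + b * A$1$1 * A$2$1 + c * (A$2$1)^2,
      2 * a * A$1$1 * A$1$2 + b * (A$1$1 * A$2$2 + A$1$2 * A$2$1) + 2 * c * A$2$1 * A$2$2,
      a * (A$1$2)^2 + b * A$1$2 * A$2$2 + c * (A$2$2)^2)"

lemma form_eval_act:
  "form_eval (form_act Q A) x y =
   form_eval Q (of_int (A$1$1) * x + of_int (A$1$2) * y) (of_int (A$2$1) * x + of_int (A$2$2) * y)"
  by (cases Q) (simp add: algebra_simps power2_eq_square)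

definition form_equiv :: "int \<Rightarrow> nat \<Rightarrow> (qform \<times> qform) set" where
  "form_equiv D N =
     {(P, Q). P \<in> forms D N \<and> Q \<in> forms D N \<and> (\<exists>A\<in>Gamma0 N. Q = form_act P A)}"

definition form_root :: "qform \<Rightarrow> complex" where
  "form_root Q = (THE \<tau>. \<tau> \<in> upper_half_plane \<and> form_eval Q \<tau> 1 = 0)"

text \<open>Elements of \<open>\<Gamma>\<^sub>0(N)/{\<plusminus>1}\<close> are the sets \<open>{A, -A}\<close>.\<close>

definition form_weight :: "nat \<Rightarrow> qform \<Rightarrow> nat" where
  "form_weight N Q = card ((\<lambda>A. {A, - A}) ` {A \<in> Gamma0 N. form_act Q A = Q})"

text \<open>The summands depend only on the class, so the choice of representative is immaterial.\<close>

definition class_number :: "int \<Rightarrow> nat \<Rightarrow> real" where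
  "class_number D N =
     (\<Sum>X \<in> forms D N // form_equiv D N. let Q = (SOME Q. Q \<in> X) in 1 / real (form_weight N Q))"

definition form_trace :: "(complex \<Rightarrow> complex) \<Rightarrow> int \<Rightarrow> nat \<Rightarrow> complex" where
  "form_trace j D N =
     (\<Sum>X \<in> forms D N // form_equiv D N. let Q = (SOME Q. Q \<in> X) in
        1 / of_nat (form_weight N Q) * j (form_root Q))"


section \<open>Cusp and divisor terms\<close>

definition cusp_denom :: "riemann_sphere \<Rightarrow> nat" where
  "cusp_denom s = (THE b. \<exists>a. coprime a (int b) \<and> s = cusp a (int b))"

definition \<nu> :: "riemann_sphere \<Rightarrow> nat \<Rightarrow> nat \<Rightarrow> nat" where
  "\<nu> s n N = (let b = cusp_denom s in
     \<Sum>d | d dvd n \<and> [n = d^2] (mod gcd b (N div gcd b N)). min d (n div d))"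

definition \<sigma> :: "nat \<Rightarrow> nat" where
  "\<sigma> n = \<Sum>{d. d dvd n}"

end

theory Submission
  imports Defs "HOL-Computational_Algebra.Fundamental_Theorem_Algebra"
begin

text \<open>
  Let \<open>M\<close> be the set of integral matrices of determinant \<open>n\<close> whose lower left entry is divisible by \<open>N\<close>,
  and let \<open>\<Phi>(\<tau>) = \<Prod> (j(\<tau>) - j(A \<tau>))\<close>, the product over the cosets \<open>\<Gamma>\<^sub>0(N) A\<close> in \<open>M\<close>. This is a modular
  function for \<open>\<Gamma>\<^sub>0(N)\<close> with poles at cusps only. As \<open>j\<close> generates the function field, \<open>\<Phi> = R(j)\<close> for a rational
  function \<open>R(X) = C \<Prod>\<^sub>c (X - c)\<^sup>m\<^sup>(\<^sup>c\<^sup>)\<close>. Since \<open>j = q\<^sup>-\<^sup>1 + O(q)\<close>, the expansion at infinity is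
  \<open>R(j) = C q\<^sup>-\<^sup>M (1 - T q + o(q))\<close> with \<open>M = \<Sum>\<^sub>c m(c)\<close> and \<open>T = \<Sum>\<^sub>c m(c) c\<close>. The two identities of the theorem
  are these two sums, with \<open>m(c)\<close>, \<open>M\<close> and \<open>T\<close> computed from the product.

  At infinity the cosets are represented by the triangular matrices with diagonal \<open>(a, d)\<close>, \<open>a d = n\<close>, and upper
  right entry modulo \<open>d\<close>. For fixed \<open>d\<close> the leading terms multiply to \<open>q\<^sup>-\<^sup>d - q\<^sup>-\<^sup>a\<close>, by the factorization of
  \<open>X\<^sup>d - Y\<^sup>d\<close> (\<open>hecke_prod_at_infinity\<close>). Hence \<open>M = \<Sum> max a d\<close>, which is \<open>2 \<sigma>(n)\<close> minus the cusp term of infinity,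
  and \<open>T\<close> counts the factorizations \<open>n = a d\<close> with \<open>\<bar>a - d\<bar> = 1\<close>; there are two if \<open>4 n + 1\<close> is a square and
  none otherwise.

  At a point \<open>\<tau>\<close> of the upper half plane, \<open>m(j(\<tau>))\<close> is the number of cosets containing a matrix that fixes \<open>\<tau>\<close>
  (\<open>hecke_prod_at_point\<close>, \<open>order_at_point\<close>). A matrix of determinant \<open>n\<close> and trace \<open>r\<close> fixes \<open>\<tau>\<close> iff \<open>\<tau>\<close> is the
  root of a form of discriminant \<open>r\<^sup>2 - 4 n\<close>, and every such coset contains as many fixing matrices as there are
  elements of \<open>\<Gamma>\<^sub>0(N)\<close> fixing \<open>\<tau>\<close>; so the number of cosets is the sum of the weights \<open>1 / \<omega>\<close> of the forms with root \<open>\<tau>\<close>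
  (\<open>fixing_cosets_count\<close>). At a cusp \<open>s\<close> inequivalent to infinity the cosets fixing \<open>s\<close> are again given by
  triangular matrices, now restricted by a congruence; the factor of \<open>(a, d)\<close> vanishes to order \<open>min 1 (a / d)\<close>
  relative to \<open>j - j(s)\<close>, and there are \<open>d\<close> cosets for each admissible \<open>d\<close>. This gives \<open>m(j(s)) = \<nu> s n N\<close>
  (\<open>cusp_cosets\<close>, \<open>hecke_prod_at_cusp\<close>).

  All this presupposes that \<open>j\<close> separates the orbits of \<open>\<Gamma>\<^sub>0(N)\<close>, that its values at the cusps inequivalent to
  infinity are distinct, and that they are exactly the values that \<open>j\<close> omits on the upper half plane. These facts
  are proved by a connectedness argument instead of a degree theory for \<open>X\<^sub>0(N)\<close>: the set of values taken at two
  inequivalent points is open by the open mapping theorem, it is closed away from the countable set of critical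
  values and cusp values, and it is bounded because \<open>j\<close> is injective in \<open>q\<close> near infinity. The complement of a
  countable set in the plane is connected, so the set is empty (\<open>j_injective\<close>). Multiplicities need not be followed
  through this argument, and elliptic points require no special treatment.
\<close>

section \<open>Integral matrices of size two\<close>

definition mat2 :: "int \<Rightarrow> int \<Rightarrow> int \<Rightarrow> int \<Rightarrow> int^2^2" where
  "mat2 a b c d = (\<chi> i j. if i = 1 then (if j = 1 then a else b) else (if j = 1 then c else d))"

lemma mat2_sel [simp]:
  "mat2 a b c d $ 1 $ 1 = a" "mat2 a b c d $ 1 $ 2 = b"
  "mat2 a b c d $ 2 $ 1 = c" "mat2 a b c d $ 2 $ 2 = d"
  by (simp_all add: mat2_def)

lemma matrix2_eqI:
  fixes A B :: "int^2^2"
  assumes "A$1$1 = B$1$1" "A$1$2 = B$1$2" "A$2$1 = B$2$1" "A$2$2 = B$2$2"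
  shows "A = B"
  using assms by (simp add: vec_eq_iff forall_2)

lemma matrix2_mult_sel [simp]:
  fixes A B :: "int^2^2"
  shows "(A ** B)$1$1 = A$1$1 * B$1$1 + A$1$2 * B$2$1"
    "(A ** B)$1$2 = A$1$1 * B$1$2 + A$1$2 * B$2$2"
    "(A ** B)$2$1 = A$2$1 * B$1$1 + A$2$2 * B$2$1"
    "(A ** B)$2$2 = A$2$1 * B$1$2 + A$2$2 * B$2$2"
  by (simp_all add: matrix_matrix_mult_def sum_2)

lemma mat_sel [simp]:
  "(mat k :: int^2^2)$1$1 = k" "(mat k :: int^2^2)$1$2 = 0"
  "(mat k :: int^2^2)$2$1 = 0" "(mat k :: int^2^2)$2$2 = k"
  by (simp_all add: mat_def)

text \<open>
  The adjugate: the inverse on \<open>SL\<^sub>2(\<int>)\<close>, but integral for every determinant.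
\<close>

definition adj :: "int^2^2 \<Rightarrow> int^2^2" where
  "adj A = mat2 (A$2$2) (- A$1$2) (- A$2$1) (A$1$1)"

lemma adj_sel [simp]:
  "adj A $ 1 $ 1 = A$2$2" "adj A $ 1 $ 2 = - A$1$2"
  "adj A $ 2 $ 1 = - A$2$1" "adj A $ 2 $ 2 = A$1$1"
  by (simp_all add: adj_def)

lemma adj_adj [simp]: "adj (adj A) = A"
  by (rule matrix2_eqI) simp_all

lemma det_adj [simp]: "det (adj A) = det A"
  by (simp add: det_2 algebra_simps)

lemma det_neg2 [simp]: "det (- A) = det (A :: int^2^2)"
  by (simp add: det_2)

lemma adj_mult: "adj (A ** B) = adj B ** adj A"
  by (rule matrix2_eqI) (simp_all add: algebra_simps)

lemma mult_adj: "A ** adj A = mat (det A)" "adj A ** A = mat (det A)"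
  by (rule matrix2_eqI, simp_all add: det_2 algebra_simps)+

lemma mat_1_mult [simp]: "mat 1 ** A = A" "A ** mat 1 = (A :: int^2^2)"
  by (rule matrix2_eqI, simp_all)+

lemma adj_cancel [simp]:
  assumes "det A = 1"
  shows "A ** adj A = mat 1" "adj A ** A = mat 1"
    "A ** (adj A ** B) = B" "adj A ** (A ** B) = B"
    "(B ** A) ** adj A = B" "(B ** adj A) ** A = B"
proof -
  show 1: "A ** adj A = mat 1" "adj A ** A = mat 1" using mult_adj[of A] assms by auto
  show "A ** (adj A ** B) = B" "adj A ** (A ** B) = B"
    by (simp_all add: matrix_mul_assoc 1)
  show "(B ** A) ** adj A = B" "(B ** adj A) ** A = B"
    by (simp_all add: matrix_mul_assoc[symmetric] 1)
qed

definition Hecke :: "nat \<Rightarrow> nat \<Rightarrow> (int^2^2) set" where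
  "Hecke N n = {A. det A = int n \<and> int N dvd A$2$1}"

lemma Gamma0_iff: "A \<in> Gamma0 N \<longleftrightarrow> det A = 1 \<and> int N dvd A$2$1"
  by (auto simp: Gamma0_def SL2Z_def)

lemma Hecke_iff: "A \<in> Hecke N n \<longleftrightarrow> det A = int n \<and> int N dvd A$2$1"
  by (auto simp: Hecke_def)

lemma SL2Z_iff: "A \<in> SL2Z \<longleftrightarrow> det A = 1"
  by (auto simp: SL2Z_def)

lemma Gamma0_SL2Z: "A \<in> Gamma0 N \<Longrightarrow> A \<in> SL2Z"
  by (auto simp: Gamma0_def)

lemma SL2Z_closed [simp]:
  "mat 1 \<in> SL2Z" "A \<in> SL2Z \<Longrightarrow> B \<in> SL2Z \<Longrightarrow> A ** B \<in> SL2Z"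
  "A \<in> SL2Z \<Longrightarrow> adj A \<in> SL2Z" "A \<in> SL2Z \<Longrightarrow> - A \<in> SL2Z"
  by (auto simp: SL2Z_iff det_mul)

lemma Gamma0_closed [simp]:
  "mat 1 \<in> Gamma0 N" "A \<in> Gamma0 N \<Longrightarrow> B \<in> Gamma0 N \<Longrightarrow> A ** B \<in> Gamma0 N"
  "A \<in> Gamma0 N \<Longrightarrow> adj A \<in> Gamma0 N" "A \<in> Gamma0 N \<Longrightarrow> - A \<in> Gamma0 N"
  by (auto simp: Gamma0_iff det_mul)

lemma Hecke_closed [simp]:
  "A \<in> Gamma0 N \<Longrightarrow> B \<in> Hecke N n \<Longrightarrow> A ** B \<in> Hecke N n"
  "A \<in> Hecke N n \<Longrightarrow> B \<in> Gamma0 N \<Longrightarrow> A ** B \<in> Hecke N n"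
  "A \<in> Hecke N n \<Longrightarrow> adj A \<in> Hecke N n"
  "A \<in> Hecke N n \<Longrightarrow> - A \<in> Hecke N n"
  by (auto simp: Gamma0_iff Hecke_iff det_mul)

section \<open>Moebius transformations\<close>

lemma mem_upper_half_plane [simp]: "\<tau> \<in> upper_half_plane \<longleftrightarrow> Im \<tau> > 0"
  by (simp add: upper_half_plane_def)

text \<open>
  The automorphy factor: it is multiplicative along compositions, and it controls imaginary parts and derivatives.
\<close>

definition den :: "int^2^2 \<Rightarrow> complex \<Rightarrow> complex" where
  "den A \<tau> = of_int (A$2$1) * \<tau> + of_int (A$2$2)"

lemma den_nonzero:
  assumes "Im \<tau> > 0" "det A \<noteq> 0"
  shows "den A \<tau> \<noteq> 0"
proof
  assume h: "den A \<tau> = 0"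
  hence "Im (den A \<tau>) = 0" "Re (den A \<tau>) = 0" by simp_all
  hence "A$2$1 = 0" "A$2$2 = 0" using assms(1) by (auto simp: den_def)
  thus False using assms(2) by (simp add: det_2)
qed

lemma moebius_mult:
  assumes "den B \<tau> \<noteq> 0"
  shows "moebius (A ** B) \<tau> = moebius A (moebius B \<tau>)"
proof -
  let ?n = "of_int (B$1$1) * \<tau> + of_int (B$1$2) :: complex"
  have e: "of_int x * moebius B \<tau> + of_int y = (of_int x * ?n + of_int y * den B \<tau>) / den B \<tau>" for x y
    using assms by (simp add: moebius_def den_def field_simps)
  have "moebius A (moebius B \<tau>) = (of_int (A$1$1) * ?n + of_int (A$1$2) * den B \<tau>)
     / (of_int (A$2$1) * ?n + of_int (A$2$2) * den B \<tau>)"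
    unfolding moebius_def[of A] e using assms by simp
  also have "\<dots> = moebius (A ** B) \<tau>"
    by (simp add: moebius_def den_def algebra_simps)
  finally show ?thesis ..
qed

lemma den_mult:
  assumes "den B \<tau> \<noteq> 0"
  shows "den (A ** B) \<tau> = den A (moebius B \<tau>) * den B \<tau>"
  using assms by (simp add: moebius_def den_def field_simps)

lemma Im_moebius:
  "Im (moebius A \<tau>) = of_int (det A) * Im \<tau> / (cmod (den A \<tau>))\<^sup>2"
  unfolding moebius_def den_def[symmetric] Im_divide cmod_power2
  by (simp add: den_def det_2 algebra_simps)

lemma Im_moebius_pos:
  assumes "Im \<tau> > 0" "det A > 0" shows "Im (moebius A \<tau>) > 0"
  using assms den_nonzero[of \<tau> A] by (simp add: Im_moebius)

lemma moebius_mat_1 [simp]: "moebius (mat 1) \<tau> = \<tau>"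
  by (simp add: moebius_def)

lemma moebius_uminus [simp]: "moebius (- A) \<tau> = moebius A \<tau>"
proof -
  have "moebius (- A) \<tau> = (-(of_int (A $ 1 $ 1) * \<tau> + of_int (A $ 1 $ 2))) / (-(of_int (A $ 2 $ 1) * \<tau> + of_int (A $ 2 $ 2)))"
    by (simp add: moebius_def)
  thus ?thesis unfolding minus_divide_divide by (simp add: moebius_def)
qed

lemma moebius_compose:
  assumes "Im \<tau> > 0" "det B \<noteq> 0"
  shows "moebius A (moebius B \<tau>) = moebius (A ** B) \<tau>"
  using moebius_mult[OF den_nonzero[OF assms]] by simp

lemma moebius_adj:
  assumes "Im \<tau> > 0" "det A \<noteq> 0"
  shows "moebius (adj A) (moebius A \<tau>) = \<tau>"
  using assms by (simp add: moebius_compose mult_adj) (simp add: moebius_def)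

lemma has_field_derivative_moebius:
  assumes "den A \<tau> \<noteq> 0"
  shows "(moebius A has_field_derivative of_int (det A) / (den A \<tau>)\<^sup>2) (at \<tau>)"
proof -
  have "((\<lambda>\<tau>. (of_int (A$1$1) * \<tau> + of_int (A$1$2)) / (of_int (A$2$1) * \<tau> + of_int (A$2$2)))
      has_field_derivative of_int (det A) / (den A \<tau>)\<^sup>2) (at \<tau>)"
    using assms by (auto intro!: derivative_eq_intros simp: den_def det_2 power2_eq_square algebra_simps)
  thus ?thesis by (simp add: moebius_def[abs_def])
qed

lemma holomorphic_moebius:
  assumes "det A \<noteq> 0"
  shows "moebius A holomorphic_on upper_half_plane"
proof (rule holomorphic_onI)
  fix \<tau> assume "\<tau> \<in> upper_half_plane"
  hence "den A \<tau> \<noteq> 0" using assms by (intro den_nonzero) auto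
  from has_field_derivative_moebius[OF this]
  show "moebius A field_differentiable at \<tau> within upper_half_plane"
    using field_differentiable_at_within field_differentiable_def by blast
qed

section \<open>Cusps\<close>

lemma moebius_ext_Infty: "moebius_ext A Infty = cusp (A$1$1) (A$2$1)"
  by (simp add: cusp_def)

lemma SL2Z_coprime:
  assumes "A \<in> SL2Z" shows "coprime (A$1$1) (A$2$1)" "coprime (A$2$2) (A$2$1)"
proof -
  have d: "A$1$1 * A$2$2 - A$1$2 * A$2$1 = 1" using assms by (simp add: SL2Z_iff det_2)
  show "coprime (A$1$1) (A$2$1)"
  proof (rule coprimeI)
    fix c assume "c dvd A$1$1" "c dvd A$2$1"
    hence "c dvd A$1$1 * A$2$2 - A$1$2 * A$2$1" by auto
    thus "is_unit c" using d by simp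
  qed
  show "coprime (A$2$2) (A$2$1)"
  proof (rule coprimeI)
    fix c assume "c dvd A$2$2" "c dvd A$2$1"
    hence "c dvd A$1$1 * A$2$2 - A$1$2 * A$2$1" by auto
    thus "is_unit c" using d by simp
  qed
qed

lemma SL2Z_of_coprime:
  assumes "coprime a (c::int)"
  obtains A where "A \<in> SL2Z" "A$1$1 = a" "A$2$1 = c"
proof -
  obtain u v where "u * a + v * c = 1" using assms bezout_int[of a c] by auto
  hence "mat2 a (-v) c u \<in> SL2Z" by (simp add: SL2Z_iff det_2 algebra_simps)
  thus ?thesis using that[of "mat2 a (-v) c u"] by simp
qed

lemma cusps_eq: "cusps = (\<lambda>A. moebius_ext A Infty) ` SL2Z"
proof (intro equalityI subsetI)
  fix s assume "s \<in> cusps"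
  then obtain a b where ab: "s = cusp a b" "coprime a b" by (auto simp: cusps_def)
  then obtain A where "A \<in> SL2Z" "A$1$1 = a" "A$2$1 = b" using SL2Z_of_coprime by blast
  thus "s \<in> (\<lambda>A. moebius_ext A Infty) ` SL2Z"
    using ab by (intro image_eqI[of _ _ A]) (auto simp: moebius_ext_Infty simp del: moebius_ext.simps)
next
  fix s assume "s \<in> (\<lambda>A. moebius_ext A Infty) ` SL2Z"
  thus "s \<in> cusps" using SL2Z_coprime by (auto simp: cusps_def moebius_ext_Infty simp del: moebius_ext.simps)
qed

lemma cusp_eq_iff:
  assumes "coprime a c" "coprime a' c'"
  shows "cusp a c = cusp a' c' \<longleftrightarrow> a * c' = a' * c"
proof (cases "c = 0 \<or> c' = 0")
  case True
  thus ?thesis using assms by (auto simp: cusp_def)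
next
  case False
  hence "cusp a c = cusp a' c' \<longleftrightarrow> (of_int (a * c') :: complex) = of_int (a' * c)"
    by (simp add: cusp_def field_simps)
  thus ?thesis by (simp only: of_int_eq_iff)
qed

text \<open>
  Both cusps are reduced fractions formed from the first columns, so they agree iff the cross product of the columns
  vanishes, and that is the lower left entry of \<open>B\<^sup>-\<^sup>1 A\<close>.
\<close>

lemma moebius_ext_Infty_eq_iff:
  assumes "A \<in> SL2Z" "B \<in> SL2Z"
  shows "moebius_ext A Infty = moebius_ext B Infty \<longleftrightarrow> (adj B ** A)$2$1 = 0"
  unfolding moebius_ext_Infty
  by (subst cusp_eq_iff) (use assms SL2Z_coprime in \<open>auto simp: algebra_simps\<close>)

lemma moebius_ext_mult_Infty:
  assumes "A \<in> SL2Z" "B \<in> SL2Z"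
  shows "moebius_ext A (moebius_ext B Infty) = moebius_ext (A ** B) Infty"
proof (cases "B$2$1 = 0")
  case True
  hence "B$1$1 \<noteq> 0" using assms by (auto simp: SL2Z_iff det_2)
  thus ?thesis using True by simp
next
  case False
  have "of_int (A$2$1) * (of_int (B$1$1) / of_int (B$2$1)) + of_int (A$2$2) = (0::complex)
     \<longleftrightarrow> (of_int (A$2$1 * B$1$1 + A$2$2 * B$2$1) :: complex) = 0"
    using False by (simp add: field_simps)
  also have "\<dots> \<longleftrightarrow> (A**B)$2$1 = 0" by (subst of_int_eq_0_iff) simp
  finally have iff: "of_int (A$2$1) * (of_int (B$1$1) / of_int (B$2$1)) + of_int (A$2$2) = (0::complex)
     \<longleftrightarrow> (A**B)$2$1 = 0" .
  have "moebius A (of_int (B$1$1) / of_int (B$2$1)) = (of_int (A$1$1 * B$1$1 + A$1$2 * B$2$1) / of_int (B$2$1))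
      / (of_int (A$2$1 * B$1$1 + A$2$2 * B$2$1) / of_int (B$2$1))"
    using False by (simp add: moebius_def field_simps)
  also have "\<dots> = of_int ((A**B)$1$1) / of_int ((A**B)$2$1)"
    using False by simp
  finally show ?thesis using False iff by simp
qed

lemma Gamma0_equiv_cusps:
  assumes "A \<in> SL2Z" "B \<in> SL2Z"
  shows "Gamma0_equiv N (moebius_ext A Infty) (moebius_ext B Infty)
    \<longleftrightarrow> (\<exists>\<gamma>\<in>Gamma0 N. (adj B ** \<gamma> ** A)$2$1 = 0)"
  unfolding Gamma0_equiv_def
proof (rule bex_cong[OF refl])
  fix \<gamma> assume g: "\<gamma> \<in> Gamma0 N"
  hence "moebius_ext \<gamma> (moebius_ext A Infty) = moebius_ext (\<gamma> ** A) Infty"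
    using assms moebius_ext_mult_Infty Gamma0_SL2Z by blast
  thus "(moebius_ext B Infty = moebius_ext \<gamma> (moebius_ext A Infty)) \<longleftrightarrow> (adj B ** \<gamma> ** A)$2$1 = 0"
    using moebius_ext_Infty_eq_iff[of "\<gamma> ** A" B] assms g
    by (metis Gamma0_SL2Z SL2Z_closed(2) matrix_mul_assoc)
qed

lemma SL2Z_upper:
  assumes "A \<in> SL2Z" "A$2$1 = 0"
  shows "moebius A \<tau> = \<tau> + of_int (A$1$1 * A$1$2)" "A$1$1 = A$2$2" "A$1$1 = 1 \<or> A$1$1 = -1"
proof -
  have 1: "A$1$1 * A$2$2 = 1" using assms by (simp add: SL2Z_iff det_2)
  thus 2: "A$1$1 = A$2$2" "A$1$1 = 1 \<or> A$1$1 = -1" using zmult_eq_1_iff by auto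
  show "moebius A \<tau> = \<tau> + of_int (A$1$1 * A$1$2)"
    using 2 assms(2) by (auto simp: moebius_def)
qed

text \<open>
  Dividing the first column by its gcd gives a primitive vector, which is the first column of some \<open>\<sigma>\<close> in
  \<open>SL\<^sub>2(\<int>)\<close>. The gcd divides \<open>n\<close>; if it is prime to \<open>N\<close>, divisibility of the lower left entry by \<open>N\<close> survives
  the division.
\<close>

lemma triangular_decomposition:
  assumes "det A = int n" "n > 0"
  obtains \<sigma> B where "\<sigma> \<in> SL2Z" "A = \<sigma> ** B" "det B = int n" "B$2$1 = 0" "B$1$1 > 0" "B$2$2 > 0"
    "coprime n N \<Longrightarrow> int N dvd A$2$1 \<Longrightarrow> \<sigma> \<in> Gamma0 N"
proof -
  define g where "g = gcd (A$1$1) (A$2$1)"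
  have dt: "A$1$1 * A$2$2 - A$1$2 * A$2$1 = int n" using assms by (simp add: det_2)
  have "g \<noteq> 0" using dt assms by (auto simp: g_def)
  hence g0: "g > 0" by (simp add: g_def order_less_le)
  obtain u v where uv: "u * A$1$1 + v * A$2$1 = g" using bezout_int g_def by blast
  define x y where "x = A$1$1 div g" and "y = A$2$1 div g"
  have xy: "A$1$1 = g * x" "A$2$1 = g * y" by (auto simp: x_def y_def g_def)
  have "g * (u * x + v * y) = g * 1" using uv xy by (simp add: algebra_simps)
  hence uv1: "u * x + v * y = 1" using g0 by simp
  define \<sigma> where "\<sigma> = mat2 x (-v) y u"
  define B where "B = adj \<sigma> ** A"
  have s: "\<sigma> \<in> SL2Z" using uv1 by (simp add: \<sigma>_def SL2Z_iff det_2 algebra_simps)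
  hence ds: "det \<sigma> = 1" by (simp add: SL2Z_iff)
  have AB: "A = \<sigma> ** B" using ds by (simp add: B_def)
  have dB: "det B = int n" using ds assms by (simp add: B_def det_mul)
  have B21: "B$2$1 = 0" by (simp add: B_def \<sigma>_def xy)
  have B11: "B$1$1 = g" using uv by (simp add: B_def \<sigma>_def algebra_simps)
  have "g * B$2$2 = int n" using dB B21 B11 by (simp add: det_2)
  hence B22: "B$2$2 > 0" using g0 assms by (metis of_nat_0_less_iff zero_less_mult_pos)
  have last: "\<sigma> \<in> Gamma0 N" if "coprime n N" "int N dvd A$2$1"
  proof -
    have "g dvd int n" using \<open>g * B$2$2 = int n\<close> by (metis dvd_triv_left)
    hence "coprime g (int N)" using that(1)
      by (meson coprime_divisors coprime_int_iff dvd_refl)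
    hence "int N dvd y" using that(2) xy by (simp add: coprime_commute coprime_dvd_mult_right_iff)
    thus ?thesis using ds by (simp add: Gamma0_iff \<sigma>_def)
  qed
  show ?thesis by (rule that[OF s AB dB B21 _ B22 last]) (use B11 g0 in auto)
qed

section \<open>Cosets of matrices of determinant n\<close>

definition coset :: "nat \<Rightarrow> int^2^2 \<Rightarrow> (int^2^2) set" where
  "coset N A = {\<gamma> ** A | \<gamma>. \<gamma> \<in> Gamma0 N}"

definition hcosets :: "nat \<Rightarrow> nat \<Rightarrow> (int^2^2) set set" where
  "hcosets N n = coset N ` Hecke N n"

lemma coset_self [simp]: "A \<in> coset N A"
  unfolding coset_def using mat_1_mult(1)[of A] Gamma0_closed(1) by (metis (mono_tags, lifting) mem_Collect_eq)

lemma coset_memI: "\<gamma> \<in> Gamma0 N \<Longrightarrow> \<gamma> ** A \<in> coset N A"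
  by (auto simp: coset_def)

lemma coset_mult:
  assumes "\<gamma> \<in> Gamma0 N"
  shows "coset N (\<gamma> ** A) = coset N A"
proof -
  have d: "det \<gamma> = 1" using assms by (simp add: Gamma0_iff)
  have "\<exists>\<gamma>'. \<delta> ** (\<gamma> ** A) = \<gamma>' ** A \<and> \<gamma>' \<in> Gamma0 N" if "\<delta> \<in> Gamma0 N" for \<delta>
    using that assms by (intro exI[of _ "\<delta> ** \<gamma>"]) (auto simp: matrix_mul_assoc)
  moreover have "\<exists>\<gamma>'. \<delta> ** A = \<gamma>' ** (\<gamma> ** A) \<and> \<gamma>' \<in> Gamma0 N" if "\<delta> \<in> Gamma0 N" for \<delta>
    using that assms d by (intro exI[of _ "\<delta> ** adj \<gamma>"]) (auto simp: matrix_mul_assoc)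
  ultimately show ?thesis unfolding coset_def by blast
qed

lemma coset_eq_iff: "coset N A = coset N B \<longleftrightarrow> (\<exists>\<gamma>\<in>Gamma0 N. B = \<gamma> ** A)"
proof
  assume "coset N A = coset N B"
  hence "B \<in> coset N A" by simp
  thus "\<exists>\<gamma>\<in>Gamma0 N. B = \<gamma> ** A" by (auto simp: coset_def)
qed (auto simp: coset_mult)

lemma coset_eqI: "A \<in> coset N B \<Longrightarrow> coset N A = coset N B"
proof -
  assume "A \<in> coset N B"
  then obtain \<gamma> where "\<gamma> \<in> Gamma0 N" "A = \<gamma> ** B" by (auto simp: coset_def)
  thus ?thesis by (simp add: coset_mult)
qed

lemma hcosets_mem:
  assumes "X \<in> hcosets N n" "A \<in> X"
  shows "A \<in> Hecke N n" "X = coset N A"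
proof -
  obtain B where B: "B \<in> Hecke N n" "X = coset N B" using assms(1) by (auto simp: hcosets_def)
  show "X = coset N A" using coset_eqI assms(2) B(2) by blast
  show "A \<in> Hecke N n" using assms(2) B by (auto simp: coset_def)
qed

lemma hcosets_nonempty: "X \<in> hcosets N n \<Longrightarrow> \<exists>A. A \<in> X"
  unfolding hcosets_def using coset_self by blast

lemma coset_in_hcosets: "A \<in> Hecke N n \<Longrightarrow> coset N A \<in> hcosets N n"
  by (auto simp: hcosets_def)

text \<open>
  This permutation of the cosets makes products over all cosets invariant under \<open>\<Gamma>\<^sub>0(N)\<close>.
\<close>

lemma hcosets_right_mult:
  assumes "\<gamma> \<in> Gamma0 N"
  shows "bij_betw (\<lambda>X. (\<lambda>A. A ** \<gamma>) ` X) (hcosets N n) (hcosets N n)"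
proof -
  have d: "det \<gamma> = 1" using assms by (simp add: Gamma0_iff)
  have e: "(\<lambda>A. A ** \<delta>) ` coset N A = coset N (A ** \<delta>)" for A \<delta>
    unfolding coset_def setcompr_eq_image image_image by (simp add: matrix_mul_assoc)
  have im: "(\<lambda>A. A ** \<delta>) ` X \<in> hcosets N n" if "\<delta> \<in> Gamma0 N" "X \<in> hcosets N n" for X \<delta>
    using that by (auto simp: hcosets_def e)
  show ?thesis
    by (rule bij_betw_byWitness[where f' = "\<lambda>X. (\<lambda>A. A ** adj \<gamma>) ` X"])
       (use assms im d in \<open>auto simp: image_image\<close>)
qed

lemma hcosets_upper_representative:
  assumes "n > 0" "coprime n N" "X \<in> hcosets N n"
  shows "\<exists>B\<in>X. B$2$1 = 0"
proof -
  obtain A where A: "A \<in> X" using hcosets_nonempty[OF assms(3)] by blast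
  have AH: "A \<in> Hecke N n" "X = coset N A" using hcosets_mem[OF assms(3) A] by auto
  have dA: "det A = int n" "int N dvd A$2$1" using AH(1) by (auto simp: Hecke_iff)
  obtain \<sigma> B where sB: "A = \<sigma> ** B" "B$2$1 = 0" "\<sigma> \<in> Gamma0 N"
    by (rule triangular_decomposition[OF dA(1) assms(1), of N]) (use dA(2) assms(2) in blast)
  hence "B \<in> X" using AH(2) coset_mult coset_self by metis
  thus ?thesis using sB(2) by blast
qed

section \<open>Cosets fixing a cusp\<close>

lemma lower_left_conj:
  fixes \<sigma> :: "int^2^2"
  shows "(\<sigma> ** mat2 a b 0 d ** adj \<sigma>)$2$1 = \<sigma>$2$1 * (\<sigma>$2$2 * (a - d) - \<sigma>$2$1 * b)"
  by (simp add: algebra_simps)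

text \<open>
  Let \<open>(y, w)\<close> be the bottom row of \<open>\<sigma>\<close>. By \<open>lower_left_conj\<close> the conjugate by \<open>\<sigma>\<close> of the triangular matrix with
  diagonal \<open>(a, d)\<close> and upper right entry \<open>b\<close> has lower left entry \<open>y (w (a - d) - y b)\<close>, and it must be divisible
  by \<open>N\<close>. After the factor \<open>gcd y N\<close> is removed, this is a linear congruence for \<open>b\<close> modulo \<open>N' = N / gcd y N\<close>.
  It is solvable iff \<open>g = gcd y N'\<close> divides \<open>a - d\<close>, which for \<open>a d = n\<close> prime to \<open>N\<close> means \<open>n \<equiv> d\<^sup>2 (mod g)\<close>,
  and then \<open>b\<close> is determined modulo the width \<open>h = N' / g\<close> of the cusp.
\<close>

lemma cusp_congruences:
  fixes y w :: int and N n :: nat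
  assumes "N > 0" "coprime w y"
  defines "N' \<equiv> N div gcd (nat \<bar>y\<bar>) N"
  defines "g \<equiv> gcd (nat \<bar>y\<bar>) N'"
  defines "h \<equiv> N' div g"
  shows "h > 0" "int N dvd y * k \<longleftrightarrow> int N' dvd k"
    "int N' dvd y * m \<longleftrightarrow> int h dvd m"
    "a * int d = int n \<Longrightarrow> int N' dvd w * (a - int d) - y * b \<Longrightarrow> [n = d\<^sup>2] (mod g)"
    "coprime n N \<Longrightarrow> a * int d = int n \<Longrightarrow> [n = d\<^sup>2] (mod g) \<Longrightarrow>
       \<exists>\<beta>. \<forall>b. int N' dvd w * (a - int d) - y * b \<longleftrightarrow> int h dvd b - \<beta>"
proof -
  have gG: "int (gcd (nat \<bar>y\<bar>) x) = gcd y (int x)" for x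
    unfolding gcd_int_def by simp
  define G where "G = gcd (nat \<bar>y\<bar>) N"
  have G0: "G > 0" using assms(1) by (simp add: G_def)
  have NG: "N = N' * G" by (simp only: N'_def G_def dvd_div_mult_self[OF gcd_dvd2])
  have N'0: "N' > 0" using NG assms(1) by (cases "N' = 0") auto
  have g0: "g > 0" using N'0 by (simp add: g_def)
  have hg: "N' = h * g" by (simp only: h_def g_def dvd_div_mult_self[OF gcd_dvd2])
  show h0: "h > 0" using hg N'0 by (cases "h = 0") auto
  have GY: "int G dvd y" using gG[of N] by (simp add: G_def)
  then obtain y' where y': "y = int G * y'" by blast
  have "coprime y' (int N')"
  proof -
    have e: "gcd y (int N) = int G" using gG[of N] by (simp only: G_def)
    have "gcd y (int N) \<noteq> 0" "y = y' * gcd y (int N)" "int N = int N' * gcd y (int N)"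
      unfolding e using G0 y' NG by (simp_all add: mult.commute)
    thus ?thesis by (rule gcd_coprime)
  qed
  note cop1 = this
  show N1: "int N dvd y * k \<longleftrightarrow> int N' dvd k" for k
  proof -
    have "int N dvd y * k \<longleftrightarrow> int G * int N' dvd int G * (y' * k)"
      using y' NG by (simp add: ac_simps)
    also have "\<dots> \<longleftrightarrow> int N' dvd y' * k" using G0 by simp
    also have "\<dots> \<longleftrightarrow> int N' dvd k" using cop1 by (simp add: coprime_commute coprime_dvd_mult_right_iff)
    finally show ?thesis .
  qed
  have gy: "int g dvd y" using gG[of N'] by (simp add: g_def)
  then obtain z where z: "y = int g * z" by blast
  have cop2: "coprime z (int h)"
  proof -
    have e: "gcd y (int N') = int g" using gG[of N'] by (simp only: g_def)
    have "gcd y (int N') \<noteq> 0" "y = z * gcd y (int N')" "int N' = int h * gcd y (int N')"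
      unfolding e using g0 z hg by (simp_all add: mult.commute)
    thus ?thesis by (rule gcd_coprime)
  qed
  show "int N' dvd y * m \<longleftrightarrow> int h dvd m" for m
  proof -
    have "int N' dvd y * m \<longleftrightarrow> int g * int h dvd int g * (z * m)"
      using z hg by (simp add: ac_simps)
    also have "\<dots> \<longleftrightarrow> int h dvd z * m" using g0 by simp
    also have "\<dots> \<longleftrightarrow> int h dvd m" using cop2 by (simp add: coprime_commute coprime_dvd_mult_right_iff)
    finally show ?thesis .
  qed
  have gN': "int g dvd int N'" using hg by simp
  have cong: "[n = d\<^sup>2] (mod g) \<longleftrightarrow> int g dvd int d * (a - int d)" if "a * int d = int n" for a d
  proof -
    have "[n = d\<^sup>2] (mod g) \<longleftrightarrow> [int n = int (d\<^sup>2)] (mod int g)" by (simp only: cong_int_iff)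
    also have "\<dots> \<longleftrightarrow> int g dvd int n - int (d\<^sup>2)" by (simp add: cong_iff_dvd_diff)
    also have "int n - int (d\<^sup>2) = int d * (a - int d)"
      using that by (simp add: power2_eq_square algebra_simps)
    finally show ?thesis .
  qed
  show "[n = d\<^sup>2] (mod g)" if "a * int d = int n" "int N' dvd w * (a - int d) - y * b" for a b d
  proof -
    have "int g dvd w * (a - int d) - y * b" using gN' that(2) by (rule dvd_trans)
    hence "int g dvd (w * (a - int d) - y * b) + y * b" using gy by (meson dvd_add dvd_mult2)
    hence "int g dvd w * (a - int d)" by simp
    moreover have "coprime (int g) w" using assms(2) gy by (meson coprime_commute coprime_divisors dvd_refl)
    ultimately have "int g dvd a - int d" by (simp add: coprime_dvd_mult_right_iff)
    thus ?thesis using cong[OF that(1)] by simp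
  qed
  show "\<exists>\<beta>. \<forall>b. int N' dvd w * (a - int d) - y * b \<longleftrightarrow> int h dvd b - \<beta>"
    if "coprime n N" "a * int d = int n" "[n = d\<^sup>2] (mod g)" for a d
  proof -
    have "int d dvd int n" using that(2) by (metis dvd_triv_right)
    hence "coprime d N" using that(1) by (meson coprime_divisors dvd_refl of_nat_dvd_iff)
    moreover have "g dvd N" using NG hg by simp
    ultimately have "coprime g d" by (meson coprime_commute coprime_divisors dvd_refl)
    hence "coprime (int g) (int d)" by simp
    moreover have "int g dvd int d * (a - int d)" using cong[OF that(2)] that(3) by simp
    ultimately have "int g dvd a - int d" by (simp add: coprime_dvd_mult_right_iff)
    hence "int g dvd w * (a - int d)" by simp
    then obtain e where e: "w * (a - int d) = int g * e" by blast
    obtain u v where uv: "u * z + v * int h = 1" using cop2 bezout_int[of z "int h"] by auto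
    show ?thesis
    proof (intro exI allI)
      fix b
      have "w * (a - int d) - y * b = int g * (e - z * b)" using e z by (simp add: algebra_simps)
      hence "int N' dvd w * (a - int d) - y * b \<longleftrightarrow> int g * int h dvd int g * (e - z * b)"
        using hg by (simp add: mult.commute)
      also have "\<dots> \<longleftrightarrow> int h dvd e - z * b" using g0 by simp
      also have "\<dots> \<longleftrightarrow> int h dvd z * (b - e * u)"
      proof -
        have "e - z * b = - (z * (b - e * u)) + int h * (v * e)"
        proof -
          have "e = (u * z + v * int h) * e" using uv by simp
          thus ?thesis by (simp add: algebra_simps)
        qed
        moreover have "int h dvd - (z * (b - e * u)) + int h * (v * e) \<longleftrightarrow> int h dvd - (z * (b - e * u))"
          by (rule dvd_add_left_iff) simp
        ultimately show ?thesis by simp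
      qed
      also have "\<dots> \<longleftrightarrow> int h dvd b - e * u" using cop2 by (simp add: coprime_commute coprime_dvd_mult_right_iff)
      finally show "int N' dvd w * (a - int d) - y * b \<longleftrightarrow> int h dvd b - e * u" .
    qed
  qed
qed

text \<open>
  The cosets fixing the cusp \<open>\<sigma>\<infinity>\<close> are represented by conjugates of triangular matrices. The unipotent elements of
  \<open>\<sigma>\<^sup>-\<^sup>1 \<Gamma>\<^sub>0(N) \<sigma>\<close> are the translations by multiples of \<open>h\<close>, and left multiplication by the translation by \<open>h\<close>
  shifts the upper right entry by \<open>h d\<close>. As that entry runs through a residue class modulo \<open>h\<close>, there remain \<open>d\<close>
  cosets for each admissible \<open>d\<close>.
\<close>

lemma cusp_cosets:
  fixes \<sigma> :: "int^2^2" and N n :: nat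
  assumes "N > 0" "n > 0" "coprime n N" "\<sigma> \<in> SL2Z"
  defines "N' \<equiv> N div gcd (nat \<bar>\<sigma>$2$1\<bar>) N"
  defines "g \<equiv> gcd (nat \<bar>\<sigma>$2$1\<bar>) N'"
  defines "h \<equiv> N' div g"
  defines "D \<equiv> {d. d dvd n \<and> [n = d\<^sup>2] (mod g)}"
  obtains \<beta> :: "nat \<Rightarrow> int" where
    "\<And>d k. d \<in> D \<Longrightarrow> \<sigma> ** mat2 (int (n div d)) (\<beta> d + int h * int k) 0 (int d) ** adj \<sigma> \<in> Hecke N n"
    "bij_betw (\<lambda>(d,k). coset N (\<sigma> ** mat2 (int (n div d)) (\<beta> d + int h * int k) 0 (int d) ** adj \<sigma>))
       (SIGMA d:D. {..<d}) {X \<in> hcosets N n. \<exists>A\<in>X. (adj \<sigma> ** A ** \<sigma>)$2$1 = 0}"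
proof -
  define y w where "y = \<sigma>$2$1" and "w = \<sigma>$2$2"
  have ds: "det \<sigma> = 1" using assms(4) by (simp add: SL2Z_iff)
  have wy: "coprime w y" using SL2Z_coprime(2)[OF assms(4)] by (simp add: y_def w_def)
  note cc = cusp_congruences[OF assms(1) wy, folded N'_def[folded y_def], folded g_def[folded y_def], folded h_def]
  have eq: "int (n div d) * int d = int n" if "d dvd n" for d
    using that by (metis dvd_div_mult_self of_nat_mult)
  have "\<exists>\<beta>. \<forall>b. int N' dvd w * (int (n div d) - int d) - y * b \<longleftrightarrow> int h dvd b - \<beta>" if "d \<in> D" for d
    using cc(5)[OF assms(3) eq, of d] that by (auto simp: D_def)
  then obtain \<beta> where \<beta>: "\<And>d b. d \<in> D \<Longrightarrow> int N' dvd w * (int (n div d) - int d) - y * b \<longleftrightarrow> int h dvd b - \<beta> d"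
    by metis
  define B where "B = (\<lambda>d k. mat2 (int (n div d)) (\<beta> d + int h * int k) 0 (int d))"
  define Fix where "Fix = {X \<in> hcosets N n. \<exists>A\<in>X. (adj \<sigma> ** A ** \<sigma>)$2$1 = 0}"
  have D0: "d > 0" if "d \<in> D" for d using that assms(2) by (auto simp: D_def intro: Nat.gr0I)
  have H: "\<sigma> ** B d k ** adj \<sigma> \<in> Hecke N n" if "d \<in> D" for d k
  proof -
    have "det (B d k) = int n" using that eq by (simp add: B_def det_2 D_def)
    moreover have "int N dvd (\<sigma> ** B d k ** adj \<sigma>)$2$1"
      unfolding B_def lower_left_conj y_def[symmetric] w_def[symmetric] cc(2) \<beta>[OF that] by simp
    ultimately show ?thesis using ds by (simp add: Hecke_iff det_mul)
  qed
  have inj: "d = d' \<and> k = k'" if d: "d \<in> D" "d' \<in> D" "k < d" "k' < d'"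
    and e: "coset N (\<sigma> ** B d k ** adj \<sigma>) = coset N (\<sigma> ** B d' k' ** adj \<sigma>)" for d d' k k'
  proof -
    obtain \<gamma> where \<gamma>: "\<gamma> \<in> Gamma0 N" "\<sigma> ** B d' k' ** adj \<sigma> = \<gamma> ** (\<sigma> ** B d k ** adj \<sigma>)"
      using e coset_eq_iff by metis
    define \<delta> where "\<delta> = adj \<sigma> ** \<gamma> ** \<sigma>"
    have "adj \<sigma> ** (\<sigma> ** B d' k' ** adj \<sigma>) ** \<sigma> = \<delta> ** B d k"
      unfolding \<gamma> \<delta>_def using ds by (simp add: matrix_mul_assoc)
    hence 1: "B d' k' = \<delta> ** B d k" using ds by (simp add: matrix_mul_assoc)
    have dd: "det \<delta> = 1" using ds \<gamma>(1) by (simp add: \<delta>_def det_mul Gamma0_iff)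
    have "n div d > 0" using eq[of d] d assms(2) by (cases "n div d = 0") (auto simp: D_def)
    hence 2: "\<delta>$2$1 = 0" using arg_cong[OF 1, of "\<lambda>A. A$2$1"] by (simp add: B_def)
    have 3: "\<delta>$1$1 * \<delta>$2$2 = 1" using dd 2 by (simp add: det_2)
    have 4: "int d' = \<delta>$2$2 * int d" using arg_cong[OF 1, of "\<lambda>A. A$2$2"] 2 by (simp add: B_def)
    have "\<delta>$2$2 > 0" using 4 D0[OF d(1)] D0[OF d(2)] by (metis of_nat_0_less_iff zero_less_mult_pos2)
    hence 5: "\<delta>$2$2 = 1" "\<delta>$1$1 = 1" using 3 by (auto simp: zmult_eq_1_iff)
    have 6: "d' = d" using 4 5 by simp
    have 7: "\<beta> d + int h * int k' = \<beta> d + int h * int k + \<delta>$1$2 * int d"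
      using arg_cong[OF 1, of "\<lambda>A. A$1$2"] 5 6 by (simp add: B_def)
    have "\<delta> = mat2 1 (\<delta>$1$2) 0 1" by (rule matrix2_eqI) (simp_all add: 5 2)
    moreover have "\<gamma> = \<sigma> ** \<delta> ** adj \<sigma>" using ds by (simp add: \<delta>_def matrix_mul_assoc)
    ultimately have "\<gamma>$2$1 = y * (w * (1 - 1) - y * \<delta>$1$2)"
      by (metis lower_left_conj y_def w_def)
    hence "int N dvd y * (w * (1 - 1) - y * \<delta>$1$2)" using \<gamma>(1) by (simp add: Gamma0_iff)
    hence "int h dvd \<delta>$1$2" unfolding cc(2) using cc(3) by simp
    then obtain m where m: "\<delta>$1$2 = int h * m" by blast
    have "int h * (int k' - int k) = int h * (m * int d)" using 7 m by (simp add: algebra_simps)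
    hence 8: "int k' - int k = m * int d" using cc(1) by simp
    have "m = 0"
    proof (rule ccontr)
      assume "m \<noteq> 0"
      hence "1 * int d \<le> \<bar>m\<bar> * int d" by (intro mult_right_mono) auto
      hence "\<bar>m * int d\<bar> \<ge> int d" by (simp add: abs_mult)
      thus False using 8 d 6 by auto
    qed
    thus ?thesis using 8 6 by simp
  qed
  have surj: "\<exists>d k. d \<in> D \<and> k < d \<and> X = coset N (\<sigma> ** B d k ** adj \<sigma>)" if X: "X \<in> Fix" for X
  proof -
    obtain A0 where A0: "A0 \<in> X" "(adj \<sigma> ** A0 ** \<sigma>)$2$1 = 0" "X \<in> hcosets N n" using X by (auto simp: Fix_def)
    (* The lower right entry may have the wrong sign; a coset contains the negatives of its elements. *)
    have "- A0 \<in> X"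
    proof -
      have "- A0 = (- mat 1) ** A0" by (rule matrix2_eqI) simp_all
      hence "- A0 \<in> coset N A0" unfolding coset_def using Gamma0_closed by blast
      thus ?thesis using hcosets_mem[OF A0(3) A0(1)] by simp
    qed
    have "adj \<sigma> ** (-A0) ** \<sigma> = - (adj \<sigma> ** A0 ** \<sigma>)"
      by (rule matrix2_eqI) (simp_all add: algebra_simps)
    then obtain A where A: "A \<in> X" "(adj \<sigma> ** A ** \<sigma>)$2$1 = 0" "(adj \<sigma> ** A ** \<sigma>)$2$2 \<ge> 0"
      using A0 \<open>- A0 \<in> X\<close> by (metis neg_0_le_iff_le linear uminus_apply vector_uminus_component minus_zero)
    define B0 where "B0 = adj \<sigma> ** A ** \<sigma>"
    have AH: "A \<in> Hecke N n" "X = coset N A" using hcosets_mem[OF A0(3) A(1)] by auto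
    have "det B0 = int n" using AH ds by (simp add: B0_def det_mul Hecke_iff)
    hence ad: "B0$1$1 * B0$2$2 = int n" using A(2) by (simp add: B0_def[symmetric] det_2)
    define d where "d = nat (B0$2$2)"
    have B22: "B0$2$2 = int d" using A(3) by (simp add: d_def B0_def)
    have d0: "d > 0" using ad assms(2) B22 by (cases "d = 0") auto
    have "int d dvd int n" using ad B22 by (metis dvd_triv_right)
    hence dn: "d dvd n" by simp
    have B11: "B0$1$1 = int (n div d)" using ad B22 eq[OF dn] d0
      by (metis mult_right_cancel of_nat_0_less_iff order_less_irrefl)
    have B0': "B0 = mat2 (int (n div d)) (B0$1$2) 0 (int d)"
      by (rule matrix2_eqI) (use B11 B22 A(2) in \<open>simp_all add: B0_def\<close>)
    have AB: "A = \<sigma> ** B0 ** adj \<sigma>" using ds by (simp add: B0_def matrix_mul_assoc)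
    have "A$2$1 = y * (w * (int (n div d) - int d) - y * B0$1$2)"
      by (subst AB, subst B0', subst lower_left_conj) (simp add: y_def w_def)
    hence N1: "int N' dvd w * (int (n div d) - int d) - y * B0$1$2"
      using AH(1) cc(2) by (simp add: Hecke_iff)
    hence dD: "d \<in> D" using cc(4)[OF eq[OF dn]] dn by (simp add: D_def)
    hence "int h dvd B0$1$2 - \<beta> d" using N1 \<beta> by blast
    then obtain q where q: "B0$1$2 - \<beta> d = int h * q" by blast
    define k m where "k = nat (q mod int d)" and "m = q div int d"
    have k: "k < d" using d0 by (simp add: k_def nat_less_iff)
    have qk: "q = int k + m * int d" using d0 by (simp add: k_def m_def)
    define \<gamma> where "\<gamma> = \<sigma> ** mat2 1 (int h * m) 0 1 ** adj \<sigma>"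
    have "B0 = mat2 1 (int h * m) 0 1 ** B d k"
      by (subst B0', rule matrix2_eqI) (use q qk in \<open>simp_all add: B_def algebra_simps\<close>)
    hence "A = \<gamma> ** (\<sigma> ** B d k ** adj \<sigma>)"
      using ds AB by (simp add: \<gamma>_def matrix_mul_assoc)
    moreover have "\<gamma> \<in> Gamma0 N"
    proof -
      have "int N' dvd y * (- (int h * m))" unfolding cc(3) by simp
      hence "int N dvd \<gamma>$2$1"
        unfolding \<gamma>_def lower_left_conj y_def[symmetric] w_def[symmetric] cc(2) by simp
      moreover have "det \<gamma> = 1" using ds by (simp add: \<gamma>_def det_mul) (simp add: det_2)
      ultimately show ?thesis by (simp add: Gamma0_iff)
    qed
    ultimately have "X = coset N (\<sigma> ** B d k ** adj \<sigma>)" using AH(2) coset_mult by simp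
    thus ?thesis using dD k by blast
  qed
  have into: "coset N (\<sigma> ** B d k ** adj \<sigma>) \<in> Fix" if "d \<in> D" for d k
  proof -
    have "adj \<sigma> ** (\<sigma> ** B d k ** adj \<sigma>) ** \<sigma> = B d k" using ds by (simp add: matrix_mul_assoc)
    hence "(adj \<sigma> ** (\<sigma> ** B d k ** adj \<sigma>) ** \<sigma>)$2$1 = 0" by (simp only: B_def mat2_sel)
    thus ?thesis using coset_in_hcosets[OF H[OF that]] coset_self unfolding Fix_def by blast
  qed
  have "bij_betw (\<lambda>(d,k). coset N (\<sigma> ** B d k ** adj \<sigma>)) (SIGMA d:D. {..<d}) Fix"
    unfolding bij_betw_def
  proof (intro conjI equalityI subsetI)
    show "inj_on (\<lambda>(d,k). coset N (\<sigma> ** B d k ** adj \<sigma>)) (SIGMA d:D. {..<d})"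
      using inj by (auto simp: inj_on_def)
  next
    fix X assume "X \<in> Fix"
    then obtain d k where "d \<in> D" "k < d" "X = coset N (\<sigma> ** B d k ** adj \<sigma>)" using surj by blast
    thus "X \<in> (\<lambda>(d,k). coset N (\<sigma> ** B d k ** adj \<sigma>)) ` (SIGMA d:D. {..<d})"
      by (intro image_eqI[of _ _ "(d,k)"]) auto
  qed (use into in auto)
  from that[of \<beta>, OF H[unfolded B_def] this[unfolded B_def Fix_def]] show ?thesis by blast
qed

section \<open>Reduction theory\<close>

text \<open>
  If the bottom rows of \<open>A\<close> and \<open>\<sigma>\<close> agree modulo \<open>N\<close>, then the lower left entry of \<open>A \<sigma>\<^sup>-\<^sup>1\<close>, their
  determinant, is divisible by \<open>N\<close>.
\<close>

lemma finite_index_Gamma0: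
  assumes "N > 0"
  obtains \<Sigma> where "finite \<Sigma>" "\<Sigma> \<subseteq> SL2Z" "\<And>A. A \<in> SL2Z \<Longrightarrow> \<exists>\<gamma>\<in>Gamma0 N. \<exists>\<sigma>\<in>\<Sigma>. A = \<gamma> ** \<sigma>"
proof -
  define \<phi> where "\<phi> = (\<lambda>A::int^2^2. (A$2$1 mod int N, A$2$2 mod int N))"
  define rep where "rep = (\<lambda>v. SOME A. A \<in> SL2Z \<and> \<phi> A = v)"
  have rep: "rep (\<phi> A) \<in> SL2Z \<and> \<phi> (rep (\<phi> A)) = \<phi> A" if "A \<in> SL2Z" for A
    unfolding rep_def by (rule someI[of _ A]) (use that in auto)
  have "\<phi> ` SL2Z \<subseteq> {0..<int N} \<times> {0..<int N}"
    using assms by (auto simp: \<phi>_def)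
  hence "finite (\<phi> ` SL2Z)" by (rule finite_subset) auto
  show ?thesis
  proof (rule that[of "rep ` \<phi> ` SL2Z"])
    show "finite (rep ` \<phi> ` SL2Z)" using \<open>finite (\<phi> ` SL2Z)\<close> by auto
    show "rep ` \<phi> ` SL2Z \<subseteq> SL2Z" using rep by auto
    fix A assume A: "A \<in> SL2Z"
    define \<sigma> where "\<sigma> = rep (\<phi> A)"
    have s: "\<sigma> \<in> SL2Z" "\<phi> \<sigma> = \<phi> A" using rep[OF A] by (auto simp: \<sigma>_def)
    have "[A$2$1 * \<sigma>$2$2 = \<sigma>$2$1 * A$2$2] (mod int N)"
      by (rule cong_mult) (use s(2) in \<open>auto simp: \<phi>_def cong_def\<close>)
    hence "int N dvd (A ** adj \<sigma>)$2$1" by (simp add: cong_iff_dvd_diff algebra_simps)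
    moreover have "det (A ** adj \<sigma>) = 1" using A s by (simp add: det_mul SL2Z_iff)
    ultimately have "A ** adj \<sigma> \<in> Gamma0 N" by (simp add: Gamma0_iff)
    moreover have "A = (A ** adj \<sigma>) ** \<sigma>" using s(1) by (simp add: SL2Z_iff)
    ultimately show "\<exists>\<gamma>\<in>Gamma0 N. \<exists>\<sigma>\<in>rep ` \<phi> ` SL2Z. A = \<gamma> ** \<sigma>"
      using A unfolding \<sigma>_def by blast
  qed
qed

lemma den_bounds:
  assumes "Im \<tau> \<ge> r" "r > 0"
  shows "\<bar>of_int (A$2$1)\<bar> \<le> cmod (den A \<tau>) / r"
    "\<bar>of_int (A$2$2)\<bar> \<le> cmod (den A \<tau>) + cmod (den A \<tau>) / r * cmod \<tau>"
proof -
  have "\<bar>Im (den A \<tau>)\<bar> \<le> cmod (den A \<tau>)" by (rule abs_Im_le_cmod)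
  moreover have "\<bar>Im (den A \<tau>)\<bar> = \<bar>of_int (A$2$1)\<bar> * Im \<tau>"
    using assms by (simp add: den_def abs_mult)
  moreover have "\<bar>of_int (A$2$1)\<bar> * r \<le> \<bar>of_int (A$2$1)\<bar> * Im \<tau>"
    using assms by (intro mult_left_mono) auto
  ultimately have "\<bar>of_int (A$2$1)\<bar> * r \<le> cmod (den A \<tau>)" by linarith
  thus 1: "\<bar>of_int (A$2$1)\<bar> \<le> cmod (den A \<tau>) / r" using assms by (simp add: field_simps)
  have "of_int (A$2$2) = den A \<tau> - of_int (A$2$1) * \<tau>" by (simp add: den_def)
  hence "cmod (of_int (A$2$2)) \<le> cmod (den A \<tau>) + cmod (of_int (A$2$1) * \<tau>)"
    by (metis norm_triangle_ineq4)
  hence "\<bar>of_int (A$2$2)\<bar> \<le> cmod (den A \<tau>) + \<bar>of_int (A$2$1)\<bar> * cmod \<tau>"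
    by (simp add: norm_mult)
  also have "\<dots> \<le> cmod (den A \<tau>) + cmod (den A \<tau>) / r * cmod \<tau>"
    using 1 by (intro add_left_mono mult_right_mono) auto
  finally show "\<bar>of_int (A$2$2)\<bar> \<le> cmod (den A \<tau>) + cmod (den A \<tau>) / r * cmod \<tau>" .
qed

lemma abs_int_le_ceiling: "\<bar>of_int k\<bar> \<le> (x::real) \<Longrightarrow> k \<in> {-\<lceil>x\<rceil>..\<lceil>x\<rceil>}"
  by (auto simp: abs_le_iff) linarith+

text \<open>
  Choose \<open>A\<close> with the least value of \<open>\<bar>c \<tau> + d\<bar>\<close>, equivalently the greatest imaginary part of \<open>A \<tau>\<close>, and translate
  the real part into \<open>[-1/2, 1/2]\<close>. Minimality against the composition with \<open>\<tau> \<mapsto> -1/\<tau>\<close> shows \<open>\<bar>A \<tau>\<bar> \<ge> 1\<close>, which bounds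
  the imaginary part below. The weak bound \<open>1/2\<close> is enough to get a compact set after cutting off the cusp.
\<close>

lemma fundamental_domain:
  assumes "Im \<tau> > 0"
  obtains A where "A \<in> SL2Z" "\<bar>Re (moebius A \<tau>)\<bar> \<le> 1/2" "Im (moebius A \<tau>) \<ge> 1/2"
proof -
  define S where "S = {A \<in> SL2Z. cmod (den A \<tau>) \<le> 1}"
  define m where "m = \<lceil>1 / Im \<tau>\<rceil>"
  define m' where "m' = \<lceil>1 + 1 / Im \<tau> * cmod \<tau>\<rceil>"
  have "(\<lambda>A. cmod (den A \<tau>)) ` S \<subseteq> (\<lambda>(c,d). cmod (of_int c * \<tau> + of_int d)) ` ({-m..m} \<times> {-m'..m'})"
  proof
    fix x assume "x \<in> (\<lambda>A. cmod (den A \<tau>)) ` S"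
    then obtain A where A: "cmod (den A \<tau>) \<le> 1" "x = cmod (den A \<tau>)" by (auto simp: S_def)
    have "\<bar>of_int (A$2$1)\<bar> \<le> 1 / Im \<tau>"
      using den_bounds(1)[of "Im \<tau>" \<tau> A] A(1) assms by (meson divide_right_mono order.refl order.trans less_imp_le)
    moreover have "\<bar>of_int (A$2$2)\<bar> \<le> 1 + 1 / Im \<tau> * cmod \<tau>"
    proof -
      have "cmod (den A \<tau>) + cmod (den A \<tau>) / Im \<tau> * cmod \<tau> \<le> 1 + 1 / Im \<tau> * cmod \<tau>"
        using A(1) assms by (intro add_mono mult_right_mono divide_right_mono) auto
      thus ?thesis using den_bounds(2)[of "Im \<tau>" \<tau> A] assms by linarith
    qed
    ultimately have "(A$2$1, A$2$2) \<in> {-m..m} \<times> {-m'..m'}"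
      unfolding m_def m'_def using abs_int_le_ceiling by blast
    thus "x \<in> (\<lambda>(c,d). cmod (of_int c * \<tau> + of_int d)) ` ({-m..m} \<times> {-m'..m'})"
      using A(2) by (intro image_eqI[of _ _ "(A$2$1, A$2$2)"]) (auto simp: den_def)
  qed
  hence fin: "finite ((\<lambda>A. cmod (den A \<tau>)) ` S)" by (rule finite_subset) auto
  have S1: "mat 1 \<in> S" by (auto simp: S_def den_def)
  define \<mu> where "\<mu> = Min ((\<lambda>A. cmod (den A \<tau>)) ` S)"
  have "\<mu> \<in> (\<lambda>A. cmod (den A \<tau>)) ` S" unfolding \<mu>_def using fin S1 by (intro Min_in) auto
  then obtain A where A: "A \<in> S" "\<mu> = cmod (den A \<tau>)" by auto
  have min: "cmod (den A \<tau>) \<le> cmod (den B \<tau>)" if "B \<in> SL2Z" for B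
  proof (cases "B \<in> S")
    case True
    thus ?thesis unfolding A(2)[symmetric] \<mu>_def using fin by (intro Min_le) auto
  next
    case False
    thus ?thesis using that A(1) by (auto simp: S_def)
  qed
  define k where "k = round (Re (moebius A \<tau>))"
  define B where "B = mat2 1 (-k) 0 1 ** A"
  have AS: "A \<in> SL2Z" using A(1) by (simp add: S_def)
  have T: "mat2 1 (-k) 0 1 \<in> SL2Z" by (simp add: SL2Z_iff det_2)
  have BS: "B \<in> SL2Z" unfolding B_def using T AS by simp
  have B\<tau>: "moebius B \<tau> = moebius A \<tau> - of_int k"
    unfolding B_def using assms AS by (subst moebius_compose[symmetric]) (auto simp: SL2Z_iff, simp add: moebius_def)
  have dB: "den B \<tau> = den A \<tau>" by (simp add: B_def den_def)
  have Re: "\<bar>Re (moebius B \<tau>)\<bar> \<le> 1/2"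
    using of_int_round_abs_le[of "Re (moebius A \<tau>)"] by (simp add: B\<tau> k_def abs_minus_commute)
  have Im0: "Im (moebius B \<tau>) > 0" using assms BS by (intro Im_moebius_pos) (auto simp: SL2Z_iff)
  (* The inversion: its automorphy factor at B tau is B tau itself. *)
  define W where "W = mat2 0 (-1) 1 0 ** B"
  have "W \<in> SL2Z" unfolding W_def using BS by (intro SL2Z_closed) (auto simp: SL2Z_iff det_2)
  hence "cmod (den A \<tau>) \<le> cmod (den W \<tau>)" by (rule min)
  also have "den W \<tau> = moebius B \<tau> * den B \<tau>"
    unfolding W_def using assms BS den_nonzero[of \<tau> B] by (subst den_mult) (auto simp: SL2Z_iff den_def[of "mat2 _ _ _ _"])
  finally have "1 * cmod (den B \<tau>) \<le> cmod (moebius B \<tau>) * cmod (den B \<tau>)" by (simp add: dB norm_mult)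
  moreover have "cmod (den B \<tau>) > 0" using assms BS den_nonzero[of \<tau> B] by (auto simp: SL2Z_iff)
  ultimately have "1 \<le> cmod (moebius B \<tau>)" by simp
  hence "1\<^sup>2 \<le> (cmod (moebius B \<tau>))\<^sup>2" by (intro power_mono) auto
  hence "1 \<le> (Re (moebius B \<tau>))\<^sup>2 + (Im (moebius B \<tau>))\<^sup>2" by (simp add: cmod_power2)
  moreover have "(Re (moebius B \<tau>))\<^sup>2 \<le> (1/2)\<^sup>2" using Re by (metis abs_le_square_iff abs_of_nonneg divide_nonneg_nonneg zero_le_numeral zero_le_one)
  ultimately have "(1/2)\<^sup>2 \<le> (Im (moebius B \<tau>))\<^sup>2" by (simp add: power2_eq_square)
  hence "1/2 \<le> Im (moebius B \<tau>)" using Im0 by (metis less_imp_le power2_le_imp_le)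
  from that[OF BS Re this] show ?thesis .
qed

text \<open>
  The formula for imaginary parts bounds \<open>\<bar>c \<tau> + d\<bar>\<close>, hence \<open>c\<close> and \<open>d\<close>; then \<open>a \<tau> + b = (A \<tau>) (c \<tau> + d)\<close> is bounded,
  hence so are \<open>a\<close> and \<open>b\<close>.
\<close>

lemma finite_SL2Z_meeting:
  assumes "r > 0"
  shows "finite {A \<in> SL2Z. \<exists>\<tau>. Im \<tau> \<ge> r \<and> cmod \<tau> \<le> R \<and> Im (moebius A \<tau>) \<ge> r \<and> cmod (moebius A \<tau>) \<le> R}"
    (is "finite ?S")
proof -
  define C where "C = sqrt (R / r)"
  define b1 where "b1 = C / r"
  define b2 where "b2 = C + C / r * R"
  define b3 where "b3 = R * C / r"
  define b4 where "b4 = R * C + R * C / r * R"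
  have "?S \<subseteq> (\<lambda>(a,b,c,d). mat2 a b c d) ` ({-\<lceil>b3\<rceil>..\<lceil>b3\<rceil>} \<times> {-\<lceil>b4\<rceil>..\<lceil>b4\<rceil>} \<times> {-\<lceil>b1\<rceil>..\<lceil>b1\<rceil>} \<times> {-\<lceil>b2\<rceil>..\<lceil>b2\<rceil>})"
  proof
    fix A assume "A \<in> ?S"
    then obtain \<tau> where A: "A \<in> SL2Z" and \<tau>: "Im \<tau> \<ge> r" "cmod \<tau> \<le> R" "Im (moebius A \<tau>) \<ge> r" "cmod (moebius A \<tau>) \<le> R" by auto
    have R0: "R \<ge> 0" using \<tau>(2) norm_ge_zero order_trans by blast
    have dA: "det A = 1" using A by (simp add: SL2Z_iff)
    have n0: "den A \<tau> \<noteq> 0" using dA \<tau> assms by (intro den_nonzero) auto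
    have "Im \<tau> \<le> cmod \<tau>" using abs_Im_le_cmod[of \<tau>] by linarith
    hence "Im \<tau> \<le> R" using \<tau> by linarith
    have "r * (cmod (den A \<tau>))\<^sup>2 \<le> Im \<tau>" using \<tau>(3) n0 by (simp add: Im_moebius dA field_simps)
    hence "(cmod (den A \<tau>))\<^sup>2 \<le> R / r" using assms \<open>Im \<tau> \<le> R\<close> by (simp add: field_simps)
    hence c: "cmod (den A \<tau>) \<le> C" unfolding C_def using real_le_rsqrt by blast
    have C0: "C \<ge> 0" using c norm_ge_zero order_trans by blast
    have 1: "\<bar>of_int (A$2$1)\<bar> \<le> b1" unfolding b1_def
      using den_bounds(1)[OF \<tau>(1) assms, of A] c assms by (meson divide_right_mono less_imp_le order.trans)
    have 2: "\<bar>of_int (A$2$2)\<bar> \<le> b2"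
    proof -
      have "cmod (den A \<tau>) + cmod (den A \<tau>) / r * cmod \<tau> \<le> b2" unfolding b2_def
        using c assms \<tau>(2) C0 by (intro add_mono mult_mono divide_right_mono) auto
      thus ?thesis using den_bounds(2)[OF \<tau>(1) assms, of A] by linarith
    qed
    (* The top row put at the bottom, so that the bounds for bottom rows apply to it. *)
    define A' where "A' = mat2 0 0 (A$1$1) (A$1$2)"
    have "den A' \<tau> = moebius A \<tau> * den A \<tau>"
      using n0 by (simp add: A'_def moebius_def den_def)
    hence c': "cmod (den A' \<tau>) \<le> R * C" using c \<tau>(4) R0 by (simp add: norm_mult mult_mono)
    have 3: "\<bar>of_int (A$1$1)\<bar> \<le> b3" unfolding b3_def
      using den_bounds(1)[OF \<tau>(1) assms, of A'] c' assms unfolding A'_def mat2_sel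
      by (meson divide_right_mono less_imp_le order.trans)
    have 4: "\<bar>of_int (A$1$2)\<bar> \<le> b4"
    proof -
      have "cmod (den A' \<tau>) + cmod (den A' \<tau>) / r * cmod \<tau> \<le> b4" unfolding b4_def
        using c' assms \<tau>(2) C0 R0 by (intro add_mono mult_mono divide_right_mono) auto
      thus ?thesis using den_bounds(2)[OF \<tau>(1) assms, of A'] unfolding A'_def mat2_sel by linarith
    qed
    have "A = mat2 (A$1$1) (A$1$2) (A$2$1) (A$2$2)" by (rule matrix2_eqI) simp_all
    thus "A \<in> (\<lambda>(a,b,c,d). mat2 a b c d) ` ({-\<lceil>b3\<rceil>..\<lceil>b3\<rceil>} \<times> {-\<lceil>b4\<rceil>..\<lceil>b4\<rceil>} \<times> {-\<lceil>b1\<rceil>..\<lceil>b1\<rceil>} \<times> {-\<lceil>b2\<rceil>..\<lceil>b2\<rceil>})"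
      using abs_int_le_ceiling[OF 1] abs_int_le_ceiling[OF 2] abs_int_le_ceiling[OF 3] abs_int_le_ceiling[OF 4]
      by (intro image_eqI[of _ _ "(A$1$1, A$1$2, A$2$1, A$2$2)"]) auto
  qed
  thus ?thesis by (rule finite_subset) auto
qed

lemma finite_stabilizer:
  assumes "Im \<tau> > 0"
  shows "finite {A \<in> SL2Z. moebius A \<tau> = \<tau>}"
  by (rule finite_subset[OF _ finite_SL2Z_meeting[OF assms, of "cmod \<tau>"]]) auto

text \<open>
  Only finitely many matrices move a point near \<open>\<tau>1\<close> to a point near \<open>\<tau>2\<close>. Those that do not map \<open>\<tau>1\<close> to \<open>\<tau>2\<close> are
  excluded by continuity after the neighbourhoods are shrunk.
\<close>

lemma proper_discontinuity:
  assumes "Im \<tau>1 > 0" "Im \<tau>2 > 0"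
  obtains \<epsilon> where "\<epsilon> > 0" "ball \<tau>1 \<epsilon> \<subseteq> upper_half_plane" "ball \<tau>2 \<epsilon> \<subseteq> upper_half_plane"
    "\<And>A t. A \<in> SL2Z \<Longrightarrow> t \<in> ball \<tau>1 \<epsilon> \<Longrightarrow> moebius A t \<in> ball \<tau>2 \<epsilon> \<Longrightarrow> moebius A \<tau>1 = \<tau>2"
proof -
  define r where "r = min (Im \<tau>1) (Im \<tau>2) / 2"
  define R where "R = max (cmod \<tau>1) (cmod \<tau>2) + r"
  have r0: "r > 0" using assms by (auto simp: r_def)
  define F where "F = {A \<in> SL2Z. \<exists>\<tau>. Im \<tau> \<ge> r \<and> cmod \<tau> \<le> R \<and> Im (moebius A \<tau>) \<ge> r \<and> cmod (moebius A \<tau>) \<le> R}"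
  have finF: "finite F" unfolding F_def by (rule finite_SL2Z_meeting[OF r0])
  have ballr: "Im t \<ge> r \<and> cmod t \<le> R" if tt: "t \<in> ball \<tau>1 r \<or> t \<in> ball \<tau>2 r" for t
  proof -
    obtain \<tau> where \<tau>: "\<tau> = \<tau>1 \<or> \<tau> = \<tau>2" "cmod (\<tau> - t) < r" using tt by (auto simp: dist_norm)
    have "Im \<tau> \<ge> 2 * r" "cmod \<tau> \<le> R - r" using \<tau>(1) by (auto simp: r_def R_def)
    moreover have "\<bar>Im (\<tau> - t)\<bar> < r" using \<tau>(2) abs_Im_le_cmod le_less_trans by blast
    moreover have "cmod t \<le> cmod \<tau> + cmod (\<tau> - t)" using norm_triangle_ineq4[of \<tau> "\<tau> - t"] by simp
    ultimately show ?thesis using \<tau>(2) by auto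
  qed
  have "\<exists>\<delta>>0. \<forall>t. t \<in> ball \<tau>1 \<delta> \<longrightarrow> moebius A t \<notin> ball \<tau>2 \<delta>" if "A \<in> F" "moebius A \<tau>1 \<noteq> \<tau>2" for A
  proof -
    have "isCont (moebius A) \<tau>1"
      using has_field_derivative_moebius[OF den_nonzero[OF assms(1), of A]] that(1)
      by (intro DERIV_isCont) (auto simp: F_def SL2Z_iff)
    define e where "e = dist (moebius A \<tau>1) \<tau>2 / 2"
    have e0: "e > 0" using that(2) by (simp add: e_def)
    obtain d where d: "d > 0" "\<And>t. dist t \<tau>1 < d \<Longrightarrow> dist (moebius A t) (moebius A \<tau>1) < e"
      using \<open>isCont (moebius A) \<tau>1\<close> e0 unfolding continuous_at_eps_delta by blast
    have "moebius A t \<notin> ball \<tau>2 (min d e)" if "t \<in> ball \<tau>1 (min d e)" for t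
    proof
      assume h: "moebius A t \<in> ball \<tau>2 (min d e)"
      have "dist (moebius A t) (moebius A \<tau>1) < e" using that by (intro d(2)) (auto simp: dist_commute)
      moreover have "dist (moebius A t) \<tau>2 < e" using h by (auto simp: dist_commute)
      moreover have "dist (moebius A \<tau>1) \<tau>2 \<le> dist (moebius A t) (moebius A \<tau>1) + dist (moebius A t) \<tau>2"
        by (metis dist_commute dist_triangle)
      ultimately show False by (simp add: e_def)
    qed
    thus ?thesis using d(1) e0 by (intro exI[of _ "min d e"]) auto
  qed
  then obtain \<delta> where \<delta>: "\<And>A. A \<in> F \<Longrightarrow> moebius A \<tau>1 \<noteq> \<tau>2 \<Longrightarrow> \<delta> A > 0"
     "\<And>A t. A \<in> F \<Longrightarrow> moebius A \<tau>1 \<noteq> \<tau>2 \<Longrightarrow> t \<in> ball \<tau>1 (\<delta> A) \<Longrightarrow> moebius A t \<notin> ball \<tau>2 (\<delta> A)"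
    by metis
  define F' where "F' = {A \<in> F. moebius A \<tau>1 \<noteq> \<tau>2}"
  define \<epsilon> where "\<epsilon> = Min (insert r (\<delta> ` F'))"
  have finF': "finite (insert r (\<delta> ` F'))" using finF by (auto simp: F'_def)
  have \<epsilon>r: "\<epsilon> \<le> r" unfolding \<epsilon>_def using finF' by (intro Min_le) auto
  have \<epsilon>\<delta>: "\<epsilon> \<le> \<delta> A" if "A \<in> F'" for A unfolding \<epsilon>_def using finF' that by (intro Min_le) auto
  show ?thesis
  proof (rule that[of \<epsilon>])
    show "\<epsilon> > 0" unfolding \<epsilon>_def using finF' r0 \<delta>(1) by (subst Min_gr_iff) (auto simp: F'_def)
    have "Im t > 0" if "t \<in> ball \<tau>1 \<epsilon>" for t using ballr[of t] \<epsilon>r r0 that by auto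
    thus "ball \<tau>1 \<epsilon> \<subseteq> upper_half_plane" by auto
    have "Im t > 0" if "t \<in> ball \<tau>2 \<epsilon>" for t using ballr[of t] \<epsilon>r r0 that by auto
    thus "ball \<tau>2 \<epsilon> \<subseteq> upper_half_plane" by auto
    fix A t assume A: "A \<in> SL2Z" "t \<in> ball \<tau>1 \<epsilon>" "moebius A t \<in> ball \<tau>2 \<epsilon>"
    show "moebius A \<tau>1 = \<tau>2"
    proof (rule ccontr)
      assume ne: "moebius A \<tau>1 \<noteq> \<tau>2"
      have "A \<in> F" using A ballr[of t] ballr[of "moebius A t"] \<epsilon>r by (auto simp: F_def)
      hence "A \<in> F'" using ne by (simp add: F'_def)
      from \<epsilon>\<delta>[OF this] have "t \<in> ball \<tau>1 (\<delta> A)" "moebius A t \<in> ball \<tau>2 (\<delta> A)" using A by auto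
      thus False using \<delta>(2) \<open>A \<in> F\<close> ne by blast
    qed
  qed
qed

section \<open>Quadratic forms and matrices fixing a point\<close>

lemma form_pos_def_iff:
  "form_pos_def (a, b, c) \<longleftrightarrow> a > 0 \<and> b\<^sup>2 - 4 * a * c < 0"
proof
  assume h: "form_pos_def (a, b, c)"
  have "form_eval (a,b,c) (1::real) 0 > 0" using h[unfolded form_pos_def_def, rule_format, of 1 0] by simp
  hence a: "a > 0" by simp
  have "form_eval (a,b,c) (- of_int b :: real) (2 * of_int a) > 0"
    using h[unfolded form_pos_def_def, rule_format, of "- of_int b" "2 * of_int a"] a by (simp del: form_eval.simps)
  also have "form_eval (a,b,c) (- of_int b :: real) (2 * of_int a) = of_int (a * (4 * a * c - b\<^sup>2))"
    by (simp add: algebra_simps power2_eq_square)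
  finally have "a * (4 * a * c - b\<^sup>2) > 0" by (simp only: of_int_0_less_iff)
  thus "a > 0 \<and> b\<^sup>2 - 4 * a * c < 0" using a by (simp add: zero_less_mult_iff)
next
  assume h: "a > 0 \<and> b\<^sup>2 - 4 * a * c < 0"
  show "form_pos_def (a, b, c)" unfolding form_pos_def_def
  proof (intro allI impI)
    fix x y :: real assume xy: "(x, y) \<noteq> (0, 0)"
    have D: "4 * real_of_int a * of_int c - (of_int b)\<^sup>2 > 0"
    proof -
      have "4 * a * c - b\<^sup>2 > 0" using h by linarith
      hence "real_of_int (4 * a * c - b\<^sup>2) > 0" by (simp only: of_int_0_less_iff)
      thus ?thesis by simp
    qed
    have e: "4 * of_int a * form_eval (a,b,c) x y = (2 * of_int a * x + of_int b * y)\<^sup>2 + (4 * of_int a * of_int c - (of_int b)\<^sup>2) * y\<^sup>2"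
      by (simp add: algebra_simps power2_eq_square)
    have "\<dots> > 0"
    proof (cases "y = 0")
      case True
      thus ?thesis using xy h by simp
    next
      case False
      thus ?thesis using D by (intro add_nonneg_pos mult_pos_pos) auto
    qed
    hence "4 * of_int a * form_eval (a,b,c) x y > 0" using e by simp
    thus "form_eval (a,b,c) x y > 0" using h by (simp add: zero_less_mult_iff)
  qed
qed

lemma forms_iff:
  assumes "D < 0"
  shows "(a, b, c) \<in> forms D N \<longleftrightarrow> a > 0 \<and> b\<^sup>2 - 4 * a * c = D \<and> int N dvd a"
  using assms by (auto simp: forms_def form_pos_def_iff)

lemma form_root_unique:
  assumes "form_pos_def Q"
  shows "\<exists>!\<tau>. \<tau> \<in> upper_half_plane \<and> form_eval Q \<tau> 1 = 0"
proof -
  obtain a b c where Q: "Q = (a, b, c)" by (cases Q)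
  have h: "a > 0" "b\<^sup>2 - 4 * a * c < 0" using assms by (auto simp: Q form_pos_def_iff)
  define s where "s = sqrt (of_int (4 * a * c - b\<^sup>2))"
  have s0: "s > 0" using h by (simp add: s_def del: of_int_diff)
  have "s\<^sup>2 = of_int (4 * a * c - b\<^sup>2)" using h by (simp add: s_def del: of_int_diff)
  hence "(complex_of_real s)\<^sup>2 = complex_of_real (of_int (4 * a * c - b\<^sup>2))" by (metis of_real_power)
  hence s2: "(complex_of_real s)\<^sup>2 = of_int (4 * a * c - b\<^sup>2)" by simp
  have fac: "4 * of_int a * form_eval Q \<tau> 1 = (2 * of_int a * \<tau> + of_int b - \<i> * of_real s) * (2 * of_int a * \<tau> + of_int b + \<i> * of_real s)" for \<tau> :: complex
  proof -
    have "(2 * of_int a * \<tau> + of_int b - \<i> * of_real s) * (2 * of_int a * \<tau> + of_int b + \<i> * of_real s)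
      = (2 * of_int a * \<tau> + of_int b)\<^sup>2 + (of_real s)\<^sup>2" by (simp add: algebra_simps power2_eq_square)
    also have "\<dots> = 4 * of_int a * form_eval Q \<tau> 1" unfolding s2 by (simp add: Q algebra_simps power2_eq_square)
    finally show ?thesis ..
  qed
  define \<rho> where "\<rho> = Complex (- of_int b / (2 * of_int a)) (s / (2 * of_int a))"
  have \<rho>: "2 * of_int a * \<rho> + of_int b - \<i> * of_real s = 0"
    using h by (simp add: \<rho>_def complex_eq_iff)
  show ?thesis
  proof (rule ex1I[of _ \<rho>])
    have "4 * of_int a * form_eval Q \<rho> 1 = 0" unfolding fac \<rho> by simp
    thus "\<rho> \<in> upper_half_plane \<and> form_eval Q \<rho> 1 = 0" using h s0 by (simp add: \<rho>_def)
  next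
    fix \<tau> assume t: "\<tau> \<in> upper_half_plane \<and> form_eval Q \<tau> 1 = 0"
    have "Im (2 * of_int a * \<tau> + of_int b + \<i> * of_real s) > 0" using t h s0 by (simp add: add_pos_pos)
    hence "2 * of_int a * \<tau> + of_int b + \<i> * of_real s \<noteq> 0"
      by (metis less_irrefl zero_complex.simps(2))
    hence "2 * of_int a * \<tau> + of_int b - \<i> * of_real s = 0" using fac[of \<tau>] t by simp
    moreover have "2 * of_int a * (\<tau> - \<rho>) = (2 * of_int a * \<tau> + of_int b - \<i> * of_real s)
        - (2 * of_int a * \<rho> + of_int b - \<i> * of_real s)" by (simp add: algebra_simps)
    ultimately have "2 * of_int a * (\<tau> - \<rho>) = 0" using \<rho> by simp
    thus "\<tau> = \<rho>" using h by simp
  qed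
qed

lemma form_root:
  assumes "form_pos_def Q"
  shows "Im (form_root Q) > 0" "form_eval Q (form_root Q) 1 = 0"
    "Im \<tau> > 0 \<Longrightarrow> form_eval Q \<tau> 1 = 0 \<Longrightarrow> form_root Q = \<tau>"
  using theI'[OF form_root_unique[OF assms]] the1_equality[OF form_root_unique[OF assms], of \<tau>]
  unfolding form_root_def[symmetric] by auto

lemma quadratic_proportional:
  fixes a b c a' b' c' :: int
  assumes "Im \<tau> > 0" "of_int a * \<tau>\<^sup>2 + of_int b * \<tau> + of_int c = 0" "of_int a' * \<tau>\<^sup>2 + of_int b' * \<tau> + of_int c' = 0"
  shows "a * b' = a' * b" "a * c' = a' * c"
proof -
  have "of_int a' * (of_int a * \<tau>\<^sup>2 + of_int b * \<tau> + of_int c) - of_int a * (of_int a' * \<tau>\<^sup>2 + of_int b' * \<tau> + of_int c') = 0"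
    using assms by simp
  hence e: "of_int (a' * b - a * b') * \<tau> + of_int (a' * c - a * c') = 0" by (simp add: algebra_simps)
  have "real_of_int (a' * b - a * b') * Im \<tau> = 0"
    using arg_cong[OF e, of Im] by (simp del: of_int_diff of_int_mult)
  hence "real_of_int (a' * b - a * b') = 0" using assms(1) by (simp del: of_int_diff of_int_mult)
  hence "a' * b - a * b' = 0" by (simp only: of_int_eq_0_iff)
  moreover from this have "complex_of_int (a' * c - a * c') = 0" using e by (simp del: of_int_diff of_int_mult)
  hence "a' * c - a * c' = 0" by (simp only: of_int_eq_0_iff)
  ultimately show "a * b' = a' * b" "a * c' = a' * c" by simp_all
qed

text \<open>
  The root determines a form up to a scalar, the discriminant determines the scalar up to sign, and definiteness the sign.
\<close>

lemma form_eq_of_root: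
  assumes "Q \<in> forms D N" "Q' \<in> forms D N" "D < 0" "form_root Q = form_root Q'"
  shows "Q = Q'"
proof -
  obtain a b c a' b' c' where Q: "Q = (a, b, c)" "Q' = (a', b', c')" by (cases Q, cases Q') auto
  have h: "a > 0" "b\<^sup>2 - 4 * a * c = D" "a' > 0" "b'\<^sup>2 - 4 * a' * c' = D" using assms Q by (auto simp: forms_iff)
  have pd: "form_pos_def Q" "form_pos_def Q'" using assms by (auto simp: forms_def)
  have p: "a * b' = a' * b" "a * c' = a' * c"
    using quadratic_proportional[of "form_root Q" a b c a' b' c'] form_root(1,2)[OF pd(1)] form_root(2)[OF pd(2)] assms(4)
    by (simp_all add: Q)
  have "a\<^sup>2 * D = a\<^sup>2 * (b'\<^sup>2 - 4 * a' * c')" using h by simp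
  also have "\<dots> = (a * b')\<^sup>2 - 4 * a * a' * (a * c')" by (simp add: power2_eq_square algebra_simps)
  also have "\<dots> = a'\<^sup>2 * (b\<^sup>2 - 4 * a * c)" unfolding p by (simp add: power2_eq_square algebra_simps)
  finally have "a\<^sup>2 = a'\<^sup>2" using h assms(3) by simp
  hence "a = a'" using h by (simp add: power2_eq_iff)
  thus ?thesis using p h Q by simp
qed

lemma form_act_props:
  assumes "form_pos_def Q" "A \<in> SL2Z"
  shows "form_pos_def (form_act Q A)" "form_disc (form_act Q A) = form_disc Q"
    "form_root (form_act Q A) = moebius (adj A) (form_root Q)"
proof -
  obtain a b c where Q: "Q = (a, b, c)" by (cases Q)
  have dA: "det A = 1" "A$1$1 * A$2$2 - A$1$2 * A$2$1 = 1" using assms by (auto simp: SL2Z_iff det_2)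
  show pd: "form_pos_def (form_act Q A)" unfolding form_pos_def_def form_eval_act
  proof (intro allI impI)
    fix x y :: real assume xy: "(x, y) \<noteq> (0, 0)"
    define u v where "u = of_int (A$1$1) * x + of_int (A$1$2) * y" and "v = of_int (A$2$1) * x + of_int (A$2$2) * y"
    have d: "real_of_int (A$1$1) * of_int (A$2$2) - of_int (A$1$2) * of_int (A$2$1) = 1"
      using arg_cong[OF dA(2), of real_of_int] by simp
    have "of_int (A$2$2) * u - of_int (A$1$2) * v = (real_of_int (A$1$1) * of_int (A$2$2) - of_int (A$1$2) * of_int (A$2$1)) * x"
      "of_int (A$1$1) * v - of_int (A$2$1) * u = (real_of_int (A$1$1) * of_int (A$2$2) - of_int (A$1$2) * of_int (A$2$1)) * y"
      by (simp_all add: u_def v_def algebra_simps)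
    hence "(u, v) \<noteq> (0, 0)" unfolding d using xy by auto
    thus "form_eval Q u v > 0" using assms(1)[unfolded form_pos_def_def, rule_format] by blast
  qed
  have "form_disc (form_act Q A) = (A$1$1 * A$2$2 - A$1$2 * A$2$1)\<^sup>2 * form_disc Q"
    by (simp add: Q power2_eq_square algebra_simps)
  thus "form_disc (form_act Q A) = form_disc Q" by (simp add: dA)
  define \<tau> where "\<tau> = form_root Q"
  define t where "t = moebius (adj A) \<tau>"
  have \<tau>0: "Im \<tau> > 0" using form_root(1)[OF assms(1)] by (simp add: \<tau>_def)
  have t0: "Im t > 0" unfolding t_def using \<tau>0 dA by (intro Im_moebius_pos) auto
  have At: "moebius A t = \<tau>" using moebius_adj[OF \<tau>0, of "adj A"] dA by (simp add: t_def)
  have n0: "den A t \<noteq> 0" using t0 dA by (intro den_nonzero) auto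
  have hom: "form_eval Q (\<tau> * d) d = d\<^sup>2 * form_eval Q \<tau> 1" for d :: complex
    by (simp add: Q power2_eq_square algebra_simps)
  have "form_eval (form_act Q A) t 1 = form_eval Q (\<tau> * den A t) (den A t)"
    unfolding form_eval_act using n0 by (simp add: At[symmetric] moebius_def den_def)
  also have "\<dots> = 0" unfolding hom using form_root(2)[OF assms(1)] by (simp add: \<tau>_def)
  finally show "form_root (form_act Q A) = moebius (adj A) (form_root Q)"
    using form_root(3)[OF pd t0] by (simp add: t_def \<tau>_def)
qed

lemma form_act_forms:
  assumes "Q \<in> forms D N" "A \<in> Gamma0 N"
  shows "form_act Q A \<in> forms D N"
proof -
  obtain a b c where Q: "Q = (a, b, c)" by (cases Q)
  have "int N dvd fst (form_act Q A)" using assms by (auto simp: Q forms_def Gamma0_iff power2_eq_square)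
  thus ?thesis using assms form_act_props(1,2)[of Q A] Gamma0_SL2Z by (auto simp: forms_def)
qed

lemma form_act_eq_iff:
  assumes "Q \<in> forms D N" "Q' \<in> forms D N" "D < 0" "A \<in> Gamma0 N"
  shows "form_act Q A = Q' \<longleftrightarrow> moebius A (form_root Q') = form_root Q"
proof -
  have pd: "form_pos_def Q" "form_pos_def Q'" using assms by (auto simp: forms_def)
  have dA: "det A = 1" "A \<in> SL2Z" using assms by (auto simp: Gamma0_iff SL2Z_iff)
  have "form_act Q A = Q' \<longleftrightarrow> form_root (form_act Q A) = form_root Q'"
    using form_eq_of_root[OF form_act_forms[OF assms(1,4)] assms(2,3)] by auto
  also have "\<dots> \<longleftrightarrow> moebius (adj A) (form_root Q) = form_root Q'"
    using form_act_props(3)[OF pd(1) dA(2)] by simp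
  also have "\<dots> \<longleftrightarrow> moebius A (form_root Q') = form_root Q"
    using moebius_adj[OF form_root(1)[OF pd(2)], of A] moebius_adj[OF form_root(1)[OF pd(1)], of "adj A"] dA
    by auto
  finally show ?thesis .
qed

text \<open>
  The weight of a form depends on its root only, which makes it comparable between different discriminants.
\<close>

definition stabilizer_order :: "nat \<Rightarrow> complex \<Rightarrow> nat" where
  "stabilizer_order N \<tau> = card ((\<lambda>A. {A, - A}) ` {A \<in> Gamma0 N. moebius A \<tau> = \<tau>})"

lemma form_weight_eq:
  assumes "Q \<in> forms D N" "D < 0"
  shows "form_weight N Q = stabilizer_order N (form_root Q)"
proof -
  have "{A \<in> Gamma0 N. form_act Q A = Q} = {A \<in> Gamma0 N. moebius A (form_root Q) = form_root Q}"
    using form_act_eq_iff[OF assms(1) assms(1) assms(2)] by blast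
  thus ?thesis by (simp only: form_weight_def stabilizer_order_def)
qed

lemma card_sign_classes:
  fixes G :: "(int^2^2) set"
  assumes "finite G" "\<And>A. A \<in> G \<Longrightarrow> - A \<in> G" "\<And>A. A \<in> G \<Longrightarrow> A \<noteq> 0"
  shows "card G = 2 * card ((\<lambda>A. {A, - A}) ` G)"
proof -
  have ne: "A \<noteq> - A" if "A \<in> G" for A
  proof
    assume "A = - A"
    hence "A$i$j = - A$i$j" for i j by (metis vector_uminus_component)
    hence "A$i$j = 0" for i j by (metis neg_equal_zero)
    hence "A = 0" by (simp add: vec_eq_iff)
    thus False using assms(3)[OF that] by simp
  qed
  have "2 * card ((\<lambda>A. {A, - A}) ` G) = card (\<Union> ((\<lambda>A. {A, - A}) ` G))"
  proof (rule card_partition)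
    show "finite (\<Union> ((\<lambda>A. {A, - A}) ` G))" using assms(1) by auto
    show "card c = 2" if c: "c \<in> (\<lambda>A. {A, - A}) ` G" for c
    proof -
      obtain A where A: "A \<in> G" "c = {A, - A}" using c by blast
      show ?thesis unfolding A(2) card_2_iff using ne[OF A(1)] by blast
    qed
    show "c1 \<inter> c2 = {}" if "c1 \<in> (\<lambda>A. {A, - A}) ` G" "c2 \<in> (\<lambda>A. {A, - A}) ` G" "c1 \<noteq> c2" for c1 c2
      using that by (auto simp: doubleton_eq_iff)
  qed (use assms(1) in auto)
  also have "\<Union> ((\<lambda>A. {A, - A}) ` G) = G" using assms(2) by auto
  finally show ?thesis by simp
qed

lemma card_stabilizer:
  assumes "Im \<tau> > 0"
  shows "finite {A \<in> Gamma0 N. moebius A \<tau> = \<tau>}"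
    "card {A \<in> Gamma0 N. moebius A \<tau> = \<tau>} = 2 * stabilizer_order N \<tau>"
    "stabilizer_order N \<tau> > 0"
proof -
  show fin: "finite {A \<in> Gamma0 N. moebius A \<tau> = \<tau>}"
    by (rule finite_subset[OF _ finite_stabilizer[OF assms]]) (auto simp: Gamma0_SL2Z)
  show "card {A \<in> Gamma0 N. moebius A \<tau> = \<tau>} = 2 * stabilizer_order N \<tau>"
    unfolding stabilizer_order_def by (rule card_sign_classes) (use fin in \<open>auto simp: Gamma0_iff det_2\<close>)
  have "mat 1 \<in> {A \<in> Gamma0 N. moebius A \<tau> = \<tau>}" by simp
  thus "stabilizer_order N \<tau> > 0" unfolding stabilizer_order_def using fin by (subst card_gt_0_iff) blast
qed

lemma moebius_fix_iff:
  assumes "Im \<tau> > 0" "det A \<noteq> 0"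
  shows "moebius A \<tau> = \<tau> \<longleftrightarrow> of_int (A$2$1) * \<tau>\<^sup>2 + of_int (A$2$2 - A$1$1) * \<tau> + of_int (- A$1$2) = 0"
proof -
  have "moebius A \<tau> = \<tau> \<longleftrightarrow> of_int (A$1$1) * \<tau> + of_int (A$1$2) = \<tau> * den A \<tau>"
    unfolding moebius_def den_def[symmetric] using den_nonzero[OF assms] by (simp add: divide_eq_eq)
  moreover have "of_int (A$2$1) * \<tau>\<^sup>2 + of_int (A$2$2 - A$1$1) * \<tau> + of_int (- A$1$2)
     = \<tau> * den A \<tau> - (of_int (A$1$1) * \<tau> + of_int (A$1$2))"
    by (simp add: den_def power2_eq_square algebra_simps)
  ultimately show ?thesis by (simp only: right_minus_eq) (rule eq_commute)
qed

lemma abs_less_two_sqrt_iff: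
  "\<bar>real_of_int r\<bar> < 2 * sqrt (real n) \<longleftrightarrow> r\<^sup>2 - 4 * int n < 0"
proof -
  have "2 * sqrt (real n) = sqrt (of_int (4 * int n))" by (simp add: real_sqrt_mult)
  hence "\<bar>real_of_int r\<bar> < 2 * sqrt (real n) \<longleftrightarrow> sqrt (of_int (r\<^sup>2)) < sqrt (of_int (4 * int n))" by simp
  also have "\<dots> \<longleftrightarrow> r\<^sup>2 < 4 * int n" unfolding real_sqrt_less_iff of_int_less_iff ..
  finally show ?thesis by simp
qed

text \<open>
  Clearing denominators in \<open>A \<tau> = \<tau>\<close> gives the quadratic equation \<open>c \<tau>\<^sup>2 + (d - a) \<tau> - b = 0\<close>, whose discriminant is
  \<open>(a + d)\<^sup>2 - 4 n\<close>. Conversely the form and the trace determine \<open>A\<close>, with integral entries because the trace and the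
  middle coefficient have the same parity.
\<close>

lemma fixing_matrices_bij:
  assumes "Im \<tau> > 0" "n > 0"
  shows "bij_betw (\<lambda>A. (A$1$1 + A$2$2, (A$2$1, A$2$2 - A$1$1, - A$1$2)))
    {A \<in> Hecke N n. A$2$1 > 0 \<and> moebius A \<tau> = \<tau>}
    (SIGMA r:{r. \<bar>real_of_int r\<bar> < 2 * sqrt (real n)}. {Q \<in> forms (r\<^sup>2 - 4 * int n) N. form_root Q = \<tau>})"
    (is "bij_betw ?f ?S ?T")
proof (rule bij_betw_imageI)
  show "inj_on ?f ?S" by (rule inj_onI, rule matrix2_eqI) auto
  note rn = abs_less_two_sqrt_iff
  show "?f ` ?S = ?T"
  proof (intro equalityI subsetI)
    fix x assume "x \<in> ?f ` ?S"
    then obtain A where A: "A \<in> Hecke N n" "A$2$1 > 0" "moebius A \<tau> = \<tau>" "x = ?f A" by auto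
    define r where "r = A$1$1 + A$2$2"
    define Q where "Q = (A$2$1, A$2$2 - A$1$1, - A$1$2)"
    have dA: "A$1$1 * A$2$2 - A$1$2 * A$2$1 = int n" using A(1) by (simp add: Hecke_iff det_2)
    have fx: "of_int (A$2$1) * \<tau>\<^sup>2 + of_int (A$2$2 - A$1$1) * \<tau> + of_int (- A$1$2) = 0"
      using moebius_fix_iff[OF assms(1), of A] A assms(2) by (simp add: Hecke_iff)
    have disc: "(A$2$2 - A$1$1)\<^sup>2 - 4 * A$2$1 * (- A$1$2) = r\<^sup>2 - 4 * int n"
      unfolding dA[symmetric] r_def by (simp add: power2_eq_square algebra_simps)
    have neg: "r\<^sup>2 - 4 * int n < 0"
    proof -
      have "4 * of_int (A$2$1) * (of_int (A$2$1) * \<tau>\<^sup>2 + of_int (A$2$2 - A$1$1) * \<tau> + of_int (- A$1$2))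
         = (2 * of_int (A$2$1) * \<tau> + of_int (A$2$2 - A$1$1))\<^sup>2 - of_int (r\<^sup>2 - 4 * int n)"
        unfolding disc[symmetric] by (simp add: power2_eq_square algebra_simps)
      hence sq: "(2 * of_int (A$2$1) * \<tau> + of_int (A$2$2 - A$1$1))\<^sup>2 = of_int (r\<^sup>2 - 4 * int n)"
        unfolding fx by simp
      define z where "z = 2 * of_int (A$2$1) * \<tau> + of_int (A$2$2 - A$1$1)"
      have z: "Im z > 0" using A(2) assms(1) by (simp add: z_def)
      have "Im (z\<^sup>2) = 0" using sq unfolding z_def[symmetric] by simp
      hence "Re z = 0" using z by (simp add: power2_eq_square)
      hence "Re (z\<^sup>2) < 0" using z by (simp add: power2_eq_square)
      hence "real_of_int (r\<^sup>2 - 4 * int n) < 0" using sq unfolding z_def[symmetric] by simp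
      thus ?thesis by (simp only: of_int_less_0_iff)
    qed
    have Q: "Q \<in> forms (r\<^sup>2 - 4 * int n) N" unfolding Q_def forms_iff[OF neg] using A disc by (simp add: Hecke_iff)
    hence "form_root Q = \<tau>" using fx assms(1) by (intro form_root(3)) (auto simp: forms_def Q_def)
    thus "x \<in> ?T" using A(4) Q neg rn by (auto simp: r_def Q_def)
  next
    fix x assume "x \<in> ?T"
    then obtain r a b c where x: "x = (r, (a, b, c))" "(a, b, c) \<in> forms (r\<^sup>2 - 4 * int n) N"
      "form_root (a, b, c) = \<tau>" "r\<^sup>2 - 4 * int n < 0" using rn by auto
    have h: "a > 0" "b\<^sup>2 - 4 * a * c = r\<^sup>2 - 4 * int n" "int N dvd a" using x(2) forms_iff[OF x(4)] by auto
    have "r\<^sup>2 - b\<^sup>2 = 2 * (2 * int n - 2 * (a * c))" using h(2) by simp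
    hence "even (r\<^sup>2 - b\<^sup>2)" by simp
    hence ev: "even (r - b)" by simp
    then obtain k where k: "r - b = 2 * k" by blast
    have k': "r + b = 2 * (k + b)" using k by simp
    define A where "A = mat2 k (-c) a (k + b)"
    have r: "r = 2 * k + b" using k by simp
    have "det A = int n" using h(2) unfolding r by (simp add: A_def det_2 power2_eq_square algebra_simps)
    moreover have "form_eval (a,b,c) \<tau> 1 = 0" using form_root(2)[of "(a,b,c)"] x by (auto simp: forms_def)
    ultimately have "A \<in> ?S" using h assms
      by (auto simp: Hecke_iff moebius_fix_iff) (auto simp: A_def eq_neg_iff_add_eq_0)
    moreover have "?f A = x" using r by (simp add: A_def x(1))
    ultimately show "x \<in> ?f ` ?S" by blast
  qed
qed

lemma finite_abs_less: "finite {r. \<bar>real_of_int r\<bar> < x}"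
  by (rule finite_subset[of _ "{-\<lceil>x\<rceil>..\<lceil>x\<rceil>}"]) (use abs_int_le_ceiling in force, simp)

lemma finite_hcosets:
  assumes "N > 0" "n > 0" "coprime n N"
  shows "finite (hcosets N n)"
proof -
  have s: "mat 1 \<in> SL2Z" by simp
  have all: "{X \<in> hcosets N n. \<exists>A\<in>X. (adj (mat 1) ** A ** mat 1)$2$1 = 0} = hcosets N n"
  proof (intro equalityI subsetI CollectI conjI)
    fix X assume "X \<in> hcosets N n"
    from hcosets_upper_representative[OF assms(2,3) this] obtain B where "B \<in> X" "B$2$1 = 0" by blast
    thus "\<exists>A\<in>X. (adj (mat 1) ** A ** mat 1)$2$1 = 0" by (intro bexI[of _ B]) simp_all
  qed auto
  show ?thesis
    by (rule cusp_cosets[OF assms s], unfold all, drule bij_betw_finite, erule iffD1, rule finite_SigmaI,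
        rule finite_subset[OF _ finite_divisors_nat[OF assms(2)]]) auto
qed

text \<open>
  Matrices fixing \<open>\<tau>\<close> are counted in two ways. Each coset that meets them does so in a translate of the stabilizer
  of \<open>\<tau>\<close> in \<open>\<Gamma>\<^sub>0(N)\<close>, which has twice as many elements as the stabilizer modulo signs. On the other hand, up to sign
  the fixing matrices are the pairs of a trace \<open>r\<close> and a form of discriminant \<open>r\<^sup>2 - 4 n\<close> with root \<open>\<tau>\<close>. There is at
  most one such form for each \<open>r\<close>.
\<close>

lemma fixing_cosets_count:
  assumes "N > 0" "n > 0" "coprime n N" "\<not> is_square n" "Im \<tau> > 0"
  shows "real (card {X \<in> hcosets N n. \<exists>A\<in>X. moebius A \<tau> = \<tau>}) =
    (\<Sum>r | \<bar>real_of_int r\<bar> < 2 * sqrt (real n).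
       if \<exists>Q\<in>forms (r\<^sup>2 - 4 * int n) N. form_root Q = \<tau> then 1 / real (stabilizer_order N \<tau>) else 0)"
proof -
  define F where "F = {A \<in> Hecke N n. moebius A \<tau> = \<tau>}"
  define C where "C = {X \<in> hcosets N n. \<exists>A\<in>X. moebius A \<tau> = \<tau>}"
  define St where "St = {A \<in> Gamma0 N. moebius A \<tau> = \<tau>}"
  define R where "R = {r. \<bar>real_of_int r\<bar> < 2 * sqrt (real n)}"
  define w where "w = stabilizer_order N \<tau>"
  have w: "card St = 2 * w" "w > 0" "finite St" using card_stabilizer[OF assms(5)] by (auto simp: St_def w_def)
  have finC: "finite C" unfolding C_def using finite_hcosets[OF assms(1-3)] by simp
  have XF: "X \<inter> F = (\<lambda>\<gamma>. \<gamma> ** A) ` St" if "X \<in> hcosets N n" "A \<in> X" "moebius A \<tau> = \<tau>" for X A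
  proof -
    have A: "A \<in> Hecke N n" "X = coset N A" using hcosets_mem[OF that(1,2)] by auto
    have "moebius (\<gamma> ** A) \<tau> = moebius \<gamma> \<tau>" for \<gamma>
      using moebius_compose[OF assms(5), of A \<gamma>] A(1) assms(2) that(3) by (simp add: Hecke_iff)
    thus ?thesis using A by (auto simp: coset_def F_def St_def)
  qed
  have cardXF: "card (X \<inter> F) = 2 * w" if XC: "X \<in> C" for X
  proof -
    obtain A where A: "X \<in> hcosets N n" "A \<in> X" "moebius A \<tau> = \<tau>" using XC by (auto simp: C_def)
    have "inj_on (\<lambda>\<gamma>. \<gamma> ** A) St"
    proof (rule inj_onI)
      fix x y :: "int^2^2" assume "x ** A = y ** A"
      hence "x ** (A ** adj A) = y ** (A ** adj A)" by (simp add: matrix_mul_assoc)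
      hence e: "x ** mat (int n) = y ** mat (int n)" using hcosets_mem(1)[OF A(1,2)] by (simp add: mult_adj Hecke_iff)
      have "n \<noteq> 0" using assms(2) by simp
      thus "x = y" using arg_cong[OF e, of "\<lambda>M::int^2^2. M$1$1"] arg_cong[OF e, of "\<lambda>M::int^2^2. M$1$2"]
         arg_cong[OF e, of "\<lambda>M::int^2^2. M$2$1"] arg_cong[OF e, of "\<lambda>M::int^2^2. M$2$2"] by (intro matrix2_eqI) simp_all
    qed
    thus ?thesis unfolding XF[OF A] using w by (simp add: card_image)
  qed
  have FU: "F = \<Union> ((\<lambda>X. X \<inter> F) ` C)"
  proof (intro equalityI subsetI)
    fix A assume "A \<in> F"
    moreover from this have "coset N A \<in> C" unfolding C_def F_def using coset_in_hcosets coset_self by blast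
    ultimately show "A \<in> \<Union> ((\<lambda>X. X \<inter> F) ` C)" using coset_self by blast
  qed auto
  have finXF: "finite (X \<inter> F)" if "X \<in> C" for X
    using cardXF[OF that] w(2) by (intro card_ge_0_finite) simp
  have finF: "finite F" by (subst FU, rule finite_Union) (use finC finXF in blast)+
  have "card F = (\<Sum>X\<in>C. card (X \<inter> F))"
  proof (subst FU, rule card_UN_disjoint)
    show "\<forall>X\<in>C. \<forall>Y\<in>C. X \<noteq> Y \<longrightarrow> (X \<inter> F) \<inter> (Y \<inter> F) = {}"
      unfolding C_def using hcosets_mem(2) by blast
  qed (use finC finXF in auto)
  hence cF: "card F = card C * (2 * w)" using cardXF by simp
  define P where "P = {A \<in> F. A$2$1 > 0}"
  (* A fixing matrix with lower left entry 0 would be scalar, and n would be a square. *)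
  have c0: "A$2$1 \<noteq> 0" if "A \<in> F" for A
  proof
    assume c: "A$2$1 = 0"
    have "det A = int n" "moebius A \<tau> = \<tau>" using that by (auto simp: F_def Hecke_iff)
    hence e: "of_int (A$2$2 - A$1$1) * \<tau> + of_int (- A$1$2) = 0" using moebius_fix_iff[OF assms(5), of A] assms(2) c by simp
    from arg_cong[OF e, of Im] have "A$2$2 = A$1$1" using assms(5) by simp
    hence "int n = (A$1$1)\<^sup>2" using \<open>det A = int n\<close> c by (simp add: det_2 power2_eq_square)
    hence "n = (nat \<bar>A$1$1\<bar>)\<^sup>2" by (metis nat_int nat_power_eq abs_ge_zero power2_abs)
    thus False using assms(4) by (auto simp: is_nth_power_def)
  qed
  have negF: "- A \<in> F" if "A \<in> F" for A using that by (auto simp: F_def)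
  have "F = P \<union> uminus ` P"
  proof (intro equalityI subsetI)
    fix A assume A: "A \<in> F"
    show "A \<in> P \<union> uminus ` P"
    proof (cases "A$2$1 > 0")
      case True thus ?thesis using A by (simp add: P_def)
    next
      case False
      hence "- A \<in> P" using A c0[OF A] negF by (simp add: P_def)
      thus ?thesis by (metis UnI2 imageI minus_minus)
    qed
  qed (use negF in \<open>auto simp: P_def\<close>)
  moreover have "P \<inter> uminus ` P = {}" by (auto simp: P_def)
  ultimately have "card F = card P + card (uminus ` P)"
    using finF by (metis card_Un_disjoint finite_Un)
  also have "card (uminus ` P) = card P" by (intro card_image) (simp add: inj_on_def)
  finally have cP: "card C * w = card P" using cF by simp
  have "card P = card (SIGMA r:R. {Q \<in> forms (r\<^sup>2 - 4 * int n) N. form_root Q = \<tau>})"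
    unfolding P_def F_def R_def using bij_betw_same_card[OF fixing_matrices_bij[OF assms(5,2), of N]]
    by (simp add: conj_commute conj_left_commute)
  also have "\<dots> = (\<Sum>r\<in>R. if \<exists>Q\<in>forms (r\<^sup>2 - 4 * int n) N. form_root Q = \<tau> then 1 else 0)"
  proof -
    have neg: "r\<^sup>2 - 4 * int n < 0" if "r \<in> R" for r
      using that unfolding R_def mem_Collect_eq abs_less_two_sqrt_iff .
    have one: "{Q \<in> forms (r\<^sup>2 - 4 * int n) N. form_root Q = \<tau>} = {Q}"
      if "r \<in> R" "Q \<in> forms (r\<^sup>2 - 4 * int n) N" "form_root Q = \<tau>" for r Q
    proof (intro equalityI subsetI)
      fix Q' assume "Q' \<in> {Q \<in> forms (r\<^sup>2 - 4 * int n) N. form_root Q = \<tau>}"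
      hence "Q' \<in> forms (r\<^sup>2 - 4 * int n) N" "form_root Q = form_root Q'" using that(3) by simp_all
      from form_eq_of_root[OF that(2) this(1) neg[OF that(1)] this(2)] show "Q' \<in> {Q}" by simp
    qed (use that in simp)
    have sing: "card {Q \<in> forms (r\<^sup>2 - 4 * int n) N. form_root Q = \<tau>} = (if \<exists>Q\<in>forms (r\<^sup>2 - 4 * int n) N. form_root Q = \<tau> then 1 else 0)
       \<and> finite {Q \<in> forms (r\<^sup>2 - 4 * int n) N. form_root Q = \<tau>}" if "r \<in> R" for r
    proof (cases "\<exists>Q\<in>forms (r\<^sup>2 - 4 * int n) N. form_root Q = \<tau>")
      case True
      then obtain Q where "Q \<in> forms (r\<^sup>2 - 4 * int n) N" "form_root Q = \<tau>" by blast
      from one[OF that this] show ?thesis using True by simp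
    next
      case False
      hence e: "{Q \<in> forms (r\<^sup>2 - 4 * int n) N. form_root Q = \<tau>} = {}" by auto
      show ?thesis unfolding e using False by simp
    qed
    have "finite R" unfolding R_def by (rule finite_abs_less)
    hence "card (SIGMA r:R. {Q \<in> forms (r\<^sup>2 - 4 * int n) N. form_root Q = \<tau>})
      = (\<Sum>r\<in>R. card {Q \<in> forms (r\<^sup>2 - 4 * int n) N. form_root Q = \<tau>})"
      using sing by (intro card_SigmaI) auto
    also have "\<dots> = (\<Sum>r\<in>R. if \<exists>Q\<in>forms (r\<^sup>2 - 4 * int n) N. form_root Q = \<tau> then 1 else 0)"
      using sing by (intro sum.cong) auto
    finally show ?thesis .
  qed
  finally have cP': "card P = (\<Sum>r\<in>R. if \<exists>Q\<in>forms (r\<^sup>2 - 4 * int n) N. form_root Q = \<tau> then 1 else 0)" .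
  have "real (card C) * real w = real (card P)" using cP by (metis of_nat_mult)
  also have "\<dots> = (\<Sum>r\<in>R. if \<exists>Q\<in>forms (r\<^sup>2 - 4 * int n) N. form_root Q = \<tau> then 1 else 0)"
    unfolding cP' of_nat_sum by (intro sum.cong refl) (simp only: of_nat_0 of_nat_1 if_distrib[of real])
  finally have "real (card C) * real w = (\<Sum>r\<in>R. if \<exists>Q\<in>forms (r\<^sup>2 - 4 * int n) N. form_root Q = \<tau> then 1 else 0)" .
  hence "real (card C) = (\<Sum>r\<in>R. if \<exists>Q\<in>forms (r\<^sup>2 - 4 * int n) N. form_root Q = \<tau> then 1 else 0) / real w"
    using w(2) by (simp add: field_simps)
  also have "\<dots> = (\<Sum>r\<in>R. if \<exists>Q\<in>forms (r\<^sup>2 - 4 * int n) N. form_root Q = \<tau> then 1 / real w else 0)"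
    unfolding sum_divide_distrib by (intro sum.cong) auto
  finally show ?thesis unfolding C_def R_def w_def .
qed

section \<open>Leading terms at infinity\<close>

text \<open>
  The function \<open>q\<^sup>\<kappa>\<close> of \<open>\<tau>\<close>. Fractional exponents occur because of the widths of the cusps and because of the
  substitutions \<open>\<tau> \<mapsto> (a \<tau> + b) / d\<close>.
\<close>

definition qpow :: "real \<Rightarrow> complex \<Rightarrow> complex" where
  "qpow \<kappa> \<tau> = exp (2 * of_real pi * \<i> * of_real \<kappa> * \<tau>)"

lemma qpow_nonzero [simp]: "qpow \<kappa> \<tau> \<noteq> 0"
  by (simp add: qpow_def)

lemma qpow_add: "qpow (a + b) \<tau> = qpow a \<tau> * qpow b \<tau>"
  by (simp add: qpow_def exp_add[symmetric] algebra_simps)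

lemma qpow_0 [simp]: "qpow 0 \<tau> = 1"
  by (simp add: qpow_def)

lemma qpow_minus: "qpow (- a) \<tau> = inverse (qpow a \<tau>)"
  by (simp add: qpow_def exp_minus)

lemma qpow_power: "qpow a \<tau> ^ m = qpow (real m * a) \<tau>"
  by (simp add: qpow_def exp_of_nat_mult[symmetric] algebra_simps)

lemma norm_qpow: "cmod (qpow \<kappa> \<tau>) = exp (- (2 * pi * \<kappa> * Im \<tau>))"
  by (simp add: qpow_def norm_exp_eq_Re algebra_simps)

lemma qpow_surj:
  assumes "w \<noteq> 0" "\<kappa> > 0"
  obtains \<tau> where "qpow \<kappa> \<tau> = w" "Im \<tau> = - (ln (cmod w) / (2 * pi * \<kappa>))"
proof -
  define \<tau> where "\<tau> = Ln w / (2 * of_real pi * \<i> * of_real \<kappa>)"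
  have "qpow \<kappa> \<tau> = exp (Ln w)" using assms by (simp add: qpow_def \<tau>_def field_simps)
  hence 1: "qpow \<kappa> \<tau> = w" using assms by simp
  hence "cmod w = exp (- (2 * pi * \<kappa> * Im \<tau>))" using norm_qpow by metis
  hence "ln (cmod w) = - (2 * pi * \<kappa> * Im \<tau>)" by simp
  hence "Im \<tau> = - (ln (cmod w) / (2 * pi * \<kappa>))" using assms by (simp add: field_simps)
  with 1 that show ?thesis by blast
qed

lemma qpow_eq_iff: "qpow 1 \<tau> = qpow 1 \<tau>' \<longleftrightarrow> (\<exists>k::int. \<tau> = \<tau>' + of_int k)"
proof -
  have "qpow 1 \<tau> = qpow 1 \<tau>' \<longleftrightarrow> (\<exists>k::int. 2 * of_real pi * \<i> * \<tau> = 2 * of_real pi * \<i> * \<tau>' + of_int (2 * k) * of_real pi * \<i>)"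
    by (simp add: qpow_def exp_eq)
  also have "\<dots> \<longleftrightarrow> (\<exists>k::int. 2 * of_real pi * \<i> * \<tau> = 2 * of_real pi * \<i> * (\<tau>' + of_int k))"
    by (simp add: algebra_simps)
  finally show ?thesis by (simp only: mult_cancel_left) simp
qed

lemma eventually_at_i_infinity:
  "eventually P at_i_infinity \<longleftrightarrow> (\<exists>Y. \<forall>\<tau>. Im \<tau> > Y \<longrightarrow> P \<tau>)"
proof
  assume "eventually P at_i_infinity"
  then obtain Q where Q: "eventually Q (at_top :: real filter)" "\<And>\<tau>. Q (Im \<tau>) \<Longrightarrow> P \<tau>"
    by (auto simp: eventually_filtercomap)
  then obtain Y where "\<And>y. y > Y \<Longrightarrow> Q y" by (auto simp: eventually_at_top_dense)
  thus "\<exists>Y. \<forall>\<tau>. Im \<tau> > Y \<longrightarrow> P \<tau>" using Q by blast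
next
  assume "\<exists>Y. \<forall>\<tau>. Im \<tau> > Y \<longrightarrow> P \<tau>"
  then obtain Y where Y: "\<And>\<tau>. Im \<tau> > Y \<Longrightarrow> P \<tau>" by blast
  show "eventually P at_i_infinity"
    unfolding eventually_filtercomap
    by (rule exI[of _ "\<lambda>y. y > Y"]) (use Y in \<open>auto simp: eventually_gt_at_top\<close>)
qed

lemma at_i_infinity_neq_bot [simp]: "at_i_infinity \<noteq> bot"
proof
  assume "at_i_infinity = bot"
  hence "eventually (\<lambda>_. False) at_i_infinity" by simp
  then obtain Y where "\<And>\<tau>. Im \<tau> > Y \<Longrightarrow> False" unfolding eventually_at_i_infinity by blast
  from this[of "Complex 0 (Y + 1)"] show False by simp
qed

lemma eventually_Im_gt: "eventually (\<lambda>\<tau>. Im \<tau> > Y) at_i_infinity"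
  by (auto simp: eventually_at_i_infinity)

lemma qpow_tendsto_0:
  assumes "\<kappa> > 0"
  shows "(qpow \<kappa> \<longlongrightarrow> 0) at_i_infinity"
proof (rule tendstoI)
  fix e :: real assume e: "e > 0"
  have "cmod (qpow \<kappa> \<tau>) < e" if "Im \<tau> > - (ln e / (2 * pi * \<kappa>))" for \<tau>
  proof -
    have "2 * pi * \<kappa> > 0" using assms by simp
    hence "- (2 * pi * \<kappa> * Im \<tau>) < ln e" using that assms by (simp add: field_simps)
    hence "exp (- (2 * pi * \<kappa> * Im \<tau>)) < exp (ln e)" by (simp only: exp_less_cancel_iff)
    thus ?thesis using e by (simp add: norm_qpow)
  qed
  thus "eventually (\<lambda>\<tau>. dist (qpow \<kappa> \<tau>) 0 < e) at_i_infinity"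
    by (auto simp: eventually_at_i_infinity)
qed

lemma qpow_filterlim_at_0:
  assumes "\<kappa> > 0"
  shows "filterlim (qpow \<kappa>) (at 0) at_i_infinity"
  unfolding filterlim_at using qpow_tendsto_0[OF assms] by auto

lemma filterlim_moebius_upper:
  assumes "B$2$1 = 0" "B$1$1 > 0" "B$2$2 > 0"
  shows "filterlim (moebius B) at_i_infinity at_i_infinity"
  unfolding filterlim_iff
proof (intro allI impI)
  fix P assume "eventually P at_i_infinity"
  then obtain Y where Y: "\<And>\<tau>. Im \<tau> > Y \<Longrightarrow> P \<tau>" unfolding eventually_at_i_infinity by blast
  have "Im (moebius B \<tau>) > Y" if "Im \<tau> > Y * of_int (B$2$2) / of_int (B$1$1)" for \<tau>
  proof -
    have "Im (moebius B \<tau>) = of_int (B$1$1) * Im \<tau> / of_int (B$2$2)"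
      using assms by (simp add: moebius_def Im_divide power2_eq_square)
    hence "Y * of_int (B$2$2) < Im (moebius B \<tau>) * of_int (B$2$2)" using that assms by (simp add: field_simps)
    thus ?thesis using assms by simp
  qed
  thus "eventually (\<lambda>\<tau>. P (moebius B \<tau>)) at_i_infinity"
    using Y unfolding eventually_at_i_infinity by blast
qed

lemma qpow_moebius_upper:
  assumes "B$2$1 = 0" "B$2$2 > 0"
  shows "qpow \<kappa> (moebius B \<tau>) =
    qpow \<kappa> (of_int (B$1$2) / of_int (B$2$2)) * qpow (\<kappa> * of_int (B$1$1) / of_int (B$2$2)) \<tau>"
proof -
  have m: "moebius B \<tau> = of_int (B$1$2) / of_int (B$2$2) + of_int (B$1$1) / of_int (B$2$2) * \<tau>"
    using assms by (simp add: moebius_def add_divide_distrib)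
  show ?thesis unfolding m qpow_def exp_add[symmetric]
    by (rule arg_cong[of _ _ exp]) (simp add: algebra_simps)
qed

text \<open>
  \<open>f\<close> is asymptotic to \<open>C q\<^sup>\<kappa>\<close> at infinity, with \<open>C \<noteq> 0\<close>. This is a substitute for orders of vanishing at cusps
  that needs no choice of a local parameter.
\<close>

definition leading :: "(complex \<Rightarrow> complex) \<Rightarrow> real \<Rightarrow> complex \<Rightarrow> bool" where
  "leading f \<kappa> C \<longleftrightarrow> C \<noteq> 0 \<and> ((\<lambda>\<tau>. f \<tau> * qpow (- \<kappa>) \<tau>) \<longlongrightarrow> C) at_i_infinity"

lemma leading_cong:
  assumes "leading f \<kappa> C" "eventually (\<lambda>\<tau>. f \<tau> = g \<tau>) at_i_infinity"
  shows "leading g \<kappa> C"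
proof -
  have "eventually (\<lambda>\<tau>. f \<tau> * qpow (- \<kappa>) \<tau> = g \<tau> * qpow (- \<kappa>) \<tau>) at_i_infinity"
    using assms(2) by eventually_elim simp
  from tendsto_cong[OF this] assms(1) show ?thesis by (simp add: leading_def)
qed

lemma leading_const: "C \<noteq> 0 \<Longrightarrow> leading (\<lambda>_. C) 0 C"
  by (simp add: leading_def)

lemma leading_mult:
  assumes "leading f \<kappa> C" "leading g \<mu> D"
  shows "leading (\<lambda>\<tau>. f \<tau> * g \<tau>) (\<kappa> + \<mu>) (C * D)"
proof -
  have "((\<lambda>\<tau>. (f \<tau> * qpow (- \<kappa>) \<tau>) * (g \<tau> * qpow (- \<mu>) \<tau>)) \<longlongrightarrow> C * D) at_i_infinity"
    using assms by (intro tendsto_mult) (auto simp: leading_def)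
  moreover have "qpow (- (\<kappa> + \<mu>)) \<tau> = qpow (- \<kappa>) \<tau> * qpow (- \<mu>) \<tau>" for \<tau>
    by (simp add: qpow_add[symmetric])
  ultimately show ?thesis using assms by (simp add: leading_def ac_simps)
qed

lemma leading_prod:
  assumes "finite A" "\<And>x. x \<in> A \<Longrightarrow> leading (f x) (\<kappa> x) (C x)"
  shows "leading (\<lambda>\<tau>. \<Prod>x\<in>A. f x \<tau>) (\<Sum>x\<in>A. \<kappa> x) (\<Prod>x\<in>A. C x)"
  using assms
proof (induction A rule: finite_induct)
  case empty
  show ?case using leading_const[of 1] by simp
next
  case (insert x A)
  have "leading (\<lambda>\<tau>. f x \<tau> * (\<Prod>x\<in>A. f x \<tau>)) (\<kappa> x + (\<Sum>x\<in>A. \<kappa> x)) (C x * (\<Prod>x\<in>A. C x))"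
    using insert by (intro leading_mult) simp_all
  thus ?case using insert(1,2) by simp
qed

lemma leading_inverse:
  assumes "leading f \<kappa> C"
  shows "leading (\<lambda>\<tau>. inverse (f \<tau>)) (- \<kappa>) (inverse C)"
proof -
  have "((\<lambda>\<tau>. inverse (f \<tau> * qpow (- \<kappa>) \<tau>)) \<longlongrightarrow> inverse C) at_i_infinity"
    using assms by (intro tendsto_inverse) (auto simp: leading_def)
  thus ?thesis using assms by (simp add: leading_def qpow_minus)
qed

lemma leading_power:
  assumes "leading f \<kappa> C"
  shows "leading (\<lambda>\<tau>. f \<tau> ^ m) (real m * \<kappa>) (C ^ m)"
proof (induction m)
  case 0
  show ?case using leading_const[of 1] by simp
next
  case (Suc m)
  have "leading (\<lambda>\<tau>. f \<tau> * f \<tau> ^ m) (\<kappa> + real m * \<kappa>) (C * C ^ m)" by (rule leading_mult[OF assms Suc])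
  thus ?case by (simp add: algebra_simps)
qed

lemma leading_uminus: "leading f \<kappa> C \<Longrightarrow> leading (\<lambda>\<tau>. - f \<tau>) \<kappa> (- C)"
  using leading_mult[OF leading_const[of "-1"], of f \<kappa> C] by simp

lemma leading_tendsto_0:
  assumes "leading f \<kappa> C" "\<mu> < \<kappa>"
  shows "((\<lambda>\<tau>. f \<tau> * qpow (- \<mu>) \<tau>) \<longlongrightarrow> 0) at_i_infinity"
proof -
  have "((\<lambda>\<tau>. (f \<tau> * qpow (- \<kappa>) \<tau>) * qpow (\<kappa> - \<mu>) \<tau>) \<longlongrightarrow> C * 0) at_i_infinity"
    using assms by (intro tendsto_mult qpow_tendsto_0) (auto simp: leading_def)
  moreover have "qpow (- \<kappa>) \<tau> * qpow (\<kappa> - \<mu>) \<tau> = qpow (- \<mu>) \<tau>" for \<tau> by (simp add: qpow_add[symmetric])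
  ultimately show ?thesis by (simp add: mult.assoc)
qed

lemma leading_add_lower:
  assumes "leading f \<kappa> C" "leading g \<mu> D" "\<kappa> < \<mu>"
  shows "leading (\<lambda>\<tau>. f \<tau> + g \<tau>) \<kappa> C"
proof -
  have "((\<lambda>\<tau>. f \<tau> * qpow (- \<kappa>) \<tau> + g \<tau> * qpow (- \<kappa>) \<tau>) \<longlongrightarrow> C + 0) at_i_infinity"
    using assms leading_tendsto_0[OF assms(2,3)] by (intro tendsto_add) (auto simp: leading_def)
  thus ?thesis using assms(1) by (simp add: leading_def algebra_simps)
qed

text \<open>
  For different exponents nothing cancels and the lower one survives. In the Hecke product the two exponents are in
  the ratio \<open>a : d\<close> with \<open>a d = n\<close>, so they differ because \<open>n\<close> is not a square.
\<close>

lemma leading_diff: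
  assumes "leading f \<kappa> C" "leading g \<mu> D" "\<kappa> \<noteq> \<mu>"
  shows "\<exists>E. leading (\<lambda>\<tau>. f \<tau> - g \<tau>) (min \<kappa> \<mu>) E"
proof (cases "\<kappa> < \<mu>")
  case True
  thus ?thesis using leading_add_lower[OF assms(1) leading_uminus[OF assms(2)]] by auto
next
  case False
  hence "leading (\<lambda>\<tau>. - g \<tau> + f \<tau>) \<mu> (- D)"
    using assms by (intro leading_add_lower[OF leading_uminus[OF assms(2)] assms(1)]) auto
  thus ?thesis using False by (auto simp: min_def)
qed

lemma leading_unique:
  assumes "leading f \<kappa> C" "leading f \<mu> D"
  shows "\<kappa> = \<mu>" "C = D"
proof -
  have *: False if "leading f \<kappa> C" "leading f \<mu> D" "\<mu> < \<kappa>" for \<kappa> \<mu> C D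
    using leading_tendsto_0[OF that(1,3)] that(2) tendsto_unique[OF at_i_infinity_neq_bot]
    unfolding leading_def by blast
  show "\<kappa> = \<mu>" by (rule linorder_cases[of \<kappa> \<mu>]) (use *[OF assms] *[OF assms(2,1)] in auto)
  thus "C = D" using assms tendsto_unique[OF at_i_infinity_neq_bot] unfolding leading_def by blast
qed

lemma leading_moebius_upper:
  assumes "leading f \<kappa> C" "B$2$1 = 0" "B$1$1 > 0" "B$2$2 > 0"
  shows "leading (\<lambda>\<tau>. f (moebius B \<tau>)) (\<kappa> * of_int (B$1$1) / of_int (B$2$2))
    (C * qpow \<kappa> (of_int (B$1$2) / of_int (B$2$2)))"
proof -
  let ?u = "qpow \<kappa> (of_int (B$1$2) / of_int (B$2$2))"
  have "((\<lambda>\<tau>. f (moebius B \<tau>) * qpow (- \<kappa>) (moebius B \<tau>)) \<longlongrightarrow> C) at_i_infinity"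
    using filterlim_compose[OF _ filterlim_moebius_upper[OF assms(2-4)]] assms(1) unfolding leading_def by fast
  hence "((\<lambda>\<tau>. f (moebius B \<tau>) * qpow (- \<kappa>) (moebius B \<tau>) * ?u) \<longlongrightarrow> C * ?u) at_i_infinity"
    by (intro tendsto_mult) auto
  moreover have "qpow (- \<kappa>) (moebius B \<tau>) * ?u = qpow (- (\<kappa> * of_int (B$1$1) / of_int (B$2$2))) \<tau>" for \<tau>
    unfolding qpow_minus by (simp add: qpow_moebius_upper[OF assms(2,4)])
  ultimately show ?thesis using assms(1) by (simp add: leading_def mult.assoc)
qed

section \<open>Expansions of the Hauptmodul at the cusps\<close>

locale hauptmodul =
  fixes N :: nat and j :: "complex \<Rightarrow> complex"
  assumes N_pos: "N > 0" and Hauptmodul: "is_Hauptmodul N j"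
begin

lemma holomorphic_j: "j holomorphic_on upper_half_plane"
  using Hauptmodul by (simp add: is_Hauptmodul_def)

lemma open_upper_half_plane: "open upper_half_plane"
  unfolding upper_half_plane_def by (rule open_halfspace_Im_gt)

lemma connected_upper_half_plane: "connected upper_half_plane"
  unfolding upper_half_plane_def by (rule convex_connected[OF convex_halfspace_Im_gt])

lemma j_invariant: "\<gamma> \<in> Gamma0 N \<Longrightarrow> Im \<tau> > 0 \<Longrightarrow> j (moebius \<gamma> \<tau>) = j \<tau>"
  using Hauptmodul by (simp add: is_Hauptmodul_def function_field_def)

text \<open>
  Every nonzero \<open>q\<close> in the unit disc has the form \<open>exp (2 \<pi> \<i> \<tau>)\<close>, so the given series converges in the whole disc and
  defines a holomorphic function there.
\<close>

lemma q_expansion: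
  obtains g where "g holomorphic_on ball 0 1" "g 0 = 0"
    "\<And>\<tau>. Im \<tau> > 0 \<Longrightarrow> j \<tau> = inverse (qpow 1 \<tau>) + g (qpow 1 \<tau>)"
proof -
  have qe: "exp (2 * pi * \<i> * \<tau>) = qpow 1 \<tau>" for \<tau> by (simp add: qpow_def)
  obtain c :: "nat \<Rightarrow> int" where c0: "\<forall>\<tau>\<in>upper_half_plane.
    (\<lambda>m. of_int (c (Suc m)) * qpow 1 \<tau> ^ Suc m) sums (j \<tau> - inverse (qpow 1 \<tau>))"
    using Hauptmodul unfolding is_Hauptmodul_def qe by blast
  have c: "(\<lambda>m. of_int (c (Suc m)) * qpow 1 \<tau> ^ Suc m) sums (j \<tau> - inverse (qpow 1 \<tau>))" if "Im \<tau> > 0" for \<tau>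
    by (rule bspec[OF c0]) (use that in simp)
  define a where "a = (\<lambda>m. if m = 0 then 0 else of_int (c m) :: complex)"
  define g where "g = (\<lambda>w. suminf (\<lambda>m. a m * w ^ m))"
  have sm: "(\<lambda>m. a m * w ^ m) sums g w \<and> (\<forall>\<tau>. Im \<tau> > 0 \<longrightarrow> qpow 1 \<tau> = w \<longrightarrow> j \<tau> = inverse w + g w)" if "cmod w < 1" for w
  proof (cases "w = 0")
    case True
    have "(\<lambda>m. a m * w ^ m) = (\<lambda>_. 0)" using True by (auto simp: a_def)
    thus ?thesis using True by (auto simp: g_def)
  next
    case False
    obtain \<tau> where \<tau>: "qpow 1 \<tau> = w" "Im \<tau> = - (ln (cmod w) / (2 * pi))" using qpow_surj[OF False, of 1] by auto
    have *: "(\<lambda>m. a m * w ^ m) sums (j \<tau> - inverse w)" if "Im \<tau> > 0" "qpow 1 \<tau> = w" for \<tau>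
    proof -
      have "(\<lambda>m. a (Suc m) * w ^ Suc m) sums (j \<tau> - inverse w)" using c[OF that(1)] that(2) by (simp add: a_def)
      hence "(\<lambda>m. a m * w ^ m) sums ((j \<tau> - inverse w) + a 0 * w ^ 0)"
        using sums_Suc_iff[of "\<lambda>m. a m * w ^ m" "j \<tau> - inverse w"] by simp
      thus ?thesis by (simp add: a_def)
    qed
    have "ln (cmod w) < 0" using that False by simp
    hence "Im \<tau> > 0" using \<tau>(2) by (simp add: divide_neg_pos)
    have "(\<lambda>m. a m * w ^ m) sums g w" using *[OF \<open>Im \<tau> > 0\<close> \<tau>(1)] unfolding g_def by (rule sums_summable[THEN summable_sums])
    thus ?thesis using * sums_unique2 by fastforce
  qed
  have "g holomorphic_on ball 0 1"
    by (rule power_series_holomorphic[of _ _ a]) (use sm in auto)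
  moreover have "g 0 = 0" by (simp add: g_def a_def power_0_left if_distrib cong: if_cong)
  moreover have "j \<tau> = inverse (qpow 1 \<tau>) + g (qpow 1 \<tau>)" if "Im \<tau> > 0" for \<tau>
    using sm[of "qpow 1 \<tau>"] that by (simp add: norm_qpow)
  ultimately show ?thesis using that by blast
qed

text \<open>
  The expansion \<open>j = q\<^sup>-\<^sup>1 + c q + o(q)\<close>. The absence of a constant term is what makes the second identity exact.
\<close>

lemma j_expansion_inf:
  obtains c where "((\<lambda>\<tau>. (j \<tau> - qpow (-1) \<tau>) * qpow (-1) \<tau>) \<longlongrightarrow> c) at_i_infinity"
proof -
  obtain g where g: "g holomorphic_on ball 0 1" "g 0 = 0"
    "\<And>\<tau>. Im \<tau> > 0 \<Longrightarrow> j \<tau> = inverse (qpow 1 \<tau>) + g (qpow 1 \<tau>)" using q_expansion by blast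
  have "(g has_field_derivative deriv g 0) (at 0)" using g(1) by (intro holomorphic_derivI[of _ "ball 0 1"]) auto
  hence "((\<lambda>w. g w / w) \<longlongrightarrow> deriv g 0) (at 0)" using g(2) by (simp add: has_field_derivative_iff)
  from filterlim_compose[OF this qpow_filterlim_at_0[of 1]]
  have "((\<lambda>\<tau>. g (qpow 1 \<tau>) / qpow 1 \<tau>) \<longlongrightarrow> deriv g 0) at_i_infinity" by simp
  moreover have "eventually (\<lambda>\<tau>. g (qpow 1 \<tau>) / qpow 1 \<tau> = (j \<tau> - qpow (-1) \<tau>) * qpow (-1) \<tau>) at_i_infinity"
    using eventually_Im_gt[of 0] by eventually_elim (simp add: g(3) qpow_minus field_simps)
  ultimately show ?thesis using that tendsto_cong by fastforce
qed

lemma leading_j: "leading j (-1) 1"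
proof -
  obtain c where "((\<lambda>\<tau>. (j \<tau> - qpow (-1) \<tau>) * qpow (-1) \<tau>) \<longlongrightarrow> c) at_i_infinity"
    using j_expansion_inf by blast
  hence "((\<lambda>\<tau>. ((j \<tau> - qpow (-1) \<tau>) * qpow (-1) \<tau>) * (qpow 1 \<tau> * qpow 1 \<tau>) + 1) \<longlongrightarrow> c * (0 * 0) + 1) at_i_infinity"
    by (intro tendsto_add tendsto_mult qpow_tendsto_0 tendsto_const) auto
  moreover have "((j \<tau> - qpow (-1) \<tau>) * qpow (-1) \<tau>) * (qpow 1 \<tau> * qpow 1 \<tau>) + 1 = j \<tau> * qpow 1 \<tau>" for \<tau>
    by (simp add: qpow_minus field_simps)
  ultimately show ?thesis by (simp add: leading_def)
qed

text \<open>
  Near infinity \<open>1 / j\<close> is the holomorphic function \<open>q / (1 + q g(q))\<close> of \<open>q\<close>, whose derivative at \<open>0\<close> is \<open>1\<close>; hence it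
  is injective for small \<open>q\<close>.
\<close>

lemma j_inj_inf:
  obtains Y where "Y > 0" "\<And>\<tau> \<tau>'. Im \<tau> > Y \<Longrightarrow> Im \<tau>' > Y \<Longrightarrow> j \<tau> = j \<tau>' \<Longrightarrow> \<exists>k::int. \<tau> = \<tau>' + of_int k"
proof -
  obtain g where g: "g holomorphic_on ball 0 1" "g 0 = 0"
    "\<And>\<tau>. Im \<tau> > 0 \<Longrightarrow> j \<tau> = inverse (qpow 1 \<tau>) + g (qpow 1 \<tau>)" using q_expansion by blast
  have "isCont g 0" using g(1) by (metis centre_in_ball continuous_on_interior holomorphic_on_imp_continuous_on interior_ball zero_less_one)
  hence "isCont (\<lambda>w. 1 + w * g w) 0" by (intro continuous_intros)
  hence "((\<lambda>w. 1 + w * g w) \<longlongrightarrow> 1 + 0 * g 0) (nhds 0)"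
    using tendsto_at_iff_tendsto_nhds[of "\<lambda>w. 1 + w * g w" 0] unfolding isCont_def by blast
  from topological_tendstoD[OF this open_Compl[OF closed_singleton[of 0]]]
  have "eventually (\<lambda>w. 1 + w * g w \<noteq> 0) (nhds 0)" by simp
  then obtain r where r: "r > 0" "\<And>w. cmod w < r \<Longrightarrow> 1 + w * g w \<noteq> 0"
    by (auto simp: eventually_nhds_metric)
  define \<rho> where "\<rho> = min r 1"
  define h where "h = (\<lambda>w. w / (1 + w * g w))"
  have hol: "h holomorphic_on ball 0 \<rho>"
    unfolding h_def using r by (intro holomorphic_intros holomorphic_on_subset[OF g(1)]) (auto simp: \<rho>_def)
  have g': "(g has_field_derivative deriv g 0) (at 0)" using g(1) by (intro holomorphic_derivI[of _ "ball 0 1"]) auto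
  have "(h has_field_derivative 1) (at 0)"
    unfolding h_def by (rule derivative_eq_intros g' refl | simp)+
  hence dnz: "deriv h 0 \<noteq> 0" by (simp add: DERIV_imp_deriv)
  have z: "0 \<in> ball 0 \<rho>" using r(1) by (simp add: \<rho>_def)
  obtain s where s: "s > 0" "ball 0 s \<subseteq> ball (0::complex) \<rho>" "inj_on h (ball 0 s)"
    by (rule has_complex_derivative_locally_injective[OF hol z open_ball dnz]) (rule that)
  have "eventually (\<lambda>\<tau>. qpow 1 \<tau> \<in> ball 0 s) at_i_infinity"
    using qpow_tendsto_0[of 1] s(1) by (intro topological_tendstoD) auto
  then obtain Y where Y: "\<And>\<tau>. Im \<tau> > Y \<Longrightarrow> qpow 1 \<tau> \<in> ball 0 s" unfolding eventually_at_i_infinity by blast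
  show ?thesis
  proof (rule that[of "max Y 1"])
    fix \<tau> \<tau>' assume t: "Im \<tau> > max Y 1" "Im \<tau>' > max Y 1" "j \<tau> = j \<tau>'"
    have *: "inverse (h (qpow 1 \<tau>)) = j \<tau>" if "Im \<tau> > max Y 1" for \<tau>
    proof -
      have "1 + qpow 1 \<tau> * g (qpow 1 \<tau>) \<noteq> 0" using that Y[of \<tau>] s(2) r(2) by (auto simp: \<rho>_def)
      thus ?thesis using that by (simp add: h_def g(3) field_simps)
    qed
    have "h (qpow 1 \<tau>) = h (qpow 1 \<tau>')" using *[OF t(1)] *[OF t(2)] t(3) by (metis inverse_inverse_eq)
    hence "qpow 1 \<tau> = qpow 1 \<tau>'" using s(3) Y[of \<tau>] Y[of \<tau>'] t by (auto dest: inj_onD)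
    thus "\<exists>k::int. \<tau> = \<tau>' + of_int k" by (simp only: qpow_eq_iff)
  qed auto
qed

lemma j_moebius_nonconstant:
  assumes "open U" "U \<subseteq> upper_half_plane" "U \<noteq> {}" "det A > 0"
  shows "\<not> (\<lambda>\<tau>. j (moebius A \<tau>)) constant_on U"
proof
  assume "(\<lambda>\<tau>. j (moebius A \<tau>)) constant_on U"
  then obtain c where c: "\<And>\<tau>. \<tau> \<in> U \<Longrightarrow> j (moebius A \<tau>) = c" by (auto simp: constant_on_def)
  obtain \<xi> where \<xi>: "\<xi> \<in> U" using assms by auto
  have hol: "(\<lambda>\<tau>. j (moebius A \<tau>) - c) holomorphic_on upper_half_plane"
    using assms(4) Im_moebius_pos
    by (intro holomorphic_intros holomorphic_on_compose_gen[OF holomorphic_moebius holomorphic_j, unfolded o_def]) auto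
  have all: "j (moebius A \<tau>) - c = 0" if "Im \<tau> > 0" for \<tau>
    using analytic_continuation[OF hol open_upper_half_plane connected_upper_half_plane assms(2), of \<xi> \<tau>] c \<xi> that assms
    by (auto simp: interior_open interior_limit_point)
  have "j \<tau> = c" if "Im \<tau> > 0" for \<tau>
  proof -
    have "Im (moebius (adj A) \<tau>) > 0" using that assms(4) by (intro Im_moebius_pos) auto
    moreover have "moebius A (moebius (adj A) \<tau>) = \<tau>" using moebius_adj[OF that, of "adj A"] assms(4) by simp
    ultimately show ?thesis using all by force
  qed
  hence "eventually (\<lambda>\<tau>. j \<tau> = c) at_i_infinity" unfolding eventually_at_i_infinity by auto
  from leading_cong[OF leading_j this] have "leading (\<lambda>_. c) (-1) 1" .
  hence "((\<lambda>\<tau>. c * qpow 1 \<tau>) \<longlongrightarrow> 1) at_i_infinity" by (simp add: leading_def)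
  moreover have "((\<lambda>\<tau>. c * qpow 1 \<tau>) \<longlongrightarrow> c * 0) at_i_infinity" by (intro tendsto_mult qpow_tendsto_0) auto
  ultimately show False using tendsto_unique[OF at_i_infinity_neq_bot] by fastforce
qed

lemma j_nonconstant:
  assumes "open U" "U \<subseteq> upper_half_plane" "U \<noteq> {}"
  shows "\<not> j constant_on U"
  using j_moebius_nonconstant[OF assms, of "mat 1"] by simp

text \<open>
  If \<open>\<gamma> \<sigma>\<close> fixes infinity it is upper triangular, and so belongs to \<open>\<Gamma>\<^sub>0(N)\<close>. Hence the cusps \<open>\<sigma>\<infinity>\<close>
  inequivalent to infinity are those with \<open>\<sigma>\<close> outside \<open>\<Gamma>\<^sub>0(N)\<close>.
\<close>

lemma cusp_equiv_inf:
  fixes \<sigma> :: "int^2^2"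
  assumes "\<sigma> \<in> SL2Z"
  shows "Gamma0_equiv N (moebius_ext \<sigma> Infty) Infty \<longleftrightarrow> \<sigma> \<in> Gamma0 N"
proof -
  have I: "moebius_ext (mat 1) Infty = Infty" by simp
  have "Gamma0_equiv N (moebius_ext \<sigma> Infty) Infty \<longleftrightarrow> (\<exists>\<gamma>\<in>Gamma0 N. (adj (mat 1) ** \<gamma> ** \<sigma>)$2$1 = 0)"
    using Gamma0_equiv_cusps[OF assms SL2Z_closed(1), of N] unfolding I .
  also have "adj (mat 1) = mat 1" by (rule matrix2_eqI) simp_all
  finally have iff: "Gamma0_equiv N (moebius_ext \<sigma> Infty) Infty \<longleftrightarrow> (\<exists>\<gamma>\<in>Gamma0 N. (\<gamma> ** \<sigma>)$2$1 = 0)"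
    by (simp del: matrix2_mult_sel)
  show ?thesis unfolding iff
  proof
    assume "\<exists>\<gamma>\<in>Gamma0 N. (\<gamma> ** \<sigma>)$2$1 = 0"
    then obtain \<gamma> where \<gamma>: "\<gamma> \<in> Gamma0 N" "(\<gamma> ** \<sigma>)$2$1 = 0" by blast
    have "\<gamma> ** \<sigma> \<in> Gamma0 N" using \<gamma> assms by (simp add: Gamma0_iff det_mul SL2Z_iff del: matrix2_mult_sel)
    hence "adj \<gamma> ** (\<gamma> ** \<sigma>) \<in> Gamma0 N"
      by (rule Gamma0_closed(2)[OF Gamma0_closed(3)[OF \<gamma>(1)]])
    moreover have "det \<gamma> = 1" using \<gamma>(1) by (simp add: Gamma0_iff)
    ultimately show "\<sigma> \<in> Gamma0 N" by (simp only: adj_cancel)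
  next
    assume s: "\<sigma> \<in> Gamma0 N"
    hence "(adj \<sigma> ** \<sigma>)$2$1 = 0" by (simp add: Gamma0_iff del: matrix2_mult_sel)
    thus "\<exists>\<gamma>\<in>Gamma0 N. (\<gamma> ** \<sigma>)$2$1 = 0" using s by (intro bexI[of _ "adj \<sigma>"]) auto
  qed
qed

text \<open>
  At such a cusp \<open>j \<circ> \<sigma>\<close> is a meromorphic function \<open>F\<close> of \<open>w = exp (2 \<pi> \<i> \<tau> / N)\<close> near \<open>0\<close>. It has no pole, so it extends
  holomorphically by its limit \<open>L\<close>. It is not constant, so its order of vanishing gives the leading term of
  \<open>j \<circ> \<sigma> - L\<close>, and the open mapping theorem shows that all values near \<open>L\<close> are taken arbitrarily far up. As \<open>w\<close>
  need not be the local parameter, the exponent \<open>\<kappa>\<close> stays unspecified; it cancels from all later comparisons.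
\<close>

lemma cusp_expansion:
  fixes \<sigma> :: "int^2^2"
  assumes "\<sigma> \<in> SL2Z" "\<sigma> \<notin> Gamma0 N"
  obtains L \<kappa> \<alpha> where "\<kappa> > 0" "leading (\<lambda>\<tau>. j (moebius \<sigma> \<tau>) - L) \<kappa> \<alpha>"
    "\<And>Y. \<exists>\<delta>>0. \<forall>c. c \<noteq> L \<and> dist c L < \<delta> \<longrightarrow> (\<exists>\<tau>. Im \<tau> > Y \<and> j (moebius \<sigma> \<tau>) = c)"
proof -
  define \<eta> where "\<eta> = 1 / real N"
  have \<eta>0: "\<eta> > 0" using N_pos by (simp add: \<eta>_def)
  have qe: "exp (2 * pi * \<i> * \<tau> / of_nat N) = qpow \<eta> \<tau>" for \<tau> by (simp add: qpow_def \<eta>_def)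
  obtain F where F: "F meromorphic_on {0}" "eventually (\<lambda>\<tau>. j (moebius \<sigma> \<tau>) = F (qpow \<eta> \<tau>)) at_i_infinity"
    using Hauptmodul assms(1) unfolding is_Hauptmodul_def function_field_def meromorphic_at_cusp_def qe by auto
  have sing: "isolated_singularity_at F 0" "not_essential F 0" using F(1) meromorphic_at_iff by auto
  have "moebius_ext \<sigma> Infty \<in> cusps" using assms(1) cusps_eq by blast
  hence np: "\<not> pole_at_cusp j (moebius_ext \<sigma> Infty)"
    using Hauptmodul cusp_equiv_inf[OF assms(1)] assms(2) unfolding is_Hauptmodul_def by blast
  have "\<not> is_pole F 0"
  proof
    assume "is_pole F 0"
    hence "filterlim (\<lambda>\<tau>. F (qpow \<eta> \<tau>)) at_infinity at_i_infinity"
      unfolding is_pole_def using filterlim_compose qpow_filterlim_at_0[OF \<eta>0] by blast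
    hence "filterlim (\<lambda>\<tau>. j (moebius \<sigma> \<tau>)) at_infinity at_i_infinity"
      using filterlim_cong[OF refl refl F(2)] by blast
    thus False using np assms(1) unfolding pole_at_cusp_def by blast
  qed
  then obtain L where L: "F \<midarrow>0\<rightarrow> L" using sing(2) by (auto simp: not_essential_def)
  define G where "G = remove_sings F"
  have "G analytic_on {0}" unfolding G_def by (rule remove_sings_analytic_at[OF sing(1) L])
  then obtain \<rho> where \<rho>: "\<rho> > 0" "G holomorphic_on ball 0 \<rho>" using analytic_at_ball by blast
  have G0: "G 0 = L" unfolding G_def using L by blast
  have "eventually (\<lambda>w. G w = F w) (at 0)" unfolding G_def by (rule eventually_remove_sings_eq_at[OF sing(1)])
  hence "eventually (\<lambda>\<tau>. G (qpow \<eta> \<tau>) = F (qpow \<eta> \<tau>)) at_i_infinity"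
    using qpow_filterlim_at_0[OF \<eta>0] by (rule eventually_compose_filterlim)
  hence "eventually (\<lambda>\<tau>. j (moebius \<sigma> \<tau>) = G (qpow \<eta> \<tau>)) at_i_infinity" using F(2) by eventually_elim simp
  then obtain Y0 where Y0: "\<And>\<tau>. Im \<tau> > Y0 \<Longrightarrow> j (moebius \<sigma> \<tau>) = G (qpow \<eta> \<tau>)"
    unfolding eventually_at_i_infinity by blast
  have "eventually (\<lambda>\<tau>. qpow \<eta> \<tau> \<in> ball 0 \<rho>) at_i_infinity"
    using qpow_tendsto_0[OF \<eta>0] \<rho>(1) by (intro topological_tendstoD) auto
  then obtain Y1 where Y1: "\<And>\<tau>. Im \<tau> > Y1 \<Longrightarrow> qpow \<eta> \<tau> \<in> ball 0 \<rho>" unfolding eventually_at_i_infinity by blast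
  have nc: "\<not> (\<lambda>w. G w - L) constant_on ball 0 \<rho>"
  proof
    assume "(\<lambda>w. G w - L) constant_on ball 0 \<rho>"
    then obtain c where c: "\<And>w. w \<in> ball 0 \<rho> \<Longrightarrow> G w - L = c" by (auto simp: constant_on_def)
    define U where "U = {\<tau>. Im \<tau> > max 0 (max Y0 Y1)}"
    have mem: "Complex 0 (max 0 (max Y0 Y1) + 1) \<in> U" by (auto simp: U_def max_def)
    have "open U" unfolding U_def by (rule open_halfspace_Im_gt)
    moreover have "U \<subseteq> upper_half_plane" by (auto simp: U_def)
    moreover have "U \<noteq> {}" using mem by blast
    moreover have "(\<lambda>\<tau>. j (moebius \<sigma> \<tau>)) constant_on U"
      unfolding constant_on_def by (rule exI[of _ "c + L"]) (use Y0 Y1 c in \<open>auto simp: U_def algebra_simps\<close>)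
    ultimately show False using j_moebius_nonconstant[of U \<sigma>] assms(1) by (simp add: SL2Z_iff)
  qed
  have holL: "(\<lambda>w. G w - L) holomorphic_on ball 0 \<rho>" using \<rho>(2) by (intro holomorphic_intros)
  have "0 \<in> ball 0 \<rho>" "G 0 - L = 0" using \<rho>(1) G0 by simp_all
  note fac = holomorphic_factor_zero_nonconstant[OF holL open_ball connected_ball this nc]
  obtain g r m where m: "0 < m" "0 < r" "ball 0 r \<subseteq> ball (0::complex) \<rho>" "g holomorphic_on ball 0 r"
     "\<And>w. w \<in> ball 0 r \<Longrightarrow> G w - L = (w - 0)^m * g w" "\<And>w. w \<in> ball 0 r \<Longrightarrow> g w \<noteq> 0"
    by (rule fac) (rule that)
  have lead: "leading (\<lambda>\<tau>. j (moebius \<sigma> \<tau>) - L) (real m * \<eta>) (g 0)"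
  proof -
    have "isCont g 0" using m(2,4) by (metis centre_in_ball continuous_on_interior holomorphic_on_imp_continuous_on interior_ball)
    hence "((\<lambda>\<tau>. g (qpow \<eta> \<tau>)) \<longlongrightarrow> g 0) at_i_infinity"
      using isCont_tendsto_compose qpow_tendsto_0[OF \<eta>0] by blast
    moreover have "eventually (\<lambda>\<tau>. qpow \<eta> \<tau> \<in> ball 0 r) at_i_infinity"
      using qpow_tendsto_0[OF \<eta>0] m(2) by (intro topological_tendstoD) auto
    hence "eventually (\<lambda>\<tau>. g (qpow \<eta> \<tau>) = (j (moebius \<sigma> \<tau>) - L) * qpow (- (real m * \<eta>)) \<tau>) at_i_infinity"
      using eventually_Im_gt[of Y0]
    proof eventually_elim
      case (elim \<tau>)
      thus ?case using m(5)[OF elim(1)] Y0[of \<tau>] by (simp add: qpow_minus qpow_power)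
    qed
    ultimately show ?thesis unfolding leading_def using m(2,6) tendsto_cong by fastforce
  qed
  have opn: "\<exists>\<delta>>0. \<forall>c. c \<noteq> L \<and> dist c L < \<delta> \<longrightarrow> (\<exists>\<tau>. Im \<tau> > Y \<and> j (moebius \<sigma> \<tau>) = c)" for Y
  proof -
    define Y' where "Y' = max Y Y0"
    define r' where "r' = min \<rho> (exp (- (2 * pi * \<eta> * Y')))"
    have r'0: "r' > 0" using \<rho> by (simp add: r'_def)
    have "\<not> G constant_on ball 0 \<rho>" using nc unfolding constant_on_def by metis
    hence "open (G ` ball 0 r')" using \<rho> by (intro open_mapping_thm[of G "ball 0 \<rho>"]) (auto simp: r'_def)
    moreover have "L \<in> G ` ball 0 r'" using G0 r'0 by (intro image_eqI[of _ _ 0]) auto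
    ultimately obtain \<delta> where \<delta>: "\<delta> > 0" "ball L \<delta> \<subseteq> G ` ball 0 r'" using open_contains_ball by metis
    have "\<exists>\<tau>. Im \<tau> > Y \<and> j (moebius \<sigma> \<tau>) = c" if "c \<noteq> L" "dist c L < \<delta>" for c
    proof -
      have "c \<in> G ` ball 0 r'" using \<delta>(2) that(2) by (auto simp: dist_commute)
      then obtain w where w: "cmod w < r'" "G w = c" by auto
      have w0: "w \<noteq> 0" using that(1) w(2) G0 by auto
      obtain \<tau> where \<tau>: "qpow \<eta> \<tau> = w" using qpow_surj[OF w0 \<eta>0] by blast
      have "exp (- (2 * pi * \<eta> * Im \<tau>)) < exp (- (2 * pi * \<eta> * Y'))"
        using w(1) \<tau> norm_qpow[of \<eta> \<tau>] by (simp add: r'_def)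
      hence "2 * pi * \<eta> * Y' < 2 * pi * \<eta> * Im \<tau>" by simp
      hence "Im \<tau> > Y'" using \<eta>0 by simp
      thus ?thesis using Y0[of \<tau>] \<tau> w(2) by (intro exI[of _ \<tau>]) (auto simp: Y'_def)
    qed
    thus ?thesis using \<delta>(1) by blast
  qed
  from that[OF _ lead opn] show ?thesis using m(1) \<eta>0 by simp
qed

definition cusp_value :: "int^2^2 \<Rightarrow> complex" where
  "cusp_value A = Lim at_i_infinity (\<lambda>\<tau>. j (moebius A \<tau>))"

lemma cusp_value_asymptotics:
  fixes \<sigma> :: "int^2^2"
  assumes "\<sigma> \<in> SL2Z" "\<sigma> \<notin> Gamma0 N"
  shows "\<exists>\<kappa> \<alpha>. \<kappa> > 0 \<and> leading (\<lambda>\<tau>. j (moebius \<sigma> \<tau>) - cusp_value \<sigma>) \<kappa> \<alpha>"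
    "((\<lambda>\<tau>. j (moebius \<sigma> \<tau>)) \<longlongrightarrow> cusp_value \<sigma>) at_i_infinity"
    "\<exists>\<delta>>0. \<forall>c. c \<noteq> cusp_value \<sigma> \<and> dist c (cusp_value \<sigma>) < \<delta> \<longrightarrow> (\<exists>\<tau>. Im \<tau> > Y \<and> j (moebius \<sigma> \<tau>) = c)"
proof -
  obtain L \<kappa> \<alpha> where L: "\<kappa> > 0" "leading (\<lambda>\<tau>. j (moebius \<sigma> \<tau>) - L) \<kappa> \<alpha>"
    "\<And>Y. \<exists>\<delta>>0. \<forall>c. c \<noteq> L \<and> dist c L < \<delta> \<longrightarrow> (\<exists>\<tau>. Im \<tau> > Y \<and> j (moebius \<sigma> \<tau>) = c)"
    by (rule cusp_expansion[OF assms]) (rule that)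
  have "((\<lambda>\<tau>. j (moebius \<sigma> \<tau>) - L) \<longlongrightarrow> 0) at_i_infinity" using leading_tendsto_0[OF L(2), of 0] L(1) by simp
  hence lim: "((\<lambda>\<tau>. j (moebius \<sigma> \<tau>)) \<longlongrightarrow> L) at_i_infinity" by (simp add: LIM_zero_iff)
  hence "cusp_value \<sigma> = L" unfolding cusp_value_def by (rule tendsto_Lim[OF at_i_infinity_neq_bot])
  thus "\<exists>\<kappa> \<alpha>. \<kappa> > 0 \<and> leading (\<lambda>\<tau>. j (moebius \<sigma> \<tau>) - cusp_value \<sigma>) \<kappa> \<alpha>"
    "((\<lambda>\<tau>. j (moebius \<sigma> \<tau>)) \<longlongrightarrow> cusp_value \<sigma>) at_i_infinity"
    "\<exists>\<delta>>0. \<forall>c. c \<noteq> cusp_value \<sigma> \<and> dist c (cusp_value \<sigma>) < \<delta> \<longrightarrow> (\<exists>\<tau>. Im \<tau> > Y \<and> j (moebius \<sigma> \<tau>) = c)"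
    using L lim by blast+
qed

text \<open>
  Two matrices that map infinity to the same cusp differ by an upper triangular one, which acts as an integral
  translation and does not affect the limit.
\<close>

lemma value_at_cusp_eq:
  fixes \<sigma> :: "int^2^2"
  assumes "\<sigma> \<in> SL2Z" "\<sigma> \<notin> Gamma0 N"
  shows "value_at_cusp j (moebius_ext \<sigma> Infty) = cusp_value \<sigma>"
  unfolding value_at_cusp_def
proof (rule the_equality)
  show "\<forall>A\<in>SL2Z. moebius_ext A Infty = moebius_ext \<sigma> Infty \<longrightarrow> filterlim (\<lambda>\<tau>. j (moebius A \<tau>)) (nhds (cusp_value \<sigma>)) at_i_infinity"
  proof (intro ballI impI)
    fix A assume A: "A \<in> SL2Z" "moebius_ext A Infty = moebius_ext \<sigma> Infty"
    define U where "U = adj \<sigma> ** A"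
    have U: "U \<in> SL2Z" "U$2$1 = 0" "A = \<sigma> ** U"
    proof -
      show "U \<in> SL2Z" using A(1) assms(1) by (simp add: U_def)
      show "U$2$1 = 0" using moebius_ext_Infty_eq_iff[OF A(1) assms(1)] A(2) unfolding U_def by blast
      show "A = \<sigma> ** U" using assms(1) by (simp add: U_def SL2Z_iff)
    qed
    have Um: "moebius U \<tau> = moebius (mat2 1 (U$1$1 * U$1$2) 0 1) \<tau>" for \<tau>
      using SL2Z_upper(1)[OF U(1,2)] by (simp add: moebius_def)
    have "filterlim (moebius U) at_i_infinity at_i_infinity"
      unfolding Um[abs_def] by (rule filterlim_moebius_upper) simp_all
    from filterlim_compose[OF cusp_value_asymptotics(2)[OF assms] this]
    have "((\<lambda>\<tau>. j (moebius \<sigma> (moebius U \<tau>))) \<longlongrightarrow> cusp_value \<sigma>) at_i_infinity" .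
    moreover have "eventually (\<lambda>\<tau>. j (moebius \<sigma> (moebius U \<tau>)) = j (moebius A \<tau>)) at_i_infinity"
      using eventually_Im_gt[of 0] by eventually_elim (use U in \<open>simp add: moebius_compose SL2Z_iff\<close>)
    ultimately show "filterlim (\<lambda>\<tau>. j (moebius A \<tau>)) (nhds (cusp_value \<sigma>)) at_i_infinity" using tendsto_cong by fastforce
  qed
next
  fix L assume "\<forall>A\<in>SL2Z. moebius_ext A Infty = moebius_ext \<sigma> Infty \<longrightarrow> filterlim (\<lambda>\<tau>. j (moebius A \<tau>)) (nhds L) at_i_infinity"
  hence "((\<lambda>\<tau>. j (moebius \<sigma> \<tau>)) \<longlongrightarrow> L) at_i_infinity" using assms by blast
  thus "L = cusp_value \<sigma>" using cusp_value_asymptotics(2)[OF assms] tendsto_unique[OF at_i_infinity_neq_bot] by blast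
qed

end

section \<open>The values of the Hauptmodul\<close>

text \<open>
  A matrix that does not fix infinity cannot map a point far up to another point far up, since \<open>\<bar>c \<tau> + d\<bar> \<ge> Im \<tau>\<close>
  for \<open>c \<noteq> 0\<close>.
\<close>

lemma Im_moebius_mult_le:
  assumes "A \<in> SL2Z" "A$2$1 \<noteq> 0" "Im t > 0"
  shows "Im (moebius A t) * Im t \<le> 1"
proof -
  have dA: "det A = 1" using assms by (simp add: SL2Z_iff)
  have n0: "cmod (den A t) > 0" using den_nonzero[of t A] assms dA by simp
  have "1 * Im t \<le> \<bar>of_int (A$2$1)\<bar> * Im t" using assms by (intro mult_right_mono) auto
  also have "\<dots> = \<bar>Im (den A t)\<bar>" using assms by (simp add: den_def abs_mult)
  also have "\<dots> \<le> cmod (den A t)" by (rule abs_Im_le_cmod)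
  finally have "(Im t)\<^sup>2 \<le> (cmod (den A t))\<^sup>2" using assms by (intro power_mono) auto
  moreover have "Im (moebius A t) * Im t = (Im t)\<^sup>2 / (cmod (den A t))\<^sup>2"
    by (simp add: Im_moebius dA power2_eq_square)
  ultimately show ?thesis using n0 by simp
qed

text \<open>
  The complement of a countable set in the plane is connected, and \<open>V\<close> is open and closed in it. It is not empty
  there, because a nonempty open set is uncountable.
\<close>

lemma open_closed_countable:
  fixes V E :: "complex set"
  assumes "open V" "V \<noteq> {}" "countable E" "\<And>c. c \<notin> V \<Longrightarrow> c \<notin> E \<Longrightarrow> \<exists>\<epsilon>>0. ball c \<epsilon> \<inter> V = {}"
  shows "V \<union> E = UNIV"
proof -
  define W where "W = interior (- V)"
  have "connected (- E)"
    using path_connected_complement_countable[of E] assms(3) by (simp add: path_connected_imp_connected)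
  moreover have "- E \<subseteq> V \<union> W"
  proof
    fix c assume "c \<in> - E"
    show "c \<in> V \<union> W"
    proof (cases "c \<in> V")
      case False
      then obtain \<epsilon> where "\<epsilon> > 0" "ball c \<epsilon> \<inter> V = {}" using assms(4) \<open>c \<in> - E\<close> by blast
      hence "c \<in> W" unfolding W_def by (intro interiorI[of "ball c \<epsilon>"]) auto
      thus ?thesis by simp
    qed simp
  qed
  moreover have "V \<inter> W \<inter> - E = {}" using interior_subset[of "- V"] by (auto simp: W_def)
  moreover have "V \<inter> - E \<noteq> {}"
  proof
    assume "V \<inter> - E = {}"
    hence "V \<subseteq> E" by auto
    hence "countable V" using assms(3) countable_subset by blast
    obtain v where "v \<in> V" using assms(2) by auto
    then obtain r where "r > 0" "ball v r \<subseteq> V" using assms(1) open_contains_ball by blast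
    thus False using uncountable_ball[of r v] \<open>countable V\<close> countable_subset by blast
  qed
  ultimately have "W \<inter> - E = {}" using connectedD[of "- E" V W] assms(1) by (auto simp: W_def)
  thus ?thesis using \<open>- E \<subseteq> V \<union> W\<close> by auto
qed

context hauptmodul
begin

definition eqv :: "complex \<Rightarrow> complex \<Rightarrow> bool" where
  "eqv \<tau> \<tau>' \<longleftrightarrow> (\<exists>\<gamma>\<in>Gamma0 N. \<tau>' = moebius \<gamma> \<tau>)"

lemma eqv_sym: assumes "Im \<tau> > 0" "eqv \<tau> \<tau>'" shows "eqv \<tau>' \<tau>"
proof -
  obtain \<gamma> where g: "\<gamma> \<in> Gamma0 N" "\<tau>' = moebius \<gamma> \<tau>" using assms by (auto simp: eqv_def)
  have "\<tau> = moebius (adj \<gamma>) \<tau>'" using g assms(1) moebius_adj[of \<tau> \<gamma>] by (simp add: Gamma0_iff)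
  thus ?thesis using g(1) unfolding eqv_def by (intro bexI[of _ "adj \<gamma>"]) auto
qed

lemma eqv_trans: assumes "Im \<tau> > 0" "eqv \<tau> \<tau>'" "eqv \<tau>' \<tau>''" shows "eqv \<tau> \<tau>''"
proof -
  obtain \<gamma> \<delta> where g: "\<gamma> \<in> Gamma0 N" "\<tau>' = moebius \<gamma> \<tau>" "\<delta> \<in> Gamma0 N" "\<tau>'' = moebius \<delta> \<tau>'"
    using assms by (auto simp: eqv_def)
  have "\<tau>'' = moebius (\<delta> ** \<gamma>) \<tau>" using g assms(1) by (simp add: moebius_compose Gamma0_iff)
  thus ?thesis using g unfolding eqv_def by (intro bexI[of _ "\<delta> ** \<gamma>"]) auto
qed

lemma eqv_j: "Im \<tau> > 0 \<Longrightarrow> eqv \<tau> \<tau>' \<Longrightarrow> j \<tau>' = j \<tau>"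
  by (auto simp: eqv_def j_invariant)

lemma continuous_moebius: "det A \<noteq> 0 \<Longrightarrow> continuous_on upper_half_plane (moebius A)"
  by (intro holomorphic_on_imp_continuous_on holomorphic_moebius)

text \<open>
  Every orbit meets a translate \<open>\<sigma> F\<close> of the standard domain, where \<open>\<sigma>\<close> runs through finitely many coset
  representatives. Cutting off the part of \<open>F\<close> above height \<open>Y\<close> leaves a compact set.
\<close>

lemma reduction_to_cusps:
  obtains \<Sigma> where "finite \<Sigma>" "\<Sigma> \<subseteq> SL2Z" "\<And>A. A \<in> SL2Z \<Longrightarrow> \<exists>\<gamma>\<in>Gamma0 N. \<exists>\<sigma>\<in>\<Sigma>. A = \<gamma> ** \<sigma>"
    "\<And>Y. \<exists>K. compact K \<and> K \<subseteq> upper_half_plane \<and> (\<forall>\<tau>. Im \<tau> > 0 \<longrightarrow>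
       (\<exists>\<kappa>\<in>K. eqv \<kappa> \<tau>) \<or> (\<exists>\<sigma>\<in>\<Sigma>. \<exists>t. Im t > Y \<and> Im t > 0 \<and> eqv (moebius \<sigma> t) \<tau>))"
proof -
  obtain \<Sigma> where S: "finite \<Sigma>" "\<Sigma> \<subseteq> SL2Z" "\<And>A. A \<in> SL2Z \<Longrightarrow> \<exists>\<gamma>\<in>Gamma0 N. \<exists>\<sigma>\<in>\<Sigma>. A = \<gamma> ** \<sigma>"
    by (rule finite_index_Gamma0[OF N_pos]) (rule that)
  have "\<exists>K. compact K \<and> K \<subseteq> upper_half_plane \<and> (\<forall>\<tau>. Im \<tau> > 0 \<longrightarrow>
       (\<exists>\<kappa>\<in>K. eqv \<kappa> \<tau>) \<or> (\<exists>\<sigma>\<in>\<Sigma>. \<exists>t. Im t > Y \<and> Im t > 0 \<and> eqv (moebius \<sigma> t) \<tau>))" for Y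
  proof -
    define F where "F = cbox (Complex (-1/2) (1/2)) (Complex (1/2) Y)"
    have FH: "F \<subseteq> upper_half_plane" by (auto simp: F_def in_cbox_complex_iff)
    define K where "K = (\<Union>\<sigma>\<in>\<Sigma>. moebius \<sigma> ` F)"
    have dS: "det \<sigma> = 1" if "\<sigma> \<in> \<Sigma>" for \<sigma> using S(2) that by (auto simp: SL2Z_iff)
    have "compact K" unfolding K_def
    proof (intro compact_UN S(1) compact_continuous_image)
      fix \<sigma> assume "\<sigma> \<in> \<Sigma>"
      thus "continuous_on F (moebius \<sigma>)" using dS FH by (intro continuous_on_subset[OF continuous_moebius]) auto
    qed (simp add: F_def compact_cbox)
    moreover have "K \<subseteq> upper_half_plane"
    proof -
      have "Im (moebius \<sigma> t) > 0" if "\<sigma> \<in> \<Sigma>" "t \<in> F" for \<sigma> t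
        using subsetD[OF FH that(2)] dS[OF that(1)] by (intro Im_moebius_pos) simp_all
      thus ?thesis by (auto simp: K_def)
    qed
    moreover have "(\<exists>\<kappa>\<in>K. eqv \<kappa> \<tau>) \<or> (\<exists>\<sigma>\<in>\<Sigma>. \<exists>t. Im t > Y \<and> Im t > 0 \<and> eqv (moebius \<sigma> t) \<tau>)" if \<tau>: "Im \<tau> > 0" for \<tau>
    proof -
      obtain A where A: "A \<in> SL2Z" "\<bar>Re (moebius A \<tau>)\<bar> \<le> 1/2" "Im (moebius A \<tau>) \<ge> 1/2"
        by (rule fundamental_domain[OF \<tau>]) (rule that)
      define t where "t = moebius A \<tau>"
      have dA: "det A = 1" using A(1) by (simp add: SL2Z_iff)
      have "adj A \<in> SL2Z" using A(1) by simp
      then obtain \<gamma> \<sigma> where gs: "\<gamma> \<in> Gamma0 N" "\<sigma> \<in> \<Sigma>" "adj A = \<gamma> ** \<sigma>" using S(3) by blast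
      have t0: "Im t > 0" using A(3) by (simp add: t_def)
      have "\<tau> = moebius (\<gamma> ** \<sigma>) t" using moebius_adj[OF \<tau>, of A] dA gs(3) by (simp add: t_def)
      also have "\<dots> = moebius \<gamma> (moebius \<sigma> t)" using t0 dS[OF gs(2)] by (simp add: moebius_compose)
      finally have e: "eqv (moebius \<sigma> t) \<tau>" using gs(1) by (auto simp: eqv_def)
      show ?thesis
      proof (cases "Im t > Y")
        case True
        thus ?thesis using e gs(2) t0 by blast
      next
        case False
        hence "t \<in> F" using A by (auto simp: F_def in_cbox_complex_iff t_def abs_le_iff)
        hence "moebius \<sigma> t \<in> K" using gs(2) by (auto simp: K_def)
        thus ?thesis using e by blast
      qed
    qed
    ultimately show ?thesis by blast
  qed
  with S that show ?thesis by blast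
qed

lemma j_large: "eventually (\<lambda>\<tau>. cmod (j \<tau>) > R) at_i_infinity"
proof -
  have "((\<lambda>\<tau>. j \<tau> * qpow 1 \<tau>) \<longlongrightarrow> 1) at_i_infinity" using leading_j by (simp add: leading_def)
  hence "((\<lambda>\<tau>. cmod (j \<tau> * qpow 1 \<tau>)) \<longlongrightarrow> cmod 1) at_i_infinity" by (intro tendsto_norm)
  hence 1: "eventually (\<lambda>\<tau>. cmod (j \<tau> * qpow 1 \<tau>) > 1/2) at_i_infinity" by (rule order_tendstoD) simp
  have "((\<lambda>\<tau>. cmod (qpow 1 \<tau>)) \<longlongrightarrow> 0) at_i_infinity" using qpow_tendsto_0[of 1] by (simp add: tendsto_norm_zero_iff)
  hence 2: "eventually (\<lambda>\<tau>. cmod (qpow 1 \<tau>) < 1 / (2 * (\<bar>R\<bar> + 1))) at_i_infinity"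
    by (rule order_tendstoD) simp
  show ?thesis using 1 2
  proof eventually_elim
    case (elim \<tau>)
    show ?case
    proof (rule ccontr)
      assume "\<not> cmod (j \<tau>) > R"
      hence "cmod (j \<tau>) * cmod (qpow 1 \<tau>) \<le> (\<bar>R\<bar> + 1) * cmod (qpow 1 \<tau>)" by (intro mult_right_mono) auto
      also have "\<dots> \<le> (\<bar>R\<bar> + 1) * (1 / (2 * (\<bar>R\<bar> + 1)))" using elim(2) by (intro mult_left_mono) auto
      also have "\<dots> = 1/2" by (simp add: field_simps)
      finally show False using elim(1) by (simp add: norm_mult)
    qed
  qed
qed

definition cusp_values :: "complex set" where
  "cusp_values = cusp_value ` (SL2Z - Gamma0 N)"

lemma cusp_value_Gamma0_mult:
  fixes \<sigma> :: "int^2^2"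
  assumes "\<gamma> \<in> Gamma0 N" "\<sigma> \<in> SL2Z" "\<sigma> \<notin> Gamma0 N"
  shows "\<gamma> ** \<sigma> \<in> SL2Z" "\<gamma> ** \<sigma> \<notin> Gamma0 N" "cusp_value (\<gamma> ** \<sigma>) = cusp_value \<sigma>"
proof -
  have dg: "det \<gamma> = 1" using assms by (simp add: Gamma0_iff)
  show s: "\<gamma> ** \<sigma> \<in> SL2Z" using assms Gamma0_SL2Z by auto
  show g: "\<gamma> ** \<sigma> \<notin> Gamma0 N"
  proof
    assume "\<gamma> ** \<sigma> \<in> Gamma0 N"
    hence "adj \<gamma> ** (\<gamma> ** \<sigma>) \<in> Gamma0 N" by (rule Gamma0_closed(2)[OF Gamma0_closed(3)[OF assms(1)]])
    thus False using assms(3) dg by (simp only: adj_cancel)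
  qed
  have "eventually (\<lambda>\<tau>. j (moebius (\<gamma> ** \<sigma>) \<tau>) = j (moebius \<sigma> \<tau>)) at_i_infinity"
    using eventually_Im_gt[of 0]
  proof eventually_elim
    case (elim \<tau>)
    have "Im (moebius \<sigma> \<tau>) > 0" using elim assms(2) by (intro Im_moebius_pos) (auto simp: SL2Z_iff)
    thus ?case using elim assms j_invariant by (subst moebius_compose[symmetric]) (auto simp: SL2Z_iff)
  qed
  from tendsto_cong[OF this] have "((\<lambda>\<tau>. j (moebius \<sigma> \<tau>)) \<longlongrightarrow> cusp_value (\<gamma> ** \<sigma>)) at_i_infinity"
    using cusp_value_asymptotics(2)[OF s g] by blast
  thus "cusp_value (\<gamma> ** \<sigma>) = cusp_value \<sigma>" using cusp_value_asymptotics(2)[OF assms(2,3)] tendsto_unique[OF at_i_infinity_neq_bot] by blast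
qed

lemma finite_cusp_values: "finite cusp_values"
proof -
  obtain \<Sigma> where S: "finite \<Sigma>" "\<Sigma> \<subseteq> SL2Z" "\<And>A. A \<in> SL2Z \<Longrightarrow> \<exists>\<gamma>\<in>Gamma0 N. \<exists>\<sigma>\<in>\<Sigma>. A = \<gamma> ** \<sigma>"
    by (rule finite_index_Gamma0[OF N_pos]) (rule that)
  have "cusp_values \<subseteq> cusp_value ` \<Sigma>"
  proof
    fix c assume "c \<in> cusp_values"
    then obtain A where A: "A \<in> SL2Z" "A \<notin> Gamma0 N" "c = cusp_value A" by (auto simp: cusp_values_def)
    obtain \<gamma> \<sigma> where gs: "\<gamma> \<in> Gamma0 N" "\<sigma> \<in> \<Sigma>" "A = \<gamma> ** \<sigma>" using S(3)[OF A(1)] by blast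
    have "\<sigma> \<notin> Gamma0 N" using A(2) gs by auto
    hence "c = cusp_value \<sigma>" using cusp_value_Gamma0_mult(3)[OF gs(1)] gs S(2) A(3) by auto
    thus "c \<in> cusp_value ` \<Sigma>" using gs(2) by blast
  qed
  thus ?thesis using S(1) finite_surj by blast
qed

text \<open>
  High up in the translate \<open>\<sigma> F\<close> the function \<open>j\<close> is either large or close to the value at the cusp \<open>\<sigma>\<infinity>\<close>, so it avoids
  a neighbourhood of any \<open>c\<close> that is not a cusp value. Up to equivalence, the preimages of values near \<open>c\<close> thus lie
  in a compact set.
\<close>

lemma fiber_compact:
  assumes "c \<notin> cusp_values"
  obtains K \<delta> where "compact K" "K \<subseteq> upper_half_plane" "\<delta> > 0"
    "\<And>\<tau>. Im \<tau> > 0 \<Longrightarrow> j \<tau> \<in> ball c \<delta> \<Longrightarrow> \<exists>\<kappa>\<in>K. eqv \<kappa> \<tau>"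
proof -
  obtain \<Sigma> where S: "finite \<Sigma>" "\<Sigma> \<subseteq> SL2Z" "\<And>Y. \<exists>K. compact K \<and> K \<subseteq> upper_half_plane \<and> (\<forall>\<tau>. Im \<tau> > 0 \<longrightarrow>
       (\<exists>\<kappa>\<in>K. eqv \<kappa> \<tau>) \<or> (\<exists>\<sigma>\<in>\<Sigma>. \<exists>t. Im t > Y \<and> Im t > 0 \<and> eqv (moebius \<sigma> t) \<tau>))"
    by (rule reduction_to_cusps) (rule that)
  have "open (- cusp_values)" using finite_cusp_values by (simp add: finite_imp_closed open_Compl)
  then obtain d where d: "d > 0" "ball c d \<subseteq> - cusp_values" using assms open_contains_ball by blast
  define \<delta> where "\<delta> = min 1 (d / 2)"
  have \<delta>0: "\<delta> > 0" using d by (simp add: \<delta>_def)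
  have "eventually (\<lambda>t. j (moebius \<sigma> t) \<notin> ball c \<delta>) at_i_infinity" if s: "\<sigma> \<in> \<Sigma>" for \<sigma>
  proof (cases "\<sigma> \<in> Gamma0 N")
    case True
    show ?thesis using eventually_Im_gt[of 0] j_large[of "cmod c + 1"]
    proof eventually_elim
      case (elim t)
      have "cmod (j t) \<le> cmod c + dist c (j t)" using norm_triangle_ineq4[of c "c - j t"] by (simp add: dist_norm)
      hence "dist c (j t) \<ge> 1" using elim by linarith
      thus ?case using elim True by (simp add: j_invariant \<delta>_def)
    qed
  next
    case False
    have "cusp_value \<sigma> \<in> cusp_values" using False s S(2) by (auto simp: cusp_values_def)
    hence dd: "dist c (cusp_value \<sigma>) \<ge> d" using d(2) by (meson ComplD in_mono mem_ball not_le)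
    have "eventually (\<lambda>t. dist (j (moebius \<sigma> t)) (cusp_value \<sigma>) < d / 2) at_i_infinity"
      using cusp_value_asymptotics(2)[of \<sigma>] s S(2) False d(1) by (intro tendstoD) auto
    thus ?thesis
    proof eventually_elim
      case (elim t)
      have "dist c (cusp_value \<sigma>) \<le> dist c (j (moebius \<sigma> t)) + dist (j (moebius \<sigma> t)) (cusp_value \<sigma>)" by (rule dist_triangle)
      hence "dist c (j (moebius \<sigma> t)) \<ge> d / 2" using dd elim by linarith
      thus ?case by (simp add: \<delta>_def)
    qed
  qed
  hence "eventually (\<lambda>t. \<forall>\<sigma>\<in>\<Sigma>. j (moebius \<sigma> t) \<notin> ball c \<delta>) at_i_infinity"
    using S(1) by (intro eventually_ball_finite) auto
  then obtain Y where Y: "\<And>t \<sigma>. Im t > Y \<Longrightarrow> \<sigma> \<in> \<Sigma> \<Longrightarrow> j (moebius \<sigma> t) \<notin> ball c \<delta>"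
    unfolding eventually_at_i_infinity by blast
  obtain K where K: "compact K" "K \<subseteq> upper_half_plane" "\<And>\<tau>. Im \<tau> > 0 \<Longrightarrow>
       (\<exists>\<kappa>\<in>K. eqv \<kappa> \<tau>) \<or> (\<exists>\<sigma>\<in>\<Sigma>. \<exists>t. Im t > Y \<and> Im t > 0 \<and> eqv (moebius \<sigma> t) \<tau>)"
    using S(3)[of Y] by blast
  show ?thesis
  proof (rule that[OF K(1,2) \<delta>0])
    fix \<tau> assume t: "Im \<tau> > 0" "j \<tau> \<in> ball c \<delta>"
    have False if "\<sigma> \<in> \<Sigma>" "Im t > Y" "Im t > 0" "eqv (moebius \<sigma> t) \<tau>" for \<sigma> t
    proof -
      have "Im (moebius \<sigma> t) > 0" using that S(2) by (intro Im_moebius_pos) (auto simp: SL2Z_iff)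
      hence "j \<tau> = j (moebius \<sigma> t)" using eqv_j that(4) by blast
      thus False using Y[OF that(2,1)] t(2) by simp
    qed
    thus "\<exists>\<kappa>\<in>K. eqv \<kappa> \<tau>" using K(3)[OF t(1)] by metis
  qed
qed

lemma compact_avoid:
  assumes "compact K" "K \<subseteq> upper_half_plane" "c \<notin> j ` K"
  obtains \<epsilon> where "\<epsilon> > 0" "ball c \<epsilon> \<inter> j ` K = {}"
proof -
  have "compact (j ` K)"
    using assms holomorphic_j by (intro compact_continuous_image continuous_on_subset[OF holomorphic_on_imp_continuous_on]) auto
  hence "open (- (j ` K))" by (simp add: compact_imp_closed open_Compl)
  then obtain \<epsilon> where "\<epsilon> > 0" "ball c \<epsilon> \<subseteq> - (j ` K)" using assms(3) open_contains_ball by blast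
  thus ?thesis using that by blast
qed

lemma open_j_image:
  assumes "open U" "U \<subseteq> upper_half_plane"
  shows "open (j ` U)"
proof -
  have "Complex 0 1 \<in> upper_half_plane" by simp
  hence "\<not> j constant_on upper_half_plane" using j_nonconstant[OF open_upper_half_plane] by blast
  thus ?thesis using open_mapping_thm[OF holomorphic_j open_upper_half_plane connected_upper_half_plane assms] by simp
qed

lemma j_avoid:
  assumes "c \<notin> cusp_values" "c \<notin> j ` upper_half_plane"
  shows "\<exists>\<epsilon>>0. ball c \<epsilon> \<inter> j ` upper_half_plane = {}"
proof -
  obtain K \<delta> where K: "compact K" "K \<subseteq> upper_half_plane" "\<delta> > 0"
    "\<And>\<tau>. Im \<tau> > 0 \<Longrightarrow> j \<tau> \<in> ball c \<delta> \<Longrightarrow> \<exists>\<kappa>\<in>K. eqv \<kappa> \<tau>"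
    by (rule fiber_compact[OF assms(1)]) (rule that)
  have "c \<notin> j ` K" using assms(2) K(2) by blast
  then obtain \<epsilon> where e: "\<epsilon> > 0" "ball c \<epsilon> \<inter> j ` K = {}" using compact_avoid K by metis
  have "ball c (min \<epsilon> \<delta>) \<inter> j ` upper_half_plane = {}"
  proof (rule ccontr)
    assume "ball c (min \<epsilon> \<delta>) \<inter> j ` upper_half_plane \<noteq> {}"
    then obtain \<tau> where t: "Im \<tau> > 0" "j \<tau> \<in> ball c (min \<epsilon> \<delta>)"
      by (auto simp del: mem_ball)
    then obtain \<kappa> where k: "\<kappa> \<in> K" "eqv \<kappa> \<tau>" using K(4) by auto
    hence "j \<tau> = j \<kappa>" using eqv_j subsetD[OF K(2) k(1)] by simp
    thus False using k(1) t(2) e(2) by auto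
  qed
  thus ?thesis using e(1) K(3) by (intro exI[of _ "min \<epsilon> \<delta>"]) auto
qed

text \<open>
  The image of \<open>j\<close> is open, and by \<open>j_avoid\<close> it is closed away from the finitely many cusp values.
\<close>

lemma j_surjective: "j ` upper_half_plane \<union> cusp_values = UNIV"
proof (rule open_closed_countable)
  show "open (j ` upper_half_plane)" by (rule open_j_image[OF open_upper_half_plane order.refl])
  have "Complex 0 1 \<in> upper_half_plane" by simp
  thus "j ` upper_half_plane \<noteq> {}" by blast
  show "countable cusp_values" using finite_cusp_values by (rule countable_finite)
qed (use j_avoid in blast)

definition double_values :: "complex set" where
  "double_values = {c. \<exists>\<tau>1 \<tau>2. Im \<tau>1 > 0 \<and> Im \<tau>2 > 0 \<and> j \<tau>1 = c \<and> j \<tau>2 = c \<and> \<not> eqv \<tau>1 \<tau>2}"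

text \<open>
  Two inequivalent points have neighbourhoods without equivalent points, whose images under \<open>j\<close> are neighbourhoods of
  the common value.
\<close>

lemma open_double_values: "open double_values"
proof (subst open_contains_ball, intro ballI)
  fix c assume "c \<in> double_values"
  then obtain \<tau>1 \<tau>2 where t: "Im \<tau>1 > 0" "Im \<tau>2 > 0" "j \<tau>1 = c" "j \<tau>2 = c" "\<not> eqv \<tau>1 \<tau>2"
    by (auto simp: double_values_def)
  obtain \<epsilon> where e: "\<epsilon> > 0" "ball \<tau>1 \<epsilon> \<subseteq> upper_half_plane" "ball \<tau>2 \<epsilon> \<subseteq> upper_half_plane"
    "\<And>A t. A \<in> SL2Z \<Longrightarrow> t \<in> ball \<tau>1 \<epsilon> \<Longrightarrow> moebius A t \<in> ball \<tau>2 \<epsilon> \<Longrightarrow> moebius A \<tau>1 = \<tau>2"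
    by (rule proper_discontinuity[OF t(1,2)]) (rule that)
  have "open (j ` ball \<tau>1 \<epsilon> \<inter> j ` ball \<tau>2 \<epsilon>)" using open_j_image e by (intro open_Int) auto
  moreover have "c \<in> j ` ball \<tau>1 \<epsilon>" using t(3) e(1) by (intro image_eqI[of _ _ \<tau>1]) simp_all
  moreover have "c \<in> j ` ball \<tau>2 \<epsilon>" using t(4) e(1) by (intro image_eqI[of _ _ \<tau>2]) simp_all
  ultimately obtain r where r: "r > 0" "ball c r \<subseteq> j ` ball \<tau>1 \<epsilon> \<inter> j ` ball \<tau>2 \<epsilon>" using open_contains_ball by (metis IntI)
  have "ball c r \<subseteq> double_values"
  proof
    fix c' assume "c' \<in> ball c r"
    hence c': "c' \<in> j ` ball \<tau>1 \<epsilon>" "c' \<in> j ` ball \<tau>2 \<epsilon>" using r(2) by (meson IntD1 IntD2 subsetD)+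
    obtain t1 where "t1 \<in> ball \<tau>1 \<epsilon>" "c' = j t1" using c'(1) by (rule imageE)
    moreover obtain t2 where "t2 \<in> ball \<tau>2 \<epsilon>" "c' = j t2" using c'(2) by (rule imageE)
    ultimately have t': "t1 \<in> ball \<tau>1 \<epsilon>" "t2 \<in> ball \<tau>2 \<epsilon>" "j t1 = c'" "j t2 = c'" by simp_all
    have "\<not> eqv t1 t2"
    proof
      assume "eqv t1 t2"
      then obtain \<gamma> where "\<gamma> \<in> Gamma0 N" "t2 = moebius \<gamma> t1" by (auto simp: eqv_def)
      hence "moebius \<gamma> \<tau>1 = \<tau>2" using e(4) t' Gamma0_SL2Z by blast
      thus False using t(5) \<open>\<gamma> \<in> Gamma0 N\<close> by (auto simp: eqv_def)
    qed
    moreover have "Im t1 > 0" "Im t2 > 0" using e(2,3) t' by auto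
    ultimately show "c' \<in> double_values" using t' by (auto simp: double_values_def)
  qed
  thus "\<exists>r>0. ball c r \<subseteq> double_values" using r(1) by blast
qed

text \<open>
  Suppose that \<open>c\<close> is taken on the orbit of \<open>\<tau>0\<close> only, and that \<open>j\<close> is injective on a ball around \<open>\<tau>0\<close>. The union \<open>U\<close> of
  the translates of this ball is open, so the part of the compact set of \<open>fiber_compact\<close> outside \<open>U\<close> has a compact
  image that does not contain \<open>c\<close>. A value close to \<open>c\<close> is therefore taken in \<open>U\<close> only, hence on a single orbit.
\<close>

lemma double_values_closed_off_critical:
  assumes "c \<notin> double_values" "c \<notin> cusp_values" "c \<notin> j ` {\<tau> \<in> upper_half_plane. deriv j \<tau> = 0}"
  shows "\<exists>\<epsilon>>0. ball c \<epsilon> \<inter> double_values = {}"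
proof (cases "c \<in> j ` upper_half_plane")
  case False
  then obtain \<epsilon> where "\<epsilon> > 0" "ball c \<epsilon> \<inter> j ` upper_half_plane = {}" using j_avoid assms(2) by blast
  moreover have "double_values \<subseteq> j ` upper_half_plane" by (auto simp: double_values_def)
  ultimately show ?thesis by blast
next
  case True
  then obtain \<tau>0 where t0: "Im \<tau>0 > 0" "j \<tau>0 = c" by auto
  hence dnz: "deriv j \<tau>0 \<noteq> 0" using assms(3) by auto
  have "\<tau>0 \<in> upper_half_plane" using t0 by simp
  obtain r where r: "r > 0" "ball \<tau>0 r \<subseteq> upper_half_plane" "inj_on j (ball \<tau>0 r)"
    by (rule has_complex_derivative_locally_injective[OF holomorphic_j \<open>\<tau>0 \<in> upper_half_plane\<close> open_upper_half_plane dnz]) (rule that)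
  obtain K \<delta> where K: "compact K" "K \<subseteq> upper_half_plane" "\<delta> > 0"
    "\<And>\<tau>. Im \<tau> > 0 \<Longrightarrow> j \<tau> \<in> ball c \<delta> \<Longrightarrow> \<exists>\<kappa>\<in>K. eqv \<kappa> \<tau>"
    by (rule fiber_compact[OF assms(2)]) (rule that)
  define U where "U = (\<Union>\<gamma>\<in>Gamma0 N. upper_half_plane \<inter> moebius \<gamma> -` ball \<tau>0 r)"
  have "open U" unfolding U_def
    using open_upper_half_plane by (intro open_UN ballI continuous_open_preimage continuous_moebius) (auto simp: Gamma0_iff)
  hence "compact (K - U)" using K(1) by (simp add: compact_diff)
  have U: "\<tau> \<in> U \<longleftrightarrow> Im \<tau> > 0 \<and> (\<exists>t\<in>ball \<tau>0 r. eqv \<tau> t)" for \<tau>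
    by (auto simp: U_def eqv_def)
  have "c \<notin> j ` (K - U)"
  proof
    assume "c \<in> j ` (K - U)"
    then obtain \<kappa> where k: "\<kappa> \<in> K" "\<kappa> \<notin> U" "j \<kappa> = c" by auto
    have "Im \<kappa> > 0" using subsetD[OF K(2) k(1)] by simp
    hence "eqv \<kappa> \<tau>0" using assms(1) t0 k(3) by (auto simp: double_values_def)
    thus False using k(2) U \<open>Im \<kappa> > 0\<close> r(1) by (metis centre_in_ball)
  qed
  then obtain \<epsilon> where e: "\<epsilon> > 0" "ball c \<epsilon> \<inter> j ` (K - U) = {}"
    using compact_avoid[OF \<open>compact (K - U)\<close>] K(2) by (metis Diff_subset order.trans)
  have "ball c (min \<epsilon> \<delta>) \<inter> double_values = {}"
  proof (rule ccontr)
    assume "ball c (min \<epsilon> \<delta>) \<inter> double_values \<noteq> {}"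
    then obtain \<tau>1 \<tau>2 where t: "Im \<tau>1 > 0" "Im \<tau>2 > 0" "j \<tau>2 = j \<tau>1" "\<not> eqv \<tau>1 \<tau>2" "j \<tau>1 \<in> ball c (min \<epsilon> \<delta>)"
      by (auto simp: double_values_def simp del: mem_ball)
    have *: "\<exists>t\<in>ball \<tau>0 r. eqv \<tau> t" if tau: "Im \<tau> > 0" "j \<tau> = j \<tau>1" for \<tau>
    proof -
      obtain \<kappa> where k: "\<kappa> \<in> K" "eqv \<kappa> \<tau>" using K(4)[OF tau(1)] tau(2) t(5) by auto
      have k0: "Im \<kappa> > 0" using subsetD[OF K(2) k(1)] by simp
      have "j \<kappa> = j \<tau>1" using eqv_j[OF k0 k(2)] tau(2) by simp
      hence "j \<kappa> \<in> ball c \<epsilon>" using t(5) by simp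
      hence "\<kappa> \<in> U" using e(2) k(1) by blast
      then obtain t where "t \<in> ball \<tau>0 r" "eqv \<kappa> t" using U by blast
      thus ?thesis using eqv_trans[OF tau(1) eqv_sym[OF k0 k(2)]] by blast
    qed
    obtain s1 where s1: "s1 \<in> ball \<tau>0 r" "eqv \<tau>1 s1" using *[OF t(1) refl] by blast
    obtain s2 where s2: "s2 \<in> ball \<tau>0 r" "eqv \<tau>2 s2" using *[OF t(2,3)] by blast
    have "j s1 = j s2" using eqv_j[OF t(1) s1(2)] eqv_j[OF t(2) s2(2)] t(3) by simp
    hence "s1 = s2" using r(3) s1(1) s2(1) by (auto dest: inj_onD)
    thus False using t(4) eqv_trans[OF t(1) s1(2)] eqv_sym[OF t(2) s2(2)] by blast
  qed
  thus ?thesis using e(1) K(3) by (intro exI[of _ "min \<epsilon> \<delta>"]) auto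
qed

lemma countable_critical_values: "countable (j ` {\<tau> \<in> upper_half_plane. deriv j \<tau> = 0})"
proof (cases "deriv j constant_on upper_half_plane")
  case False
  have "deriv j holomorphic_on upper_half_plane" by (rule holomorphic_deriv[OF holomorphic_j open_upper_half_plane])
  moreover have "fsigma upper_half_plane"
  proof -
    have "upper_half_plane = (\<Union>n::nat. {z. Im z \<ge> inverse (real (Suc n))})"
    proof (intro equalityI subsetI)
      fix z assume "z \<in> upper_half_plane"
      then obtain n where "inverse (real (Suc n)) < Im z" using reals_Archimedean by auto
      thus "z \<in> (\<Union>n::nat. {z. Im z \<ge> inverse (real (Suc n))})" by (auto intro: less_imp_le)
    next
      fix z assume "z \<in> (\<Union>n::nat. {z. Im z \<ge> inverse (real (Suc n))})"
      then obtain n where "inverse (real (Suc n)) \<le> Im z" by auto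
      moreover have "inverse (real (Suc n)) > 0" by simp
      ultimately show "z \<in> upper_half_plane" unfolding mem_upper_half_plane by linarith
    qed
    thus ?thesis using fsigma.intros[of "\<lambda>n. {z. Im z \<ge> inverse (real (Suc n))}"] closed_halfspace_Im_ge by metis
  qed
  ultimately show ?thesis using holomorphic_countable_zeros[OF _ open_upper_half_plane connected_upper_half_plane _ False] by (intro countable_image) auto
next
  case True
  then obtain k where k: "\<And>\<tau>. Im \<tau> > 0 \<Longrightarrow> deriv j \<tau> = k" by (auto simp: constant_on_def)
  have "k \<noteq> 0"
  proof
    assume "k = 0"
    have "\<exists>c. \<forall>\<tau>\<in>upper_half_plane. j \<tau> = c"
      by (rule DERIV_zero_connected_constant[of _ "{}" j, OF connected_upper_half_plane open_upper_half_plane])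
         (use holomorphic_j holomorphic_derivI[OF holomorphic_j open_upper_half_plane] k \<open>k = 0\<close> in \<open>auto intro: holomorphic_on_imp_continuous_on\<close>)
    hence "j constant_on upper_half_plane" by (auto simp: constant_on_def)
    moreover have "Complex 0 1 \<in> upper_half_plane" by simp
    ultimately show False using j_nonconstant[OF open_upper_half_plane] by blast
  qed
  hence e: "{\<tau> \<in> upper_half_plane. deriv j \<tau> = 0} = {}" using k by auto
  show ?thesis unfolding e by simp
qed

text \<open>
  A large value can only be taken near the cusp infinity, where \<open>j\<close> is injective up to translations.
\<close>

lemma double_values_bounded:
  obtains R where "\<And>c. c \<in> double_values \<Longrightarrow> cmod c \<le> R"
proof -
  obtain \<Sigma> where S: "finite \<Sigma>" "\<Sigma> \<subseteq> SL2Z" "\<And>Y. \<exists>K. compact K \<and> K \<subseteq> upper_half_plane \<and> (\<forall>\<tau>. Im \<tau> > 0 \<longrightarrow>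
       (\<exists>\<kappa>\<in>K. eqv \<kappa> \<tau>) \<or> (\<exists>\<sigma>\<in>\<Sigma>. \<exists>t. Im t > Y \<and> Im t > 0 \<and> eqv (moebius \<sigma> t) \<tau>))"
    by (rule reduction_to_cusps) (rule that)
  obtain Y0 where Y0: "Y0 > 0" "\<And>\<tau> \<tau>'. Im \<tau> > Y0 \<Longrightarrow> Im \<tau>' > Y0 \<Longrightarrow> j \<tau> = j \<tau>' \<Longrightarrow> \<exists>k::int. \<tau> = \<tau>' + of_int k"
    by (rule j_inj_inf) (rule that)
  obtain B where B: "\<And>c. c \<in> cusp_values \<Longrightarrow> cmod c \<le> B"
    using finite_imp_bounded[OF finite_cusp_values] by (auto simp: bounded_iff)
  have "eventually (\<lambda>t. \<sigma> \<in> Gamma0 N \<or> cmod (j (moebius \<sigma> t)) \<le> B + 1) at_i_infinity" if s: "\<sigma> \<in> \<Sigma>" for \<sigma>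
  proof (cases "\<sigma> \<in> Gamma0 N")
    case False
    have "cusp_value \<sigma> \<in> cusp_values" using False s S(2) by (auto simp: cusp_values_def)
    hence b: "cmod (cusp_value \<sigma>) \<le> B" by (rule B)
    have "eventually (\<lambda>t. dist (j (moebius \<sigma> t)) (cusp_value \<sigma>) < 1) at_i_infinity"
      using cusp_value_asymptotics(2)[of \<sigma>] s S(2) False by (intro tendstoD) auto
    thus ?thesis
    proof eventually_elim
      case (elim t)
      have "cmod (j (moebius \<sigma> t)) \<le> cmod (cusp_value \<sigma>) + dist (j (moebius \<sigma> t)) (cusp_value \<sigma>)"
        using norm_triangle_ineq[of "cusp_value \<sigma>" "j (moebius \<sigma> t) - cusp_value \<sigma>"] by (simp add: dist_norm)
      thus ?case using elim b by linarith
    qed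
  qed simp
  hence "eventually (\<lambda>t. \<forall>\<sigma>\<in>\<Sigma>. \<sigma> \<in> Gamma0 N \<or> cmod (j (moebius \<sigma> t)) \<le> B + 1) at_i_infinity"
    using S(1) by (intro eventually_ball_finite) auto
  then obtain Y1 where Y1: "\<And>t \<sigma>. Im t > Y1 \<Longrightarrow> \<sigma> \<in> \<Sigma> \<Longrightarrow> \<sigma> \<in> Gamma0 N \<or> cmod (j (moebius \<sigma> t)) \<le> B + 1"
    unfolding eventually_at_i_infinity by blast
  define Y where "Y = max Y0 Y1"
  obtain K where K: "compact K" "K \<subseteq> upper_half_plane" "\<And>\<tau>. Im \<tau> > 0 \<Longrightarrow>
       (\<exists>\<kappa>\<in>K. eqv \<kappa> \<tau>) \<or> (\<exists>\<sigma>\<in>\<Sigma>. \<exists>t. Im t > Y \<and> Im t > 0 \<and> eqv (moebius \<sigma> t) \<tau>)"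
    using S(3)[of Y] by blast
  have "compact (j ` K)"
    using K holomorphic_j by (intro compact_continuous_image continuous_on_subset[OF holomorphic_on_imp_continuous_on]) auto
  hence "bounded (j ` K)" by (rule compact_imp_bounded)
  then obtain B' where B': "\<And>\<kappa>. \<kappa> \<in> K \<Longrightarrow> cmod (j \<kappa>) \<le> B'" by (auto simp: bounded_iff)
  define R where "R = max B' (B + 1)"
  have far: "\<exists>t. Im t > Y0 \<and> Im t > 0 \<and> eqv t \<tau>" if tau: "Im \<tau> > 0" "cmod (j \<tau>) > R" for \<tau>
  proof -
    have "\<not> (\<exists>\<kappa>\<in>K. eqv \<kappa> \<tau>)"
    proof
      assume "\<exists>\<kappa>\<in>K. eqv \<kappa> \<tau>"
      then obtain \<kappa> where k: "\<kappa> \<in> K" "eqv \<kappa> \<tau>" by blast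
      hence "j \<tau> = j \<kappa>" using eqv_j subsetD[OF K(2) k(1)] by simp
      thus False using B'[OF k(1)] tau(2) by (simp add: R_def)
    qed
    then obtain \<sigma> t where st: "\<sigma> \<in> \<Sigma>" "Im t > Y" "Im t > 0" "eqv (moebius \<sigma> t) \<tau>" using K(3)[OF tau(1)] by blast
    have im: "Im (moebius \<sigma> t) > 0" using st S(2) by (intro Im_moebius_pos) (auto simp: SL2Z_iff)
    have "j \<tau> = j (moebius \<sigma> t)" using eqv_j[OF im st(4)] .
    hence "\<sigma> \<in> Gamma0 N" using Y1[of t \<sigma>] st(1,2) tau(2) by (auto simp: Y_def R_def)
    hence "eqv t (moebius \<sigma> t)" by (auto simp: eqv_def)
    hence "eqv t \<tau>" using eqv_trans[OF st(3) _ st(4)] by blast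
    thus ?thesis using st by (auto simp: Y_def)
  qed
  show ?thesis
  proof (rule that[of R], rule ccontr)
    fix c assume c: "c \<in> double_values" "\<not> cmod c \<le> R"
    then obtain \<tau>1 \<tau>2 where t: "Im \<tau>1 > 0" "Im \<tau>2 > 0" "j \<tau>1 = c" "j \<tau>2 = c" "\<not> eqv \<tau>1 \<tau>2"
      by (auto simp: double_values_def)
    obtain t1 where t1: "Im t1 > Y0" "Im t1 > 0" "eqv t1 \<tau>1" using far[OF t(1)] t(3) c(2) by auto
    obtain t2 where t2: "Im t2 > Y0" "Im t2 > 0" "eqv t2 \<tau>2" using far[OF t(2)] t(4) c(2) by auto
    have "j t1 = j t2" using eqv_j[OF t1(2,3)] eqv_j[OF t2(2,3)] t by simp
    then obtain k :: int where "t1 = t2 + of_int k" using Y0(2) t1(1) t2(1) by blast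
    hence "t1 = moebius (mat2 1 k 0 1) t2" by (simp add: moebius_def)
    hence "eqv t2 t1" unfolding eqv_def by (intro bexI[of _ "mat2 1 k 0 1"]) (auto simp: Gamma0_iff det_2)
    hence "eqv \<tau>2 \<tau>1" using eqv_trans[OF t(2) eqv_sym[OF t2(2,3)]] eqv_trans[OF t2(2)] t1(3) by blast
    thus False using eqv_sym[OF t(2)] t(5) by blast
  qed
qed

theorem j_injective:
  assumes "Im \<tau>1 > 0" "Im \<tau>2 > 0" "j \<tau>1 = j \<tau>2"
  shows "\<exists>\<gamma>\<in>Gamma0 N. \<tau>2 = moebius \<gamma> \<tau>1"
proof -
  have "double_values = {}"
  proof (rule ccontr)
    assume ne: "double_values \<noteq> {}"
    define E where "E = cusp_values \<union> j ` {\<tau> \<in> upper_half_plane. deriv j \<tau> = 0}"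
    have cE: "countable E" unfolding E_def
      using finite_cusp_values countable_critical_values by (simp add: countable_finite)
    have "double_values \<union> E = UNIV"
      by (rule open_closed_countable[OF open_double_values ne cE])
         (use double_values_closed_off_critical in \<open>auto simp: E_def\<close>)
    moreover obtain R where R: "\<And>c. c \<in> double_values \<Longrightarrow> cmod c \<le> R" by (rule double_values_bounded) (rule that)
    ultimately have "ball (of_real (\<bar>R\<bar> + 2)) 1 \<subseteq> E"
    proof (intro subsetI)
      fix c :: complex assume UN: "double_values \<union> E = UNIV" and c: "c \<in> ball (of_real (\<bar>R\<bar> + 2)) 1"
      have "cmod (of_real (\<bar>R\<bar> + 2)) \<le> cmod c + cmod (of_real (\<bar>R\<bar> + 2) - c)"
        using norm_triangle_ineq[of c "of_real (\<bar>R\<bar> + 2) - c"] by simp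
      moreover have "cmod (of_real (\<bar>R\<bar> + 2) - c) < 1" using c by (simp add: dist_norm)
      moreover have "cmod (of_real (\<bar>R\<bar> + 2)) = \<bar>R\<bar> + 2" by (subst norm_of_real) simp
      ultimately have "cmod c > R" by linarith
      thus "c \<in> E" using R[of c] UN by force
    qed
    thus False using cE countable_subset uncountable_ball[of 1] by (metis zero_less_one)
  qed
  hence "eqv \<tau>1 \<tau>2" using assms by (auto simp: double_values_def)
  thus ?thesis by (auto simp: eqv_def)
qed

lemma cusp_value_nearby:
  fixes \<sigma> :: "int^2^2"
  assumes "\<sigma> \<in> SL2Z" "\<sigma> \<notin> Gamma0 N"
  obtains \<delta> where "\<delta> > 0" "\<And>c. c \<noteq> cusp_value \<sigma> \<Longrightarrow> dist c (cusp_value \<sigma>) < \<delta> \<Longrightarrow> \<exists>\<tau>. Im \<tau> > Y \<and> j (moebius \<sigma> \<tau>) = c"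
proof -
  show ?thesis using cusp_value_asymptotics(3)[OF assms, of Y] that by metis
qed

text \<open>
  If the value of \<open>j\<close> at a cusp were also taken at \<open>\<tau>\<close>, then by the open mapping theorem on both sides some nearby
  value would be taken near \<open>\<tau>\<close> and also at a point \<open>\<sigma> t'\<close> with \<open>t'\<close> arbitrarily far up. By injectivity these points
  are equivalent, which contradicts the bound on imaginary parts in an orbit.
\<close>

lemma cusp_value_not_attained:
  fixes \<sigma> :: "int^2^2"
  assumes "\<sigma> \<in> SL2Z" "\<sigma> \<notin> Gamma0 N" "Im \<tau> > 0"
  shows "cusp_value \<sigma> \<noteq> j \<tau>"
proof
  assume eq: "cusp_value \<sigma> = j \<tau>"
  define r where "r = Im \<tau> / 2"
  have r0: "r > 0" using assms by (simp add: r_def)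
  have ballr: "r < Im t \<and> Im t < 3 * r" if "t \<in> ball \<tau> r" for t
  proof -
    have "cmod (\<tau> - t) < r" using that by (simp add: dist_norm)
    hence "\<bar>Im (\<tau> - t)\<bar> < r" using abs_Im_le_cmod le_less_trans by blast
    hence "\<bar>Im \<tau> - Im t\<bar> < r" by simp
    thus ?thesis unfolding r_def by linarith
  qed
  have "open (j ` ball \<tau> r)" using ballr r0 by (intro open_j_image) (auto, meson less_trans)
  moreover have "cusp_value \<sigma> \<in> j ` ball \<tau> r" using eq r0 by (intro image_eqI[of _ _ \<tau>]) auto
  ultimately obtain d where d: "d > 0" "ball (cusp_value \<sigma>) d \<subseteq> j ` ball \<tau> r" using open_contains_ball by metis
  define Y where "Y = max (3 * r) (1 / r)"
  obtain \<delta> where \<delta>: "\<delta> > 0" "\<And>c. c \<noteq> cusp_value \<sigma> \<Longrightarrow> dist c (cusp_value \<sigma>) < \<delta> \<Longrightarrow> \<exists>\<tau>. Im \<tau> > Y \<and> j (moebius \<sigma> \<tau>) = c"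
    by (rule cusp_value_nearby[OF assms(1,2)]) (rule that)
  define c where "c = cusp_value \<sigma> + of_real (min d \<delta> / 2)"
  have c: "c \<noteq> cusp_value \<sigma>" "dist c (cusp_value \<sigma>) = min d \<delta> / 2" using d(1) \<delta>(1) by (auto simp: c_def dist_norm)
  have "dist c (cusp_value \<sigma>) < d" using c(2) d(1) \<delta>(1) by linarith
  hence "c \<in> ball (cusp_value \<sigma>) d" by (simp add: dist_commute)
  then obtain t where t: "t \<in> ball \<tau> r" "j t = c" using d(2) by blast
  have "dist c (cusp_value \<sigma>) < \<delta>" using c(2) d(1) \<delta>(1) by linarith
  then obtain t' where t': "Im t' > Y" "j (moebius \<sigma> t') = c" using \<delta>(2) c(1) by blast
  have Y0: "Y > 0" using r0 by (simp add: Y_def)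
  have im: "Im t > 0" "Im t' > 0" "Im (moebius \<sigma> t') > 0"
    using ballr[OF t(1)] r0 t'(1) Y0 assms(1) by (auto simp: SL2Z_iff intro!: Im_moebius_pos)
  obtain \<gamma> where g: "\<gamma> \<in> Gamma0 N" "moebius \<sigma> t' = moebius \<gamma> t" using j_injective[OF im(1,3)] t(2) t'(2) by auto
  define A where "A = adj \<sigma> ** \<gamma>"
  have A: "A \<in> SL2Z" using assms(1) g(1) Gamma0_SL2Z by (auto simp: A_def)
  have "moebius A t = moebius (adj \<sigma>) (moebius \<sigma> t')"
    unfolding A_def g(2) using im g(1) by (simp add: moebius_compose Gamma0_iff)
  also have "\<dots> = t'" using moebius_adj[OF im(2), of \<sigma>] assms(1) by (simp add: SL2Z_iff)
  finally have At: "moebius A t = t'" .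
  have "Im t' \<le> Y"
  proof (cases "A$2$1 = 0")
    case True
    have "Im t' = Im t" using SL2Z_upper(1)[OF A True, of t] At by simp
    thus ?thesis using ballr[OF t(1)] by (simp add: Y_def le_max_iff_disj)
  next
    case False
    have "Im t' * Im t \<le> 1" using Im_moebius_mult_le[OF A False im(1)] At by simp
    moreover have "Im t' * r \<le> Im t' * Im t" using ballr[OF t(1)] im by (intro mult_left_mono) auto
    ultimately have "Im t' \<le> 1 / r" using r0 by (simp add: field_simps)
    thus ?thesis by (simp add: Y_def)
  qed
  thus False using t'(1) by simp
qed

text \<open>
  A common value of two cusps yields, as in \<open>cusp_value_not_attained\<close>, equivalent points \<open>\<sigma> t\<close> and \<open>\<sigma>' t'\<close> with \<open>t\<close> and
  \<open>t'\<close> both of height above \<open>1\<close>. The matrix relating \<open>t\<close> and \<open>t'\<close> must then fix infinity.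
\<close>

lemma cusp_value_injective:
  fixes \<sigma> \<sigma>' :: "int^2^2"
  assumes "\<sigma> \<in> SL2Z" "\<sigma> \<notin> Gamma0 N" "\<sigma>' \<in> SL2Z" "\<sigma>' \<notin> Gamma0 N" "cusp_value \<sigma> = cusp_value \<sigma>'"
  shows "\<exists>\<gamma>\<in>Gamma0 N. (adj \<sigma>' ** \<gamma> ** \<sigma>)$2$1 = 0"
proof -
  obtain d where d: "d > 0" "\<And>c. c \<noteq> cusp_value \<sigma> \<Longrightarrow> dist c (cusp_value \<sigma>) < d \<Longrightarrow> \<exists>\<tau>. Im \<tau> > 1 \<and> j (moebius \<sigma> \<tau>) = c"
    by (rule cusp_value_nearby[OF assms(1,2)]) (rule that)
  obtain \<delta> where \<delta>: "\<delta> > 0" "\<And>c. c \<noteq> cusp_value \<sigma> \<Longrightarrow> dist c (cusp_value \<sigma>) < \<delta> \<Longrightarrow> \<exists>\<tau>. Im \<tau> > 1 \<and> j (moebius \<sigma>' \<tau>) = c"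
    by (rule cusp_value_nearby[OF assms(3,4), folded assms(5)]) (rule that)
  define c where "c = cusp_value \<sigma> + of_real (min d \<delta> / 2)"
  have c: "c \<noteq> cusp_value \<sigma>" "dist c (cusp_value \<sigma>) = min d \<delta> / 2" using d(1) \<delta>(1) by (auto simp: c_def dist_norm)
  have "dist c (cusp_value \<sigma>) < d" "dist c (cusp_value \<sigma>) < \<delta>" using c(2) d(1) \<delta>(1) by linarith+
  then obtain t t' where t: "Im t > 1" "j (moebius \<sigma> t) = c" "Im t' > 1" "j (moebius \<sigma>' t') = c"
    using d(2) \<delta>(2) c(1) by blast
  have im: "Im (moebius \<sigma> t) > 0" "Im (moebius \<sigma>' t') > 0" using t assms by (auto simp: SL2Z_iff intro!: Im_moebius_pos)
  obtain \<gamma> where g: "\<gamma> \<in> Gamma0 N" "moebius \<sigma>' t' = moebius \<gamma> (moebius \<sigma> t)" using j_injective[OF im] t by auto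
  define A where "A = adj \<sigma>' ** \<gamma> ** \<sigma>"
  have A: "A \<in> SL2Z" using assms g(1) Gamma0_SL2Z by (auto simp: A_def)
  have "moebius A t = moebius (adj \<sigma>' ** \<gamma>) (moebius \<sigma> t)"
    unfolding A_def using t assms by (simp add: moebius_compose SL2Z_iff)
  also have "\<dots> = moebius (adj \<sigma>') (moebius \<sigma>' t')"
    unfolding g(2) using im g(1) by (simp add: moebius_compose[of "moebius \<sigma> t"] Gamma0_iff)
  also have "\<dots> = t'" using moebius_adj[of t' \<sigma>'] t assms by (simp add: SL2Z_iff)
  finally have At: "moebius A t = t'" .
  have "A$2$1 = 0"
  proof (rule ccontr)
    assume "A$2$1 \<noteq> 0"
    hence "Im t' * Im t \<le> 1" using Im_moebius_mult_le[OF A, of t] At t by simp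
    moreover have "1 * 1 < Im t' * Im t" using t by (intro mult_strict_mono) auto
    ultimately show False by simp
  qed
  thus ?thesis using g(1) unfolding A_def by blast
qed

end

section \<open>Local behaviour at points fixed by matrices of determinant n\<close>

text \<open>
  The derivative of \<open>B\<close> at a fixed point \<open>\<tau>\<close> is \<open>det B / (c \<tau> + d)\<^sup>2\<close>. If \<open>A\<close> and \<open>\<gamma>\<close> have the same derivative, the
  automorphy factor of \<open>B = \<gamma>\<^sup>-\<^sup>1 A\<close> at \<open>\<tau>\<close> has square \<open>n\<close>. It is therefore real, so \<open>B\<close> has lower left entry \<open>0\<close> and
  its integral lower right entry is a square root of \<open>n\<close>.
\<close>

lemma fixing_derivative_square:
  assumes "Im \<tau> > 0" "n > 0" "det A = int n" "moebius A \<tau> = \<tau>" "det \<gamma> = 1" "moebius \<gamma> \<tau> = \<tau>"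
    and "of_nat n / (den A \<tau>)\<^sup>2 = 1 / (den \<gamma> \<tau>)\<^sup>2"
  shows "is_square n"
proof -
  define B where "B = adj \<gamma> ** A"
  have nz: "den A \<tau> \<noteq> 0" "den \<gamma> \<tau> \<noteq> 0"
    using den_nonzero[OF assms(1), of A] den_nonzero[OF assms(1), of \<gamma>] assms(2,3,5) by simp_all
  have dB: "det B = int n" using assms by (simp add: B_def det_mul)
  have "moebius (adj \<gamma>) \<tau> = \<tau>" using moebius_adj[OF assms(1), of \<gamma>] assms by simp
  hence fB: "moebius B \<tau> = \<tau>" unfolding B_def using moebius_compose[OF assms(1), of A "adj \<gamma>"] assms by simp
  have "den (adj \<gamma> ** \<gamma>) \<tau> = den (adj \<gamma>) \<tau> * den \<gamma> \<tau>" using den_mult[OF nz(2), of "adj \<gamma>"] assms(6) by simp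
  hence "den (adj \<gamma>) \<tau> * den \<gamma> \<tau> = 1" using assms(5) by (simp add: den_def)
  hence 1: "den (adj \<gamma>) \<tau> = 1 / den \<gamma> \<tau>" using nz by (simp add: field_simps)
  have "den B \<tau> = den (adj \<gamma>) \<tau> * den A \<tau>" unfolding B_def using den_mult[OF nz(1), of "adj \<gamma>"] assms(4) by simp
  hence "(den B \<tau>)\<^sup>2 = (den A \<tau>)\<^sup>2 / (den \<gamma> \<tau>)\<^sup>2" unfolding 1 by (simp add: power_divide)
  also have "\<dots> = of_nat n" using assms(7) nz by (simp add: field_simps)
  finally have sq: "(den B \<tau>)\<^sup>2 = of_nat n" .
  have imre: "Im (den B \<tau>) = of_int (B$2$1) * Im \<tau>" "Re (den B \<tau>) = of_int (B$2$1) * Re \<tau> + of_int (B$2$2)"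
    by (simp_all add: den_def)
  have "Im ((den B \<tau>)\<^sup>2) = 0" "Re ((den B \<tau>)\<^sup>2) = real n" using sq by simp_all
  hence h: "Re (den B \<tau>) * Im (den B \<tau>) = 0" "(Re (den B \<tau>))\<^sup>2 - (Im (den B \<tau>))\<^sup>2 = real n"
    by (auto simp: power2_eq_square)
  have "Re (den B \<tau>) \<noteq> 0"
  proof
    assume "Re (den B \<tau>) = 0"
    hence "real n = - ((Im (den B \<tau>))\<^sup>2)" using h(2) by simp
    moreover have "(Im (den B \<tau>))\<^sup>2 \<ge> 0" by simp
    ultimately show False using assms(2) by linarith
  qed
  hence "Im (den B \<tau>) = 0" using h(1) by simp
  hence c0: "B$2$1 = 0" using imre(1) assms(1) by simp
  hence "(real_of_int (B$2$2))\<^sup>2 = real n" using h(2) imre by simp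
  hence "real_of_int ((B$2$2)\<^sup>2) = real_of_int (int n)" by simp
  hence "(B$2$2)\<^sup>2 = int n" by (simp only: of_int_eq_iff)
  hence "n = (nat \<bar>B$2$2\<bar>)\<^sup>2" by (metis nat_int nat_power_eq abs_ge_zero power2_abs)
  thus ?thesis by (auto simp: is_nth_power_def)
qed

text \<open>
  Write \<open>f - f \<xi>\<close> as \<open>(z - \<xi>)\<^sup>e\<close> times a function without zeros; the latter has a logarithm on a ball, hence an
  \<open>e\<close>-th root.
\<close>

lemma nonconstant_local_power:
  assumes "f holomorphic_on S" "open S" "connected S" "\<xi> \<in> S" "\<not> f constant_on S"
  obtains e r h where "e > 0" "r > 0" "ball \<xi> r \<subseteq> S" "h holomorphic_on ball \<xi> r" "h \<xi> = 0" "deriv h \<xi> \<noteq> 0"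
    "\<And>z. z \<in> ball \<xi> r \<Longrightarrow> f z - f \<xi> = h z ^ e"
proof -
  have hol: "(\<lambda>z. f z - f \<xi>) holomorphic_on S" using assms(1) by (intro holomorphic_intros)
  have nc: "\<not> (\<lambda>z. f z - f \<xi>) constant_on S"
    using assms(5) unfolding constant_on_def by (metis diff_add_cancel)
  obtain g r e where g: "0 < e" "0 < r" "ball \<xi> r \<subseteq> S" "g holomorphic_on ball \<xi> r"
    "\<And>w. w \<in> ball \<xi> r \<Longrightarrow> f w - f \<xi> = (w - \<xi>) ^ e * g w" "\<And>w. w \<in> ball \<xi> r \<Longrightarrow> g w \<noteq> 0"
    by (rule holomorphic_factor_zero_nonconstant[OF hol assms(2,3,4) _ nc]) (simp, rule that)
  have c: "\<xi> \<in> ball \<xi> r" using g(2) by simp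
  obtain l where l: "l holomorphic_on ball \<xi> r" "\<And>z. z \<in> ball \<xi> r \<Longrightarrow> exp (l z) = g z"
    by (rule holomorphic_logarithm_exists[OF convex_ball open_ball g(4) g(6) c]) (assumption, rule that)
  define h where "h = (\<lambda>z. (z - \<xi>) * exp (l z / of_nat e))"
  have hh: "h holomorphic_on ball \<xi> r" unfolding h_def using l(1) g(1) by (intro holomorphic_intros) auto
  have hd: "((\<lambda>z. exp (l z / of_nat e)) has_field_derivative deriv (\<lambda>z. exp (l z / of_nat e)) \<xi>) (at \<xi>)"
    by (rule holomorphic_derivI[of _ "ball \<xi> r"]) (use g(1,2) l(1) in \<open>auto intro!: holomorphic_intros\<close>)
  have "(h has_field_derivative exp (l \<xi> / of_nat e)) (at \<xi>)"
    unfolding h_def by (rule derivative_eq_intros hd refl | simp)+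
  hence "deriv h \<xi> \<noteq> 0" by (simp add: DERIV_imp_deriv)
  moreover have "f z - f \<xi> = h z ^ e" if "z \<in> ball \<xi> r" for z
    using g(5)[OF that] l(2)[OF that] g(1)
    by (simp add: h_def power_mult_distrib exp_of_nat_mult[symmetric])
  ultimately show ?thesis using that[OF g(1,2,3) hh] by (simp add: h_def)
qed

lemma ratio_tendsto_deriv:
  assumes "(h has_field_derivative c) (at \<xi>)" "h \<xi> = 0" "c \<noteq> 0" "(m has_field_derivative d) (at \<xi>)" "m \<xi> = \<xi>"
  shows "((\<lambda>z. h (m z) / h z) \<longlongrightarrow> d) (at \<xi>)"
proof -
  have "((\<lambda>z. h (m z)) has_field_derivative c * d) (at \<xi>)"
    using DERIV_chain2[of h c m \<xi> d UNIV] assms by simp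
  hence "((\<lambda>z. h (m z) / (z - \<xi>)) \<longlongrightarrow> c * d) (at \<xi>)" using assms(2,5) by (simp add: has_field_derivative_iff)
  moreover have "((\<lambda>z. h z / (z - \<xi>)) \<longlongrightarrow> c) (at \<xi>)" using assms(1,2) by (simp add: has_field_derivative_iff)
  ultimately have "((\<lambda>z. (h (m z) / (z - \<xi>)) / (h z / (z - \<xi>))) \<longlongrightarrow> c * d / c) (at \<xi>)"
    using assms(3) by (intro tendsto_divide)
  hence lim: "((\<lambda>z. (h (m z) / (z - \<xi>)) / (h z / (z - \<xi>))) \<longlongrightarrow> d) (at \<xi>)" using assms(3) by simp
  have "eventually (\<lambda>z. (h (m z) / (z - \<xi>)) / (h z / (z - \<xi>)) = h (m z) / h z) (at \<xi>)"
    by (auto simp: eventually_at_filter)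
  with lim show ?thesis by (rule Lim_transform_eventually)
qed

context hauptmodul
begin

text \<open>
  Write \<open>j - j(\<tau>0) = h\<^sup>e\<close> with a local coordinate \<open>h\<close>, and let \<open>\<rho>\<close> be the derivative of \<open>A\<close> at \<open>\<tau>0\<close>. The quotient in
  question equals \<open>1 - (h(A \<tau>) / h(\<tau>))\<^sup>e\<close>, which tends to \<open>1 - \<rho>\<^sup>e\<close>; the point is that \<open>\<rho>\<^sup>e \<noteq> 1\<close>. Suppose \<open>\<rho>\<^sup>e = 1\<close>.
  For \<open>z\<close> near \<open>\<tau>0\<close> let \<open>z'\<close> be the point with \<open>h(z') = \<rho> h(z)\<close>. Then \<open>j(z') = j(z)\<close>, so \<open>z' = \<gamma> z\<close> for an element
  \<open>\<gamma>\<close> of the finite stabilizer of \<open>\<tau>0\<close>, and for some \<open>\<gamma>\<close> this happens for \<open>z\<close> arbitrarily close to \<open>\<tau>0\<close>. That \<open>\<gamma>\<close> has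
  the derivative \<open>\<rho>\<close> at \<open>\<tau>0\<close>, so \<open>n\<close> is a square by \<open>fixing_derivative_square\<close>.
\<close>

lemma tendsto_fixing_factor:
  assumes \<tau>: "Im \<tau>0 > 0" and n: "n > 0" "\<not> is_square n" and A: "det A = int n" "moebius A \<tau>0 = \<tau>0"
  shows "\<exists>E. E \<noteq> 0 \<and> ((\<lambda>\<tau>. (j \<tau> - j (moebius A \<tau>)) / (j \<tau> - j \<tau>0)) \<longlongrightarrow> E) (at \<tau>0)"
proof -
  have t0: "\<tau>0 \<in> upper_half_plane" using \<tau> by simp
  have nc: "\<not> j constant_on upper_half_plane" using j_nonconstant[OF open_upper_half_plane] t0 by blast
  obtain e r h where h: "e > 0" "r > 0" "ball \<tau>0 r \<subseteq> upper_half_plane" "h holomorphic_on ball \<tau>0 r" "h \<tau>0 = 0" "deriv h \<tau>0 \<noteq> 0"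
    "\<And>z. z \<in> ball \<tau>0 r \<Longrightarrow> j z - j \<tau>0 = h z ^ e"
    by (rule nonconstant_local_power[OF holomorphic_j open_upper_half_plane connected_upper_half_plane t0 nc]) (rule that)
  have cent: "\<tau>0 \<in> ball \<tau>0 r" using h(2) by simp
  have hder: "(h has_field_derivative deriv h \<tau>0) (at \<tau>0)" by (rule holomorphic_derivI[OF h(4) open_ball cent])
  define \<mu> where "\<mu> = (\<lambda>B. of_int (det B) / (den B \<tau>0)\<^sup>2 :: complex)"
  have mder: "(moebius B has_field_derivative \<mu> B) (at \<tau>0)" if "det B \<noteq> 0" for B
    unfolding \<mu>_def using den_nonzero[OF \<tau> that] by (rule has_field_derivative_moebius)
  have ratio: "((\<lambda>z. h (moebius B z) / h z) \<longlongrightarrow> \<mu> B) (at \<tau>0)" if "det B \<noteq> 0" "moebius B \<tau>0 = \<tau>0" for B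
    by (rule ratio_tendsto_deriv[OF hder h(5,6) mder[OF that(1)] that(2)])
  have inball: "eventually (\<lambda>z. moebius B z \<in> ball \<tau>0 s) (at \<tau>0)" if "det B \<noteq> 0" "moebius B \<tau>0 = \<tau>0" "s > 0" for B s
  proof -
    have "isCont (moebius B) \<tau>0" using mder[OF that(1)] by (rule DERIV_isCont)
    hence "(moebius B \<longlongrightarrow> \<tau>0) (at \<tau>0)" using that(2) by (simp add: isCont_def)
    from tendstoD[OF this that(3)] show ?thesis by (simp add: dist_commute)
  qed
  have hnz: "eventually (\<lambda>z. h z \<noteq> 0) (at \<tau>0)"
  proof -
    obtain s where s: "s > 0" "ball \<tau>0 s \<subseteq> ball \<tau>0 r" "inj_on h (ball \<tau>0 s)"
      by (rule has_complex_derivative_locally_injective[OF h(4) cent open_ball h(6)]) (rule that)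
    have "eventually (\<lambda>z. z \<in> ball \<tau>0 s - {\<tau>0}) (at \<tau>0)" using s(1) by (intro eventually_at_in_open) auto
    thus ?thesis
    proof eventually_elim
      case (elim z)
      have "z \<in> ball \<tau>0 s" "\<tau>0 \<in> ball \<tau>0 s" "z \<noteq> \<tau>0" using elim s(1) by auto
      thus ?case using inj_onD[OF s(3), of z \<tau>0] h(5) by metis
    qed
  qed
  have dA: "det A \<noteq> 0" using A(1) n(1) by simp
  define \<rho> where "\<rho> = \<mu> A"
  have le1: "\<rho> ^ e \<noteq> 1"
  proof
    assume le: "\<rho> ^ e = 1"
    have l1: "cmod \<rho> = 1" using power_eq_1_iff[OF le] h(1) by simp
    define St where "St = {\<gamma> \<in> Gamma0 N. moebius \<gamma> \<tau>0 = \<tau>0}"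
    have finSt: "finite St" unfolding St_def by (rule card_stabilizer(1)[OF \<tau>])
    (* No element of the stabilizer has the derivative rho, so none of them acts on h as multiplication by rho. *)
    have ne: "eventually (\<lambda>z. h (moebius \<gamma> z) / h z \<noteq> \<rho>) (at \<tau>0)" if g: "\<gamma> \<in> St" for \<gamma>
    proof -
      have dg: "det \<gamma> = 1" "moebius \<gamma> \<tau>0 = \<tau>0" using g by (auto simp: St_def Gamma0_iff)
      have "\<mu> \<gamma> \<noteq> \<rho>"
      proof
        assume "\<mu> \<gamma> = \<rho>"
        hence "of_nat n / (den A \<tau>0)\<^sup>2 = 1 / (den \<gamma> \<tau>0)\<^sup>2" using A(1) dg(1) by (simp add: \<mu>_def \<rho>_def)
        thus False using fixing_derivative_square[OF \<tau> n(1) A dg] n(2) by blast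
      qed
      thus ?thesis using ratio[of \<gamma>] dg by (intro tendsto_imp_eventually_ne) auto
    qed
    have all: "eventually (\<lambda>z. \<forall>\<gamma>\<in>St. h (moebius \<gamma> z) / h z \<noteq> \<rho>) (at \<tau>0)"
      using finSt ne by (intro eventually_ball_finite) auto
    obtain \<epsilon> where e: "\<epsilon> > 0" "ball \<tau>0 \<epsilon> \<subseteq> upper_half_plane"
      "\<And>B t. B \<in> SL2Z \<Longrightarrow> t \<in> ball \<tau>0 \<epsilon> \<Longrightarrow> moebius B t \<in> ball \<tau>0 \<epsilon> \<Longrightarrow> moebius B \<tau>0 = \<tau>0"
      by (rule proper_discontinuity[OF \<tau> \<tau>]) (rule that)
    define s where "s = min \<epsilon> r"
    have s0: "s > 0" "ball \<tau>0 s \<subseteq> ball \<tau>0 r" "ball \<tau>0 s \<subseteq> ball \<tau>0 \<epsilon>" using e(1) h(2) by (auto simp: s_def)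
    have "\<not> h constant_on ball \<tau>0 r"
    proof
      assume "h constant_on ball \<tau>0 r"
      then obtain k where k: "\<And>z. z \<in> ball \<tau>0 r \<Longrightarrow> h z = k" unfolding constant_on_def by blast
      have "eventually (\<lambda>z. h z = k) (nhds \<tau>0)"
        using eventually_nhds_in_open[OF open_ball cent] by (rule eventually_mono) (rule k)
      hence "deriv h \<tau>0 = deriv (\<lambda>_. k) \<tau>0" by (intro deriv_cong_ev) auto
      thus False using h(6) by simp
    qed
    hence "open (h ` ball \<tau>0 s)" using h(4) s0 by (intro open_mapping_thm[of h "ball \<tau>0 r"]) auto
    moreover have "0 \<in> h ` ball \<tau>0 s" using s0(1) h(5) by (intro image_eqI[of _ _ \<tau>0]) auto
    ultimately obtain d where d: "d > 0" "ball 0 d \<subseteq> h ` ball \<tau>0 s" using open_contains_ball by metis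
    have "isCont h \<tau>0" using hder by (rule DERIV_isCont)
    hence "(h \<longlongrightarrow> 0) (at \<tau>0)" using h(5) by (simp add: isCont_def)
    hence "eventually (\<lambda>z. dist (h z) 0 < d) (at \<tau>0)" using d(1) by (rule tendstoD)
    moreover have "eventually (\<lambda>z. z \<in> ball \<tau>0 s - {\<tau>0}) (at \<tau>0)" using s0(1) by (intro eventually_at_in_open) auto
    ultimately have "eventually (\<lambda>z. False) (at \<tau>0)" using all hnz
    proof eventually_elim
      case (elim z)
      have "\<rho> * h z \<in> ball 0 d" using elim(1) l1 by (simp add: norm_mult)
      then obtain z' where z': "z' \<in> ball \<tau>0 s" "h z' = \<rho> * h z" using d(2) by (metis imageE subsetD)
      have zr: "z \<in> ball \<tau>0 r" "z' \<in> ball \<tau>0 r" "z \<in> ball \<tau>0 \<epsilon>" "z' \<in> ball \<tau>0 \<epsilon>" using elim(2) z'(1) s0 by auto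
      have im: "Im z > 0" "Im z' > 0" using subsetD[OF e(2) zr(3)] subsetD[OF e(2) zr(4)] by simp_all
      have "j z' - j \<tau>0 = j z - j \<tau>0" using h(7)[OF zr(1)] h(7)[OF zr(2)] z'(2) le by (simp add: power_mult_distrib)
      then obtain \<gamma> where g: "\<gamma> \<in> Gamma0 N" "z' = moebius \<gamma> z" using j_injective[OF im] by auto
      hence "moebius \<gamma> \<tau>0 = \<tau>0" using e(3)[of \<gamma> z] zr Gamma0_SL2Z by blast
      hence "\<gamma> \<in> St" using g(1) by (simp add: St_def)
      hence "h (moebius \<gamma> z) / h z \<noteq> \<rho>" using elim(3) by blast
      thus False using z'(2) g(2) elim(4) by simp
    qed
    thus False by simp
  qed
  have lim: "((\<lambda>z. 1 - (h (moebius A z) / h z) ^ e) \<longlongrightarrow> 1 - \<rho> ^ e) (at \<tau>0)"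
    unfolding \<rho>_def by (intro tendsto_intros ratio dA A(2))
  have "eventually (\<lambda>z. z \<in> ball \<tau>0 r - {\<tau>0}) (at \<tau>0)" using h(2) by (intro eventually_at_in_open) auto
  hence "eventually (\<lambda>z. 1 - (h (moebius A z) / h z) ^ e = (j z - j (moebius A z)) / (j z - j \<tau>0)) (at \<tau>0)"
    using inball[OF dA A(2) h(2)] hnz
  proof eventually_elim
    case (elim z)
    have "j z - j \<tau>0 = h z ^ e" "j (moebius A z) - j \<tau>0 = h (moebius A z) ^ e" using h(7) elim by auto
    hence "(j z - j (moebius A z)) / (j z - j \<tau>0) = (h z ^ e - h (moebius A z) ^ e) / h z ^ e" by (simp add: algebra_simps)
    thus ?case using elim(3) by (simp add: diff_divide_distrib power_divide)
  qed
  from tendsto_cong[OF this] lim le1 show ?thesis by (intro exI[of _ "1 - \<rho> ^ e"]) auto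
qed

end

section \<open>The Hecke product\<close>

locale hecke = hauptmodul +
  fixes n :: nat
  assumes n_pos: "n > 0" and coprime_n_N: "coprime n N" and n_nonsquare: "\<not> is_square n"
begin

text \<open>
  The choice of the representative does not matter, by \<open>j_coset_eq\<close>.
\<close>

definition j_coset :: "(int^2^2) set \<Rightarrow> complex \<Rightarrow> complex" where
  "j_coset X \<tau> = j (moebius (SOME A. A \<in> X) \<tau>)"

definition hecke_prod :: "complex \<Rightarrow> complex" where
  "hecke_prod \<tau> = (\<Prod>X\<in>hcosets N n. j \<tau> - j_coset X \<tau>)"

lemma Hecke_Im: "A \<in> Hecke N n \<Longrightarrow> Im \<tau> > 0 \<Longrightarrow> Im (moebius A \<tau>) > 0"
  using n_pos by (intro Im_moebius_pos) (auto simp: Hecke_iff)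

lemma j_coset_eq:
  assumes "X \<in> hcosets N n" "A \<in> X" "Im \<tau> > 0"
  shows "j_coset X \<tau> = j (moebius A \<tau>)"
proof -
  define A0 where "A0 = (SOME A. A \<in> X)"
  have A0: "A0 \<in> X" unfolding A0_def using assms(2) by (rule someI)
  have H: "A \<in> Hecke N n" "A0 \<in> Hecke N n" using hcosets_mem(1)[OF assms(1)] assms(2) A0 by auto
  have "A0 \<in> coset N A" using hcosets_mem(2)[OF assms(1,2)] A0 by simp
  then obtain \<gamma> where g: "\<gamma> \<in> Gamma0 N" "A0 = \<gamma> ** A" by (auto simp: coset_def)
  have "moebius A0 \<tau> = moebius \<gamma> (moebius A \<tau>)"
    using g(2) assms(3) H(1) n_pos by (simp add: moebius_compose Hecke_iff)
  thus ?thesis using j_invariant[OF g(1) Hecke_Im[OF H(1) assms(3)]] by (simp add: j_coset_def A0_def)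
qed

lemma finite_cosets: "finite (hcosets N n)"
  by (rule finite_hcosets[OF N_pos n_pos coprime_n_N])

lemma holomorphic_j_coset: "X \<in> hcosets N n \<Longrightarrow> j_coset X holomorphic_on upper_half_plane"
proof -
  assume X: "X \<in> hcosets N n"
  obtain A where A: "A \<in> X" using hcosets_nonempty[OF X] by blast
  have H: "A \<in> Hecke N n" using hcosets_mem(1)[OF X A] .
  have "(\<lambda>\<tau>. j (moebius A \<tau>)) holomorphic_on upper_half_plane"
    using H Hecke_Im n_pos
    by (intro holomorphic_on_compose_gen[OF holomorphic_moebius holomorphic_j, unfolded o_def]) (auto simp: Hecke_iff)
  thus ?thesis by (rule holomorphic_transform) (use j_coset_eq[OF X A] in auto)
qed

lemma holomorphic_hecke_prod: "hecke_prod holomorphic_on upper_half_plane"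
  unfolding hecke_prod_def by (intro holomorphic_intros holomorphic_j holomorphic_j_coset)

lemma hecke_prod_invariant:
  assumes "\<gamma> \<in> Gamma0 N" "Im \<tau> > 0"
  shows "hecke_prod (moebius \<gamma> \<tau>) = hecke_prod \<tau>"
proof -
  have dg: "det \<gamma> = 1" using assms(1) by (simp add: Gamma0_iff)
  have im: "Im (moebius \<gamma> \<tau>) > 0" using assms dg by (intro Im_moebius_pos) auto
  have "hecke_prod \<tau> = (\<Prod>X\<in>hcosets N n. j \<tau> - j_coset ((\<lambda>A. A ** \<gamma>) ` X) \<tau>)"
    unfolding hecke_prod_def by (rule prod.reindex_bij_betw[OF hcosets_right_mult[OF assms(1)], symmetric])
  also have "\<dots> = (\<Prod>X\<in>hcosets N n. j (moebius \<gamma> \<tau>) - j_coset X (moebius \<gamma> \<tau>))"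
  proof (rule prod.cong[OF refl])
    fix X assume X: "X \<in> hcosets N n"
    obtain A where A: "A \<in> X" using hcosets_nonempty[OF X] by blast
    have X': "(\<lambda>A. A ** \<gamma>) ` X \<in> hcosets N n" using bij_betwE[OF hcosets_right_mult[OF assms(1)]] X by blast
    have "j_coset ((\<lambda>A. A ** \<gamma>) ` X) \<tau> = j (moebius (A ** \<gamma>) \<tau>)" by (rule j_coset_eq[OF X' _ assms(2)]) (use A in blast)
    also have "\<dots> = j_coset X (moebius \<gamma> \<tau>)" using j_coset_eq[OF X A im] assms(2) dg by (simp add: moebius_compose)
    finally show "j \<tau> - j_coset ((\<lambda>A. A ** \<gamma>) ` X) \<tau> = j (moebius \<gamma> \<tau>) - j_coset X (moebius \<gamma> \<tau>)"
      using j_invariant[OF assms] by simp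
  qed
  finally show ?thesis by (simp add: hecke_prod_def)
qed

text \<open>
  The factor of a coset tends to a nonzero limit unless \<open>j(A \<tau>0) = j(\<tau>0)\<close>. In that case injectivity of \<open>j\<close> provides
  a representative that fixes \<open>\<tau>0\<close>, and the factor is comparable to \<open>j - j(\<tau>0)\<close> by \<open>tendsto_fixing_factor\<close>.
\<close>

lemma hecke_prod_at_point:
  assumes "Im \<tau>0 > 0"
  defines "k \<equiv> card {X \<in> hcosets N n. \<exists>A\<in>X. moebius A \<tau>0 = \<tau>0}"
  shows "\<exists>E. E \<noteq> 0 \<and> ((\<lambda>\<tau>. hecke_prod \<tau> / (j \<tau> - j \<tau>0) ^ k) \<longlongrightarrow> E) (at \<tau>0)"
proof -
  define Fx where "Fx = {X \<in> hcosets N n. \<exists>A\<in>X. moebius A \<tau>0 = \<tau>0}"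
  have ev: "eventually (\<lambda>\<tau>. Im \<tau> > 0) (at \<tau>0)"
    using eventually_at_in_open'[OF open_upper_half_plane, of \<tau>0] assms(1) by simp
  have fac: "\<exists>E. E \<noteq> 0 \<and> ((\<lambda>\<tau>. (j \<tau> - j_coset X \<tau>) / (if X \<in> Fx then j \<tau> - j \<tau>0 else 1)) \<longlongrightarrow> E) (at \<tau>0)"
    if X: "X \<in> hcosets N n" for X
  proof (cases "X \<in> Fx")
    case True
    then obtain A where A: "A \<in> X" "moebius A \<tau>0 = \<tau>0" by (auto simp: Fx_def)
    have "det A = int n" using hcosets_mem(1)[OF X A(1)] by (simp add: Hecke_iff)
    then obtain E where E: "E \<noteq> 0" "((\<lambda>\<tau>. (j \<tau> - j (moebius A \<tau>)) / (j \<tau> - j \<tau>0)) \<longlongrightarrow> E) (at \<tau>0)"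
      using tendsto_fixing_factor[OF assms(1) n_pos n_nonsquare _ A(2)] by blast
    have "eventually (\<lambda>\<tau>. (j \<tau> - j (moebius A \<tau>)) / (j \<tau> - j \<tau>0) = (j \<tau> - j_coset X \<tau>) / (if X \<in> Fx then j \<tau> - j \<tau>0 else 1)) (at \<tau>0)"
      using ev by eventually_elim (use True j_coset_eq[OF X A(1)] in simp)
    from tendsto_cong[OF this] E show ?thesis by blast
  next
    case False
    obtain A where A: "A \<in> X" using hcosets_nonempty[OF X] by blast
    have H: "A \<in> Hecke N n" using hcosets_mem(1)[OF X A] .
    have "j_coset X holomorphic_on upper_half_plane" by (rule holomorphic_j_coset[OF X])
    hence "(\<lambda>\<tau>. j \<tau> - j_coset X \<tau>) holomorphic_on upper_half_plane" using holomorphic_j by (intro holomorphic_intros)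
    hence "isCont (\<lambda>\<tau>. j \<tau> - j_coset X \<tau>) \<tau>0"
      using holomorphic_on_imp_continuous_on continuous_on_eq_continuous_at[OF open_upper_half_plane] assms(1) by fastforce
    hence "((\<lambda>\<tau>. j \<tau> - j_coset X \<tau>) \<longlongrightarrow> j \<tau>0 - j_coset X \<tau>0) (at \<tau>0)" by (simp add: isCont_def)
    moreover have "j \<tau>0 - j_coset X \<tau>0 \<noteq> 0"
    proof
      assume "j \<tau>0 - j_coset X \<tau>0 = 0"
      hence "j (moebius A \<tau>0) = j \<tau>0" using j_coset_eq[OF X A assms(1)] by simp
      then obtain \<gamma> where g: "\<gamma> \<in> Gamma0 N" "\<tau>0 = moebius \<gamma> (moebius A \<tau>0)"
        using j_injective[OF Hecke_Im[OF H assms(1)] assms(1)] by blast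
      have "moebius (\<gamma> ** A) \<tau>0 = \<tau>0" using g(2) assms(1) H n_pos by (simp add: moebius_compose Hecke_iff)
      moreover have "\<gamma> ** A \<in> X" using hcosets_mem(2)[OF X A] g(1) by (auto simp: coset_def)
      ultimately show False using False X by (auto simp: Fx_def)
    qed
    ultimately show ?thesis using False by (intro exI[of _ "j \<tau>0 - j_coset X \<tau>0"]) simp
  qed
  then obtain E where E: "\<And>X. X \<in> hcosets N n \<Longrightarrow> E X \<noteq> 0"
    "\<And>X. X \<in> hcosets N n \<Longrightarrow> ((\<lambda>\<tau>. (j \<tau> - j_coset X \<tau>) / (if X \<in> Fx then j \<tau> - j \<tau>0 else 1)) \<longlongrightarrow> E X) (at \<tau>0)"
    by metis
  have "((\<lambda>\<tau>. \<Prod>X\<in>hcosets N n. (j \<tau> - j_coset X \<tau>) / (if X \<in> Fx then j \<tau> - j \<tau>0 else 1)) \<longlongrightarrow> (\<Prod>X\<in>hcosets N n. E X)) (at \<tau>0)"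
    using E(2) by (intro tendsto_prod) auto
  moreover have "(\<Prod>X\<in>hcosets N n. (j \<tau> - j_coset X \<tau>) / (if X \<in> Fx then j \<tau> - j \<tau>0 else 1)) = hecke_prod \<tau> / (j \<tau> - j \<tau>0) ^ k" for \<tau>
  proof -
    have "(\<Prod>X\<in>hcosets N n. if X \<in> Fx then j \<tau> - j \<tau>0 else 1) = (\<Prod>X\<in>hcosets N n \<inter> Fx. j \<tau> - j \<tau>0)"
      by (rule prod.inter_restrict[OF finite_cosets, symmetric])
    also have "hcosets N n \<inter> Fx = Fx" by (auto simp: Fx_def)
    finally show ?thesis by (simp add: prod_dividef hecke_prod_def k_def Fx_def)
  qed
  moreover have "(\<Prod>X\<in>hcosets N n. E X) \<noteq> 0" using E(1) finite_cosets by simp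
  ultimately show ?thesis by auto
qed

text \<open>
  A coset fixing the cusp is represented by the conjugate of a triangular matrix with diagonal \<open>(a, d)\<close>, so its factor
  is the difference of two functions with exponents \<open>\<kappa>\<close> and \<open>\<kappa> a / d\<close>. The other cosets map the cusp to one that is
  inequivalent both to it and to infinity, where \<open>j\<close> has another finite value; their factors tend to nonzero constants.
\<close>

lemma hecke_prod_at_cusp:
  fixes \<sigma> :: "int^2^2"
  assumes "\<sigma> \<in> SL2Z" "\<sigma> \<notin> Gamma0 N" "leading (\<lambda>\<tau>. j (moebius \<sigma> \<tau>) - cusp_value \<sigma>) \<kappa> \<alpha>"
  defines "b \<equiv> nat \<bar>\<sigma>$2$1\<bar>"
  shows "\<exists>C. leading (\<lambda>\<tau>. hecke_prod (moebius \<sigma> \<tau>))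
    (\<kappa> * real (\<Sum>d | d dvd n \<and> [n = d^2] (mod gcd b (N div gcd b N)). min d (n div d))) C"
proof -
  define D where "D = {d. d dvd n \<and> [n = d^2] (mod gcd b (N div gcd b N))}"
  define Fx where "Fx = {X \<in> hcosets N n. \<exists>A\<in>X. (adj \<sigma> ** A ** \<sigma>)$2$1 = 0}"
  have ds: "det \<sigma> = 1" using assms(1) by (simp add: SL2Z_iff)
  have fin: "finite D" unfolding D_def using n_pos by (intro finite_subset[OF _ finite_divisors_nat[OF n_pos]]) auto
  have ims: "Im (moebius \<sigma> \<tau>) > 0" if "Im \<tau> > 0" for \<tau> using that ds by (intro Im_moebius_pos) auto
  define h where "h = N div gcd b N div gcd b (N div gcd b N)"
  have "\<exists>\<beta> :: nat \<Rightarrow> int. bij_betw (\<lambda>(d,k). coset N (\<sigma> ** mat2 (int (n div d)) (\<beta> d + int h * int k) 0 (int d) ** adj \<sigma>))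
       (SIGMA d:D. {..<d}) Fx \<and>
     (\<forall>d k. d \<in> D \<longrightarrow> \<sigma> ** mat2 (int (n div d)) (\<beta> d + int h * int k) 0 (int d) ** adj \<sigma> \<in> Hecke N n)"
    unfolding D_def Fx_def h_def b_def
    by (rule cusp_cosets[OF N_pos n_pos coprime_n_N assms(1)], rule exI, rule conjI, assumption, intro allI impI)
  then obtain \<beta> where \<beta>': "bij_betw (\<lambda>(d,k). coset N (\<sigma> ** mat2 (int (n div d)) (\<beta> d + int h * int k) 0 (int d) ** adj \<sigma>))
       (SIGMA d:D. {..<d}) Fx"
     "\<forall>d k. d \<in> D \<longrightarrow> \<sigma> ** mat2 (int (n div d)) (\<beta> d + int h * int k) 0 (int d) ** adj \<sigma> \<in> Hecke N n"
    by (elim exE conjE)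
  note \<beta> = \<beta>'(2)[rule_format] \<beta>'(1)
  define B where "B = (\<lambda>d k. mat2 (int (n div d)) (\<beta> d + int h * int k) 0 (int d))"
  have on_Fx: "\<exists>C. leading (\<lambda>\<tau>. j (moebius \<sigma> \<tau>) - j_coset (coset N (\<sigma> ** B d k ** adj \<sigma>)) (moebius \<sigma> \<tau>))
      (\<kappa> * min 1 (real (n div d) / real d)) C" if d: "d \<in> D" for d k
  proof -
    have dn: "d dvd n" using d by (simp add: D_def)
    have d0: "d > 0" using dn by (rule dvd_pos_nat[OF n_pos])
    note dn = dn d0
    have a0: "n div d > 0" using dn n_pos by (metis dvd_mult_div_cancel gr0I mult_0_right less_irrefl)
    have Bp: "B d k$2$1 = 0" "B d k$1$1 > 0" "B d k$2$2 > 0" using dn a0 by (simp_all add: B_def)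
    have ne: "real (n div d) / real d \<noteq> 1"
    proof
      assume "real (n div d) / real d = 1"
      hence "n div d = d" using dn(2) by (simp add: field_simps)
      hence "n = d\<^sup>2" using dn(1) by (metis dvd_mult_div_cancel power2_eq_square)
      thus False using n_nonsquare by (auto simp: is_nth_power_def)
    qed
    have \<kappa>0: "\<kappa> \<noteq> 0"
    proof
      assume "\<kappa> = 0"
      hence "((\<lambda>\<tau>. j (moebius \<sigma> \<tau>) - cusp_value \<sigma>) \<longlongrightarrow> \<alpha>) at_i_infinity" "\<alpha> \<noteq> 0" using assms(3) by (auto simp: leading_def)
      moreover have "((\<lambda>\<tau>. j (moebius \<sigma> \<tau>) - cusp_value \<sigma>) \<longlongrightarrow> 0) at_i_infinity"
        using cusp_value_asymptotics(2)[OF assms(1,2)] by (simp add: LIM_zero)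
      ultimately show False using tendsto_unique[OF at_i_infinity_neq_bot] by blast
    qed
    have \<kappa>0': "\<kappa> > 0"
    proof -
      obtain \<kappa>' \<alpha>' where "\<kappa>' > 0" "leading (\<lambda>\<tau>. j (moebius \<sigma> \<tau>) - cusp_value \<sigma>) \<kappa>' \<alpha>'" using cusp_value_asymptotics(1)[OF assms(1,2)] by blast
      thus ?thesis using leading_unique(1)[OF assms(3)] by blast
    qed
    have L2: "leading (\<lambda>\<tau>. j (moebius \<sigma> (moebius (B d k) \<tau>)) - cusp_value \<sigma>) (\<kappa> * of_int (B d k$1$1) / of_int (B d k$2$2))
      (\<alpha> * qpow \<kappa> (of_int (B d k$1$2) / of_int (B d k$2$2)))"
      by (rule leading_moebius_upper[OF assms(3) Bp])
    have e: "\<kappa> * of_int (B d k$1$1) / of_int (B d k$2$2) = \<kappa> * (real (n div d) / real d)" by (simp add: B_def)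
    have "\<kappa> \<noteq> \<kappa> * (real (n div d) / real d)"
      unfolding mult_cancel_left1 using \<kappa>0 ne by blast
    then obtain C where C: "leading (\<lambda>\<tau>. (j (moebius \<sigma> \<tau>) - cusp_value \<sigma>) - (j (moebius \<sigma> (moebius (B d k) \<tau>)) - cusp_value \<sigma>)) (min \<kappa> (\<kappa> * (real (n div d) / real d))) C"
      using leading_diff[OF assms(3) L2[unfolded e]] by blast
    have m: "min \<kappa> (\<kappa> * (real (n div d) / real d)) = \<kappa> * min 1 (real (n div d) / real d)"
      using \<kappa>0' by (simp add: min_mult_distrib_left)
    have "eventually (\<lambda>\<tau>. (j (moebius \<sigma> \<tau>) - cusp_value \<sigma>) - (j (moebius \<sigma> (moebius (B d k) \<tau>)) - cusp_value \<sigma>)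
        = j (moebius \<sigma> \<tau>) - j_coset (coset N (\<sigma> ** B d k ** adj \<sigma>)) (moebius \<sigma> \<tau>)) at_i_infinity"
      using eventually_Im_gt[of 0]
    proof eventually_elim
      case (elim \<tau>)
      have "coset N (\<sigma> ** B d k ** adj \<sigma>) \<in> hcosets N n" using coset_in_hcosets \<beta>(1)[OF d] by (simp add: B_def)
      hence "j_coset (coset N (\<sigma> ** B d k ** adj \<sigma>)) (moebius \<sigma> \<tau>) = j (moebius (\<sigma> ** B d k ** adj \<sigma>) (moebius \<sigma> \<tau>))"
        by (rule j_coset_eq[OF _ coset_self ims[OF elim]])
      also have "moebius (\<sigma> ** B d k ** adj \<sigma>) (moebius \<sigma> \<tau>) = moebius (\<sigma> ** B d k) \<tau>"
        using elim ds by (simp add: moebius_compose)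
      also have "\<dots> = moebius \<sigma> (moebius (B d k) \<tau>)" using elim Bp by (intro moebius_compose[symmetric]) (auto simp: det_2)
      finally show ?case by simp
    qed
    from leading_cong[OF C[unfolded m] this] show ?thesis by blast
  qed
  have off_Fx: "\<exists>C. leading (\<lambda>\<tau>. j (moebius \<sigma> \<tau>) - j_coset X (moebius \<sigma> \<tau>)) 0 C" if X: "X \<in> hcosets N n" "X \<notin> Fx" for X
  proof -
    obtain A where A: "A \<in> X" using hcosets_nonempty[OF X(1)] by blast
    have H: "A \<in> Hecke N n" using hcosets_mem(1)[OF X(1) A] .
    have dA: "det (A ** \<sigma>) = int n" using H ds by (simp add: det_mul Hecke_iff)
    obtain \<sigma>' B' where sB: "\<sigma>' \<in> SL2Z" "A ** \<sigma> = \<sigma>' ** B'" "det B' = int n" "B'$2$1 = 0" "B'$1$1 > 0" "B'$2$2 > 0"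
      by (rule triangular_decomposition[OF dA n_pos]) (rule that)
    have ds': "det \<sigma>' = 1" using sB(1) by (simp add: SL2Z_iff)
    have s'G: "\<sigma>' \<notin> Gamma0 N"
    proof
      assume s': "\<sigma>' \<in> Gamma0 N"
      (* If A mapped the cusp to infinity, the adjugate of A would map infinity to it; but for n prime to N
         the adjugate maps infinity to an equivalent cusp. *)
      define C where "C = adj A ** \<sigma>'"
      have C: "C \<in> Hecke N n" unfolding C_def using H s' by simp
      have dC: "det C = int n" "int N dvd C$2$1" using C by (auto simp: Hecke_iff)
      obtain \<gamma> B'' where g: "C = \<gamma> ** B''" "B''$2$1 = 0" "\<gamma> \<in> Gamma0 N"
        by (rule triangular_decomposition[OF dC(1) n_pos, of N]) (use dC(2) coprime_n_N in blast)
      have "adj A ** (A ** \<sigma>) = \<gamma> ** B'' ** B'" unfolding sB(2) g(1)[symmetric] C_def by (simp add: matrix_mul_assoc)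
      hence "mat (int n) ** \<sigma> = \<gamma> ** B'' ** B'" using H by (simp add: matrix_mul_assoc mult_adj Hecke_iff)
      hence "adj \<gamma> ** (mat (int n) ** \<sigma>) = adj \<gamma> ** (\<gamma> ** (B'' ** B'))" by (simp add: matrix_mul_assoc)
      also have "\<dots> = B'' ** B'" using g(3) by (simp add: Gamma0_iff)
      finally have "(adj \<gamma> ** (mat (int n) ** \<sigma>))$2$1 = 0" using g(2) sB(4) by simp
      hence "int n * (- \<gamma>$2$1 * \<sigma>$1$1 + \<gamma>$1$1 * \<sigma>$2$1) = 0" by (simp add: algebra_simps)
      hence "(adj \<gamma> ** \<sigma>)$2$1 = 0" using n_pos by simp
      hence "adj \<gamma> ** \<sigma> \<in> Gamma0 N" using g(3) ds by (simp add: Gamma0_iff det_mul del: matrix2_mult_sel)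
      hence "\<gamma> ** (adj \<gamma> ** \<sigma>) \<in> Gamma0 N" by (rule Gamma0_closed(2)[OF g(3)])
      moreover have "det \<gamma> = 1" using g(3) by (simp add: Gamma0_iff)
      ultimately show False using assms(2) by (simp only: adj_cancel)
    qed
    have ne: "cusp_value \<sigma> \<noteq> cusp_value \<sigma>'"
    proof
      assume "cusp_value \<sigma> = cusp_value \<sigma>'"
      then obtain \<gamma> where g: "\<gamma> \<in> Gamma0 N" "(adj \<sigma>' ** \<gamma> ** \<sigma>)$2$1 = 0"
        using cusp_value_injective[OF assms(1,2) sB(1) s'G] by blast
      have dg: "det \<gamma> = 1" using g by (simp add: Gamma0_iff)
      define U where "U = adj \<sigma>' ** \<gamma> ** \<sigma>"
      have "adj U = adj \<sigma> ** adj \<gamma> ** \<sigma>'" by (simp add: U_def adj_mult matrix_mul_assoc)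
      have "adj \<sigma> ** (adj \<gamma> ** A) ** \<sigma> = adj \<sigma> ** adj \<gamma> ** (A ** \<sigma>)" by (simp add: matrix_mul_assoc)
      also have "\<dots> = adj U ** B'" unfolding sB(2) by (simp add: \<open>adj U = _\<close> matrix_mul_assoc)
      finally have "(adj \<sigma> ** (adj \<gamma> ** A) ** \<sigma>)$2$1 = (adj U ** B')$2$1" by simp
      also have "\<dots> = 0" using g(2)[folded U_def] sB(4) by simp
      finally have "(adj \<sigma> ** (adj \<gamma> ** A) ** \<sigma>)$2$1 = 0" .
      moreover have "adj \<gamma> ** A \<in> X"
        unfolding hcosets_mem(2)[OF X(1) A] by (rule coset_memI[OF Gamma0_closed(3)[OF g(1)]])
      ultimately show False using X unfolding Fx_def by blast
    qed
    have "((\<lambda>\<tau>. j (moebius \<sigma>' (moebius B' \<tau>))) \<longlongrightarrow> cusp_value \<sigma>') at_i_infinity"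
      using filterlim_compose[OF cusp_value_asymptotics(2)[OF sB(1) s'G] filterlim_moebius_upper[OF sB(4-6)]] .
    hence "((\<lambda>\<tau>. j (moebius \<sigma> \<tau>) - j (moebius \<sigma>' (moebius B' \<tau>))) \<longlongrightarrow> cusp_value \<sigma> - cusp_value \<sigma>') at_i_infinity"
      using cusp_value_asymptotics(2)[OF assms(1,2)] by (intro tendsto_diff)
    hence L: "leading (\<lambda>\<tau>. j (moebius \<sigma> \<tau>) - j (moebius \<sigma>' (moebius B' \<tau>))) 0 (cusp_value \<sigma> - cusp_value \<sigma>')"
      using ne by (simp add: leading_def)
    have "eventually (\<lambda>\<tau>. j (moebius \<sigma> \<tau>) - j (moebius \<sigma>' (moebius B' \<tau>)) = j (moebius \<sigma> \<tau>) - j_coset X (moebius \<sigma> \<tau>)) at_i_infinity"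
      using eventually_Im_gt[of 0]
    proof eventually_elim
      case (elim \<tau>)
      have "j_coset X (moebius \<sigma> \<tau>) = j (moebius A (moebius \<sigma> \<tau>))" by (rule j_coset_eq[OF X(1) A ims[OF elim]])
      also have "moebius A (moebius \<sigma> \<tau>) = moebius (\<sigma>' ** B') \<tau>" using elim ds sB(2) by (simp add: moebius_compose)
      also have "\<dots> = moebius \<sigma>' (moebius B' \<tau>)" using elim sB(3) n_pos by (simp add: moebius_compose)
      finally show ?case by simp
    qed
    from leading_cong[OF L this] show ?thesis by blast
  qed
  have "\<exists>C. leading (\<lambda>\<tau>. \<Prod>X\<in>Fx. j (moebius \<sigma> \<tau>) - j_coset X (moebius \<sigma> \<tau>)) (\<Sum>(d,k)\<in>(SIGMA d:D. {..<d}). \<kappa> * min 1 (real (n div d) / real d)) C"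
  proof -
    obtain C where C: "\<And>d k. d \<in> D \<Longrightarrow> leading (\<lambda>\<tau>. j (moebius \<sigma> \<tau>) - j_coset (coset N (\<sigma> ** B d k ** adj \<sigma>)) (moebius \<sigma> \<tau>))
      (\<kappa> * min 1 (real (n div d) / real d)) (C d k)" using on_Fx by metis
    have "leading (\<lambda>\<tau>. \<Prod>p\<in>(SIGMA d:D. {..<d}). j (moebius \<sigma> \<tau>) - j_coset (coset N (\<sigma> ** B (fst p) (snd p) ** adj \<sigma>)) (moebius \<sigma> \<tau>))
      (\<Sum>p\<in>(SIGMA d:D. {..<d}). \<kappa> * min 1 (real (n div fst p) / real (fst p))) (\<Prod>p\<in>(SIGMA d:D. {..<d}). C (fst p) (snd p))"
      using fin C by (intro leading_prod) auto
    moreover have "(\<Prod>p\<in>(SIGMA d:D. {..<d}). j (moebius \<sigma> \<tau>) - j_coset (coset N (\<sigma> ** B (fst p) (snd p) ** adj \<sigma>)) (moebius \<sigma> \<tau>))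
       = (\<Prod>X\<in>Fx. j (moebius \<sigma> \<tau>) - j_coset X (moebius \<sigma> \<tau>))" for \<tau>
      using prod.reindex_bij_betw[OF \<beta>(2)[folded B_def], of "\<lambda>X. j (moebius \<sigma> \<tau>) - j_coset X (moebius \<sigma> \<tau>)"]
      by (simp add: case_prod_unfold B_def)
    ultimately show ?thesis by (auto simp: case_prod_unfold)
  qed
  then obtain C1 where C1: "leading (\<lambda>\<tau>. \<Prod>X\<in>Fx. j (moebius \<sigma> \<tau>) - j_coset X (moebius \<sigma> \<tau>)) (\<Sum>(d,k)\<in>(SIGMA d:D. {..<d}). \<kappa> * min 1 (real (n div d) / real d)) C1" by blast
  obtain C where C: "\<And>X. X \<in> hcosets N n - Fx \<Longrightarrow> leading (\<lambda>\<tau>. j (moebius \<sigma> \<tau>) - j_coset X (moebius \<sigma> \<tau>)) 0 (C X)"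
    using off_Fx by (metis DiffD1 DiffD2)
  have C2: "leading (\<lambda>\<tau>. \<Prod>X\<in>hcosets N n - Fx. j (moebius \<sigma> \<tau>) - j_coset X (moebius \<sigma> \<tau>)) (\<Sum>X\<in>hcosets N n - Fx. 0) (\<Prod>X\<in>hcosets N n - Fx. C X)"
    using finite_cosets C by (intro leading_prod) auto
  have sub: "Fx \<subseteq> hcosets N n" by (auto simp: Fx_def)
  have split: "hecke_prod (moebius \<sigma> \<tau>) = (\<Prod>X\<in>Fx. j (moebius \<sigma> \<tau>) - j_coset X (moebius \<sigma> \<tau>)) * (\<Prod>X\<in>hcosets N n - Fx. j (moebius \<sigma> \<tau>) - j_coset X (moebius \<sigma> \<tau>))" for \<tau>
    unfolding hecke_prod_def by (subst prod.subset_diff[OF sub finite_cosets]) (rule mult.commute)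
  have inner: "(\<Sum>k<d. \<kappa> * min 1 (real (n div d) / real d)) = \<kappa> * real (min d (n div d))" if "d \<in> D" for d
  proof -
    have "d dvd n" using that unfolding D_def by blast
    hence d0: "d > 0" by (rule dvd_pos_nat[OF n_pos])
    have "real d * min 1 (real (n div d) / real d) = min (real d) (real (n div d))"
      using d0 by (simp add: min_mult_distrib_left)
    thus ?thesis by (simp add: of_nat_min algebra_simps)
  qed
  have "(\<Sum>(d,k)\<in>(SIGMA d:D. {..<d}). \<kappa> * min 1 (real (n div d) / real d)) = (\<Sum>d\<in>D. \<Sum>k<d. \<kappa> * min 1 (real (n div d) / real d))"
    by (rule sum.Sigma[symmetric]) (use fin in auto)
  also have "\<dots> = (\<Sum>d\<in>D. \<kappa> * real (min d (n div d)))" by (rule sum.cong[OF refl inner])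
  also have "\<dots> = \<kappa> * real (\<Sum>d\<in>D. min d (n div d))" by (simp only: sum_distrib_left of_nat_sum)
  finally have exps: "(\<Sum>(d,k)\<in>(SIGMA d:D. {..<d}). \<kappa> * min 1 (real (n div d) / real d)) = \<kappa> * real (\<Sum>d\<in>D. min d (n div d))" .
  have "leading (\<lambda>\<tau>. hecke_prod (moebius \<sigma> \<tau>)) (\<kappa> * real (\<Sum>d\<in>D. min d (n div d)) + (\<Sum>X\<in>hcosets N n - Fx. 0)) (C1 * (\<Prod>X\<in>hcosets N n - Fx. C X))"
    using leading_mult[OF C1 C2] unfolding split exps .
  thus ?thesis unfolding D_def by (auto intro: exI)
qed

end

section \<open>Second-order asymptotics at infinity\<close>

text \<open>
  The expansion \<open>g = 1 + t q + o(q)\<close>; the coefficients \<open>t\<close> add up under multiplication.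
\<close>

definition unit_expansion :: "(complex \<Rightarrow> complex) \<Rightarrow> complex \<Rightarrow> bool" where
  "unit_expansion g t \<longleftrightarrow> ((\<lambda>\<tau>. (g \<tau> - 1) * qpow (-1) \<tau>) \<longlongrightarrow> t) at_i_infinity"

lemma unit_expansion_cong:
  assumes "unit_expansion f t" "eventually (\<lambda>\<tau>. f \<tau> = g \<tau>) at_i_infinity"
  shows "unit_expansion g t"
proof -
  have "eventually (\<lambda>\<tau>. (f \<tau> - 1) * qpow (-1) \<tau> = (g \<tau> - 1) * qpow (-1) \<tau>) at_i_infinity"
    using assms(2) by eventually_elim simp
  with assms(1) show ?thesis unfolding unit_expansion_def by (rule Lim_transform_eventually)
qed

lemma unit_expansion_tendsto_1:
  assumes "unit_expansion f t" shows "(f \<longlongrightarrow> 1) at_i_infinity"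
proof -
  have "((\<lambda>\<tau>. (f \<tau> - 1) * qpow (-1) \<tau> * qpow 1 \<tau> + 1) \<longlongrightarrow> t * 0 + 1) at_i_infinity"
    using assms unfolding unit_expansion_def by (intro tendsto_intros qpow_tendsto_0) auto
  moreover have "(f \<tau> - 1) * qpow (-1) \<tau> * qpow 1 \<tau> + 1 = f \<tau>" for \<tau>
    by (simp add: qpow_minus mult.assoc)
  ultimately show ?thesis by simp
qed

lemma unit_expansion_leading: "unit_expansion f t \<Longrightarrow> leading f 0 1"
  using unit_expansion_tendsto_1 by (simp add: leading_def)

lemma unit_expansion_mult:
  assumes "unit_expansion f s" "unit_expansion g t"
  shows "unit_expansion (\<lambda>\<tau>. f \<tau> * g \<tau>) (s + t)"
proof -
  have "((\<lambda>\<tau>. ((f \<tau> - 1) * qpow (-1) \<tau>) * g \<tau> + (g \<tau> - 1) * qpow (-1) \<tau>) \<longlongrightarrow> s * 1 + t) at_i_infinity"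
    using assms unit_expansion_tendsto_1[OF assms(2)] unfolding unit_expansion_def by (intro tendsto_intros)
  moreover have "((f \<tau> - 1) * qpow (-1) \<tau>) * g \<tau> + (g \<tau> - 1) * qpow (-1) \<tau> = (f \<tau> * g \<tau> - 1) * qpow (-1) \<tau>" for \<tau>
    by (simp add: algebra_simps)
  ultimately show ?thesis by (simp add: unit_expansion_def)
qed

lemma unit_expansion_one: "unit_expansion (\<lambda>_. 1) 0"
  by (simp add: unit_expansion_def)

lemma unit_expansion_prod:
  assumes "finite A" "\<And>x. x \<in> A \<Longrightarrow> unit_expansion (f x) (t x)"
  shows "unit_expansion (\<lambda>\<tau>. \<Prod>x\<in>A. f x \<tau>) (\<Sum>x\<in>A. t x)"
  using assms
proof (induction A rule: finite_induct)
  case empty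
  show ?case using unit_expansion_one by simp
next
  case (insert x A)
  have "unit_expansion (\<lambda>\<tau>. f x \<tau> * (\<Prod>x\<in>A. f x \<tau>)) (t x + (\<Sum>x\<in>A. t x))"
    using insert by (intro unit_expansion_mult) simp_all
  thus ?case using insert(1,2) by simp
qed

lemma unit_expansion_power:
  assumes "unit_expansion f t" shows "unit_expansion (\<lambda>\<tau>. f \<tau> ^ m) (of_nat m * t)"
proof (induction m)
  case 0
  show ?case using unit_expansion_one by simp
next
  case (Suc m)
  from unit_expansion_mult[OF assms this] show ?case by (simp add: algebra_simps)
qed

lemma unit_expansion_unique:
  assumes "unit_expansion f s" "unit_expansion f t" shows "s = t"
  using assms tendsto_unique[OF at_i_infinity_neq_bot] unfolding unit_expansion_def by blast

lemma unit_expansion_qpow: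
  assumes "m > 0" shows "unit_expansion (\<lambda>\<tau>. 1 - qpow (real m) \<tau>) (if m = 1 then -1 else 0)"
proof (cases "m = 1")
  case True
  have "(1 - qpow 1 \<tau> - 1) * qpow (-1) \<tau> = - 1" for \<tau> by (simp add: qpow_minus)
  thus ?thesis using True by (simp add: unit_expansion_def)
next
  case False
  have "((\<lambda>\<tau>. - qpow (real m - 1) \<tau>) \<longlongrightarrow> - 0) at_i_infinity"
    using False assms by (intro tendsto_minus qpow_tendsto_0) simp
  moreover have "(1 - qpow (real m) \<tau> - 1) * qpow (-1) \<tau> = - qpow (real m - 1) \<tau>" for \<tau>
    using qpow_add[of "real m" "-1" \<tau>] by simp
  ultimately show ?thesis using False by (simp add: unit_expansion_def)
qed

lemma qpow_sum:
  assumes "finite A" shows "(\<Prod>x\<in>A. qpow (f x) \<tau>) = qpow (\<Sum>x\<in>A. f x) \<tau>"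
  using assms by (induction A rule: finite_induct) (simp_all add: qpow_add)

text \<open>
  The hypotheses say that \<open>\<zeta>\<close> enumerates all \<open>d\<close>-th roots of unity, so this is the factorization of \<open>x\<^sup>d - y\<^sup>d\<close>.
\<close>

lemma prod_roots_of_unity:
  fixes x y :: complex
  assumes d: "d > 0" and \<zeta>: "\<And>k. k < d \<Longrightarrow> \<zeta> k ^ d = 1" "inj_on \<zeta> {..<d}" and y: "y \<noteq> 0"
  shows "(\<Prod>k<d. x - \<zeta> k * y) = x ^ d - y ^ d"
proof -
  define p where "p = (\<Prod>k<d. [:- (\<zeta> k * y), 1:])"
  define r where "r = Polynomial.monom 1 d - [:y ^ d:]"
  have dp: "degree p = d" unfolding p_def by (subst degree_prod_eq_sum_degree) auto
  have lp: "Polynomial.coeff p d = 1" using lead_coeff_prod[of "\<lambda>k. [:- (\<zeta> k * y), 1:]" "{..<d}"] dp by (simp add: p_def)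
  have lr: "Polynomial.coeff r d = 1" using d by (cases d) (simp_all add: r_def)
  have dr: "degree r \<le> d" unfolding r_def by (intro degree_diff_le) (auto simp: degree_monom_le)
  have "p - r = 0"
  proof (rule ccontr)
    assume ne: "p - r \<noteq> 0"
    have "degree (p - r) \<le> d" using dp dr by (intro degree_diff_le) auto
    moreover have "Polynomial.coeff (p - r) d = 0" using lp lr by simp
    ultimately have "degree (p - r) < d" using ne d by (metis le_neq_implies_less leading_coeff_0_iff)
    moreover have "(\<lambda>k. \<zeta> k * y) ` {..<d} \<subseteq> {z. poly (p - r) z = 0}"
    proof
      fix z assume "z \<in> (\<lambda>k. \<zeta> k * y) ` {..<d}"
      then obtain k where k: "k < d" "z = \<zeta> k * y" by auto
      have "poly p z = 0" unfolding p_def poly_prod using k by (intro prod_zero) auto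
      moreover have "poly r z = 0" using \<zeta>(1)[OF k(1)] by (simp add: r_def k(2) poly_monom power_mult_distrib)
      ultimately show "z \<in> {z. poly (p - r) z = 0}" by simp
    qed
    hence "card ((\<lambda>k. \<zeta> k * y) ` {..<d}) \<le> card {z. poly (p - r) z = 0}"
      using poly_roots_finite[OF ne] by (intro card_mono)
    moreover have "card ((\<lambda>k. \<zeta> k * y) ` {..<d}) = d"
      using \<zeta>(2) y by (subst card_image) (auto simp: inj_on_def)
    moreover have "card {z. poly (p - r) z = 0} \<le> degree (p - r)" by (rule card_poly_roots_bound[OF ne])
    ultimately show False by linarith
  qed
  hence "poly p x = poly r x" by simp
  thus ?thesis by (simp add: p_def r_def poly_prod poly_monom)
qed

text \<open>
  By periodicity \<open>\<phi>\<close> is a function \<open>F\<close> of \<open>z = exp (2 \<pi> \<i> \<tau> / N)\<close> in the punctured disc. It is holomorphic because it can be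
  computed with any local branch of the logarithm, and the leading term shows that it tends to a limit or to infinity
  at \<open>0\<close>, so the singularity is not essential.
\<close>

lemma periodic_meromorphic_at_cusp:
  assumes N: "N > 0" and hol: "\<phi> holomorphic_on upper_half_plane"
    and per: "\<And>\<tau> k. Im \<tau> > 0 \<Longrightarrow> \<phi> (\<tau> + of_int k * of_nat N) = \<phi> \<tau>"
    and lead: "leading \<phi> \<kappa> C"
  shows "\<exists>F. F meromorphic_on {0} \<and> (\<forall>\<^sub>F \<tau> in at_i_infinity. \<phi> \<tau> = F (exp (2 * pi * \<i> * \<tau> / of_nat N)))"
proof -
  define T where "T = (\<lambda>w. of_nat N * w / (2 * of_real pi * \<i>) :: complex)"
  define F where "F = (\<lambda>z. \<phi> (T (Ln z)))"
  have ImT: "Im (T w) = - (real N * Re w / (2 * pi))" for w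
    by (simp add: T_def Im_divide power2_eq_square field_simps)
  have indep: "\<phi> (T w) = F z" if "exp w = z" "cmod z < 1" for w z
  proof -
    have z0: "z \<noteq> 0" using that(1) by auto
    have "exp w = exp (Ln z)" using that z0 by simp
    then obtain k :: int where k: "w = Ln z + of_int (2 * k) * of_real pi * \<i>" unfolding exp_eq by auto
    have "T w = T (Ln z) + of_int k * of_nat N" unfolding k T_def by (simp add: field_simps)
    moreover have "Im (T (Ln z)) > 0"
    proof -
      have "ln (cmod z) < 0" using that(2) z0 by simp
      thus ?thesis unfolding ImT using N z0 by (simp add: field_simps mult_pos_neg mult_neg_pos)
    qed
    ultimately show ?thesis using per by (simp add: F_def)
  qed
  define D where "D = ball (0::complex) 1 - {0}"
  have pos: "Im (T w) > 0" if "Re w < 0" for w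
    unfolding ImT using N that by (simp add: field_simps mult_pos_neg mult_neg_pos)
  have holT: "(\<lambda>w. T w) holomorphic_on S" for S unfolding T_def by (intro holomorphic_intros) auto
  have re: "Re (Ln z) < 0" if "z \<in> D" for z using that by (simp add: D_def)
  have h1: "F holomorphic_on (D - \<real>\<^sub>\<le>\<^sub>0)"
    unfolding F_def
  proof (rule holomorphic_on_compose_gen[of "\<lambda>z. T (Ln z)" _ \<phi> upper_half_plane, unfolded o_def])
    show "(\<lambda>z. T (Ln z)) holomorphic_on (D - \<real>\<^sub>\<le>\<^sub>0)"
      by (rule holomorphic_on_compose_gen[of Ln _ T UNIV, unfolded o_def]) (auto intro!: holomorphic_intros holT)
  qed (use hol pos re in auto)
  (* Across the cut of the principal logarithm, use the branch whose cut is the positive axis. *)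
  have h2: "F holomorphic_on (D \<inter> {z. - z \<notin> \<real>\<^sub>\<le>\<^sub>0})"
  proof (rule holomorphic_transform)
    show "(\<lambda>z. \<phi> (T (Ln (- z) + of_real pi * \<i>))) holomorphic_on (D \<inter> {z. - z \<notin> \<real>\<^sub>\<le>\<^sub>0})"
    proof (rule holomorphic_on_compose_gen[of "\<lambda>z. T (Ln (- z) + of_real pi * \<i>)" _ \<phi> upper_half_plane, unfolded o_def])
      show "(\<lambda>z. T (Ln (- z) + of_real pi * \<i>)) holomorphic_on (D \<inter> {z. - z \<notin> \<real>\<^sub>\<le>\<^sub>0})"
        unfolding T_def by (intro holomorphic_intros) auto
      show "(\<lambda>z. T (Ln (- z) + of_real pi * \<i>)) ` (D \<inter> {z. - z \<notin> \<real>\<^sub>\<le>\<^sub>0}) \<subseteq> upper_half_plane"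
        by (auto simp: D_def intro!: pos)
    qed (rule hol)
    fix z assume z: "z \<in> D \<inter> {z. - z \<notin> \<real>\<^sub>\<le>\<^sub>0}"
    hence "exp (Ln (- z) + of_real pi * \<i>) = z" by (simp add: D_def exp_add)
    thus "\<phi> (T (Ln (- z) + of_real pi * \<i>)) = F z" using indep z by (simp add: D_def)
  qed
  have oD: "open D" by (simp add: D_def open_delete)
  have o2: "open (D \<inter> {z. - z \<notin> \<real>\<^sub>\<le>\<^sub>0})"
  proof -
    have "open (uminus -` (- \<real>\<^sub>\<le>\<^sub>0 :: complex set))"
      by (intro open_vimage) (auto simp: open_Compl closed_nonpos_Reals_complex intro!: continuous_intros)
    moreover have "{z::complex. - z \<notin> \<real>\<^sub>\<le>\<^sub>0} = uminus -` (- \<real>\<^sub>\<le>\<^sub>0)" by auto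
    ultimately show ?thesis using oD by auto
  qed
  have o1: "open (D - \<real>\<^sub>\<le>\<^sub>0)" using oD closed_nonpos_Reals_complex by (rule open_Diff)
  have "(D - \<real>\<^sub>\<le>\<^sub>0) \<union> (D \<inter> {z. - z \<notin> \<real>\<^sub>\<le>\<^sub>0}) = D"
    by (auto simp: D_def complex_nonpos_Reals_iff complex_eq_iff)
  hence holF: "F holomorphic_on D" using holomorphic_on_Un[OF h1 h2 o1 o2] by simp
  have iso: "isolated_singularity_at F 0"
    unfolding isolated_singularity_at_def
    by (rule exI[of _ 1]) (use holF oD in \<open>simp add: analytic_on_open D_def\<close>)
  have flim: "filterlim (\<lambda>z. T (Ln z)) at_i_infinity (at 0)"
    unfolding filterlim_iff
  proof (intro allI impI)
    fix P assume "eventually P at_i_infinity"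
    then obtain Y where Y: "\<And>\<tau>. Im \<tau> > Y \<Longrightarrow> P \<tau>" unfolding eventually_at_i_infinity by blast
    define \<epsilon> where "\<epsilon> = exp (- (2 * pi * Y / real N))"
    have "eventually (\<lambda>z. z \<in> ball (0::complex) \<epsilon> - {0}) (at 0)" by (intro eventually_at_in_open) (auto simp: \<epsilon>_def)
    thus "eventually (\<lambda>z. P (T (Ln z))) (at 0)"
    proof eventually_elim
      case (elim z)
      hence "ln (cmod z) < ln \<epsilon>" by (subst ln_less_cancel_iff) (auto simp: \<epsilon>_def)
      hence "ln (cmod z) < - (2 * pi * Y / real N)" by (simp add: \<epsilon>_def)
      hence "Y < Im (T (Ln z))" unfolding ImT using N elim by (simp add: field_simps)
      thus ?case by (rule Y)
    qed
  qed
  have "(\<exists>L. (\<phi> \<longlongrightarrow> L) at_i_infinity) \<or> filterlim \<phi> at_infinity at_i_infinity"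
  proof (cases \<kappa> "0::real" rule: linorder_cases)
    case less
    have li: "leading (\<lambda>\<tau>. inverse (\<phi> \<tau>)) (- \<kappa>) (inverse C)" by (rule leading_inverse[OF lead])
    have "((\<lambda>\<tau>. inverse (\<phi> \<tau>)) \<longlongrightarrow> 0) at_i_infinity" using leading_tendsto_0[OF li, of 0] less by simp
    moreover have "eventually (\<lambda>\<tau>. \<phi> \<tau> * qpow (- \<kappa>) \<tau> \<noteq> 0) at_i_infinity"
      using lead unfolding leading_def by (intro tendsto_imp_eventually_ne) auto
    hence "eventually (\<lambda>\<tau>. inverse (\<phi> \<tau>) \<noteq> 0) at_i_infinity" by eventually_elim auto
    ultimately have "filterlim (\<lambda>\<tau>. inverse (\<phi> \<tau>)) (at 0) at_i_infinity" by (simp add: filterlim_at)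
    thus ?thesis using filterlim_inverse_at_iff by blast
  next
    case equal
    thus ?thesis using lead by (auto simp: leading_def)
  next
    case greater
    thus ?thesis using leading_tendsto_0[OF lead, of 0] by auto
  qed
  hence "not_essential F 0"
  proof
    assume "\<exists>L. (\<phi> \<longlongrightarrow> L) at_i_infinity"
    then obtain L where "(\<phi> \<longlongrightarrow> L) at_i_infinity" by blast
    from filterlim_compose[OF this flim] have "F \<midarrow>0\<rightarrow> L" by (simp add: F_def)
    thus ?thesis by (auto simp: not_essential_def)
  next
    assume "filterlim \<phi> at_infinity at_i_infinity"
    from filterlim_compose[OF this flim] have "is_pole F 0" by (simp add: F_def is_pole_def)
    thus ?thesis by (auto simp: not_essential_def)
  qed
  hence "F meromorphic_on {0}" using iso meromorphic_at_iff by blast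
  moreover have "\<forall>\<^sub>F \<tau> in at_i_infinity. \<phi> \<tau> = F (exp (2 * pi * \<i> * \<tau> / of_nat N))"
    using eventually_Im_gt[of 0]
  proof eventually_elim
    case (elim \<tau>)
    define w where "w = 2 * pi * \<i> * \<tau> / of_nat N"
    have Tw: "T w = \<tau>" using N by (simp add: T_def w_def)
    have "Re w < 0"
    proof -
      have "Re w = - (2 * pi * Im \<tau> / real N)" by (simp add: w_def Re_divide_of_nat)
      thus ?thesis using elim N by simp
    qed
    hence "cmod (exp w) < 1" by (simp add: norm_exp_eq_Re)
    from indep[OF refl this] show ?case unfolding Tw by (simp add: w_def)
  qed
  ultimately show ?thesis by blast
qed

context hecke
begin

lemma divisor_facts:
  assumes "d dvd n"
  shows "d > 0" "n div d > 0" "n div d \<noteq> d" "d * (n div d) = n"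
proof -
  show 1: "d > 0" using assms n_pos by (auto intro: Nat.gr0I)
  show 2: "d * (n div d) = n" using assms by simp
  show "n div d > 0" using 2 n_pos by (auto intro: Nat.gr0I)
  show "n div d \<noteq> d"
  proof
    assume "n div d = d"
    hence "n = d\<^sup>2" using 2 by (simp add: power2_eq_square)
    thus False using n_nonsquare by (auto simp: is_nth_power_def)
  qed
qed

text \<open>
  Replace \<open>j\<close> by \<open>q\<^sup>-\<^sup>1\<close> in both terms, which gives \<open>P\<close>. The errors are \<open>O(q)\<close> and \<open>O(q\<^sup>r)\<close>, while \<open>P\<close> has order
  \<open>- max 1 r\<close>; so the relative errors are \<open>O(q\<^sup>1\<^sup>+\<^sup>r)\<close> or smaller, hence \<open>o(q)\<close>.
\<close>

lemma factor_at_infinity: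
  assumes "B$2$1 = 0" "B$1$1 > 0" "B$2$2 > 0" "B$1$1 \<noteq> B$2$2"
  defines "r \<equiv> of_int (B$1$1) / of_int (B$2$2) :: real"
  defines "P \<equiv> \<lambda>\<tau>. qpow (-1) \<tau> - qpow (-1) (of_int (B$1$2) / of_int (B$2$2)) * qpow (- r) \<tau>"
  shows "\<exists>u. unit_expansion u 0 \<and> eventually (\<lambda>\<tau>. j \<tau> - j (moebius B \<tau>) = P \<tau> * u \<tau>) at_i_infinity"
proof -
  define z where "z = qpow (-1) (of_int (B$1$2) / of_int (B$2$2))"
  have r0: "r > 0" using assms(2,3) by (simp add: r_def)
  have r1: "r \<noteq> 1" using assms(3,4) by (simp add: r_def)
  have qB: "qpow (-1) (moebius B \<tau>) = z * qpow (- r) \<tau>" for \<tau>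
    unfolding qpow_moebius_upper[OF assms(1,3)] z_def r_def by simp
  have l1: "leading (qpow (-1)) (-1) 1" by (simp add: leading_def qpow_add[symmetric])
  have l2: "leading (\<lambda>\<tau>. z * qpow (- r) \<tau>) (- r) z" by (simp add: leading_def qpow_add[symmetric] z_def mult.assoc)
  obtain E where E: "leading P (min (-1) (- r)) E"
    using leading_diff[OF l1 l2] r1 unfolding P_def z_def by auto
  have Einv: "leading (\<lambda>\<tau>. inverse (P \<tau>)) (max 1 r) (inverse E)"
  proof -
    have "- min (-1) (- r) = max 1 r" by (simp add: min_def max_def)
    thus ?thesis using leading_inverse[OF E] by simp
  qed
  obtain c where c: "((\<lambda>\<tau>. (j \<tau> - qpow (-1) \<tau>) * qpow (-1) \<tau>) \<longlongrightarrow> c) at_i_infinity"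
    by (rule j_expansion_inf) (rule that)
  define u where "u = (\<lambda>\<tau>. 1 + ((j \<tau> - qpow (-1) \<tau>) - (j (moebius B \<tau>) - z * qpow (- r) \<tau>)) * inverse (P \<tau>))"
  have t1: "((\<lambda>\<tau>. ((j \<tau> - qpow (-1) \<tau>) * qpow (-1) \<tau>) * inverse (P \<tau>)) \<longlongrightarrow> c * 0) at_i_infinity"
    using leading_tendsto_0[OF Einv, of 0] r0 by (intro tendsto_mult c) auto
  have t2: "((\<lambda>\<tau>. ((j (moebius B \<tau>) - qpow (-1) (moebius B \<tau>)) * qpow (-1) (moebius B \<tau>))
      * (inverse z * (inverse (P \<tau>) * qpow (- (1 - r)) \<tau>))) \<longlongrightarrow> c * (inverse z * 0)) at_i_infinity"
  proof (intro tendsto_mult tendsto_const)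
    show "((\<lambda>\<tau>. (j (moebius B \<tau>) - qpow (-1) (moebius B \<tau>)) * qpow (-1) (moebius B \<tau>)) \<longlongrightarrow> c) at_i_infinity"
      using filterlim_compose[OF c filterlim_moebius_upper[OF assms(1-3)]] .
    show "((\<lambda>\<tau>. inverse (P \<tau>) * qpow (- (1 - r)) \<tau>) \<longlongrightarrow> 0) at_i_infinity"
      using r0 by (intro leading_tendsto_0[OF Einv]) auto
  qed
  have z0: "z \<noteq> 0" by (simp add: z_def)
  have e2: "((j (moebius B \<tau>) - qpow (-1) (moebius B \<tau>)) * qpow (-1) (moebius B \<tau>))
      * (inverse z * (inverse (P \<tau>) * qpow (- (1 - r)) \<tau>)) = (j (moebius B \<tau>) - z * qpow (- r) \<tau>) * inverse (P \<tau>) * qpow (-1) \<tau>" for \<tau>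
  proof -
    have "qpow (- r) \<tau> * qpow (- (1 - r)) \<tau> = qpow (-1) \<tau>" by (simp add: qpow_add[symmetric])
    hence "(z * qpow (- r) \<tau>) * (inverse z * (inverse (P \<tau>) * qpow (- (1 - r)) \<tau>)) = inverse (P \<tau>) * qpow (-1) \<tau>"
      using z0 by (simp add: field_simps)
    thus ?thesis unfolding qB by (simp only: mult.assoc)
  qed
  have "((\<lambda>\<tau>. ((j \<tau> - qpow (-1) \<tau>) * qpow (-1) \<tau>) * inverse (P \<tau>) -
      (j (moebius B \<tau>) - z * qpow (- r) \<tau>) * inverse (P \<tau>) * qpow (-1) \<tau>) \<longlongrightarrow> c * 0 - c * (inverse z * 0)) at_i_infinity"
    using t1 t2 unfolding e2 by (rule tendsto_diff)
  hence "unit_expansion u 0" unfolding unit_expansion_def u_def by (simp add: algebra_simps)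
  moreover have "eventually (\<lambda>\<tau>. P \<tau> * qpow (- min (-1) (- r)) \<tau> \<noteq> 0) at_i_infinity"
    using E unfolding leading_def by (intro tendsto_imp_eventually_ne) auto
  hence "eventually (\<lambda>\<tau>. j \<tau> - j (moebius B \<tau>) = P \<tau> * u \<tau>) at_i_infinity"
  proof eventually_elim
    case (elim \<tau>)
    hence "P \<tau> \<noteq> 0" by simp
    hence "P \<tau> * u \<tau> = P \<tau> + ((j \<tau> - qpow (-1) \<tau>) - (j (moebius B \<tau>) - z * qpow (- r) \<tau>))"
      by (simp add: u_def distrib_left)
    thus ?case by (simp add: P_def z_def)
  qed
  ultimately show ?thesis by blast
qed

definition pole_order :: nat where
  "pole_order = (\<Sum>d | d dvd n. max d (n div d))"

definition adjacent_divisors :: nat where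
  "adjacent_divisors = card {d. d dvd n \<and> (n div d = d + 1 \<or> d = n div d + 1)}"

text \<open>
  All cosets fix the cusp infinity, and its width is \<open>1\<close>. For fixed \<open>d\<close> the approximate factors multiply to
  \<open>q\<^sup>-\<^sup>d - q\<^sup>-\<^sup>a\<close> with \<open>a = n / d\<close>, that is, up to sign, \<open>q\<^sup>-\<^sup>m\<^sup>a\<^sup>x (1 - q\<^sup>m)\<close> with \<open>m = \<bar>a - d\<bar>\<close>. Such a product contributes to
  the coefficient of \<open>q\<close> only if \<open>m = 1\<close>.
\<close>

lemma hecke_prod_at_infinity:
  "\<exists>s u. s \<noteq> 0 \<and> unit_expansion u (- of_nat adjacent_divisors) \<and>
     eventually (\<lambda>\<tau>. hecke_prod \<tau> = s * qpow (- real pole_order) \<tau> * u \<tau>) at_i_infinity"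
proof -
  define D where "D = {d. d dvd n}"
  have finD: "finite D" unfolding D_def by (rule finite_divisors_nat[OF n_pos])
  define one :: "int^2^2" where "one = mat 1"
  have o: "one \<in> SL2Z" "one$2$1 = 0" "adj one = one" by (auto simp: one_def intro: matrix2_eqI)
  have all: "{X \<in> hcosets N n. \<exists>A\<in>X. (adj one ** A ** one)$2$1 = 0} = hcosets N n"
  proof (intro equalityI subsetI CollectI conjI)
    fix X assume "X \<in> hcosets N n"
    from hcosets_upper_representative[OF n_pos coprime_n_N this] obtain B where "B \<in> X" "B$2$1 = 0" by blast
    thus "\<exists>A\<in>X. (adj one ** A ** one)$2$1 = 0" unfolding o(3) by (intro bexI[of _ B]) (simp_all add: one_def)
  qed auto
  have gc: "gcd (nat \<bar>one$2$1\<bar>) N = N" "gcd (nat \<bar>one$2$1\<bar>) (N div N) = 1" using o(2) N_pos by simp_all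
  have ex: "\<exists>\<beta> :: nat \<Rightarrow> int. bij_betw (\<lambda>(d,k). coset N (one ** mat2 (int (n div d)) (\<beta> d + int (N div N div 1) * int k) 0 (int d) ** adj one))
       (SIGMA d:{d. d dvd n \<and> [n = d\<^sup>2] (mod 1)}. {..<d}) (hcosets N n) \<and>
     (\<forall>d k. d \<in> {d. d dvd n \<and> [n = d\<^sup>2] (mod 1)} \<longrightarrow> one ** mat2 (int (n div d)) (\<beta> d + int (N div N div 1) * int k) 0 (int d) ** adj one \<in> Hecke N n)"
    by (rule cusp_cosets[OF N_pos n_pos coprime_n_N o(1)], unfold gc all, rule exI, rule conjI, assumption, intro allI impI)
  have e: "{d. d dvd n \<and> [n = d\<^sup>2] (mod 1)} = D" "int (N div N div 1) = 1"
    using N_pos by (simp_all add: D_def)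
  have e3: "one ** B ** adj one = B" for B unfolding o(3) by (simp add: one_def)
  from ex[unfolded e e3] obtain \<beta> :: "nat \<Rightarrow> int" where
    \<beta>': "bij_betw (\<lambda>(d,k). coset N (mat2 (int (n div d)) (\<beta> d + 1 * int k) 0 (int d))) (SIGMA d:D. {..<d}) (hcosets N n)"
     "\<forall>d k. d \<in> D \<longrightarrow> mat2 (int (n div d)) (\<beta> d + 1 * int k) 0 (int d) \<in> Hecke N n"
    by (elim exE conjE)
  note \<beta> = \<beta>'(1) \<beta>'(2)[rule_format]
  define B where "B = (\<lambda>d k. mat2 (int (n div d)) (\<beta> d + 1 * int k) 0 (int d))"
  define r where "r = (\<lambda>d. real (n div d) / real d)"
  define \<zeta> where "\<zeta> = (\<lambda>d k. qpow (-1) (of_int (\<beta> d + int k) / of_nat d))"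
  define P where "P = (\<lambda>d k \<tau>. qpow (-1) \<tau> - \<zeta> d k * qpow (- r d) \<tau>)"
  have fac: "\<exists>u. unit_expansion u 0 \<and> eventually (\<lambda>\<tau>. j \<tau> - j (moebius (B d k) \<tau>) = P d k \<tau> * u \<tau>) at_i_infinity" if "d \<in> D" for d k
  proof -
    have "d dvd n" using that unfolding D_def by blast
    note d = divisor_facts(1-3)[OF this]
    show ?thesis using factor_at_infinity[of "B d k"] d by (simp add: B_def P_def r_def \<zeta>_def)
  qed
  then obtain u where u: "\<And>d k. d \<in> D \<Longrightarrow> unit_expansion (u d k) 0"
    "\<And>d k. d \<in> D \<Longrightarrow> eventually (\<lambda>\<tau>. j \<tau> - j (moebius (B d k) \<tau>) = P d k \<tau> * u d k \<tau>) at_i_infinity"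
    by metis
  define I where "I = (SIGMA d:D. {..<d})"
  have finI: "finite I" using finD by (auto simp: I_def)
  define U where "U = (\<lambda>\<tau>. \<Prod>p\<in>I. u (fst p) (snd p) \<tau>)"
  have U: "unit_expansion U 0"
  proof -
    have "unit_expansion U (\<Sum>p\<in>I. 0)" unfolding U_def using finI u(1) by (intro unit_expansion_prod) (auto simp: I_def)
    thus ?thesis by simp
  qed
  have "eventually (\<lambda>\<tau>. \<forall>p\<in>I. j \<tau> - j (moebius (B (fst p) (snd p)) \<tau>) = P (fst p) (snd p) \<tau> * u (fst p) (snd p) \<tau>) at_i_infinity"
    using finI u(2) by (intro eventually_ball_finite) (auto simp: I_def)
  hence ev1: "eventually (\<lambda>\<tau>. hecke_prod \<tau> = (\<Prod>p\<in>I. P (fst p) (snd p) \<tau>) * U \<tau>) at_i_infinity"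
    using eventually_Im_gt[of 0]
  proof eventually_elim
    case (elim \<tau>)
    have "hecke_prod \<tau> = (\<Prod>p\<in>I. j \<tau> - j_coset (coset N (B (fst p) (snd p))) \<tau>)"
      unfolding hecke_prod_def I_def using prod.reindex_bij_betw[OF \<beta>(1), of "\<lambda>X. j \<tau> - j_coset X \<tau>"]
      by (simp add: case_prod_unfold B_def)
    also have "\<dots> = (\<Prod>p\<in>I. j \<tau> - j (moebius (B (fst p) (snd p)) \<tau>))"
    proof (rule prod.cong[OF refl])
      fix p assume "p \<in> I"
      hence "B (fst p) (snd p) \<in> Hecke N n" using \<beta>(2) by (auto simp: I_def B_def)
      from j_coset_eq[OF coset_in_hcosets[OF this] coset_self elim(2)]
      show "j \<tau> - j_coset (coset N (B (fst p) (snd p))) \<tau> = j \<tau> - j (moebius (B (fst p) (snd p)) \<tau>)" by simp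
    qed
    also have "\<dots> = (\<Prod>p\<in>I. P (fst p) (snd p) \<tau> * u (fst p) (snd p) \<tau>)" using elim(1) by (intro prod.cong) auto
    finally show ?case by (simp add: prod.distrib U_def)
  qed
  define s where "s = (\<lambda>d. if n div d < d then 1 else -1 :: complex)"
  define m where "m = (\<lambda>d. if n div d < d then d - n div d else n div d - d)"
  have inner: "(\<Prod>k<d. P d k \<tau>) = s d * qpow (- real (max d (n div d))) \<tau> * (1 - qpow (real (m d)) \<tau>)" if "d \<in> D" for d \<tau>
  proof -
    have "d dvd n" using that unfolding D_def by blast
    note d = divisor_facts(1-3)[OF this]
    have "(\<Prod>k<d. P d k \<tau>) = qpow (-1) \<tau> ^ d - qpow (- r d) \<tau> ^ d"
      unfolding P_def
    proof (rule prod_roots_of_unity[OF d(1)])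
      show "\<zeta> d k ^ d = 1" for k
      proof -
        have "\<zeta> d k ^ d = exp (of_nat d * (2 * of_real pi * \<i> * of_real (-1) * (of_int (\<beta> d + int k) / of_nat d)))"
          unfolding \<zeta>_def qpow_def by (rule exp_of_nat_mult[symmetric])
        also have "of_nat d * (2 * of_real pi * \<i> * of_real (-1) * (of_int (\<beta> d + int k) / of_nat d)) = 2 * of_real pi * \<i> * of_int (- (\<beta> d + int k))"
          using d(1) by (simp add: field_simps)
        also have "exp (2 * of_real pi * \<i> * of_int (- (\<beta> d + int k))) = qpow 1 (0 + of_int (- (\<beta> d + int k)))" by (simp add: qpow_def)
        also have "\<dots> = qpow 1 0" unfolding qpow_eq_iff by blast
        also have "\<dots> = 1" by (simp add: qpow_def)
        finally show ?thesis .
      qed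
      show "inj_on (\<zeta> d) {..<d}"
      proof (rule inj_onI)
        fix k k' assume k: "k \<in> {..<d}" "k' \<in> {..<d}" "\<zeta> d k = \<zeta> d k'"
        have "qpow 1 (of_int (\<beta> d + int k) / of_nat d) = qpow 1 (of_int (\<beta> d + int k') / of_nat d)"
          using k(3) unfolding \<zeta>_def qpow_minus by (simp only: inverse_eq_iff_eq)
        then obtain i :: int where i: "of_int (\<beta> d + int k) / of_nat d = of_int (\<beta> d + int k') / of_nat d + (of_int i :: complex)"
          unfolding qpow_eq_iff by blast
        have "(of_int (\<beta> d + int k) :: complex) = of_int (\<beta> d + int k' + i * int d)" using i d(1) by (simp add: field_simps)
        hence "\<beta> d + int k = \<beta> d + int k' + i * int d" by (simp only: of_int_eq_iff)
        hence kk: "int k - int k' = i * int d" by simp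
        have "i = 0"
        proof (rule ccontr)
          assume "i \<noteq> 0"
          hence "1 * int d \<le> \<bar>i\<bar> * int d" by (intro mult_right_mono) auto
          hence "int d \<le> \<bar>int k - int k'\<bar>" unfolding kk by (simp add: abs_mult)
          thus False using k(1,2) by auto
        qed
        thus "k = k'" using kk by simp
      qed
    qed simp
    also have "\<dots> = qpow (- real d) \<tau> - qpow (- real (n div d)) \<tau>"
      using d(1) by (simp add: qpow_power r_def)
    also have "\<dots> = s d * qpow (- real (max d (n div d))) \<tau> * (1 - qpow (real (m d)) \<tau>)"
    proof (cases "n div d < d")
      case True
      have "qpow (- real d) \<tau> * qpow (real (m d)) \<tau> = qpow (- real (n div d)) \<tau>"
        using True by (simp add: qpow_add[symmetric] m_def of_nat_diff)
      thus ?thesis using True by (simp add: s_def right_diff_distrib)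
    next
      case False
      have "qpow (- real (n div d)) \<tau> * qpow (real (m d)) \<tau> = qpow (- real d) \<tau>"
        using False by (simp add: qpow_add[symmetric] m_def of_nat_diff)
      thus ?thesis using False by (simp add: s_def right_diff_distrib max_def)
    qed
    finally show ?thesis .
  qed
  define V where "V = (\<lambda>\<tau>. \<Prod>d\<in>D. 1 - qpow (real (m d)) \<tau>)"
  have V: "unit_expansion V (- of_nat adjacent_divisors)"
  proof -
    have "unit_expansion V (\<Sum>d\<in>D. if m d = 1 then -1 else 0)" unfolding V_def
    proof (intro unit_expansion_prod finD unit_expansion_qpow)
      fix d assume "d \<in> D"
      hence "d dvd n" unfolding D_def by blast
      hence "n div d \<noteq> d" by (rule divisor_facts(3))
      thus "m d > 0" by (auto simp: m_def)
    qed
    also have "(\<Sum>d\<in>D. if m d = 1 then -1 else 0) = (\<Sum>d\<in>{d\<in>D. m d = 1}. -1 :: complex)"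
      using finD by (intro sum.inter_filter[symmetric])
    also have "\<dots> = - of_nat (card {d\<in>D. m d = 1})" by simp
    also have "{d\<in>D. m d = 1} = {d. d dvd n \<and> (n div d = d + 1 \<or> d = n div d + 1)}"
      by (auto simp: D_def m_def split: if_splits)
    finally show ?thesis by (simp add: adjacent_divisors_def)
  qed
  have prodP: "(\<Prod>p\<in>I. P (fst p) (snd p) \<tau>) = (\<Prod>d\<in>D. s d) * qpow (- real pole_order) \<tau> * V \<tau>" for \<tau>
  proof -
    have "(\<Prod>p\<in>I. P (fst p) (snd p) \<tau>) = (\<Prod>d\<in>D. \<Prod>k<d. P d k \<tau>)"
      unfolding I_def using prod.Sigma[of D "\<lambda>d. {..<d}" "\<lambda>d k. P d k \<tau>"] finD by (simp add: case_prod_unfold)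
    also have "\<dots> = (\<Prod>d\<in>D. s d * qpow (- real (max d (n div d))) \<tau> * (1 - qpow (real (m d)) \<tau>))"
      using inner by (intro prod.cong) auto
    also have "\<dots> = (\<Prod>d\<in>D. s d) * (\<Prod>d\<in>D. qpow (- real (max d (n div d))) \<tau>) * V \<tau>"
      by (simp add: prod.distrib V_def)
    also have "(\<Prod>d\<in>D. qpow (- real (max d (n div d))) \<tau>) = qpow (\<Sum>d\<in>D. - real (max d (n div d))) \<tau>"
      by (rule qpow_sum[OF finD])
    also have "(\<Sum>d\<in>D. - real (max d (n div d))) = - real pole_order"
      by (simp add: pole_order_def D_def sum_negf del: of_nat_max)
    finally show ?thesis .
  qed
  show ?thesis
  proof (intro exI conjI)
    show "(\<Prod>d\<in>D. s d) \<noteq> 0" using finD by (simp add: s_def)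
    show "unit_expansion (\<lambda>\<tau>. V \<tau> * U \<tau>) (- of_nat adjacent_divisors)" using unit_expansion_mult[OF V U] by simp
    show "eventually (\<lambda>\<tau>. hecke_prod \<tau> = (\<Prod>d\<in>D. s d) * qpow (- real pole_order) \<tau> * (V \<tau> * U \<tau>)) at_i_infinity"
      using ev1 by eventually_elim (simp add: prodP mult.assoc)
  qed
qed

lemma hecke_prod_leading_infinity: "\<exists>s. leading hecke_prod (- real pole_order) s"
proof -
  obtain s u where su: "s \<noteq> 0" "unit_expansion u (- of_nat adjacent_divisors)"
     "eventually (\<lambda>\<tau>. hecke_prod \<tau> = s * qpow (- real pole_order) \<tau> * u \<tau>) at_i_infinity" using hecke_prod_at_infinity by blast
  have "leading (\<lambda>\<tau>. s * qpow (- real pole_order) \<tau>) (- real pole_order) s"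
    using su(1) by (simp add: leading_def qpow_add[symmetric] mult.assoc)
  from leading_mult[OF this unit_expansion_leading[OF su(2)]]
  have "leading (\<lambda>\<tau>. s * qpow (- real pole_order) \<tau> * u \<tau>) (- real pole_order) s" by simp
  hence "leading hecke_prod (- real pole_order) s" by (rule leading_cong) (use su(3) in \<open>eventually_elim, simp\<close>)
  thus ?thesis by blast
qed

lemma hecke_prod_leading_cusp:
  assumes "A \<in> SL2Z" shows "\<exists>\<kappa> C. leading (\<lambda>\<tau>. hecke_prod (moebius A \<tau>)) \<kappa> C"
proof (cases "A \<in> Gamma0 N")
  case True
  obtain s where s: "leading hecke_prod (- real pole_order) s" using hecke_prod_leading_infinity by blast
  have "leading (\<lambda>\<tau>. hecke_prod (moebius A \<tau>)) (- real pole_order) s"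
    by (rule leading_cong[OF s], rule eventually_mono[OF eventually_Im_gt[of 0]]) (simp add: hecke_prod_invariant[OF True])
  thus ?thesis by blast
next
  case False
  obtain \<kappa> \<alpha> where "leading (\<lambda>\<tau>. j (moebius A \<tau>) - cusp_value A) \<kappa> \<alpha>" using cusp_value_asymptotics(1)[OF assms False] by blast
  from hecke_prod_at_cusp[OF assms False this] show ?thesis by (elim exE) (intro exI)
qed

lemma hecke_prod_in_function_field: "hecke_prod \<in> function_field N"
  unfolding function_field_def
proof (intro CollectI conjI ballI)
  have "hecke_prod analytic_on upper_half_plane" using holomorphic_hecke_prod open_upper_half_plane by (simp add: analytic_on_open)
  thus "hecke_prod nicely_meromorphic_on upper_half_plane" by (rule analytic_on_imp_nicely_meromorphic_on)
  show "hecke_prod (moebius A \<tau>) = hecke_prod \<tau>" if "A \<in> Gamma0 N" "\<tau> \<in> upper_half_plane" for A \<tau>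
    using hecke_prod_invariant that by simp
  fix A assume A: "A \<in> SL2Z"
  have dA: "det A = 1" using A by (simp add: SL2Z_iff)
  have imA: "Im (moebius A \<tau>) > 0" if "Im \<tau> > 0" for \<tau> using that dA by (intro Im_moebius_pos) auto
  have hol: "(\<lambda>\<tau>. hecke_prod (moebius A \<tau>)) holomorphic_on upper_half_plane"
    using dA imA by (intro holomorphic_on_compose_gen[OF holomorphic_moebius holomorphic_hecke_prod, unfolded o_def]) auto
  have per: "hecke_prod (moebius A (\<tau> + of_int k * of_nat N)) = hecke_prod (moebius A \<tau>)" if t: "Im \<tau> > 0" for \<tau> k
  proof -
    define T where "T = mat2 1 (k * int N) 0 1"
    define \<gamma> where "\<gamma> = A ** T ** adj A"
    have dT: "det T = 1" by (simp add: T_def det_2)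
    have "\<gamma>$2$1 = - (A$2$1 * A$2$1 * k) * int N" by (simp add: \<gamma>_def T_def algebra_simps)
    hence "int N dvd \<gamma>$2$1" by simp
    moreover have "det \<gamma> = 1" using dA dT by (simp add: \<gamma>_def det_mul)
    ultimately have g: "\<gamma> \<in> Gamma0 N" by (simp add: Gamma0_iff)
    have "moebius T \<tau> = \<tau> + of_int k * of_nat N" by (simp add: T_def moebius_def)
    hence "moebius A (\<tau> + of_int k * of_nat N) = moebius (A ** T) \<tau>" using t dT by (simp add: moebius_compose[symmetric])
    also have "A ** T = \<gamma> ** A" using dA by (simp add: \<gamma>_def)
    also have "moebius (\<gamma> ** A) \<tau> = moebius \<gamma> (moebius A \<tau>)" using t dA by (simp add: moebius_compose)
    finally show ?thesis using hecke_prod_invariant[OF g imA[OF t]] by simp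
  qed
  obtain \<kappa> C where L: "leading (\<lambda>\<tau>. hecke_prod (moebius A \<tau>)) \<kappa> C" using hecke_prod_leading_cusp[OF A] by blast
  show "meromorphic_at_cusp N hecke_prod A"
    unfolding meromorphic_at_cusp_def using periodic_meromorphic_at_cusp[OF N_pos hol per L] .
qed

end

section \<open>The Hecke product as a rational function of the Hauptmodul\<close>

text \<open>
  A quotient of two powers of a function tending to \<open>0\<close> has a finite nonzero limit only if the exponents agree.
\<close>

lemma exponent_unique:
  fixes z u v :: "'a \<Rightarrow> complex" and a b :: nat
  assumes "F \<noteq> bot" "(z \<longlongrightarrow> 0) F" "eventually (\<lambda>x. z x \<noteq> 0) F"
    "(u \<longlongrightarrow> U) F" "(v \<longlongrightarrow> V) F" "U \<noteq> 0" "V \<noteq> 0"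
    "eventually (\<lambda>x. u x * z x ^ a = v x * z x ^ b) F"
  shows "a = b"
proof -
  have *: False if h: "(u \<longlongrightarrow> U) F" "(v \<longlongrightarrow> V) F" "U \<noteq> 0" "a < b"
    "eventually (\<lambda>x. u x * z x ^ a = v x * z x ^ b) F" for u v U V and a b :: nat
  proof -
    have "eventually (\<lambda>x. v x * z x ^ (b - a) = u x) F"
      using h(5) assms(3)
    proof eventually_elim
      case (elim x)
      have "z x ^ b = z x ^ (b - a) * z x ^ a" using h(4) by (simp add: power_add[symmetric])
      hence "u x * z x ^ a = (v x * z x ^ (b - a)) * z x ^ a" using elim(1) by simp
      thus ?case using elim(2) by simp
    qed
    moreover have "((\<lambda>x. v x * z x ^ (b - a)) \<longlongrightarrow> V * 0 ^ (b - a)) F"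
      using h(2) assms(2) by (intro tendsto_intros)
    ultimately have "(u \<longlongrightarrow> V * 0 ^ (b - a)) F" by (rule Lim_transform_eventually[rotated])
    hence "U = V * 0 ^ (b - a)" using h(1) tendsto_unique[OF assms(1)] by blast
    thus False using h(3,4) by simp
  qed
  have "\<not> a < b" using *[OF assms(4,5,6) _ assms(8)] by blast
  moreover have "eventually (\<lambda>x. v x * z x ^ b = u x * z x ^ a) F" using assms(8) by eventually_elim simp
  hence "\<not> b < a" using *[OF assms(5,4,7)] by blast
  ultimately show ?thesis by simp
qed

lemma poly_order_factor:
  fixes P :: "complex poly"
  assumes "P \<noteq> 0"
  obtains P1 where "\<And>z. poly P z = (z - c) ^ Polynomial.order c P * poly P1 z" "poly P1 c \<noteq> 0"
proof -
  obtain q where q: "P = [:- c, 1:] ^ Polynomial.order c P * q" "\<not> [:- c, 1:] dvd q" using order_decomp[OF assms, of c] by blast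
  have "poly P z = (z - c) ^ Polynomial.order c P * poly q z" for z
    using arg_cong[OF q(1), of "\<lambda>p. poly p z"] by (simp add: poly_power)
  moreover have "poly q c \<noteq> 0" using q(2) by (simp add: poly_eq_0_iff_dvd)
  ultimately show ?thesis by (rule that)
qed

context hauptmodul
begin

lemma j_minus_unit_expansion: "unit_expansion (\<lambda>\<tau>. (j \<tau> - c) * qpow 1 \<tau>) (- c)"
proof -
  obtain k where k: "((\<lambda>\<tau>. (j \<tau> - qpow (-1) \<tau>) * qpow (-1) \<tau>) \<longlongrightarrow> k) at_i_infinity"
    by (rule j_expansion_inf) (rule that)
  have "((\<lambda>\<tau>. (j \<tau> - qpow (-1) \<tau>) * qpow (-1) \<tau> * qpow 1 \<tau> - c) \<longlongrightarrow> k * 0 - c) at_i_infinity"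
    using k by (intro tendsto_intros qpow_tendsto_0) auto
  moreover have "(j \<tau> - qpow (-1) \<tau>) * qpow (-1) \<tau> * qpow 1 \<tau> - c = ((j \<tau> - c) * qpow 1 \<tau> - 1) * qpow (-1) \<tau>" for \<tau>
    by (simp add: qpow_minus field_simps)
  ultimately show ?thesis by (simp add: unit_expansion_def)
qed

text \<open>
  By factorization into linear factors \<open>j - c = q\<^sup>-\<^sup>1 (1 - c q + o(q))\<close>. The set \<open>Z\<close> may be larger than the set of roots, so
  that one index set serves numerator and denominator.
\<close>

lemma poly_j_at_infinity:
  fixes P :: "complex poly"
  assumes "finite Z" "{c. poly P c = 0} \<subseteq> Z" "P \<noteq> 0"
  shows "\<exists>s u. s \<noteq> 0 \<and> unit_expansion u (- (\<Sum>c\<in>Z. of_nat (Polynomial.order c P) * c)) \<and>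
    (\<forall>\<tau>. poly P (j \<tau>) = s * qpow (- real (\<Sum>c\<in>Z. Polynomial.order c P)) \<tau> * u \<tau>)"
proof -
  define u where "u = (\<lambda>\<tau>. \<Prod>c\<in>Z. ((j \<tau> - c) * qpow 1 \<tau>) ^ Polynomial.order c P)"
  have "unit_expansion u (\<Sum>c\<in>Z. of_nat (Polynomial.order c P) * (- c))"
    unfolding u_def using assms(1) by (intro unit_expansion_prod unit_expansion_power j_minus_unit_expansion)
  hence 1: "unit_expansion u (- (\<Sum>c\<in>Z. of_nat (Polynomial.order c P) * c))" by (simp add: sum_negf)
  have ord0: "Polynomial.order c P = 0" if "c \<in> Z - {c. poly P c = 0}" for c
    using that by (simp add: order_0I)
  have "poly P (j \<tau>) = lead_coeff P * qpow (- real (\<Sum>c\<in>Z. Polynomial.order c P)) \<tau> * u \<tau>" for \<tau>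
  proof -
    have "poly P (j \<tau>) = poly (Polynomial.smult (lead_coeff P) (\<Prod>z|poly P z = 0. [:-z, 1:] ^ Polynomial.order z P)) (j \<tau>)"
      by (simp only: complex_poly_decompose)
    also have "\<dots> = lead_coeff P * (\<Prod>z|poly P z = 0. (j \<tau> - z) ^ Polynomial.order z P)"
      by (simp add: poly_prod poly_power)
    also have "(\<Prod>z|poly P z = 0. (j \<tau> - z) ^ Polynomial.order z P) = (\<Prod>z\<in>Z. (j \<tau> - z) ^ Polynomial.order z P)"
      using assms ord0 by (intro prod.mono_neutral_left) auto
    also have "\<dots> = (\<Prod>z\<in>Z. qpow (- real (Polynomial.order z P)) \<tau> * ((j \<tau> - z) * qpow 1 \<tau>) ^ Polynomial.order z P)"
    proof (rule prod.cong[OF refl])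
      fix z
      have "qpow (- real (Polynomial.order z P)) \<tau> * qpow 1 \<tau> ^ Polynomial.order z P = 1"
        by (simp add: qpow_power qpow_add[symmetric])
      hence "(j \<tau> - z) ^ Polynomial.order z P = (j \<tau> - z) ^ Polynomial.order z P * (qpow (- real (Polynomial.order z P)) \<tau> * qpow 1 \<tau> ^ Polynomial.order z P)" by simp
      thus "(j \<tau> - z) ^ Polynomial.order z P = qpow (- real (Polynomial.order z P)) \<tau> * ((j \<tau> - z) * qpow 1 \<tau>) ^ Polynomial.order z P"
        by (simp only: power_mult_distrib ac_simps)
    qed
    also have "\<dots> = qpow (\<Sum>c\<in>Z. - real (Polynomial.order c P)) \<tau> * u \<tau>"
      by (simp only: prod.distrib qpow_sum[OF assms(1)] u_def)
    finally show ?thesis by (simp add: sum_negf)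
  qed
  thus ?thesis using 1 assms(3) by (intro exI[of _ "lead_coeff P"] exI[of _ u]) simp
qed

lemma j_neq_near:
  assumes "Im \<tau>0 > 0"
  shows "eventually (\<lambda>\<tau>. j \<tau> \<noteq> c) (at \<tau>0)"
proof (rule ccontr)
  assume "\<not> eventually (\<lambda>\<tau>. j \<tau> \<noteq> c) (at \<tau>0)"
  hence "frequently (\<lambda>\<tau>. j \<tau> = c) (at \<tau>0)" by (simp add: frequently_def)
  moreover have "eventually (\<lambda>\<tau>. \<tau> \<in> upper_half_plane) (at \<tau>0)"
    using eventually_at_in_open'[OF open_upper_half_plane, of \<tau>0] assms by simp
  ultimately have "frequently (\<lambda>\<tau>. \<tau> \<in> {\<tau> \<in> upper_half_plane. j \<tau> = c}) (at \<tau>0)"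
    by (rule frequently_rev_mp[OF _ eventually_mono]) auto
  hence lp: "\<tau>0 islimpt {\<tau> \<in> upper_half_plane. j \<tau> = c}" by (simp only: islimpt_conv_frequently_at)
  have hol: "(\<lambda>\<tau>. j \<tau> - c) holomorphic_on upper_half_plane" using holomorphic_j by (intro holomorphic_intros)
  have "j \<tau> - c = 0" if "\<tau> \<in> upper_half_plane" for \<tau>
    by (rule analytic_continuation[OF hol open_upper_half_plane connected_upper_half_plane _ _ lp _ that]) (use assms in auto)
  hence "j constant_on upper_half_plane" by (auto simp: constant_on_def)
  moreover have "Complex 0 1 \<in> upper_half_plane" by simp
  ultimately show False using j_nonconstant[OF open_upper_half_plane] by blast
qed

lemma isCont_j: "Im \<tau> > 0 \<Longrightarrow> isCont j \<tau>"
  using holomorphic_on_imp_continuous_on[OF holomorphic_j] continuous_on_eq_continuous_at[OF open_upper_half_plane] by fastforce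

end

context hecke
begin

lemma isCont_hecke_prod: "Im \<tau> > 0 \<Longrightarrow> isCont hecke_prod \<tau>"
  using holomorphic_on_imp_continuous_on[OF holomorphic_hecke_prod] continuous_on_eq_continuous_at[OF open_upper_half_plane] by fastforce

text \<open>
  The function field gives the identity off a sparse set. Multiplied by the denominator, both sides are continuous,
  so it holds everywhere.
\<close>

lemma hecke_prod_rational:
  obtains P Q :: "complex poly" where "P \<noteq> 0" "Q \<noteq> 0" "\<And>\<tau>. Im \<tau> > 0 \<Longrightarrow> hecke_prod \<tau> * poly Q (j \<tau>) = poly P (j \<tau>)"
proof -
  obtain P Q :: "complex poly" where PQ: "Q \<noteq> 0" "\<forall>\<^sub>\<approx>\<tau>\<in>upper_half_plane. hecke_prod \<tau> = poly P (j \<tau>) / poly Q (j \<tau>)"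
    using Hauptmodul hecke_prod_in_function_field unfolding is_Hauptmodul_def by blast
  have eq: "hecke_prod \<tau> * poly Q (j \<tau>) = poly P (j \<tau>)" if t: "Im \<tau> > 0" for \<tau>
  proof -
    have "eventually (\<lambda>\<tau>. hecke_prod \<tau> = poly P (j \<tau>) / poly Q (j \<tau>)) (at \<tau>)"
      using eventually_cosparse_imp_eventually_at[OF PQ(2), of \<tau> UNIV] t by simp
    moreover have "eventually (\<lambda>\<tau>. \<forall>c\<in>{c. poly Q c = 0}. j \<tau> \<noteq> c) (at \<tau>)"
      using poly_roots_finite[OF PQ(1)] j_neq_near[OF t] by (intro eventually_ball_finite) auto
    ultimately have "eventually (\<lambda>\<tau>. 0 = hecke_prod \<tau> * poly Q (j \<tau>) - poly P (j \<tau>)) (at \<tau>)"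
      by eventually_elim auto
    hence "((\<lambda>\<tau>. hecke_prod \<tau> * poly Q (j \<tau>) - poly P (j \<tau>)) \<longlongrightarrow> 0) (at \<tau>)"
      by (rule Lim_transform_eventually[OF tendsto_const])
    moreover have "isCont (\<lambda>\<tau>. hecke_prod \<tau> * poly Q (j \<tau>) - poly P (j \<tau>)) \<tau>"
      using isCont_hecke_prod[OF t] isCont_j[OF t] by (intro continuous_intros)
    hence "((\<lambda>\<tau>. hecke_prod \<tau> * poly Q (j \<tau>) - poly P (j \<tau>)) \<longlongrightarrow> hecke_prod \<tau> * poly Q (j \<tau>) - poly P (j \<tau>)) (at \<tau>)"
      by (simp add: isCont_def)
    ultimately have "hecke_prod \<tau> * poly Q (j \<tau>) - poly P (j \<tau>) = 0" using tendsto_unique[OF at_neq_bot] by blast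
    thus ?thesis by simp
  qed
  have "P \<noteq> 0"
  proof
    assume P0: "P = 0"
    obtain s u where su: "s \<noteq> 0" "unit_expansion u (- (\<Sum>c|poly Q c = 0. of_nat (Polynomial.order c Q) * c))"
      "\<forall>\<tau>. poly Q (j \<tau>) = s * qpow (- real (\<Sum>c|poly Q c = 0. Polynomial.order c Q)) \<tau> * u \<tau>"
      using poly_j_at_infinity[OF poly_roots_finite[OF PQ(1)] order.refl PQ(1)] by blast
    obtain s' where "leading hecke_prod (- real pole_order) s'" using hecke_prod_leading_infinity by blast
    hence "eventually (\<lambda>\<tau>. hecke_prod \<tau> * qpow (- (- real pole_order)) \<tau> \<noteq> 0) at_i_infinity"
      unfolding leading_def by (intro tendsto_imp_eventually_ne) auto
    moreover have "eventually (\<lambda>\<tau>. u \<tau> \<noteq> 0) at_i_infinity"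
      using unit_expansion_tendsto_1[OF su(2)] by (rule tendsto_imp_eventually_ne) simp
    ultimately have "eventually (\<lambda>\<tau>. False) at_i_infinity" using eventually_Im_gt[of 0]
    proof eventually_elim
      case (elim \<tau>)
      thus ?case using eq[of \<tau>] P0 su by simp
    qed
    thus False by simp
  qed
  from that[OF this PQ(1) eq] show ?thesis .
qed

lemma order_at_point:
  fixes P Q :: "complex poly"
  assumes "P \<noteq> 0" "Q \<noteq> 0" "\<And>\<tau>. Im \<tau> > 0 \<Longrightarrow> hecke_prod \<tau> * poly Q (j \<tau>) = poly P (j \<tau>)" "Im \<tau>0 > 0"
  shows "card {X \<in> hcosets N n. \<exists>A\<in>X. moebius A \<tau>0 = \<tau>0} + Polynomial.order (j \<tau>0) Q = Polynomial.order (j \<tau>0) P"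
proof -
  define k where "k = card {X \<in> hcosets N n. \<exists>A\<in>X. moebius A \<tau>0 = \<tau>0}"
  define c where "c = j \<tau>0"
  obtain P1 where P1: "\<And>z. poly P z = (z - c) ^ Polynomial.order c P * poly P1 z" "poly P1 c \<noteq> 0" by (rule poly_order_factor[OF assms(1)]) (rule that)
  obtain Q1 where Q1: "\<And>z. poly Q z = (z - c) ^ Polynomial.order c Q * poly Q1 z" "poly Q1 c \<noteq> 0" by (rule poly_order_factor[OF assms(2)]) (rule that)
  obtain E where E: "E \<noteq> 0" "((\<lambda>\<tau>. hecke_prod \<tau> / (j \<tau> - c) ^ k) \<longlongrightarrow> E) (at \<tau>0)"
    using hecke_prod_at_point[OF assms(4)] unfolding k_def c_def by blast
  have jc: "(j \<longlongrightarrow> c) (at \<tau>0)" using isCont_j[OF assms(4)] by (simp add: isCont_def c_def)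
  have z0: "((\<lambda>\<tau>. j \<tau> - c) \<longlongrightarrow> 0) (at \<tau>0)" using jc by (simp add: LIM_zero)
  have nz: "eventually (\<lambda>\<tau>. j \<tau> - c \<noteq> 0) (at \<tau>0)" using j_neq_near[OF assms(4), of c] by simp
  have u: "((\<lambda>\<tau>. hecke_prod \<tau> / (j \<tau> - c) ^ k * poly Q1 (j \<tau>)) \<longlongrightarrow> E * poly Q1 c) (at \<tau>0)"
    using E(2) jc by (intro tendsto_mult tendsto_poly)
  have v: "((\<lambda>\<tau>. poly P1 (j \<tau>)) \<longlongrightarrow> poly P1 c) (at \<tau>0)" using jc by (intro tendsto_poly)
  have UV: "E * poly Q1 c \<noteq> 0" "poly P1 c \<noteq> 0" using E(1) P1(2) Q1(2) by auto
  have "eventually (\<lambda>\<tau>. Im \<tau> > 0) (at \<tau>0)" using eventually_at_in_open'[OF open_upper_half_plane, of \<tau>0] assms(4) by simp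
  hence ev: "eventually (\<lambda>\<tau>. hecke_prod \<tau> / (j \<tau> - c) ^ k * poly Q1 (j \<tau>) * (j \<tau> - c) ^ (k + Polynomial.order c Q)
      = poly P1 (j \<tau>) * (j \<tau> - c) ^ Polynomial.order c P) (at \<tau>0)"
    using nz
  proof eventually_elim
    case (elim \<tau>)
    have "hecke_prod \<tau> / (j \<tau> - c) ^ k * poly Q1 (j \<tau>) * (j \<tau> - c) ^ (k + Polynomial.order c Q) = hecke_prod \<tau> * poly Q (j \<tau>)"
      using elim(2) by (simp add: Q1(1) power_add)
    also have "\<dots> = poly P1 (j \<tau>) * (j \<tau> - c) ^ Polynomial.order c P" using assms(3)[OF elim(1)] by (simp add: P1(1))
    finally show ?case .
  qed
  have "k + Polynomial.order c Q = Polynomial.order c P"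
    by (rule exponent_unique[OF at_neq_bot z0 nz u v UV ev])
  thus ?thesis by (simp add: k_def c_def)
qed

lemma order_at_cusp:
  fixes P Q :: "complex poly" and \<sigma> :: "int^2^2"
  assumes "P \<noteq> 0" "Q \<noteq> 0" "\<And>\<tau>. Im \<tau> > 0 \<Longrightarrow> hecke_prod \<tau> * poly Q (j \<tau>) = poly P (j \<tau>)" "\<sigma> \<in> SL2Z" "\<sigma> \<notin> Gamma0 N"
  defines "b \<equiv> nat \<bar>\<sigma>$2$1\<bar>"
  shows "(\<Sum>d | d dvd n \<and> [n = d^2] (mod gcd b (N div gcd b N)). min d (n div d)) + Polynomial.order (cusp_value \<sigma>) Q = Polynomial.order (cusp_value \<sigma>) P"
proof -
  define v where "v = (\<Sum>d | d dvd n \<and> [n = d^2] (mod gcd b (N div gcd b N)). min d (n div d))"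
  define c where "c = cusp_value \<sigma>"
  obtain \<kappa> \<alpha> where ka: "\<kappa> > 0" "leading (\<lambda>\<tau>. j (moebius \<sigma> \<tau>) - c) \<kappa> \<alpha>" using cusp_value_asymptotics(1)[OF assms(4,5)] unfolding c_def by blast
  obtain C where C: "leading (\<lambda>\<tau>. hecke_prod (moebius \<sigma> \<tau>)) (\<kappa> * real v) C"
    using hecke_prod_at_cusp[OF assms(4,5) ka(2)[unfolded c_def]] unfolding v_def b_def by (elim exE)
  have lead_poly: "\<exists>E. leading (\<lambda>\<tau>. poly R (j (moebius \<sigma> \<tau>))) (real (Polynomial.order c R) * \<kappa>) E" if R: "R \<noteq> 0" for R :: "complex poly"
  proof -
    obtain R1 where R1: "\<And>z. poly R z = (z - c) ^ Polynomial.order c R * poly R1 z" "poly R1 c \<noteq> 0" by (rule poly_order_factor[OF R]) (rule that)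
    have "((\<lambda>\<tau>. poly R1 (j (moebius \<sigma> \<tau>))) \<longlongrightarrow> poly R1 c) at_i_infinity"
      using cusp_value_asymptotics(2)[OF assms(4,5)] unfolding c_def by (intro tendsto_poly)
    hence "leading (\<lambda>\<tau>. poly R1 (j (moebius \<sigma> \<tau>))) 0 (poly R1 c)" using R1(2) by (simp add: leading_def)
    from leading_mult[OF leading_power[OF ka(2), of "Polynomial.order c R"] this] show ?thesis by (auto simp: R1(1))
  qed
  obtain EP where EP: "leading (\<lambda>\<tau>. poly P (j (moebius \<sigma> \<tau>))) (real (Polynomial.order c P) * \<kappa>) EP" using lead_poly[OF assms(1)] by blast
  obtain EQ where EQ: "leading (\<lambda>\<tau>. poly Q (j (moebius \<sigma> \<tau>))) (real (Polynomial.order c Q) * \<kappa>) EQ" using lead_poly[OF assms(2)] by blast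
  have "leading (\<lambda>\<tau>. poly P (j (moebius \<sigma> \<tau>))) (\<kappa> * real v + real (Polynomial.order c Q) * \<kappa>) (C * EQ)"
  proof (rule leading_cong[OF leading_mult[OF C EQ]], rule eventually_mono[OF eventually_Im_gt[of 0]])
    fix \<tau> assume "Im \<tau> > 0"
    hence "Im (moebius \<sigma> \<tau>) > 0" using assms(4) by (intro Im_moebius_pos) (auto simp: SL2Z_iff)
    from assms(3)[OF this] show "hecke_prod (moebius \<sigma> \<tau>) * poly Q (j (moebius \<sigma> \<tau>)) = poly P (j (moebius \<sigma> \<tau>))" .
  qed
  hence "\<kappa> * real v + real (Polynomial.order c Q) * \<kappa> = real (Polynomial.order c P) * \<kappa>" using leading_unique(1)[OF _ EP] by blast
  hence "\<kappa> * (real v + real (Polynomial.order c Q)) = \<kappa> * real (Polynomial.order c P)" by (simp add: algebra_simps)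
  hence "real v + real (Polynomial.order c Q) = real (Polynomial.order c P)" using ka(1) by simp
  hence "v + Polynomial.order c Q = Polynomial.order c P" by linarith
  thus ?thesis by (simp add: v_def c_def)
qed

text \<open>
  The two sides of \<open>\<Phi> Q(j) = P(j)\<close> are compared at infinity: first the leading exponents, then the coefficients of \<open>q\<close>.
\<close>

lemma order_sums:
  fixes P Q :: "complex poly"
  assumes "P \<noteq> 0" "Q \<noteq> 0" "\<And>\<tau>. Im \<tau> > 0 \<Longrightarrow> hecke_prod \<tau> * poly Q (j \<tau>) = poly P (j \<tau>)"
    "finite Z" "{c. poly P c = 0} \<subseteq> Z" "{c. poly Q c = 0} \<subseteq> Z"
  defines "m \<equiv> \<lambda>c. complex_of_int (int (Polynomial.order c P) - int (Polynomial.order c Q))"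
  shows "(\<Sum>c\<in>Z. m c) = of_nat pole_order" "(\<Sum>c\<in>Z. m c * c) = of_nat adjacent_divisors"
proof -
  obtain sP uP where P: "sP \<noteq> 0" "unit_expansion uP (- (\<Sum>c\<in>Z. of_nat (Polynomial.order c P) * c))"
    "\<forall>\<tau>. poly P (j \<tau>) = sP * qpow (- real (\<Sum>c\<in>Z. Polynomial.order c P)) \<tau> * uP \<tau>"
    using poly_j_at_infinity[OF assms(4,5,1)] by blast
  obtain sQ uQ where Q: "sQ \<noteq> 0" "unit_expansion uQ (- (\<Sum>c\<in>Z. of_nat (Polynomial.order c Q) * c))"
    "\<forall>\<tau>. poly Q (j \<tau>) = sQ * qpow (- real (\<Sum>c\<in>Z. Polynomial.order c Q)) \<tau> * uQ \<tau>"
    using poly_j_at_infinity[OF assms(4,6,2)] by blast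
  obtain s u where s: "s \<noteq> 0" "unit_expansion u (- of_nat adjacent_divisors)"
    "eventually (\<lambda>\<tau>. hecke_prod \<tau> = s * qpow (- real pole_order) \<tau> * u \<tau>) at_i_infinity" using hecke_prod_at_infinity by blast
  have monomial: "leading (\<lambda>\<tau>. t * qpow \<kappa> \<tau> * w \<tau>) \<kappa> t" if "t \<noteq> 0" "unit_expansion w x" for t \<kappa> w x
  proof -
    have "leading (\<lambda>\<tau>. t * qpow \<kappa> \<tau>) \<kappa> t" using that(1) by (simp add: leading_def qpow_add[symmetric] mult.assoc)
    from leading_mult[OF this unit_expansion_leading[OF that(2)]] show ?thesis by simp
  qed
  have uQ: "unit_expansion (\<lambda>\<tau>. u \<tau> * uQ \<tau>) (- of_nat adjacent_divisors - (\<Sum>c\<in>Z. of_nat (Polynomial.order c Q) * c))"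
    using unit_expansion_mult[OF s(2) Q(2)] by simp
  define a where "a = - real pole_order - real (\<Sum>c\<in>Z. Polynomial.order c Q)"
  have ev: "eventually (\<lambda>\<tau>. (s * sQ) * qpow a \<tau> * (u \<tau> * uQ \<tau>) = sP * qpow (- real (\<Sum>c\<in>Z. Polynomial.order c P)) \<tau> * uP \<tau>) at_i_infinity"
    using s(3) eventually_Im_gt[of 0]
  proof eventually_elim
    case (elim \<tau>)
    have "qpow a \<tau> = qpow (- real pole_order) \<tau> * qpow (- real (\<Sum>c\<in>Z. Polynomial.order c Q)) \<tau>"
      unfolding a_def by (simp only: qpow_add[symmetric] add_uminus_conv_diff)
    hence "(s * sQ) * qpow a \<tau> * (u \<tau> * uQ \<tau>) = hecke_prod \<tau> * poly Q (j \<tau>)"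
      unfolding elim(1) Q(3)[rule_format] by (simp only: ac_simps)
    thus ?case using assms(3)[OF elim(2)] P(3) by simp
  qed
  have l1: "leading (\<lambda>\<tau>. sP * qpow (- real (\<Sum>c\<in>Z. Polynomial.order c P)) \<tau> * uP \<tau>) a (s * sQ)"
    by (rule leading_cong[OF monomial[OF _ uQ] ev]) (use s(1) Q(1) in simp)
  have l2: "leading (\<lambda>\<tau>. sP * qpow (- real (\<Sum>c\<in>Z. Polynomial.order c P)) \<tau> * uP \<tau>) (- real (\<Sum>c\<in>Z. Polynomial.order c P)) sP"
    by (rule monomial[OF P(1,2)])
  have e1: "a = - real (\<Sum>c\<in>Z. Polynomial.order c P)" "s * sQ = sP" using leading_unique[OF l1 l2] by auto
  have "real pole_order + real (\<Sum>c\<in>Z. Polynomial.order c Q) = real (\<Sum>c\<in>Z. Polynomial.order c P)" using e1(1) unfolding a_def by linarith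
  hence "pole_order + (\<Sum>c\<in>Z. Polynomial.order c Q) = (\<Sum>c\<in>Z. Polynomial.order c P)" by (simp only: of_nat_add[symmetric] of_nat_eq_iff)
  hence "(of_nat (pole_order + (\<Sum>c\<in>Z. Polynomial.order c Q)) :: complex) = of_nat (\<Sum>c\<in>Z. Polynomial.order c P)" by simp
  thus "(\<Sum>c\<in>Z. m c) = of_nat pole_order" by (simp add: m_def sum_subtractf algebra_simps)
  have "eventually (\<lambda>\<tau>. u \<tau> * uQ \<tau> = uP \<tau>) at_i_infinity"
    using ev by eventually_elim (use e1 P(1) in simp)
  from unit_expansion_cong[OF uQ this] have "- of_nat adjacent_divisors - (\<Sum>c\<in>Z. of_nat (Polynomial.order c Q) * c) = - (\<Sum>c\<in>Z. of_nat (Polynomial.order c P) * c)"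
    using unit_expansion_unique[OF _ P(2)] by blast
  thus "(\<Sum>c\<in>Z. m c * c) = of_nat adjacent_divisors"
    by (simp add: m_def sum_subtractf left_diff_distrib algebra_simps)
qed

end

section \<open>Sums over classes of forms and over cusps\<close>

lemma cusp_denom_eq:
  fixes \<sigma> :: "int^2^2"
  assumes "\<sigma> \<in> SL2Z"
  shows "cusp_denom (moebius_ext \<sigma> Infty) = nat \<bar>\<sigma>$2$1\<bar>"
  unfolding cusp_denom_def moebius_ext_Infty
proof (rule the_equality)
  have reduced: "coprime (\<sigma>$1$1) (\<sigma>$2$1)" by (rule SL2Z_coprime(1)[OF assms])
  define s where "s = (if \<sigma>$2$1 < 0 then -1 else 1 :: int)"
  have c: "int (nat \<bar>\<sigma>$2$1\<bar>) = s * \<sigma>$2$1" by (simp add: s_def)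
  have "coprime (s * \<sigma>$1$1) (s * \<sigma>$2$1)" using reduced by (simp add: s_def)
  moreover from this have "cusp (\<sigma>$1$1) (\<sigma>$2$1) = cusp (s * \<sigma>$1$1) (s * \<sigma>$2$1)"
    using reduced by (subst cusp_eq_iff) simp_all
  ultimately show "\<exists>a. coprime a (int (nat \<bar>\<sigma>$2$1\<bar>)) \<and> cusp (\<sigma>$1$1) (\<sigma>$2$1) = cusp a (int (nat \<bar>\<sigma>$2$1\<bar>))"
    unfolding c by blast
  fix b assume "\<exists>a. coprime a (int b) \<and> cusp (\<sigma>$1$1) (\<sigma>$2$1) = cusp a (int b)"
  then obtain a where a: "coprime a (int b)" "cusp (\<sigma>$1$1) (\<sigma>$2$1) = cusp a (int b)" by blast
  hence e: "\<sigma>$1$1 * int b = a * \<sigma>$2$1" using cusp_eq_iff[OF reduced a(1)] by simp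
  have "\<sigma>$2$1 dvd \<sigma>$1$1 * int b" unfolding e by simp
  hence 1: "\<sigma>$2$1 dvd int b" using reduced by (simp add: coprime_commute coprime_dvd_mult_right_iff)
  have "int b dvd a * \<sigma>$2$1" unfolding e[symmetric] by simp
  hence 2: "int b dvd \<sigma>$2$1" using a(1) by (simp add: coprime_commute coprime_dvd_mult_right_iff)
  show "b = nat \<bar>\<sigma>$2$1\<bar>" using zdvd_antisym_abs[OF 1 2] by simp
qed

lemma equiv_form_equiv: "equiv (forms D N) (form_equiv D N)"
proof (rule equivI)
  show "form_equiv D N \<subseteq> forms D N \<times> forms D N" by (auto simp: form_equiv_def)
  show "refl_on (forms D N) (form_equiv D N)"
  proof (rule refl_onI)
    fix Q assume "Q \<in> forms D N"
    moreover have "Q = form_act Q (mat 1)" by (cases Q) simp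
    hence "\<exists>A\<in>Gamma0 N. Q = form_act Q A" by (intro bexI[of _ "mat 1"]) simp_all
    ultimately show "(Q, Q) \<in> form_equiv D N" by (simp add: form_equiv_def)
  qed
  have act_mult: "form_act (form_act Q A) B = form_act Q (A ** B)" for Q A B
    by (cases Q) (simp add: power2_eq_square algebra_simps)
  show "sym (form_equiv D N)"
  proof (rule symI)
    fix P Q assume "(P, Q) \<in> form_equiv D N"
    then obtain A where A: "P \<in> forms D N" "Q \<in> forms D N" "A \<in> Gamma0 N" "Q = form_act P A" by (auto simp: form_equiv_def)
    have "form_act Q (adj A) = form_act P (mat 1)" unfolding A(4) act_mult using A(3) by (simp add: Gamma0_iff)
    also have "\<dots> = P" by (cases P) simp
    finally have "P = form_act Q (adj A)" ..
    thus "(Q, P) \<in> form_equiv D N" using A Gamma0_closed(3)[OF A(3)] unfolding form_equiv_def by blast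
  qed
  show "trans (form_equiv D N)"
  proof (rule transI)
    fix P Q R assume "(P, Q) \<in> form_equiv D N" "(Q, R) \<in> form_equiv D N"
    then obtain A B where A: "P \<in> forms D N" "R \<in> forms D N" "A \<in> Gamma0 N" "B \<in> Gamma0 N" "R = form_act P (A ** B)"
      by (auto simp: form_equiv_def act_mult)
    thus "(P, R) \<in> form_equiv D N" unfolding form_equiv_def using Gamma0_closed(2)[OF A(3,4)] by blast
  qed
qed

lemma stabilizer_order_moebius:
  assumes "Im \<tau> > 0" "\<gamma> \<in> Gamma0 N"
  shows "stabilizer_order N (moebius \<gamma> \<tau>) = stabilizer_order N \<tau>"
proof -
  have dg: "det \<gamma> = 1" using assms(2) by (simp add: Gamma0_iff)
  have im: "Im (moebius \<gamma> \<tau>) > 0" using assms(1) dg by (intro Im_moebius_pos) auto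
  have "bij_betw (\<lambda>A. \<gamma> ** A ** adj \<gamma>) {A \<in> Gamma0 N. moebius A \<tau> = \<tau>} {A \<in> Gamma0 N. moebius A (moebius \<gamma> \<tau>) = moebius \<gamma> \<tau>}"
  proof (rule bij_betw_byWitness[where f' = "\<lambda>A. adj \<gamma> ** A ** \<gamma>"])
    show "\<forall>A\<in>{A \<in> Gamma0 N. moebius A \<tau> = \<tau>}. adj \<gamma> ** (\<gamma> ** A ** adj \<gamma>) ** \<gamma> = A"
      using dg by (simp add: matrix_mul_assoc)
    show "\<forall>A\<in>{A \<in> Gamma0 N. moebius A (moebius \<gamma> \<tau>) = moebius \<gamma> \<tau>}. \<gamma> ** (adj \<gamma> ** A ** \<gamma>) ** adj \<gamma> = A"
      using dg by (simp add: matrix_mul_assoc)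
    have "moebius (\<gamma> ** A ** adj \<gamma>) (moebius \<gamma> \<tau>) = moebius \<gamma> \<tau>" if A: "A \<in> Gamma0 N" "moebius A \<tau> = \<tau>" for A
    proof -
      have dA: "det A = 1" using A by (simp add: Gamma0_iff)
      have "moebius (\<gamma> ** A ** adj \<gamma>) (moebius \<gamma> \<tau>) = moebius (\<gamma> ** A) \<tau>" using assms(1) dg by (simp add: moebius_compose)
      also have "\<dots> = moebius \<gamma> (moebius A \<tau>)" using assms(1) dA by (simp add: moebius_compose)
      finally show ?thesis using A(2) by simp
    qed
    thus "(\<lambda>A. \<gamma> ** A ** adj \<gamma>) ` {A \<in> Gamma0 N. moebius A \<tau> = \<tau>} \<subseteq> {A \<in> Gamma0 N. moebius A (moebius \<gamma> \<tau>) = moebius \<gamma> \<tau>}"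
      using assms(2) by auto
    have "moebius (adj \<gamma> ** A ** \<gamma>) \<tau> = \<tau>" if A: "A \<in> Gamma0 N" "moebius A (moebius \<gamma> \<tau>) = moebius \<gamma> \<tau>" for A
    proof -
      have dA: "det A = 1" using A by (simp add: Gamma0_iff)
      have "moebius (adj \<gamma> ** A ** \<gamma>) \<tau> = moebius (adj \<gamma> ** A) (moebius \<gamma> \<tau>)" using assms(1) dg by (simp add: moebius_compose)
      also have "\<dots> = moebius (adj \<gamma>) (moebius A (moebius \<gamma> \<tau>))" using im dA by (simp add: moebius_compose[OF im])
      finally show ?thesis using A(2) moebius_adj[OF assms(1), of \<gamma>] dg by simp
    qed
    thus "(\<lambda>A. adj \<gamma> ** A ** \<gamma>) ` {A \<in> Gamma0 N. moebius A (moebius \<gamma> \<tau>) = moebius \<gamma> \<tau>} \<subseteq> {A \<in> Gamma0 N. moebius A \<tau> = \<tau>}"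
      using assms(2) by auto
  qed
  from bij_betw_same_card[OF this] show ?thesis
    unfolding card_stabilizer(2)[OF assms(1)] card_stabilizer(2)[OF im] by simp
qed

context hecke
begin

definition elliptic_traces :: "int set" where
  "elliptic_traces = {r. \<bar>real_of_int r\<bar> < 2 * sqrt (real n)}"

lemma finite_elliptic_traces: "finite elliptic_traces"
  unfolding elliptic_traces_def by (rule finite_abs_less)

lemma elliptic_trace_disc_neg: "r \<in> elliptic_traces \<Longrightarrow> r\<^sup>2 - 4 * int n < 0"
  unfolding elliptic_traces_def mem_Collect_eq abs_less_two_sqrt_iff .

text \<open>
  One function covers both statements of the theorem: \<open>h = 1\<close> gives the class number, \<open>h\<close> the identity the trace.
\<close>

definition class_sum :: "(complex \<Rightarrow> complex) \<Rightarrow> int \<Rightarrow> complex" where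
  "class_sum h D = (\<Sum>X \<in> forms D N // form_equiv D N. let Q = (SOME Q. Q \<in> X) in
     1 / of_nat (form_weight N Q) * h (j (form_root Q)))"

definition preimage :: "complex \<Rightarrow> complex" where
  "preimage c = (SOME \<tau>. Im \<tau> > 0 \<and> j \<tau> = c)"

lemma preimage: "c \<in> j ` upper_half_plane \<Longrightarrow> Im (preimage c) > 0 \<and> j (preimage c) = c"
  unfolding preimage_def by (rule someI_ex) auto

text \<open>
  A class of forms is determined by the value of \<open>j\<close> at the root, since equivalence of forms is equivalence of roots and
  \<open>j\<close> separates orbits. So the sum may be taken over values of \<open>j\<close>. The finiteness of the number of classes comes for
  free, as these values lie in the finite set \<open>Z\<close>.
\<close>

lemma class_sum_eq:
  assumes D: "D < 0" and Z: "finite Z" "\<And>Q. Q \<in> forms D N \<Longrightarrow> j (form_root Q) \<in> Z"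
  shows "class_sum h D = (\<Sum>c\<in>Z \<inter> j ` upper_half_plane.
     if \<exists>Q\<in>forms D N. form_root Q = preimage c then 1 / of_nat (stabilizer_order N (preimage c)) * h c else 0)"
proof -
  let ?C = "forms D N // form_equiv D N"
  define rep where "rep = (\<lambda>X :: qform set. SOME Q. Q \<in> X)"
  define val where "val = (\<lambda>X. j (form_root (rep X)))"
  note eq = equiv_form_equiv[of D N]
  have rep: "rep X \<in> X" "rep X \<in> forms D N" if X: "X \<in> ?C" for X
  proof -
    have "X \<noteq> {}" using in_quotient_imp_non_empty[OF eq X] .
    thus r: "rep X \<in> X" unfolding rep_def by (metis ex_in_conv someI_ex)
    thus "rep X \<in> forms D N" using in_quotient_imp_subset[OF eq X] by blast
  qed
  have root: "Im (form_root Q) > 0" if "Q \<in> forms D N" for Q using that form_root(1) by (auto simp: forms_def)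
  have conj: "(Q, Q') \<in> form_equiv D N" if Q: "Q \<in> forms D N" "Q' \<in> forms D N" "j (form_root Q) = j (form_root Q')" for Q Q'
  proof -
    obtain \<gamma> where g: "\<gamma> \<in> Gamma0 N" "form_root Q = moebius \<gamma> (form_root Q')"
      using j_injective[OF root[OF Q(2)] root[OF Q(1)]] Q(3) by auto
    hence "form_act Q \<gamma> = Q'" using form_act_eq_iff[OF Q(1,2) D g(1)] by simp
    thus ?thesis using Q g(1) unfolding form_equiv_def by blast
  qed
  have inj: "inj_on val ?C"
  proof (rule inj_onI)
    fix X Y assume XY: "X \<in> ?C" "Y \<in> ?C" "val X = val Y"
    hence "(rep X, rep Y) \<in> form_equiv D N" using conj rep unfolding val_def by blast
    thus "X = Y" using quotient_eqI[OF eq XY(1,2) rep(1)[OF XY(1)] rep(1)[OF XY(2)]] by blast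
  qed
  define Z' where "Z' = {c \<in> Z \<inter> j ` upper_half_plane. \<exists>Q\<in>forms D N. form_root Q = preimage c}"
  have pt_form: "\<exists>Q'\<in>forms D N. form_root Q' = preimage (j (form_root Q)) \<and>
      stabilizer_order N (preimage (j (form_root Q))) = stabilizer_order N (form_root Q)" if Q: "Q \<in> forms D N" for Q
  proof -
    define c where "c = j (form_root Q)"
    have "c \<in> j ` upper_half_plane" unfolding c_def by (rule imageI) (simp add: root[OF Q])
    hence p: "Im (preimage c) > 0" "j (preimage c) = j (form_root Q)" using preimage[of c] by (auto simp: c_def)
    obtain \<gamma> where g: "\<gamma> \<in> Gamma0 N" "preimage c = moebius \<gamma> (form_root Q)" using j_injective[OF root[OF Q] p(1)] p(2) by auto
    have pd: "form_pos_def Q" using Q by (simp add: forms_def)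
    have "form_root (form_act Q (adj \<gamma>)) = preimage c" using form_act_props(3)[OF pd, of "adj \<gamma>"] g Gamma0_SL2Z by simp
    moreover have "form_act Q (adj \<gamma>) \<in> forms D N" by (rule form_act_forms[OF Q Gamma0_closed(3)[OF g(1)]])
    moreover have "stabilizer_order N (preimage c) = stabilizer_order N (form_root Q)"
      unfolding g(2) by (rule stabilizer_order_moebius[OF root[OF Q] g(1)])
    ultimately show ?thesis unfolding c_def by blast
  qed
  have img: "val ` ?C = Z'"
  proof (intro equalityI subsetI)
    fix c assume "c \<in> val ` ?C"
    then obtain X where X: "X \<in> ?C" "c = j (form_root (rep X))" by (auto simp: val_def)
    have "c \<in> j ` upper_half_plane" unfolding X(2) by (rule imageI) (simp add: root[OF rep(2)[OF X(1)]])
    moreover have "c \<in> Z" unfolding X(2) by (rule Z(2)[OF rep(2)[OF X(1)]])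
    moreover have "\<exists>Q\<in>forms D N. form_root Q = preimage c" unfolding X(2) using pt_form[OF rep(2)[OF X(1)]] by blast
    ultimately show "c \<in> Z'" by (simp add: Z'_def)
  next
    fix c assume "c \<in> Z'"
    then obtain Q where Q: "Q \<in> forms D N" "form_root Q = preimage c" "c \<in> j ` upper_half_plane" by (auto simp: Z'_def)
    define X where "X = form_equiv D N `` {Q}"
    have X: "X \<in> ?C" unfolding X_def using Q(1) by (rule quotientI)
    have "(Q, rep X) \<in> form_equiv D N" using rep(1)[OF X] by (simp add: X_def)
    then obtain A where A: "A \<in> Gamma0 N" "rep X = form_act Q A" by (auto simp: form_equiv_def)
    have pd: "form_pos_def Q" using Q by (simp add: forms_def)
    have "form_root (rep X) = moebius (adj A) (form_root Q)"
      unfolding A(2) using form_act_props(3)[OF pd] A(1) Gamma0_SL2Z by blast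
    hence "val X = j (form_root Q)" unfolding val_def using j_invariant[OF Gamma0_closed(3)[OF A(1)] root[OF Q(1)]] by simp
    also have "\<dots> = c" using Q(2) preimage[OF Q(3)] by simp
    finally show "c \<in> val ` ?C" using X by blast
  qed
  have wt: "form_weight N (rep X) = stabilizer_order N (preimage (val X))" if X: "X \<in> ?C" for X
    using form_weight_eq[OF rep(2)[OF X] D] pt_form[OF rep(2)[OF X]] by (auto simp: val_def)
  have repX: "(SOME Q. Q \<in> X) = rep X" for X by (simp add: rep_def)
  have "class_sum h D = (\<Sum>X\<in>?C. 1 / of_nat (stabilizer_order N (preimage (val X))) * h (val X))"
    unfolding class_sum_def Let_def repX by (rule sum.cong[OF refl]) (simp add: wt val_def)
  also have "\<dots> = (\<Sum>c\<in>val ` ?C. 1 / of_nat (stabilizer_order N (preimage c)) * h c)"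
    by (rule sum.reindex[OF inj, unfolded o_def, symmetric])
  also have "\<dots> = (\<Sum>c\<in>Z'. 1 / of_nat (stabilizer_order N (preimage c)) * h c)" unfolding img ..
  also have "\<dots> = (\<Sum>c\<in>Z \<inter> j ` upper_half_plane.
     if \<exists>Q\<in>forms D N. form_root Q = preimage c then 1 / of_nat (stabilizer_order N (preimage c)) * h c else 0)"
    unfolding Z'_def by (rule sum.inter_filter) (use Z(1) in auto)
  finally show ?thesis .
qed

text \<open>
  The set \<open>Z\<close> of zeros and poles of \<open>R\<close>, enlarged by the cusp values, is the disjoint union of values on the upper half
  plane and cusp values. The orders of \<open>R\<close> on the first part are the sums over classes of forms, on the second part the
  numbers \<open>\<nu> s n N\<close>. The remaining representative in \<open>S\<close> is equivalent to infinity; its denominator is divisible by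
  \<open>N\<close>, so its congruence condition is empty.
\<close>

theorem weighted_sum:
  assumes S: "cusp_representatives N S"
  shows "finite S"
    "(\<Sum>r\<in>elliptic_traces. class_sum (\<lambda>_. 1) (r\<^sup>2 - 4 * int n)) + (\<Sum>s | s \<in> S \<and> \<not> Gamma0_equiv N s Infty. of_nat (\<nu> s n N)) = of_nat pole_order"
    "(\<Sum>r\<in>elliptic_traces. class_sum (\<lambda>c. c) (r\<^sup>2 - 4 * int n)) + (\<Sum>s | s \<in> S \<and> \<not> Gamma0_equiv N s Infty. of_nat (\<nu> s n N) * value_at_cusp j s) = of_nat adjacent_divisors"
    "(\<Sum>s\<in>S. real (\<nu> s n N)) = (\<Sum>s | s \<in> S \<and> \<not> Gamma0_equiv N s Infty. real (\<nu> s n N)) + real (\<Sum>d | d dvd n. min d (n div d))"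
proof -
  obtain P Q :: "complex poly" where PQ: "P \<noteq> 0" "Q \<noteq> 0" "\<And>\<tau>. Im \<tau> > 0 \<Longrightarrow> hecke_prod \<tau> * poly Q (j \<tau>) = poly P (j \<tau>)"
    by (rule hecke_prod_rational) (rule that)
  define m where "m = (\<lambda>c. complex_of_int (int (Polynomial.order c P) - int (Polynomial.order c Q)))"
  define Z where "Z = {c. poly P c = 0} \<union> {c. poly Q c = 0} \<union> cusp_values"
  have finZ: "finite Z" unfolding Z_def using poly_roots_finite PQ finite_cusp_values by blast
  have sums: "(\<Sum>c\<in>Z. m c) = of_nat pole_order" "(\<Sum>c\<in>Z. m c * c) = of_nat adjacent_divisors"
    unfolding m_def using order_sums[OF PQ finZ] by (auto simp: Z_def)
  have disj: "j ` upper_half_plane \<inter> cusp_values = {}"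
    using cusp_value_not_attained unfolding cusp_values_def by fastforce
  have split: "(\<Sum>c\<in>Z. m c * h c) = (\<Sum>c\<in>Z \<inter> j ` upper_half_plane. m c * h c) + (\<Sum>c\<in>cusp_values. m c * h c)" for h
  proof -
    have "Z = (Z \<inter> j ` upper_half_plane) \<union> cusp_values" using j_surjective by (auto simp: Z_def)
    moreover have "(Z \<inter> j ` upper_half_plane) \<inter> cusp_values = {}" using disj by blast
    ultimately show ?thesis using sum.union_disjoint[of "Z \<inter> j ` upper_half_plane" cusp_values "\<lambda>c. m c * h c"] finZ finite_cusp_values by auto
  qed
  have mpt: "m c = (\<Sum>r\<in>elliptic_traces. if \<exists>Q\<in>forms (r\<^sup>2 - 4 * int n) N. form_root Q = \<tau> then 1 / of_nat (stabilizer_order N \<tau>) else 0)"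
    if t: "Im \<tau> > 0" "j \<tau> = c" for \<tau> c
  proof -
    define k where "k = card {X \<in> hcosets N n. \<exists>A\<in>X. moebius A \<tau> = \<tau>}"
    have "k + Polynomial.order c Q = Polynomial.order c P" unfolding k_def using order_at_point[OF PQ t(1)] t(2) by simp
    hence "m c = of_nat k" unfolding m_def by (metis add_diff_cancel_right' of_int_of_nat_eq of_nat_add)
    also have "\<dots> = complex_of_real (real k)" by simp
    also have "\<dots> = (\<Sum>r\<in>elliptic_traces. complex_of_real (if \<exists>Q\<in>forms (r\<^sup>2 - 4 * int n) N. form_root Q = \<tau> then 1 / real (stabilizer_order N \<tau>) else 0))"
      unfolding k_def fixing_cosets_count[OF N_pos n_pos coprime_n_N n_nonsquare t(1)] elliptic_traces_def by simp
    also have "\<dots> = (\<Sum>r\<in>elliptic_traces. if \<exists>Q\<in>forms (r\<^sup>2 - 4 * int n) N. form_root Q = \<tau> then 1 / of_nat (stabilizer_order N \<tau>) else 0)"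
      by (intro sum.cong refl) simp
    finally show ?thesis .
  qed
  (* A form with root tau makes the order at j(tau) positive, so j(tau) is a zero of the numerator. *)
  have inZ: "j (form_root Q') \<in> Z" if r: "r \<in> elliptic_traces" and Q': "Q' \<in> forms (r\<^sup>2 - 4 * int n) N" for r Q'
  proof -
    define \<tau> where "\<tau> = form_root Q'"
    have t: "Im \<tau> > 0" unfolding \<tau>_def using Q' form_root(1) by (auto simp: forms_def)
    define X where "X = {X \<in> hcosets N n. \<exists>A\<in>X. moebius A \<tau> = \<tau>}"
    have "real (card X) = (\<Sum>r\<in>elliptic_traces. if \<exists>Q\<in>forms (r\<^sup>2 - 4 * int n) N. form_root Q = \<tau> then 1 / real (stabilizer_order N \<tau>) else 0)"
      unfolding X_def elliptic_traces_def by (rule fixing_cosets_count[OF N_pos n_pos coprime_n_N n_nonsquare t])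
    also have "\<dots> > 0"
      using r Q' finite_elliptic_traces card_stabilizer(3)[OF t, of N] by (intro sum_pos2[of _ r]) (auto simp: \<tau>_def)
    finally have "card X > 0" by simp
    moreover have "card X + Polynomial.order (j \<tau>) Q = Polynomial.order (j \<tau>) P" unfolding X_def by (rule order_at_point[OF PQ t])
    ultimately have "Polynomial.order (j \<tau>) P \<noteq> 0" by simp
    hence "poly P (j \<tau>) = 0" using order_root by blast
    thus ?thesis by (simp add: Z_def \<tau>_def)
  qed
  have classes: "(\<Sum>c\<in>Z \<inter> j ` upper_half_plane. m c * h c) = (\<Sum>r\<in>elliptic_traces. class_sum h (r\<^sup>2 - 4 * int n))" for h
  proof -
    have "(\<Sum>c\<in>Z \<inter> j ` upper_half_plane. m c * h c) = (\<Sum>c\<in>Z \<inter> j ` upper_half_plane. \<Sum>r\<in>elliptic_traces.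
       if \<exists>Q\<in>forms (r\<^sup>2 - 4 * int n) N. form_root Q = preimage c then 1 / of_nat (stabilizer_order N (preimage c)) * h c else 0)"
    proof (rule sum.cong[OF refl])
      fix c assume "c \<in> Z \<inter> j ` upper_half_plane"
      hence p: "Im (preimage c) > 0" "j (preimage c) = c" using preimage by auto
      show "m c * h c = (\<Sum>r\<in>elliptic_traces. if \<exists>Q\<in>forms (r\<^sup>2 - 4 * int n) N. form_root Q = preimage c then 1 / of_nat (stabilizer_order N (preimage c)) * h c else 0)"
        unfolding mpt[OF p] sum_distrib_right by (intro sum.cong refl) simp
    qed
    also have "\<dots> = (\<Sum>r\<in>elliptic_traces. \<Sum>c\<in>Z \<inter> j ` upper_half_plane.
       if \<exists>Q\<in>forms (r\<^sup>2 - 4 * int n) N. form_root Q = preimage c then 1 / of_nat (stabilizer_order N (preimage c)) * h c else 0)"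
      by (rule sum.swap)
    also have "\<dots> = (\<Sum>r\<in>elliptic_traces. class_sum h (r\<^sup>2 - 4 * int n))"
      by (rule sum.cong[OF refl]) (rule class_sum_eq[OF elliptic_trace_disc_neg finZ inZ, symmetric])
    finally show ?thesis .
  qed
  define S' where "S' = {s. s \<in> S \<and> \<not> Gamma0_equiv N s Infty}"
  have S1: "S \<subseteq> cusps" "\<And>s. s \<in> cusps \<Longrightarrow> \<exists>!s'. s' \<in> S \<and> Gamma0_equiv N s s'"
    using S by (auto simp: cusp_representatives_def)
  have S'_cusp: "\<exists>A. A \<in> SL2Z \<and> A \<notin> Gamma0 N \<and> s = moebius_ext A Infty" if s: "s \<in> S'" for s
  proof -
    have "s \<in> cusps" using s S1(1) unfolding S'_def by blast
    hence "s \<in> (\<lambda>A. moebius_ext A Infty) ` SL2Z" unfolding cusps_eq .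
    then obtain A where A: "A \<in> SL2Z" "s = moebius_ext A Infty" by blast
    thus ?thesis using s cusp_equiv_inf[OF A(1)] by (auto simp: S'_def)
  qed
  have bij: "bij_betw (value_at_cusp j) S' cusp_values"
  proof (rule bij_betw_imageI)
    show "inj_on (value_at_cusp j) S'"
    proof (rule inj_onI)
      fix s t assume st: "s \<in> S'" "t \<in> S'" "value_at_cusp j s = value_at_cusp j t"
      obtain A where A: "A \<in> SL2Z" "A \<notin> Gamma0 N" "s = moebius_ext A Infty" using S'_cusp[OF st(1)] by blast
      obtain B where B: "B \<in> SL2Z" "B \<notin> Gamma0 N" "t = moebius_ext B Infty" using S'_cusp[OF st(2)] by blast
      have "cusp_value A = cusp_value B" using st(3) unfolding A(3) B(3) value_at_cusp_eq[OF A(1,2)] value_at_cusp_eq[OF B(1,2)] .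
      hence "\<exists>\<gamma>\<in>Gamma0 N. (adj B ** \<gamma> ** A)$2$1 = 0" by (rule cusp_value_injective[OF A(1,2) B(1,2)])
      hence eq: "Gamma0_equiv N s t" unfolding A(3) B(3) using Gamma0_equiv_cusps[OF A(1) B(1)] by blast
      have "(adj A ** mat 1 ** A)$2$1 = 0" using A(1) by (simp add: algebra_simps)
      hence "Gamma0_equiv N s s" unfolding A(3) using Gamma0_equiv_cusps[OF A(1) A(1)] Gamma0_closed(1) by blast
      moreover have "s \<in> cusps" "s \<in> S" "t \<in> S" using st S1(1) by (auto simp: S'_def)
      ultimately show "s = t" using S1(2)[of s] eq by blast
    qed
    show "value_at_cusp j ` S' = cusp_values"
    proof (intro equalityI subsetI)
      fix c assume "c \<in> value_at_cusp j ` S'"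
      then obtain s where s: "s \<in> S'" "c = value_at_cusp j s" by blast
      obtain A where A: "A \<in> SL2Z" "A \<notin> Gamma0 N" "s = moebius_ext A Infty" using S'_cusp[OF s(1)] by blast
      have "c = cusp_value A" unfolding s(2) A(3) by (rule value_at_cusp_eq[OF A(1,2)])
      thus "c \<in> cusp_values" using A(1,2) by (auto simp: cusp_values_def)
    next
      fix c assume "c \<in> cusp_values"
      then obtain A where A: "A \<in> SL2Z" "A \<notin> Gamma0 N" "c = cusp_value A" by (auto simp: cusp_values_def)
      have "moebius_ext A Infty \<in> cusps" unfolding cusps_eq using A(1) by (rule imageI)
      then obtain s where s: "s \<in> S" "Gamma0_equiv N (moebius_ext A Infty) s" using S1(2) by blast
      obtain \<gamma> where g: "\<gamma> \<in> Gamma0 N" "s = moebius_ext \<gamma> (moebius_ext A Infty)" using s(2) by (auto simp: Gamma0_equiv_def)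
      have s': "s = moebius_ext (\<gamma> ** A) Infty" unfolding g(2) by (rule moebius_ext_mult_Infty[OF Gamma0_SL2Z[OF g(1)] A(1)])
      note cg = cusp_value_Gamma0_mult[OF g(1) A(1,2)]
      have "\<not> Gamma0_equiv N s Infty" unfolding s' using cusp_equiv_inf[OF cg(1)] cg(2) by blast
      hence "s \<in> S'" using s(1) by (simp add: S'_def)
      moreover have "value_at_cusp j s = c" unfolding s' value_at_cusp_eq[OF cg(1,2)] cg(3) A(3) ..
      ultimately show "c \<in> value_at_cusp j ` S'" by blast
    qed
  qed
  have nu: "m (value_at_cusp j s) = of_nat (\<nu> s n N)" if s: "s \<in> S'" for s
  proof -
    obtain A where A: "A \<in> SL2Z" "A \<notin> Gamma0 N" "s = moebius_ext A Infty" using S'_cusp[OF s] by blast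
    have "\<nu> s n N + Polynomial.order (cusp_value A) Q = Polynomial.order (cusp_value A) P"
      unfolding \<nu>_def Let_def A(3) cusp_denom_eq[OF A(1)] by (rule order_at_cusp[OF PQ A(1,2)])
    thus ?thesis unfolding m_def A(3) value_at_cusp_eq[OF A(1,2)] by (metis add_diff_cancel_right' of_int_of_nat_eq of_nat_add)
  qed
  have cusp_sum: "(\<Sum>c\<in>cusp_values. m c * h c) = (\<Sum>s\<in>S'. of_nat (\<nu> s n N) * h (value_at_cusp j s))" for h
    using sum.reindex_bij_betw[OF bij, of "\<lambda>c. m c * h c"] nu by (simp cong: sum.cong)
  have total: "(\<Sum>c\<in>Z. m c * h c) = (\<Sum>r\<in>elliptic_traces. class_sum h (r\<^sup>2 - 4 * int n)) + (\<Sum>s\<in>S'. of_nat (\<nu> s n N) * h (value_at_cusp j s))" for h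
    unfolding split classes cusp_sum ..
  show "(\<Sum>r\<in>elliptic_traces. class_sum (\<lambda>_. 1) (r\<^sup>2 - 4 * int n)) + (\<Sum>s | s \<in> S \<and> \<not> Gamma0_equiv N s Infty. of_nat (\<nu> s n N)) = of_nat pole_order"
    using total[of "\<lambda>_. 1"] sums(1) by (simp add: S'_def)
  show "(\<Sum>r\<in>elliptic_traces. class_sum (\<lambda>c. c) (r\<^sup>2 - 4 * int n)) + (\<Sum>s | s \<in> S \<and> \<not> Gamma0_equiv N s Infty. of_nat (\<nu> s n N) * value_at_cusp j s) = of_nat adjacent_divisors"
    using total[of "\<lambda>c. c"] sums(2) by (simp add: S'_def)
  have finS': "finite S'" using bij finite_cusp_values bij_betw_finite by blast
  have inf_cusp: "Gamma0_equiv N s Infty \<longleftrightarrow> Gamma0_equiv N Infty s" if s: "s \<in> cusps" for s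
  proof -
    obtain A where A: "A \<in> SL2Z" "s = moebius_ext A Infty" using s unfolding cusps_eq by blast
    show ?thesis
    proof
      assume "Gamma0_equiv N s Infty"
      hence "A \<in> Gamma0 N" using cusp_equiv_inf[OF A(1)] unfolding A(2) by blast
      thus "Gamma0_equiv N Infty s" unfolding A(2) Gamma0_equiv_def by blast
    next
      assume "Gamma0_equiv N Infty s"
      then obtain \<gamma> where g: "\<gamma> \<in> Gamma0 N" "s = moebius_ext \<gamma> Infty" unfolding Gamma0_equiv_def by blast
      show "Gamma0_equiv N s Infty" unfolding g(2) using cusp_equiv_inf[OF Gamma0_SL2Z[OF g(1)]] g(1) by blast
    qed
  qed
  have "Infty \<in> cusps"
  proof -
    have "moebius_ext (mat 1) Infty = Infty" by simp
    thus ?thesis unfolding cusps_eq using SL2Z_closed(1) by (metis image_eqI)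
  qed
  from S1(2)[OF this] obtain s0 where s0: "s0 \<in> S" "Gamma0_equiv N Infty s0"
    "\<And>s. s \<in> S \<Longrightarrow> Gamma0_equiv N Infty s \<Longrightarrow> s = s0" by blast
  have SS: "S = insert s0 S'" "s0 \<notin> S'"
    using s0 inf_cusp S1(1) unfolding S'_def by blast+
  show "finite S" unfolding SS(1) using finS' by simp
  have nu0: "\<nu> s0 n N = (\<Sum>d | d dvd n. min d (n div d))"
  proof -
    obtain \<gamma> where g: "\<gamma> \<in> Gamma0 N" "s0 = moebius_ext \<gamma> Infty" using s0(2) unfolding Gamma0_equiv_def by blast
    have den: "cusp_denom s0 = nat \<bar>\<gamma>$2$1\<bar>" unfolding g(2) by (rule cusp_denom_eq[OF Gamma0_SL2Z[OF g(1)]])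
    have "int N dvd \<bar>\<gamma>$2$1\<bar>" using g(1) by (simp add: Gamma0_iff)
    hence "int N dvd int (nat \<bar>\<gamma>$2$1\<bar>)" by simp
    hence "N dvd nat \<bar>\<gamma>$2$1\<bar>" by (simp only: int_dvd_int_iff)
    hence "gcd (nat \<bar>\<gamma>$2$1\<bar>) N = N" by (rule gcd_nat.absorb2)
    hence e: "gcd (cusp_denom s0) (N div gcd (cusp_denom s0) N) = 1" unfolding den using N_pos by simp
    show ?thesis unfolding \<nu>_def Let_def e by simp
  qed
  show "(\<Sum>s\<in>S. real (\<nu> s n N)) = (\<Sum>s | s \<in> S \<and> \<not> Gamma0_equiv N s Infty. real (\<nu> s n N)) + real (\<Sum>d | d dvd n. min d (n div d))"
    unfolding S'_def[symmetric] using SS(2) finS' by (simp add: SS(1) nu0 del: of_nat_sum)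
qed

lemma pole_order_sigma: "pole_order + (\<Sum>d | d dvd n. min d (n div d)) = 2 * Defs.\<sigma> n"
proof -
  have "pole_order + (\<Sum>d | d dvd n. min d (n div d)) = (\<Sum>d | d dvd n. d + n div d)"
    unfolding pole_order_def sum.distrib[symmetric] by (intro sum.cong refl) (simp add: max_def min_def)
  also have "\<dots> = (\<Sum>d | d dvd n. d) + (\<Sum>d | d dvd n. n div d)" by (rule sum.distrib)
  also have "(\<Sum>d | d dvd n. n div d) = (\<Sum>d | d dvd n. d)"
  proof (rule sum.reindex_bij_witness[of _ "\<lambda>d. n div d" "\<lambda>d. n div d"])
    fix d assume "d \<in> {d. d dvd n}"
    hence d: "d dvd n" by simp
    show "n div (n div d) = d" "n div d \<in> {d. d dvd n}"
      using divisor_facts[OF d] by (metis nonzero_mult_div_cancel_right less_irrefl, metis dvd_triv_right mem_Collect_eq)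
    show "n div (n div d) = d" "n div d \<in> {d. d dvd n}" by fact+
  qed simp
  finally show ?thesis by (simp add: Defs.\<sigma>_def)
qed

text \<open>
  If \<open>4 n + 1 = (2 k + 1)\<^sup>2\<close> then \<open>n = k (k + 1)\<close>, and the divisors in question are \<open>k\<close> and \<open>k + 1\<close>.
\<close>

lemma adjacent_divisors_eq: "adjacent_divisors = (if is_square (4 * n + 1) then 2 else 0)"
proof (cases "is_square (4 * n + 1)")
  case True
  then obtain s where s: "4 * n + 1 = s\<^sup>2" by (auto simp: is_nth_power_def)
  have "odd s"
  proof
    assume "even s"
    hence "even (s\<^sup>2)" by simp
    thus False unfolding s[symmetric] by simp
  qed
  then obtain k where k: "s = 2 * k + 1" by (elim oddE)
  have nk: "n = k * (k + 1)" using s unfolding k by (simp add: power2_eq_square algebra_simps)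
  have k0: "k > 0" using n_pos nk by (cases "k = 0") auto
  have "{d. d dvd n \<and> (n div d = d + 1 \<or> d = n div d + 1)} = {k, k + 1}"
  proof (intro equalityI subsetI)
    fix d assume "d \<in> {d. d dvd n \<and> (n div d = d + 1 \<or> d = n div d + 1)}"
    hence d: "d dvd n" "n div d = d + 1 \<or> d = n div d + 1" by auto
    define a where "a = n div d"
    have ad: "d * a = k * (k + 1)" using divisor_facts(4)[OF d(1)] nk by (simp add: a_def)
    have mono: "x = k" if "x * (x + 1) = k * (k + 1)" for x
    proof (rule linorder_cases[of x k])
      assume "x < k"
      hence "x * (x + 1) < k * (k + 1)" by (intro mult_strict_mono) auto
      thus ?thesis using that by simp
    next
      assume "k < x"
      hence "k * (k + 1) < x * (x + 1)" using k0 by (intro mult_strict_mono) auto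
      thus ?thesis using that by simp
    qed
    from d(2) show "d \<in> {k, k + 1}"
    proof
      assume "n div d = d + 1"
      hence "d = k" using ad mono[of d] by (simp add: a_def)
      thus ?thesis by simp
    next
      assume "d = n div d + 1"
      hence "a = k" using ad mono[of a] by (simp add: a_def mult.commute)
      thus ?thesis using \<open>d = n div d + 1\<close> by (simp add: a_def)
    qed
  next
    fix d assume "d \<in> {k, k + 1}"
    thus "d \<in> {d. d dvd n \<and> (n div d = d + 1 \<or> d = n div d + 1)}" using k0 by (auto simp: nk simp del: mult_Suc_right)
  qed
  hence "adjacent_divisors = card {k, k + 1}" unfolding adjacent_divisors_def by simp
  thus ?thesis using True by simp
next
  case False
  have "\<not> (d dvd n \<and> (n div d = d + 1 \<or> d = n div d + 1))" for d
  proof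
    assume h: "d dvd n \<and> (n div d = d + 1 \<or> d = n div d + 1)"
    hence d: "d dvd n" by simp
    define a where "a = n div d"
    have ad: "d * a = n" using divisor_facts(4)[OF d] by (simp add: a_def)
    have "a = d + 1 \<or> d = a + 1" using h by (simp add: a_def)
    moreover define x where "x = min d a"
    ultimately have "n = x * (x + 1)" unfolding ad[symmetric] by (auto simp: min_def)
    hence "4 * n + 1 = (2 * x + 1)\<^sup>2" by (simp add: power2_eq_square algebra_simps)
    thus False using False by (metis is_nth_power_def)
  qed
  hence e: "{d. d dvd n \<and> (n div d = d + 1 \<or> d = n div d + 1)} = {}" by blast
  show ?thesis unfolding adjacent_divisors_def e using False by simp
qed

end

section \<open>The class number and trace identities\<close>

theorem corollary2p8:
  fixes N n :: nat and j :: "complex \<Rightarrow> complex" and S :: "riemann_sphere set"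
  assumes "N > 0"
    and "has_genus (X0 N) 0"
    and "is_Hauptmodul N j"
    and "n > 0"
    and "coprime n N"
    and "\<not> is_square n"
    and "cusp_representatives N S"
  shows "((\<Sum>r | \<bar>real_of_int r\<bar> < 2 * sqrt (real n). class_number (r^2 - 4 * int n) N)
           + (\<Sum>s\<in>S. real (\<nu> s n N)) = 2 * real (\<sigma> n)) \<and>
         ((\<Sum>r | \<bar>real_of_int r\<bar> < 2 * sqrt (real n). form_trace j (r^2 - 4 * int n) N)
           + (\<Sum>s | s \<in> S \<and> \<not> Gamma0_equiv N s Infty. of_nat (\<nu> s n N) * value_at_cusp j s)
         = (if is_square (4 * n + 1) then 2 else 0))"
proof -
  interpret hecke N j n
    using assms by unfold_locales auto
  note ws = weighted_sum[OF assms(7)]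
  have cs1: "class_sum (\<lambda>_. 1) D = complex_of_real (class_number D N)" for D
    unfolding class_sum_def class_number_def Let_def by simp
  have cs2: "class_sum (\<lambda>c. c) D = form_trace j D N" for D
    unfolding class_sum_def form_trace_def ..
  have "complex_of_real ((\<Sum>r\<in>elliptic_traces. class_number (r\<^sup>2 - 4 * int n) N)
      + (\<Sum>s | s \<in> S \<and> \<not> Gamma0_equiv N s Infty. real (\<nu> s n N))) = complex_of_real (real pole_order)"
    using ws(2) unfolding cs1 by simp
  hence "(\<Sum>r\<in>elliptic_traces. class_number (r\<^sup>2 - 4 * int n) N)
      + (\<Sum>s | s \<in> S \<and> \<not> Gamma0_equiv N s Infty. real (\<nu> s n N)) = real pole_order"
    by (simp only: of_real_eq_iff)
  moreover have "real pole_order + real (\<Sum>d | d dvd n. min d (n div d)) = 2 * real (\<sigma> n)"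
    unfolding of_nat_add[symmetric] pole_order_sigma by simp
  ultimately have 1: "(\<Sum>r\<in>elliptic_traces. class_number (r\<^sup>2 - 4 * int n) N) + (\<Sum>s\<in>S. real (\<nu> s n N)) = 2 * real (\<sigma> n)"
    unfolding ws(4) by linarith
  have 2: "(\<Sum>r\<in>elliptic_traces. form_trace j (r\<^sup>2 - 4 * int n) N)
      + (\<Sum>s | s \<in> S \<and> \<not> Gamma0_equiv N s Infty. of_nat (\<nu> s n N) * value_at_cusp j s)
      = (if is_square (4 * n + 1) then 2 else 0)"
    using ws(3) unfolding cs2 adjacent_divisors_eq by simp
  show ?thesis using 1 2 unfolding elliptic_traces_def by blast
qed

end
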